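(* Let $\omega$, $\psi_A$, $\Gamma_D$ and $\alpha>0$ be as in the context, let $f\in L^2(\omega;\mathbb{R}^3)$, and let $$\mathcal{A}=\left\{\psi\in H^2(\omega;\mathbb{R}^3)\;\middle|\;(\nabla\psi)^\top\nabla\psi=(\nabla\psi_A)^\top\nabla\psi_A\ \text{a.e. in }\omega;\ \psi=\psi_A,\ \nabla\psi=\nabla\psi_A\ \text{on }\Gamma_D\right\}.$$ Then there exists $\psi_B\in\mathcal{A}$ which minimizes, over all $\psi\in\mathcal{A}$, the energy $$E[\psi]=\frac{\alpha}{2}\int_\omega\sqrt{\det g_A}\left(\sum_{m=1}^{3}\left|g_A^{-\frac12}D^2\psi^m\,g_A^{-\frac12}\right|^2-2\,II[\psi]:\left(g_A^{-1}II_A\,g_A^{-1}\right)\right)\mathrm{d}x-\int_\omega\sqrt{\det g_A}\;f\cdot\psi\,\mathrm{d}x .$$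
   Context: $\omega\subset\mathbb{R}^2$ is a bounded, connected Lipschitz domain, $\Gamma_D\subset\partial\omega$ has positive one-dimensional Hausdorff measure $\mathcal{H}^1(\Gamma_D)>0$ (boundary conditions on $\Gamma_D$ are in the sense of traces), and $\alpha>0$. $\psi_A\in H^3(\omega;\mathbb{R}^3)$ is an injective regular parametrization: using $H^3(\omega)\hookrightarrow C^1(\overline{\omega})$, the matrix $\nabla\psi_A(x)\in\mathbb{R}^{3\times2}$ has rank $2$ for all $x\in\overline\omega$, so that $g_A:=(\nabla\psi_A)^\top\nabla\psi_A$ is symmetric positive definite with $g_A$, $g_A^{-1}$, $g_A^{-1/2}$ uniformly bounded; $g_A^{-1/2}$ is the symmetric positive definite square root of $g_A^{-1}$. For a parametrization $\psi$, the unit normal is $n[\psi]=\frac{\partial_1\psi\times\partial_2\psi}{|\partial_1\psi\times\partial_2\psi|}$, and $II[\psi]=-D^2\psi\cdot n[\psi]$ is the second fundamental form, where $D^2\psi\cdot n=(\partial_i\partial_j\psi\cdot n)_{i,j=1,2}$; $II_A=II[\psi_A]$. $D^2\psi^m$ is the $2\times 2$ Hessian of the $m$-th component of $\psi$, $X:Y=\sum_{i,j}X_{ij}Y_{ij}$, and $|X|^2=X:X$ is the squared Frobenius norm. *)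

theory Defs
  imports "HOL-Analysis.Analysis"
begin

section \<open>One-dimensional Hausdorff measure in the plane\<close>

text \<open>The covering sets are required to be bounded because \<^const>\<open>diameter\<close> is unspecified
  on unbounded sets.\<close>

definition hausdorff_pre :: "real \<Rightarrow> (real^2) set \<Rightarrow> ennreal" where
  "hausdorff_pre \<delta> S =
     (INF C \<in> {C :: nat \<Rightarrow> (real^2) set. S \<subseteq> (\<Union>i. C i) \<and> (\<forall>i. bounded (C i) \<and> diameter (C i) \<le> \<delta>)}.
        \<Sum>i. ennreal (diameter (C i)))"

definition hausdorff_outer :: "(real^2) set \<Rightarrow> ennreal" where
  "hausdorff_outer S = (SUP \<delta> \<in> {0<..}. hausdorff_pre \<delta> S)"

text \<open>\<^const>\<open>measure_of\<close> yields the zero measure unless the given set function is a measure on the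
  given sigma-algebra; that this is the case here is shown at the end of this theory.\<close>

definition hausdorff1 :: "(real^2) measure" where
  "hausdorff1 = measure_of UNIV (sets borel) hausdorff_outer"


section \<open>Lipschitz domains\<close>

text \<open>After a rotation or reflection \<open>T\<close>, the set is locally the strict epigraph of a Lipschitz
  function.\<close>

definition bounded_lipschitz_domain :: "(real^2) set \<Rightarrow> bool" where
  "bounded_lipschitz_domain \<omega> \<longleftrightarrow>
     open \<omega> \<and> connected \<omega> \<and> bounded \<omega> \<and>
     (\<forall>p \<in> frontier \<omega>. \<exists>(T :: real^2 \<Rightarrow> real^2) r \<gamma> L.
        orthogonal_transformation T \<and> r > 0 \<and> L-lipschitz_on UNIV (\<gamma> :: real \<Rightarrow> real) \<and>
        \<omega> \<inter> ball p r = {x \<in> ball p r. \<gamma> (T x $ 1) < T x $ 2})"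


section \<open>Weak derivatives and Sobolev spaces\<close>

definition L2 :: "(real^2) set \<Rightarrow> (real^2 \<Rightarrow> real) set" where
  "L2 \<omega> = {u. u \<in> borel_measurable (lebesgue_on \<omega>) \<and> integrable (lebesgue_on \<omega>) (\<lambda>x. (u x)\<^sup>2)}"

definition partial :: "2 \<Rightarrow> (real^2 \<Rightarrow> real) \<Rightarrow> real^2 \<Rightarrow> real" where
  "partial i \<phi> x = frechet_derivative \<phi> (at x) (axis i 1)"

primrec Ck :: "nat \<Rightarrow> (real^2 \<Rightarrow> real) \<Rightarrow> bool" where
  "Ck 0 \<phi> \<longleftrightarrow> continuous_on UNIV \<phi>"
| "Ck (Suc k) \<phi> \<longleftrightarrow> \<phi> differentiable_on UNIV \<and> (\<forall>i. Ck k (partial i \<phi>))"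

definition test_functions :: "(real^2) set \<Rightarrow> (real^2 \<Rightarrow> real) set" where
  "test_functions \<omega> =
     {\<phi>. (\<forall>k. Ck k \<phi>) \<and> compact (closure {x. \<phi> x \<noteq> 0}) \<and> closure {x. \<phi> x \<noteq> 0} \<subseteq> \<omega>}"

text \<open>Only square-integrable weak derivatives of square-integrable functions are needed.\<close>

definition is_weak_partial ::
    "(real^2) set \<Rightarrow> 2 \<Rightarrow> (real^2 \<Rightarrow> real) \<Rightarrow> (real^2 \<Rightarrow> real) \<Rightarrow> bool" where
  "is_weak_partial \<omega> i u v \<longleftrightarrow> u \<in> L2 \<omega> \<and> v \<in> L2 \<omega> \<and>
     (\<forall>\<phi> \<in> test_functions \<omega>.
        (LINT x|lebesgue_on \<omega>. u x * partial i \<phi> x) = - (LINT x|lebesgue_on \<omega>. v x * \<phi> x))"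

text \<open>\<open>sobolevH k \<omega>\<close> is $H^k(\omega)$, with functions in place of classes modulo null sets.\<close>

primrec sobolevH :: "nat \<Rightarrow> (real^2) set \<Rightarrow> (real^2 \<Rightarrow> real) set" where
  "sobolevH 0 \<omega> = L2 \<omega>"
| "sobolevH (Suc k) \<omega> = {u \<in> L2 \<omega>. \<forall>i. \<exists>v \<in> sobolevH k \<omega>. is_weak_partial \<omega> i u v}"

text \<open>A representative of the weak derivative. It is determined up to a null set in \<open>\<omega>\<close>, and it is used
  below only under integrals, almost-everywhere quantifiers and traces, none of which
  depends on the choice.\<close>

definition wpartial :: "(real^2) set \<Rightarrow> 2 \<Rightarrow> (real^2 \<Rightarrow> real) \<Rightarrow> real^2 \<Rightarrow> real" where
  "wpartial \<omega> i u = (SOME v. is_weak_partial \<omega> i u v)"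

definition sobolevH_vec :: "nat \<Rightarrow> (real^2) set \<Rightarrow> (real^2 \<Rightarrow> real^3) set" where
  "sobolevH_vec k \<omega> = {\<psi>. \<forall>m. (\<lambda>x. \<psi> x $ m) \<in> sobolevH k \<omega>}"

definition L2_vec :: "(real^2) set \<Rightarrow> (real^2 \<Rightarrow> real^3) set" where
  "L2_vec \<omega> = {\<psi>. \<forall>m. (\<lambda>x. \<psi> x $ m) \<in> L2 \<omega>}"

definition grad :: "(real^2) set \<Rightarrow> (real^2 \<Rightarrow> real^3) \<Rightarrow> real^2 \<Rightarrow> real^2^3" where
  "grad \<omega> \<psi> x = (\<chi> m j. wpartial \<omega> j (\<lambda>y. \<psi> y $ m) x)"

definition hess :: "(real^2) set \<Rightarrow> (real^2 \<Rightarrow> real) \<Rightarrow> real^2 \<Rightarrow> real^2^2" where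
  "hess \<omega> u x = (\<chi> i j. wpartial \<omega> i (wpartial \<omega> j u) x)"


section \<open>Traces\<close>

text \<open>The trace operator is the continuous extension, from $H^1(\omega) \cap C(\overline\omega)$ (with the
  $H^1$ norm) to $H^1(\omega)$, of the restriction to the boundary with values in
  $L^2(\partial\omega, \mathcal{H}^1)$; \<open>is_trace \<omega> u t\<close> says that \<open>t\<close> represents the trace of \<open>u\<close>.\<close>

definition is_trace ::
    "(real^2) set \<Rightarrow> (real^2 \<Rightarrow> real) \<Rightarrow> (real^2 \<Rightarrow> real) \<Rightarrow> bool" where
  "is_trace \<omega> u t \<longleftrightarrow> u \<in> sobolevH 1 \<omega> \<and> t \<in> borel_measurable borel \<and>
     (\<exists>w :: nat \<Rightarrow> real^2 \<Rightarrow> real.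
        (\<forall>k. w k \<in> sobolevH 1 \<omega> \<and> continuous_on (closure \<omega>) (w k)) \<and>
        (\<lambda>k. LINT x|lebesgue_on \<omega>. (w k x - u x)\<^sup>2) \<longlonglongrightarrow> 0 \<and>
        (\<forall>i. (\<lambda>k. LINT x|lebesgue_on \<omega>. (wpartial \<omega> i (w k) x - wpartial \<omega> i u x)\<^sup>2) \<longlonglongrightarrow> 0) \<and>
        (\<lambda>k. \<integral>\<^sup>+x\<in>frontier \<omega>. ennreal ((w k x - t x)\<^sup>2) \<partial>hausdorff1) \<longlonglongrightarrow> 0)"

definition trace_eq_on ::
    "(real^2) set \<Rightarrow> (real^2) set \<Rightarrow> (real^2 \<Rightarrow> real) \<Rightarrow> (real^2 \<Rightarrow> real) \<Rightarrow> bool" where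
  "trace_eq_on \<omega> \<Gamma> u v \<longleftrightarrow>
     (\<exists>s t. is_trace \<omega> u s \<and> is_trace \<omega> v t \<and> hausdorff_outer {x \<in> \<Gamma>. s x \<noteq> t x} = 0)"


section \<open>Geometry of parametrized surfaces\<close>

definition first_form :: "(real^2) set \<Rightarrow> (real^2 \<Rightarrow> real^3) \<Rightarrow> real^2 \<Rightarrow> real^2^2" where
  "first_form \<omega> \<psi> x = transpose (grad \<omega> \<psi> x) ** grad \<omega> \<psi> x"

definition unit_normal :: "(real^2) set \<Rightarrow> (real^2 \<Rightarrow> real^3) \<Rightarrow> real^2 \<Rightarrow> real^3" where
  "unit_normal \<omega> \<psi> x =
     (let c = cross3 (column 1 (grad \<omega> \<psi> x)) (column 2 (grad \<omega> \<psi> x)) in c /\<^sub>R norm c)"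

definition second_form :: "(real^2) set \<Rightarrow> (real^2 \<Rightarrow> real^3) \<Rightarrow> real^2 \<Rightarrow> real^2^2" where
  "second_form \<omega> \<psi> x =
     (\<chi> i j. - ((\<chi> m. hess \<omega> (\<lambda>y. \<psi> y $ m) x $ i $ j) \<bullet> unit_normal \<omega> \<psi> x))"

text \<open>An injective regular parametrization of class $H^3$. The function itself is taken to be the
  representative in $C^1(\overline\omega)$ provided by the Sobolev embedding; \<open>G\<close> is the continuous
  extension of its gradient to the closure.\<close>

definition injective_regular_param :: "(real^2) set \<Rightarrow> (real^2 \<Rightarrow> real^3) \<Rightarrow> bool" where
  "injective_regular_param \<omega> \<psi> \<longleftrightarrow>
     \<psi> \<in> sobolevH_vec 3 \<omega> \<and> continuous_on (closure \<omega>) \<psi> \<and> inj_on \<psi> \<omega> \<and>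
     (\<exists>G :: real^2 \<Rightarrow> real^2^3. continuous_on (closure \<omega>) G \<and>
        (\<forall>x \<in> \<omega>. (\<psi> has_derivative (\<lambda>h. G x *v h)) (at x)) \<and>
        (\<forall>x \<in> closure \<omega>. rank (G x) = 2))"

definition spd :: "real^'n^'n \<Rightarrow> bool" where
  "spd A \<longleftrightarrow> transpose A = A \<and> (\<forall>x. x \<noteq> 0 \<longrightarrow> x \<bullet> (A *v x) > 0)"

definition inv_sqrt :: "real^'n^'n \<Rightarrow> real^'n^'n" where
  "inv_sqrt A = (THE S. spd S \<and> S ** S = matrix_inv A)"


section \<open>The variational problem\<close>

definition admissible ::
    "(real^2) set \<Rightarrow> (real^2) set \<Rightarrow> (real^2 \<Rightarrow> real^3) \<Rightarrow> (real^2 \<Rightarrow> real^3) set" where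
  "admissible \<omega> \<Gamma> \<psi>\<^sub>A =
     {\<psi> \<in> sobolevH_vec 2 \<omega>.
        (AE x in lebesgue_on \<omega>. first_form \<omega> \<psi> x = first_form \<omega> \<psi>\<^sub>A x) \<and>
        (\<forall>m. trace_eq_on \<omega> \<Gamma> (\<lambda>x. \<psi> x $ m) (\<lambda>x. \<psi>\<^sub>A x $ m)) \<and>
        (\<forall>m j. trace_eq_on \<omega> \<Gamma> (\<lambda>x. grad \<omega> \<psi> x $ m $ j) (\<lambda>x. grad \<omega> \<psi>\<^sub>A x $ m $ j))}"

text \<open>On \<^typ>\<open>real^2^2\<close> the inner product and norm of the library are the Frobenius ones.\<close>

definition energy ::
    "(real^2) set \<Rightarrow> real \<Rightarrow> (real^2 \<Rightarrow> real^3) \<Rightarrow> (real^2 \<Rightarrow> real^3) \<Rightarrow> (real^2 \<Rightarrow> real^3) \<Rightarrow> real" where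
  "energy \<omega> \<alpha> \<psi>\<^sub>A f \<psi> =
     (\<alpha> / 2) * (LINT x|lebesgue_on \<omega>.
        (let g = first_form \<omega> \<psi>\<^sub>A x in
          sqrt (det g) *
            ((\<Sum>m\<in>UNIV. (norm (inv_sqrt g ** hess \<omega> (\<lambda>y. \<psi> y $ m) x ** inv_sqrt g))\<^sup>2)
             - 2 * (second_form \<omega> \<psi> x \<bullet> (matrix_inv g ** second_form \<omega> \<psi>\<^sub>A x ** matrix_inv g)))))
     - (LINT x|lebesgue_on \<omega>. sqrt (det (first_form \<omega> \<psi>\<^sub>A x)) * (f x \<bullet> \<psi> x))"


section \<open>The Hausdorff outer measure is a measure on the Borel sets\<close>

lemma hausdorff_pre_empty: "\<delta> > 0 \<Longrightarrow> hausdorff_pre \<delta> {} = 0"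
proof -
  assume "\<delta> > 0"
  then have "hausdorff_pre \<delta> {} \<le> (\<Sum>i::nat. ennreal (diameter ({}::(real^2) set)))"
    unfolding hausdorff_pre_def by (intro INF_lower2[of "\<lambda>_. {}"]) auto
  then show ?thesis by simp
qed

lemma hausdorff_pre_le:
  "S \<subseteq> (\<Union>i. C i) \<Longrightarrow> (\<And>i. bounded (C i)) \<Longrightarrow> (\<And>i. diameter (C i) \<le> \<delta>) \<Longrightarrow>
    hausdorff_pre \<delta> S \<le> (\<Sum>i::nat. ennreal (diameter (C i)))"
  unfolding hausdorff_pre_def by (rule INF_lower) auto

lemma hausdorff_pre_mono: "S \<subseteq> T \<Longrightarrow> hausdorff_pre \<delta> S \<le> hausdorff_pre \<delta> T"
  unfolding hausdorff_pre_def by (rule INF_superset_mono) auto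

lemma hausdorff_pre_antimono: "\<delta> \<le> \<delta>' \<Longrightarrow> hausdorff_pre \<delta>' S \<le> hausdorff_pre \<delta> S"
  unfolding hausdorff_pre_def by (rule INF_superset_mono) (auto intro: order_trans)

lemma hausdorff_pre_le_outer: "\<delta> > 0 \<Longrightarrow> hausdorff_pre \<delta> S \<le> hausdorff_outer S"
  unfolding hausdorff_outer_def by (rule SUP_upper) auto

lemma hausdorff_outer_empty: "hausdorff_outer {} = 0"
  unfolding hausdorff_outer_def by (auto simp: hausdorff_pre_empty)

lemma hausdorff_outer_mono: "S \<subseteq> T \<Longrightarrow> hausdorff_outer S \<le> hausdorff_outer T"
  unfolding hausdorff_outer_def by (intro SUP_mono) (auto intro: hausdorff_pre_mono)

lemma hausdorff_pre_UN: "hausdorff_pre \<delta> (\<Union>i. A i) \<le> (\<Sum>i::nat. hausdorff_pre \<delta> (A i))"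
proof (rule ennreal_le_epsilon)
  fix e :: real assume e: "0 < e" and fin: "(\<Sum>i. hausdorff_pre \<delta> (A i)) < top"
  have "\<exists>C. A n \<subseteq> (\<Union>i. C i) \<and> (\<forall>i. bounded (C i) \<and> diameter (C i) \<le> \<delta>) \<and>
          (\<Sum>i. ennreal (diameter (C i))) \<le> hausdorff_pre \<delta> (A n) + e * (1/2)^Suc n" for n
  proof -
    have "hausdorff_pre \<delta> (A n) \<noteq> top"
      using ennreal_suminf_lessD[OF fin, of n] by (simp add: less_top)
    then have "hausdorff_pre \<delta> (A n) < hausdorff_pre \<delta> (A n) + ennreal (e * (1/2)^Suc n)"
      using e by (cases "hausdorff_pre \<delta> (A n)") (auto simp flip: ennreal_plus simp: ennreal_less_iff)
    then show ?thesis
      by (subst (asm) (1) hausdorff_pre_def, subst (asm) INF_less_iff) (auto intro: less_imp_le)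
  qed
  then obtain C where C: "\<And>n. A n \<subseteq> (\<Union>i. C n i)" "\<And>n i. bounded (C n i)"
      "\<And>n i. diameter (C n i) \<le> \<delta>"
      "\<And>n. (\<Sum>i. ennreal (diameter (C n i))) \<le> hausdorff_pre \<delta> (A n) + e * (1/2)^Suc n"
    by metis
  define D where "D k = case_prod C (prod_decode k)" for k
  have "(\<Union>i. A i) \<subseteq> (\<Union>k. D k)"
  proof
    fix x assume "x \<in> (\<Union>i. A i)"
    then obtain n i where "x \<in> C n i" using C(1) by blast
    then have "x \<in> D (prod_encode (n, i))" by (simp add: D_def)
    then show "x \<in> (\<Union>k. D k)" by blast
  qed
  moreover have "bounded (D k)" "diameter (D k) \<le> \<delta>" for k
    using C(2,3) by (auto simp: D_def split: prod.splits)
  ultimately have "hausdorff_pre \<delta> (\<Union>i. A i) \<le> (\<Sum>k. ennreal (diameter (D k)))"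
    by (intro hausdorff_pre_le)
  also have "\<dots> = (\<Sum>n. \<Sum>i. ennreal (diameter (C n i)))"
    using suminf_ennreal_2dimen[of "\<lambda>n. \<Sum>i. ennreal (diameter (C n i))" "\<lambda>(n, i). ennreal (diameter (C n i))"]
    by (simp add: D_def comp_def split_def)
  also have "\<dots> \<le> (\<Sum>n. hausdorff_pre \<delta> (A n) + e * (1/2)^Suc n)"
    by (intro suminf_le C) auto
  also have "\<dots> = (\<Sum>n. hausdorff_pre \<delta> (A n)) + (\<Sum>n. ennreal (e * (1/2)^Suc n))"
    by (intro suminf_add[symmetric]) auto
  also have "(\<Sum>n. ennreal (e * (1/2)^Suc n)) = e"
    unfolding suminf_ennreal_eq[of "\<lambda>n. e * (1/2)^Suc n" e]
    using e sums_mult[OF power_half_series, of e] by (subst suminf_ennreal_eq) auto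
  finally show "hausdorff_pre \<delta> (\<Union>i. A i) \<le> (\<Sum>i. hausdorff_pre \<delta> (A i)) + ennreal e" .
qed

lemma hausdorff_outer_UN: "hausdorff_outer (\<Union>i. A i) \<le> (\<Sum>i::nat. hausdorff_outer (A i))"
  unfolding hausdorff_outer_def[of "\<Union>i. A i"]
proof (rule SUP_least)
  fix \<delta> :: real assume "\<delta> \<in> {0<..}"
  then show "hausdorff_pre \<delta> (\<Union>i. A i) \<le> (\<Sum>i. hausdorff_outer (A i))"
    by (intro order_trans[OF hausdorff_pre_UN] suminf_le) (auto intro: hausdorff_pre_le_outer)
qed

lemma hausdorff_outer_Un: "hausdorff_outer (A \<union> B) \<le> hausdorff_outer A + hausdorff_outer B"
proof -
  define D where "D i = (if i = 0 then A else if i = Suc 0 then B else {})" for i :: nat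
  have "A \<union> B = (\<Union>i. D i)" by (auto simp: D_def split: if_splits)
  then have "hausdorff_outer (A \<union> B) \<le> (\<Sum>i. hausdorff_outer (D i))"
    using hausdorff_outer_UN[of D] by simp
  also have "\<dots> = (\<Sum>i\<in>{0, Suc 0}. hausdorff_outer (D i))"
    by (rule suminf_finite) (auto simp: D_def hausdorff_outer_empty)
  finally show ?thesis by (simp add: D_def)
qed

lemma hausdorff_outer_metric:
  assumes "d > 0" and sep: "\<And>x y. x \<in> A \<Longrightarrow> y \<in> B \<Longrightarrow> d \<le> dist x y"
  shows "hausdorff_outer A + hausdorff_outer B \<le> hausdorff_outer (A \<union> B)"
proof -
  have *: "hausdorff_pre \<delta> A + hausdorff_pre \<delta> B \<le> hausdorff_pre \<delta> (A \<union> B)" if \<delta>: "0 < \<delta>" "\<delta> < d" for \<delta>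
    unfolding hausdorff_pre_def[of _ "A \<union> B"]
  proof (rule INF_greatest, clarify)
    fix C :: "nat \<Rightarrow> (real^2) set"
    assume cov: "A \<union> B \<subseteq> (\<Union>i. C i)" and C: "\<forall>i. bounded (C i) \<and> diameter (C i) \<le> \<delta>"
    define P where "P i = (if C i \<inter> A = {} then {} else C i)" for i
    define Q where "Q i = (if C i \<inter> B = {} then {} else C i)" for i
    have one: "C i \<inter> A = {} \<or> C i \<inter> B = {}" for i
    proof (rule ccontr)
      assume "\<not> ?thesis"
      then obtain x y where xy: "x \<in> C i" "x \<in> A" "y \<in> C i" "y \<in> B" by blast
      then have "dist x y \<le> diameter (C i)" using C by (intro diameter_bounded_bound) auto
      then show False using sep[of x y] xy C[rule_format, of i] \<delta> by simp
    qed
    have "hausdorff_pre \<delta> A \<le> (\<Sum>i. ennreal (diameter (P i)))"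
      using cov C \<delta> by (intro hausdorff_pre_le) (auto simp: P_def, blast)
    moreover have "hausdorff_pre \<delta> B \<le> (\<Sum>i. ennreal (diameter (Q i)))"
      using cov C \<delta> by (intro hausdorff_pre_le) (auto simp: Q_def, blast)
    ultimately have "hausdorff_pre \<delta> A + hausdorff_pre \<delta> B
        \<le> (\<Sum>i. ennreal (diameter (P i))) + (\<Sum>i. ennreal (diameter (Q i)))"
      by (rule add_mono)
    also have "\<dots> = (\<Sum>i. ennreal (diameter (P i)) + ennreal (diameter (Q i)))"
      by (intro suminf_add) auto
    also have "\<dots> \<le> (\<Sum>i. ennreal (diameter (C i)))"
      by (intro suminf_le) (use one in \<open>auto simp: P_def Q_def\<close>)
    finally show "hausdorff_pre \<delta> A + hausdorff_pre \<delta> B \<le> (\<Sum>i. ennreal (diameter (C i)))" .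
  qed
  have **: "hausdorff_pre \<delta> A + hausdorff_pre \<delta>' B \<le> hausdorff_outer (A \<union> B)"
    if "0 < \<delta>" "0 < \<delta>'" for \<delta> \<delta>'
  proof -
    define m where "m = Min {\<delta>, \<delta>', d / 2}"
    have m: "0 < m" "m < d" "m \<le> \<delta>" "m \<le> \<delta>'" using that \<open>d > 0\<close> by (auto simp: m_def min_def)
    have "hausdorff_pre \<delta> A + hausdorff_pre \<delta>' B \<le> hausdorff_pre m A + hausdorff_pre m B"
      using m by (intro add_mono hausdorff_pre_antimono)
    also have "\<dots> \<le> hausdorff_pre m (A \<union> B)" using * m by blast
    also have "\<dots> \<le> hausdorff_outer (A \<union> B)" using m by (intro hausdorff_pre_le_outer)
    finally show ?thesis .
  qed
  have "hausdorff_pre \<delta> A + hausdorff_outer B \<le> hausdorff_outer (A \<union> B)" if "0 < \<delta>" for \<delta>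
    unfolding hausdorff_outer_def[of B]
    by (subst add.commute, subst ennreal_SUP_add_left[symmetric])
      (use ** that in \<open>auto intro!: SUP_least simp: add.commute[of _ "hausdorff_pre \<delta> A"]\<close>)
  then show ?thesis
    unfolding hausdorff_outer_def[of A]
    by (subst ennreal_SUP_add_left[symmetric]) (auto intro!: SUP_least)
qed

lemma hausdorff_outer_infdist:
  assumes "b < a" "\<And>x. x \<in> A \<Longrightarrow> a \<le> infdist x F" "\<And>y. y \<in> B \<Longrightarrow> infdist y F \<le> b"
  shows "hausdorff_outer A + hausdorff_outer B \<le> hausdorff_outer (A \<union> B)"
proof (rule hausdorff_outer_metric)
  show "a - b > 0" using assms by simp
  fix x y assume "x \<in> A" "y \<in> B"
  then show "a - b \<le> dist x y"
    using assms(2)[of x] assms(3)[of y] infdist_triangle[of x F y] by simp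
qed

lemma hausdorff_outer_closed:
  assumes "closed F"
  shows "hausdorff_outer (X \<inter> F) + hausdorff_outer (X - F) \<le> hausdorff_outer X"
proof (cases "F = {} \<or> hausdorff_outer X = top")
  case True
  then show ?thesis by (auto simp: hausdorff_outer_empty)
next
  case False
  then have ne: "F \<noteq> {}" and fin: "hausdorff_outer X < top" by (auto simp: less_top)
  define c where "c n = 1 / real (Suc n)" for n
  have c: "c n > 0" "m < n \<Longrightarrow> c n < c m" "m \<le> n \<Longrightarrow> c n \<le> c m" for m n
    by (auto simp: c_def frac_less2 frac_le)
  define A where "A n = {x \<in> X. c n \<le> infdist x F}" for n
  define R where "R n = {x \<in> X. c (Suc n) \<le> infdist x F \<and> infdist x F < c n}" for n
  have half: "(\<Sum>i. hausdorff_outer (R (2 * i + p))) \<le> hausdorff_outer X" for p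
  proof (rule suminf_le_const)
    fix n
    have "(\<Sum>i<n. hausdorff_outer (R (2 * i + p))) \<le> hausdorff_outer (\<Union>i<n. R (2 * i + p))"
    proof (induction n)
      case (Suc n)
      have "(\<Sum>i<Suc n. hausdorff_outer (R (2 * i + p)))
          \<le> hausdorff_outer (\<Union>i<n. R (2 * i + p)) + hausdorff_outer (R (2 * n + p))"
        using Suc by (simp add: add_right_mono)
      also have "\<dots> \<le> hausdorff_outer ((\<Union>i<n. R (2 * i + p)) \<union> R (2 * n + p))"
      proof (cases n)
        case (Suc m)
        show ?thesis
        proof (rule hausdorff_outer_infdist[of "c (2 * n + p)" "c (2 * m + p + 1)"])
          show "c (2 * n + p) < c (2 * m + p + 1)" using Suc by (intro c) simp
          fix x assume "x \<in> (\<Union>i<n. R (2 * i + p))"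
          then obtain i where i: "i \<le> m" "x \<in> R (2 * i + p)" using Suc less_Suc_eq_le by auto
          have "c (2 * m + p + 1) \<le> c (Suc (2 * i + p))" using i by (intro c) simp
          then show "c (2 * m + p + 1) \<le> infdist x F" using i by (auto simp: R_def)
        qed (auto simp: R_def)
      qed (simp add: hausdorff_outer_empty)
      also have "(\<Union>i<n. R (2 * i + p)) \<union> R (2 * n + p) = (\<Union>i<Suc n. R (2 * i + p))"
        by (auto simp: lessThan_Suc)
      finally show ?case .
    qed simp
    also have "\<dots> \<le> hausdorff_outer X" by (rule hausdorff_outer_mono) (auto simp: R_def)
    finally show "(\<Sum>i<n. hausdorff_outer (R (2 * i + p))) \<le> hausdorff_outer X" .
  qed auto
  have "(\<Sum>i. hausdorff_outer (R i)) \<noteq> top"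
  proof -
    have "(\<Sum>i. hausdorff_outer (R i)) \<le> hausdorff_outer X + hausdorff_outer X"
    proof (rule suminf_le_const)
      fix n
      have "(\<Sum>i<n. hausdorff_outer (R i)) \<le> (\<Sum>i<2 * n. hausdorff_outer (R i))"
        by (intro sum_mono2) auto
      also have "\<dots> = (\<Sum>i<n. hausdorff_outer (R (2 * i + 0))) + (\<Sum>i<n. hausdorff_outer (R (2 * i + 1)))"
        by (induction n) (auto simp: algebra_simps)
      also have "\<dots> \<le> hausdorff_outer X + hausdorff_outer X"
        by (intro add_mono order_trans[OF sum_le_suminf half]) auto
      finally show "(\<Sum>i<n. hausdorff_outer (R i)) \<le> hausdorff_outer X + hausdorff_outer X" .
    qed auto
    then show ?thesis using fin by (metis ennreal_add_less_top leD less_top)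
  qed
  then have fR: "hausdorff_outer (R i) < top" for i
    using ennreal_suminf_lessD[of "\<lambda>i. hausdorff_outer (R i)" top i] by (simp add: less_top)
  have sm: "summable (\<lambda>i. enn2real (hausdorff_outer (R i)))"
    using \<open>_ \<noteq> top\<close> fR by (intro summable_suminf_not_top) auto
  have "(\<lambda>n. ennreal (\<Sum>i. enn2real (hausdorff_outer (R (i + n))))) \<longlonglongrightarrow> ennreal 0"
    by (intro tendsto_ennrealI suminf_exist_split2[OF sm])
  moreover have "ennreal (\<Sum>i. enn2real (hausdorff_outer (R (i + n)))) = (\<Sum>i. hausdorff_outer (R (i + n)))" for n
    using fR summable_ignore_initial_segment[OF sm, of n]
    by (subst suminf_ennreal2[symmetric]) auto
  ultimately have tail: "(\<lambda>n. \<Sum>i. hausdorff_outer (R (i + n))) \<longlonglongrightarrow> 0"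
    by simp
  have "hausdorff_outer (X \<inter> F) + hausdorff_outer (X - F)
      \<le> hausdorff_outer X + (\<Sum>i. hausdorff_outer (R (i + n)))" for n
  proof -
    have "X - F \<subseteq> A n \<union> (\<Union>i. R (i + n))"
    proof
      fix x assume x: "x \<in> X - F"
      then have pos: "0 < infdist x F"
        using assms ne in_closed_iff_infdist_zero[of F x] infdist_nonneg[of x F] by fastforce
      have "\<exists>k. c k \<le> infdist x F"
        using reals_Archimedean[OF pos] by (auto simp: c_def inverse_eq_divide intro: less_imp_le)
      define k where "k = (LEAST k. c k \<le> infdist x F)"
      have k: "c k \<le> infdist x F"
        unfolding k_def using \<open>\<exists>k. c k \<le> infdist x F\<close> by (rule LeastI_ex)
      have k': "infdist x F < c j" if "j < k" for j
        using not_less_Least[OF that[unfolded k_def]] by simp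
      show "x \<in> A n \<union> (\<Union>i. R (i + n))"
      proof (cases "k \<le> n")
        case True
        then show ?thesis using x k c(3)[OF True] by (auto simp: A_def)
      next
        case False
        then obtain i where i: "k = Suc (i + n)"
          by (metis add.commute less_imp_Suc_add not_le)
        then have "x \<in> R (i + n)" using x k k'[of "i + n"] by (simp add: R_def)
        then show ?thesis by blast
      qed
    qed
    then have "hausdorff_outer (X - F) \<le> hausdorff_outer (A n \<union> (\<Union>i. R (i + n)))"
      by (rule hausdorff_outer_mono)
    also have "\<dots> \<le> hausdorff_outer (A n) + (\<Sum>i. hausdorff_outer (R (i + n)))"
      by (rule order_trans[OF hausdorff_outer_Un add_left_mono[OF hausdorff_outer_UN]])
    finally have 1: "hausdorff_outer (X - F) \<le> hausdorff_outer (A n) + (\<Sum>i. hausdorff_outer (R (i + n)))" .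
    have "hausdorff_outer (A n) + hausdorff_outer (X \<inter> F) \<le> hausdorff_outer (A n \<union> X \<inter> F)"
      using c(1) by (intro hausdorff_outer_infdist[of 0 "c n" _ F]) (auto simp: A_def)
    also have "\<dots> \<le> hausdorff_outer X" by (rule hausdorff_outer_mono) (auto simp: A_def)
    finally have 2: "hausdorff_outer (A n) + hausdorff_outer (X \<inter> F) \<le> hausdorff_outer X" .
    show ?thesis
      using order_trans[OF add_left_mono[OF 1, of "hausdorff_outer (X \<inter> F)"],
          of "hausdorff_outer X + (\<Sum>i. hausdorff_outer (R (i + n)))"]
        add_right_mono[OF 2, of "\<Sum>i. hausdorff_outer (R (i + n))"]
      by (metis add.assoc add.commute)
  qed
  then have "hausdorff_outer (X \<inter> F) + hausdorff_outer (X - F) \<le> hausdorff_outer X + 0"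
    by (intro LIMSEQ_le_const[OF tendsto_add[OF tendsto_const tail]]) auto
  then show ?thesis by simp
qed

lemma measure_space_hausdorff: "measure_space UNIV (sets borel) hausdorff_outer"
proof -
  let ?L = "lambda_system UNIV (Pow UNIV) hausdorff_outer"
  have "outer_measure_space (Pow UNIV) hausdorff_outer"
    by (auto simp: outer_measure_space_def positive_def increasing_def countably_subadditive_def
        hausdorff_outer_empty hausdorff_outer_mono hausdorff_outer_UN)
  then have L: "measure_space UNIV ?L hausdorff_outer"
    by (rule sigma_algebra.caratheodory_lemma[OF sigma_algebra_Pow])
  then interpret L: sigma_algebra UNIV ?L by (simp add: measure_space_def)
  have "F \<in> ?L" if "closed F" for F
  proof -
    have "hausdorff_outer X = hausdorff_outer (X \<inter> F) + hausdorff_outer (X - F)" for X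
    proof (rule antisym)
      show "hausdorff_outer X \<le> hausdorff_outer (X \<inter> F) + hausdorff_outer (X - F)"
        using hausdorff_outer_Un[of "X \<inter> F" "X - F"] unfolding Int_Diff_Un .
      show "hausdorff_outer (X \<inter> F) + hausdorff_outer (X - F) \<le> hausdorff_outer X"
        by (rule hausdorff_outer_closed[OF that])
    qed
    then have "\<forall>X. hausdorff_outer (X \<inter> F) + hausdorff_outer (X - F) = hausdorff_outer X"
      by metis
    then show ?thesis
      unfolding algebra.lambda_system_eq[OF algebra_Pow] by blast
  qed
  then have "sigma_sets UNIV (Collect closed) \<subseteq> ?L"
    by (intro L.sigma_sets_subset) auto
  then have "sets borel \<subseteq> ?L"
    by (simp add: borel_eq_closed)
  moreover have "sigma_algebra UNIV (sets (borel :: (real^2) measure))"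
    using sets.sigma_algebra_axioms[of "borel :: (real^2) measure"] by simp
  ultimately show ?thesis
    using L unfolding measure_space_def positive_def countably_additive_def by blast
qed

lemma sets_hausdorff1 [simp]: "sets hausdorff1 = sets borel"
  using sets.sigma_sets_eq[of borel] by (simp add: hausdorff1_def)

lemma emeasure_hausdorff1: "A \<in> sets borel \<Longrightarrow> emeasure hausdorff1 A = hausdorff_outer A"
  using measure_space_hausdorff
  by (intro emeasure_measure_of[OF hausdorff1_def]) (auto simp: measure_space_def)

end

theory Submission
  imports Defs "HOL-Complex_Analysis.Great_Picard"
begin

text \<open>
  The proof is the direct method, and the isometry constraint is what makes the energy tractable.
  If $(\nabla\psi)^\top\nabla\psi = g_A$ then $|\nabla\psi|^2 = \mathrm{tr}\, g_A$ and
  $|\partial_1\psi\times\partial_2\psi| = \sqrt{\det g_A}$. So admissible gradients are uniformly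
  bounded, and the area element times the unit normal is the polynomial
  $\partial_1\psi\times\partial_2\psi$ of the gradient. The energy density thus becomes a uniformly
  positive definite quadratic form in $D^2\psi$ plus a term linear in $D^2\psi$ whose coefficient
  depends on $\nabla\psi$ only (\<open>density_eq\<close>, \<open>energy_eq\<close>). Hence Hessians are bounded in $L^2$ along
  a minimizing sequence (\<open>coercive\<close>).

  Compactness. A function with bounded gradient has bounded oscillation on a connected Lipschitz
  domain (\<open>osc_controlled_domain\<close>), and the boundary condition on a set of positive length controls
  the remaining constant (\<open>trace_eq_on_const_bound\<close>); so admissible functions and their gradients are
  bounded pointwise. For such sequences, strong $L^2$ convergence of a subsequence needs only the
  Poincare inequality on small squares inside the domain, because the part that the squares leave
  uncovered has small measure (\<open>interior_compactness\<close>).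

  Passage to the limit. Almost everywhere convergence of the gradients preserves the isometry
  constraint. Once the normal is frozen at the limit gradient, the energy is convex in the Hessian,
  at the price of an error that tends to zero (\<open>J_freeze\<close>). The remaining constraints are linear.
  Weak convergence of the Hessians is therefore replaced by a form of Mazur's lemma: in a decreasing
  sequence of convex sets, elements of almost minimal norm converge strongly
  (\<open>midpoint_convex_selection\<close>). Their limit is the Hessian of a minimizer (\<open>minimizer_exists\<close>).

  Weakly differentiable functions enter through one formula, the integral representation of
  $u(x+e)-u(x)$ along the segment from $x$ to $x+e$ for almost every $x$ (\<open>increment_identity\<close>). It
  gives the Poincare inequality, the oscillation bound and, with increments that point into the
  domain and the estimate of the length measure on a Lipschitz graph by Lebesgue measure, the trace
  inequality (\<open>trace_inequality\<close>). The latter makes traces unique up to null sets and stable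
  under convergence in $H^1$ (\<open>is_trace_unique\<close>, \<open>is_trace_limit\<close>).
\<close>

section \<open>Square-integrable functions\<close>

abbreviation "leb (\<omega> :: 'a::euclidean_space set) \<equiv> lebesgue_on \<omega>"

abbreviation "sumsq v x \<equiv> (\<Sum>i\<in>UNIV. (v i x)\<^sup>2)"

definition sqint :: "'a measure => ('a => 'b::euclidean_space) => bool" where
  "sqint M u \<longleftrightarrow> u \<in> borel_measurable M \<and> integrable M (\<lambda>x. (norm (u x))\<^sup>2)"

definition l2sq :: "'a measure => ('a => 'b::euclidean_space) => real" where
  "l2sq M u = (LINT x|M. (norm (u x))\<^sup>2)"

lemma sqintD [dest]: "sqint M u ==> u \<in> borel_measurable M" "sqint M u ==> integrable M (\<lambda>x. (norm (u x))\<^sup>2)"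
  by (auto simp: sqint_def)

lemma norm_add_sq_le: "(norm (a + b :: 'b::real_normed_vector))\<^sup>2 <= 2 * (norm a)\<^sup>2 + 2 * (norm b)\<^sup>2"
proof -
  have "(norm (a + b))\<^sup>2 <= (norm a + norm b)\<^sup>2" by (intro power_mono norm_triangle_ineq) auto
  also have "\<dots> <= 2 * (norm a)\<^sup>2 + 2 * (norm b)\<^sup>2"
    using sum_squares_bound[of "norm a" "norm b"] by (simp add: power2_sum)
  finally show ?thesis .
qed

lemma sqint_bound:
  assumes "u \<in> borel_measurable M" "integrable M w" "AE x in M. (norm (u x))\<^sup>2 <= w x"
  shows "sqint M u"
  unfolding sqint_def
proof (intro conjI Bochner_Integration.integrable_bound[OF assms(2)])
  show "AE x in M. norm ((norm (u x))\<^sup>2) <= norm (w x)"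
    using assms(3) by eventually_elim simp
qed (use assms(1) in \<open>simp_all\<close>)

lemma sqint_add: assumes "sqint M u" "sqint M v" shows "sqint M (\<lambda>x. u x + v x)"
  using sqintD[OF assms(1)] sqintD[OF assms(2)]
  by (intro sqint_bound[where w="\<lambda>x. 2 * (norm (u x))\<^sup>2 + 2 * (norm (v x))\<^sup>2"])
     (simp_all add: norm_add_sq_le)

lemma sqint_scaleR: assumes "sqint M u" shows "sqint M (\<lambda>x. c *\<^sub>R u x)"
  using sqintD[OF assms] by (auto simp: sqint_def power_mult_distrib)

lemma sqint_cmult: assumes "sqint M u" shows "sqint M (\<lambda>x. c * u x :: real)"
  using sqint_scaleR[OF assms] by simp

lemma sqint_diff: assumes "sqint M u" "sqint M v" shows "sqint M (\<lambda>x. u x - v x)"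
  using sqint_add[OF assms(1) sqint_scaleR[OF assms(2), of "-1"]] by simp

lemma sqint_cong_AE:
  assumes "sqint M u" "AE x in M. u x = v x" "v \<in> borel_measurable M"
  shows "sqint M v"
  using sqintD[OF assms(1)] assms(2,3)
  by (intro sqint_bound[where w="\<lambda>x. (norm (u x))\<^sup>2"]) auto

lemma l2sq_nonneg [simp]: "0 <= l2sq M u"
  by (simp add: l2sq_def)

lemma l2sq_cong_AE:
  assumes "AE x in M. u x = v x" "u \<in> borel_measurable M" "v \<in> borel_measurable M"
  shows "l2sq M u = l2sq M v"
  unfolding l2sq_def using assms by (intro integral_cong_AE) auto

lemma l2sq_mono:
  assumes "sqint M v" "AE x in M. norm (u x) <= norm (v x)"
  shows "l2sq M u <= l2sq M v"
  unfolding l2sq_def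
  by (intro integral_mono_AE') (use assms in \<open>auto intro: power_mono\<close>)

lemma l2sq_scaleR: "l2sq M (\<lambda>x. c *\<^sub>R u x) = c\<^sup>2 * l2sq M u"
  by (simp add: l2sq_def power_mult_distrib)

lemma l2sq_cmult: "l2sq M (\<lambda>x. c * u x :: real) = c\<^sup>2 * l2sq M u"
  by (simp add: l2sq_def power_mult_distrib)

lemma l2sq_minus_commute: "l2sq M (\<lambda>x. u x - v x) = l2sq M (\<lambda>x. v x - u x)"
  by (simp add: l2sq_def norm_minus_commute)

lemma l2sq_add_le:
  assumes "sqint M u" "sqint M v"
  shows "l2sq M (\<lambda>x. u x + v x) <= 2 * l2sq M u + 2 * l2sq M v"
proof -
  have "l2sq M (\<lambda>x. u x + v x) <= (LINT x|M. 2 * (norm (u x))\<^sup>2 + 2 * (norm (v x))\<^sup>2)"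
    unfolding l2sq_def using sqintD[OF assms(1)] sqintD[OF assms(2)] sqintD[OF sqint_add[OF assms]]
    by (intro integral_mono) (auto simp: norm_add_sq_le)
  also have "\<dots> = 2 * l2sq M u + 2 * l2sq M v"
    unfolding l2sq_def using sqintD[OF assms(1)] sqintD[OF assms(2)] by (subst Bochner_Integration.integral_add) auto
  finally show ?thesis .
qed

lemma l2sq_diff_le:
  assumes "sqint M u" "sqint M v"
  shows "l2sq M (\<lambda>x. u x - v x) <= 2 * l2sq M u + 2 * l2sq M v"
  using l2sq_add_le[OF assms(1) sqint_scaleR[OF assms(2), of "-1"]] l2sq_scaleR[of M "-1" v] by simp

lemma l2sq_triangle:
  assumes "sqint M u" "sqint M v" "sqint M w"
  shows "l2sq M (\<lambda>x. u x - w x) <= 2 * l2sq M (\<lambda>x. u x - v x) + 2 * l2sq M (\<lambda>x. v x - w x)"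
  using l2sq_add_le[OF sqint_diff[OF assms(1,2)] sqint_diff[OF assms(2,3)]] by simp

lemma integrable_sqint_inner:
  assumes "sqint M u" "sqint M v"
  shows "integrable M (\<lambda>x. u x \<bullet> v x)"
proof (rule Bochner_Integration.integrable_bound)
  show "integrable M (\<lambda>x. (norm (u x))\<^sup>2 + (norm (v x))\<^sup>2)" using assms by auto
  have "\<bar>u x \<bullet> v x\<bar> <= (norm (u x))\<^sup>2 + (norm (v x))\<^sup>2" for x
    using Cauchy_Schwarz_ineq2[of "u x" "v x"] sum_squares_bound[of "norm (u x)" "norm (v x)"]
      zero_le_power2[of "norm (u x)"] zero_le_power2[of "norm (v x)"] by linarith
  then show "AE x in M. norm (u x \<bullet> v x) <= norm ((norm (u x))\<^sup>2 + (norm (v x))\<^sup>2)" by auto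
qed (use sqintD(1)[OF assms(1)] sqintD(1)[OF assms(2)] in measurable)

lemma integrable_sqint_mult:
  assumes "sqint M u" "sqint M v"
  shows "integrable M (\<lambda>x. u x * v x :: real)"
  using integrable_sqint_inner[OF assms] by simp

text \<open>Nonnegativity of this quadratic polynomial in the scalar yields both the
  Cauchy--Schwarz inequality and Young's inequality.\<close>

lemma l2sq_add_scaleR:
  assumes "sqint M u" "sqint M v"
  shows "l2sq M (\<lambda>x. u x + t *\<^sub>R v x) = l2sq M u + 2 * t * (LINT x|M. u x \<bullet> v x) + t\<^sup>2 * l2sq M v"
proof -
  have "(norm (u x + t *\<^sub>R v x))\<^sup>2 = (norm (u x))\<^sup>2 + (2 * t) * (u x \<bullet> v x) + t\<^sup>2 * (norm (v x))\<^sup>2" for x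
    unfolding power2_norm_eq_inner by (simp add: inner_commute algebra_simps power2_eq_square)
  then show ?thesis
    unfolding l2sq_def using sqintD[OF assms(1)] sqintD[OF assms(2)] integrable_sqint_inner[OF assms]
    by simp
qed

text \<open>This identity does the work of weak compactness below: almost minimal elements of a
  convex set are close to each other.\<close>

lemma l2sq_parallelogram:
  assumes "sqint M u" "sqint M v"
  shows "l2sq M (\<lambda>x. u x - v x) = 2 * l2sq M u + 2 * l2sq M v - 4 * l2sq M (\<lambda>x. (1/2) *\<^sub>R (u x + v x))"
  using l2sq_add_scaleR[OF assms, of "-1"] l2sq_add_scaleR[OF assms, of "1"]
    l2sq_scaleR[of M "1/2" "\<lambda>x. u x + v x"] by (simp add: power2_eq_square)

lemma l2sq_Cauchy_Schwarz:
  assumes "sqint M u" "sqint M v"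
  shows "(LINT x|M. u x \<bullet> v x)\<^sup>2 <= l2sq M u * l2sq M v"
proof -
  define b where "b = (LINT x|M. u x \<bullet> v x)"
  have q: "0 <= l2sq M u + 2 * t * b + t\<^sup>2 * l2sq M v" for t
    using l2sq_add_scaleR[OF assms, of t] l2sq_nonneg[of M "\<lambda>x. u x + t *\<^sub>R v x"] by (simp add: b_def)
  show ?thesis
  proof (cases "l2sq M v = 0")
    case True
    have "b = 0"
    proof (rule ccontr)
      assume "b \<noteq> 0"
      then show False using q[of "- (l2sq M u + 1) / (2 * b)"] True by (simp add: field_simps)
    qed
    then show ?thesis using True by (simp add: b_def)
  next
    case False
    then have "l2sq M v > 0" using l2sq_nonneg[of M v] by linarith
    then show ?thesis using q[of "- b / l2sq M v"]
      by (simp add: b_def field_simps power2_eq_square)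
  qed
qed

lemma l2sq_tendsto_inner:
  fixes u v :: "'a => 'b::euclidean_space"
  assumes su: "\<And>k. sqint M (U k)" "sqint M u" and sv: "\<And>k. sqint M (V k)" "sqint M v"
    and cu: "(\<lambda>k. l2sq M (\<lambda>x. U k x - u x)) \<longlonglongrightarrow> 0" and cv: "(\<lambda>k. l2sq M (\<lambda>x. V k x - v x)) \<longlonglongrightarrow> 0"
  shows "(\<lambda>k. LINT x|M. U k x \<bullet> V k x) \<longlonglongrightarrow> (LINT x|M. u x \<bullet> v x)"
proof -
  have sq0: "f \<longlonglongrightarrow> 0" if "\<And>k. (f k)\<^sup>2 <= g k" "g \<longlonglongrightarrow> 0" for f g :: "nat => real"
  proof -
    have "(\<lambda>k. (f k)\<^sup>2) \<longlonglongrightarrow> 0"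
      by (rule tendsto_sandwich[OF _ _ tendsto_const that(2)]) (use that(1) in auto)
    then show ?thesis by simp
  qed
  have 1: "(\<lambda>k. LINT x|M. (U k x - u x) \<bullet> v x) \<longlonglongrightarrow> 0"
    by (rule sq0[OF l2sq_Cauchy_Schwarz]) (use su sv cu in \<open>auto intro!: sqint_diff tendsto_mult_left_zero\<close>)
  have 2: "(\<lambda>k. LINT x|M. u x \<bullet> (V k x - v x)) \<longlonglongrightarrow> 0"
    by (rule sq0[OF l2sq_Cauchy_Schwarz]) (use su sv cv in \<open>auto intro!: sqint_diff tendsto_mult_right_zero\<close>)
  have 3: "(\<lambda>k. LINT x|M. (U k x - u x) \<bullet> (V k x - v x)) \<longlonglongrightarrow> 0"
    by (rule sq0[OF l2sq_Cauchy_Schwarz]) (use su sv tendsto_mult[OF cu cv] in \<open>auto intro!: sqint_diff\<close>)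
  have "(LINT x|M. U k x \<bullet> V k x) = (LINT x|M. (U k x - u x) \<bullet> v x) + (LINT x|M. u x \<bullet> (V k x - v x))
      + (LINT x|M. (U k x - u x) \<bullet> (V k x - v x)) + (LINT x|M. u x \<bullet> v x)" for k
  proof -
    have "integrable M (\<lambda>x. (U k x - u x) \<bullet> v x)" "integrable M (\<lambda>x. u x \<bullet> (V k x - v x))"
       "integrable M (\<lambda>x. (U k x - u x) \<bullet> (V k x - v x))" "integrable M (\<lambda>x. u x \<bullet> v x)"
      using su sv by (auto intro!: integrable_sqint_inner sqint_diff)
    note i = this
    have "U k x \<bullet> V k x = (U k x - u x) \<bullet> v x + u x \<bullet> (V k x - v x) + (U k x - u x) \<bullet> (V k x - v x) + u x \<bullet> v x" for x
      by (simp add: algebra_simps)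
    then show ?thesis
      using i by simp
  qed
  then show ?thesis using tendsto_add[OF tendsto_add[OF tendsto_add[OF 1 2] 3] tendsto_const[of "LINT x|M. u x \<bullet> v x"]]
    by simp
qed

lemma l2sq_tendsto:
  assumes "\<And>k. sqint M (U k)" "sqint M u" "(\<lambda>k. l2sq M (\<lambda>x. U k x - u x)) \<longlonglongrightarrow> 0"
  shows "(\<lambda>k. l2sq M (U k)) \<longlonglongrightarrow> l2sq M u"
  using l2sq_tendsto_inner[OF assms(1,2) assms(1,2) assms(3,3)] by (simp add: l2sq_def power2_norm_eq_inner)

lemma l2sq_AE_subseq:
  assumes "\<And>k. sqint M (U k)" "sqint M u" "(\<lambda>k. l2sq M (\<lambda>x. U k x - u x)) \<longlonglongrightarrow> 0"
  obtains r where "strict_mono (r::nat => nat)" "AE x in M. (\<lambda>k. U (r k) x) \<longlonglongrightarrow> u x"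
proof -
  have "\<exists>r. strict_mono (r::nat=>nat) \<and> (AE x in M. (\<lambda>k. (norm (U (r k) x - u x))\<^sup>2) \<longlonglongrightarrow> 0)"
  proof (rule tendsto_L1_AE_subseq)
    show "integrable M (\<lambda>x. (norm (U k x - u x))\<^sup>2)" for k
      using sqint_diff[OF assms(1,2)] by auto
    show "(\<lambda>n. \<integral>x. norm ((norm (U n x - u x))\<^sup>2) \<partial>M) \<longlonglongrightarrow> 0"
      using assms(3) by (simp add: l2sq_def)
  qed
  then obtain r where r: "strict_mono r" "AE x in M. (\<lambda>k. (norm (U (r k) x - u x))\<^sup>2) \<longlonglongrightarrow> 0"
    by blast
  have "AE x in M. (\<lambda>k. U (r k) x) \<longlonglongrightarrow> u x"
    using r(2) by eventually_elim (simp add: tendsto_norm_zero_iff LIM_zero_iff)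
  then show ?thesis using that r(1) by blast
qed

lemma l2sq_dominated_convergence:
  assumes "\<And>k. U k \<in> borel_measurable M" "u \<in> borel_measurable M" "integrable M (\<lambda>x. (w x)\<^sup>2)"
    "\<And>k. AE x in M. norm (U k x - u x) <= w x" "AE x in M. (\<lambda>k. U k x) \<longlonglongrightarrow> u x"
  shows "(\<lambda>k. l2sq M (\<lambda>x. U k x - u x)) \<longlonglongrightarrow> 0"
proof -
  have "(\<lambda>k. LINT x|M. (norm (U k x - u x))\<^sup>2) \<longlonglongrightarrow> (LINT x|M. 0)"
  proof (rule integral_dominated_convergence[where w="\<lambda>x. (w x)\<^sup>2"])
    show "AE x in M. (\<lambda>i. (norm (U i x - u x))\<^sup>2) \<longlonglongrightarrow> 0"
      using assms(5)
    proof eventually_elim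
      case (elim x)
      then show ?case using tendsto_power[OF tendsto_norm[OF LIM_zero[OF elim]], of 2] by simp
    qed
    show "AE x in M. norm ((norm (U i x - u x))\<^sup>2) <= (w x)\<^sup>2" for i
      using assms(4)[of i] by eventually_elim (auto intro: power_mono)
  qed (use assms in auto)
  then show ?thesis by (simp add: l2sq_def)
qed

text \<open>The Riesz--Fischer theorem, for functions with values in a Euclidean space.\<close>

lemma l2_complete:
  fixes U :: "nat => 'a => 'b::euclidean_space"
  assumes s: "\<And>k. sqint M (U k)"
    and C: "\<And>e. e > 0 ==> \<exists>N. \<forall>m\<ge>N. \<forall>n\<ge>N. l2sq M (\<lambda>x. U m x - U n x) < e"
  obtains u where "sqint M u" "(\<lambda>k. l2sq M (\<lambda>x. U k x - u x)) \<longlonglongrightarrow> 0"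
proof -
  have [measurable]: "U k \<in> borel_measurable M" for k using s by auto
  have nn: "(\<integral>\<^sup>+x. ennreal ((norm (U m x - U n x))\<^sup>2) \<partial>M) = ennreal (l2sq M (\<lambda>x. U m x - U n x))" for m n
    unfolding l2sq_def using sqint_diff[OF s s, of m n] by (intro nn_integral_eq_integral) auto
  obtain N where N: "\<And>k m n. m >= N k ==> n >= N k ==> l2sq M (\<lambda>x. U m x - U n x) < (1/4)^k"
    using C[of "(1/4)^k" for k] by (metis zero_less_divide_1_iff zero_less_numeral zero_less_power)
  define r where "r k = (\<Sum>i\<le>k. N i)" for k
  have rN: "r k >= N k" "r (Suc k) >= N k" for k
    using member_le_sum[of k "{..k}" N] by (auto simp: r_def)
  define D where "D k x = U (r (Suc k)) x - U (r k) x" for k x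
  have [measurable]: "D k \<in> borel_measurable M" for k unfolding D_def by measurable
  have "(\<integral>\<^sup>+x. (\<Sum>k. ennreal (2^k * (norm (D k x))\<^sup>2)) \<partial>M) = (\<Sum>k. \<integral>\<^sup>+x. ennreal (2^k * (norm (D k x))\<^sup>2) \<partial>M)"
    by (intro nn_integral_suminf) measurable
  also have "\<dots> <= (\<Sum>k. ennreal ((1/2)^k))"
  proof (intro suminf_le allI)
    fix k
    have "(\<integral>\<^sup>+x. ennreal (2^k * (norm (D k x))\<^sup>2) \<partial>M) = ennreal (2^k) * ennreal (l2sq M (\<lambda>x. U (r (Suc k)) x - U (r k) x))"
      unfolding nn[symmetric] D_def by (subst nn_integral_cmult[symmetric]) (auto simp: ennreal_mult)
    also have "\<dots> = ennreal (2^k * l2sq M (\<lambda>x. U (r (Suc k)) x - U (r k) x))" by (simp add: ennreal_mult)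
    also have "\<dots> <= ennreal (2^k * (1/4)^k)"
      using N[OF rN(2,1), of k] by (intro ennreal_leI mult_left_mono) auto
    also have "2^k * (1/4)^k = ((1/2)^k :: real)" by (simp flip: power_mult_distrib)
    finally show "(\<integral>\<^sup>+x. ennreal (2^k * (norm (D k x))\<^sup>2) \<partial>M) <= ennreal ((1/2)^k)" .
  qed auto
  also have "\<dots> = ennreal (\<Sum>k. (1/2)^k)" by (intro suminf_ennreal2 summable_geometric) auto
  finally have fin: "(\<integral>\<^sup>+x. (\<Sum>k. ennreal (2^k * (norm (D k x))\<^sup>2)) \<partial>M) \<noteq> \<infinity>"
    by (auto simp: top_unique)
  have "AE x in M. (\<Sum>k. ennreal (2^k * (norm (D k x))\<^sup>2)) \<noteq> \<infinity>"
    by (rule nn_integral_PInf_AE[OF _ fin]) measurable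
  then have conv: "AE x in M. convergent (\<lambda>k. U (r k) x)"
  proof eventually_elim
    case (elim x)
    have "summable (\<lambda>k. 2^k * (norm (D k x))\<^sup>2)"
      using elim by (intro summable_suminf_not_top) auto
    then have "Bseq (\<lambda>k. 2^k * (norm (D k x))\<^sup>2)"
      by (intro convergent_imp_Bseq) (use summable_LIMSEQ_zero convergentI in blast)
    then obtain K where K: "K > 0" "\<And>k. 2^k * (norm (D k x))\<^sup>2 <= K"
      by (auto simp: Bseq_def abs_mult)
    have "norm (D k x) <= sqrt K * (1 / sqrt 2)^k" for k
    proof -
      have "norm (D k x) = sqrt ((norm (D k x))\<^sup>2)" by simp
      also have "\<dots> <= sqrt (K / 2^k)" using K(2)[of k]
        by (intro real_sqrt_le_mono) (simp add: field_simps)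
      also have "\<dots> = sqrt K * (1 / sqrt 2)^k" by (simp add: real_sqrt_divide real_sqrt_power power_divide)
      finally show ?thesis .
    qed
    moreover have sg: "summable (\<lambda>k. sqrt K * (1 / sqrt 2)^k)"
      by (intro summable_mult summable_geometric) auto
    ultimately have "summable (\<lambda>k. D k x)" using summable_comparison_test'[OF sg, of 0 "\<lambda>k. D k x"] by blast
    then have "convergent (\<lambda>n. \<Sum>k<n. D k x)" by (simp add: summable_iff_convergent)
    moreover have "(\<Sum>k<n. D k x) = U (r n) x - U (r 0) x" for n
      unfolding D_def by (rule sum_lessThan_telescope)
    ultimately have "convergent (\<lambda>n. U (r n) x - U (r 0) x)" by simp
    then have "convergent (\<lambda>n. (U (r n) x - U (r 0) x) + U (r 0) x)"
      by (intro convergent_add convergent_const)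
    then show ?case by simp
  qed
  define u where "u x = lim (\<lambda>k. U (r k) x)" for x
  have [measurable]: "u \<in> borel_measurable M" unfolding u_def by measurable
  have lim: "AE x in M. (\<lambda>k. U (r k) x) \<longlonglongrightarrow> u x"
    using conv by eventually_elim (simp add: u_def convergent_LIMSEQ_iff)
  have key: "(\<integral>\<^sup>+x. ennreal ((norm (U m x - u x))\<^sup>2) \<partial>M) <= ennreal ((1/4)^k)" if "m >= N k" for m k
  proof -
    have "(\<integral>\<^sup>+x. ennreal ((norm (U m x - u x))\<^sup>2) \<partial>M)
       = (\<integral>\<^sup>+x. liminf (\<lambda>n. ennreal ((norm (U m x - U (r n) x))\<^sup>2)) \<partial>M)"
    proof (rule nn_integral_cong_AE, use lim in eventually_elim)
      case (elim x)
      then have "(\<lambda>n. ennreal ((norm (U m x - U (r n) x))\<^sup>2)) \<longlonglongrightarrow> ennreal ((norm (U m x - u x))\<^sup>2)"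
        by (intro tendsto_intros)
      then show ?case by (metis lim_imp_Liminf trivial_limit_sequentially)
    qed
    also have "\<dots> <= liminf (\<lambda>n. \<integral>\<^sup>+x. ennreal ((norm (U m x - U (r n) x))\<^sup>2) \<partial>M)"
      by (rule nn_integral_liminf) measurable
    also have "\<dots> <= ennreal ((1/4)^k)"
    proof (rule order_trans[OF Liminf_le_Limsup Limsup_bounded])
      show "\<forall>\<^sub>F n in sequentially. (\<integral>\<^sup>+x. ennreal ((norm (U m x - U (r n) x))\<^sup>2) \<partial>M) <= ennreal ((1/4)^k)"
        using eventually_ge_at_top[of k]
      proof eventually_elim
        case (elim n)
        have "N k <= r n" unfolding r_def using elim by (intro member_le_sum) auto
        then show ?case unfolding nn using N[OF that, of "r n"] by (intro ennreal_leI) auto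
      qed
    qed auto
    finally show ?thesis .
  qed
  have sd: "sqint M (\<lambda>x. U (N 0) x - u x)"
    unfolding sqint_def integrable_iff_bounded using key[of 0 "N 0"]
    by (auto intro: le_less_trans simp: less_top[symmetric] top_unique)
  have su: "sqint M u"
    using sqint_diff[OF s sd, of "N 0"] by simp
  have "(\<lambda>k. l2sq M (\<lambda>x. U k x - u x)) \<longlonglongrightarrow> 0"
  proof (rule LIMSEQ_I)
    fix e :: real assume "e > 0"
    then obtain k where k: "(1/4)^k < e" using real_arch_pow_inv[of e "1/4"] by auto
    show "\<exists>no. \<forall>n\<ge>no. norm (l2sq M (\<lambda>x. U n x - u x) - 0) < e"
    proof (intro exI allI impI)
      fix m assume m: "N k <= m"
      have "ennreal (l2sq M (\<lambda>x. U m x - u x)) <= ennreal ((1/4)^k)"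
        using key[OF m] unfolding l2sq_def
        by (subst nn_integral_eq_integral[symmetric]) (use sqint_diff[OF s su] in auto)
      then show "norm (l2sq M (\<lambda>x. U m x - u x) - 0) < e" using k by simp
    qed
  qed
  then show ?thesis using su that by blast
qed

lemma (in finite_measure) sqint_bounded:
  assumes "u \<in> borel_measurable M" "AE x in M. norm (u x) <= C"
  shows "sqint M u"
  using assms(2) by (intro sqint_bound[OF assms(1), where w="\<lambda>_. C\<^sup>2"]) (auto elim!: eventually_mono intro: power_mono)

lemma (in finite_measure) sqint_const: "sqint M (\<lambda>_. c)"
  by (rule sqint_bounded[of _ "norm c"]) auto

lemma (in finite_measure) integrable_sqint:
  assumes "sqint M u"
  shows "integrable M u"
proof (rule Bochner_Integration.integrable_bound)
  show "integrable M (\<lambda>x. 1 + (norm (u x))\<^sup>2)" using assms by auto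
  have "norm (u x) <= 1 + (norm (u x))\<^sup>2" for x
    using sum_squares_bound[of "1" "norm (u x)"] norm_ge_zero[of "u x"] by (simp only: power_one mult_1_right)
  then show "AE x in M. norm (u x) <= norm (1 + (norm (u x))\<^sup>2)" by auto
qed (use assms in auto)

lemma sqint_mult_bounded:
  assumes "sqint M u" "a \<in> borel_measurable M" "AE x in M. \<bar>a x\<bar> <= C"
  shows "sqint M (\<lambda>x. a x *\<^sub>R u x)"
proof (rule sqint_bound[where w="\<lambda>x. C\<^sup>2 * (norm (u x))\<^sup>2"])
  show "AE x in M. (norm (a x *\<^sub>R u x))\<^sup>2 <= C\<^sup>2 * (norm (u x))\<^sup>2"
    using assms(3)
  proof eventually_elim
    case (elim x)
    have "\<bar>a x\<bar>\<^sup>2 <= C\<^sup>2" using elim by (intro power_mono) auto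
    then show ?case by (auto simp: power_mult_distrib intro: mult_right_mono)
  qed
qed (use assms in auto)

section \<open>Smooth cut-off functions and the fundamental lemma\<close>

text \<open>The functions $p(1/t)e^{-1/t}$, extended by zero to the left half-line: the smallest
  class that contains $e^{-1/t}$ and all of its derivatives.\<close>

definition flat :: "real poly => real => real" where
  "flat p t = (if t > 0 then poly p (1/t) * exp (- (1/t)) else 0)"

lemma poly_div_exp_tendsto_0: "((\<lambda>x::real. poly p x * exp (- x)) \<longlongrightarrow> 0) at_top"
proof -
  have "((\<lambda>x::real. \<Sum>i\<le>degree p. coeff p i * (x ^ i / exp x)) \<longlongrightarrow> (\<Sum>i\<le>degree p. coeff p i * 0)) at_top"
    by (intro tendsto_intros tendsto_power_div_exp_0)
  moreover have "(\<Sum>i\<le>degree p. coeff p i * (x ^ i / exp x)) = poly p x * exp (- x)" for x :: real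
    by (simp add: poly_altdef sum_distrib_right exp_minus divide_inverse mult.assoc)
  ultimately show ?thesis by simp
qed

text \<open>Products of $e^{-1/t}$ with polynomials in $1/t$ are closed under differentiation,
  because $(p(1/t)e^{-1/t})' = t^{-2}(p - p')(1/t)\,e^{-1/t}$; at the origin all of them are
  flat.\<close>

lemma flat_has_derivative: "(flat p has_real_derivative flat ([:0,0,1:] * (p - pderiv p)) t) (at t)"
proof -
  consider "t < 0" | "t = 0" | "t > 0" by linarith
  then show ?thesis
  proof cases
    case 1
    have "((\<lambda>_. 0) has_real_derivative 0) (at t)" by simp
    then have "(flat p has_real_derivative 0) (at t)"
      by (rule DERIV_cong_ev[THEN iffD1, rotated 3])
         (use 1 in \<open>auto intro!: eventually_mono[OF eventually_nhds_in_open[of "{..<0}"]] simp: flat_def\<close>)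
    then show ?thesis using 1 by (simp add: flat_def)
  next
    case 2
    have "((\<lambda>h. poly (pCons 0 p) (inverse h) * exp (- inverse h)) \<longlongrightarrow> 0) (at_right 0)"
      by (rule filterlim_compose[OF poly_div_exp_tendsto_0 filterlim_inverse_at_top_right])
    then have r: "((\<lambda>h. (flat p (0 + h) - flat p 0) / h) \<longlongrightarrow> 0) (at_right 0)"
      by (rule Lim_transform_eventually)
         (auto simp: flat_def eventually_at_filter field_simps intro!: always_eventually)
    have l: "((\<lambda>h. (flat p (0 + h) - flat p 0) / h) \<longlongrightarrow> 0) (at_left 0)"
      by (rule Lim_transform_eventually[OF tendsto_const])
         (auto simp: flat_def eventually_at_filter intro!: always_eventually)
    have "((\<lambda>h. (flat p (0 + h) - flat p 0) / h) \<longlongrightarrow> 0) (at 0)"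
      using l r by (rule filterlim_split_at)
    then show ?thesis using 2 by (simp add: DERIV_def flat_def)
  next
    case 3
    have "((\<lambda>s. poly p (1/s) * exp (- (1/s))) has_real_derivative
        poly (pderiv p) (1/t) * (- 1 / t^2) * exp (-(1/t)) + poly p (1/t) * (exp (-(1/t)) * (1/t^2))) (at t)"
      using 3 by (auto intro!: derivative_eq_intros poly_DERIV[THEN DERIV_chain2] simp: power2_eq_square)
    moreover have "poly (pderiv p) (1/t) * (- 1 / t^2) * exp (-(1/t)) + poly p (1/t) * (exp (-(1/t)) * (1/t^2))
        = poly ([:0,0,1:] * (p - pderiv p)) (1/t) * exp (-(1/t))"
      by (simp add: power2_eq_square algebra_simps)
    ultimately have "((\<lambda>s. poly p (1/s) * exp (- (1/s))) has_real_derivative flat ([:0,0,1:] * (p - pderiv p)) t) (at t)"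
      using 3 by (simp add: flat_def)
    then show ?thesis
      by (rule DERIV_cong_ev[THEN iffD1, rotated 3])
         (use 3 in \<open>auto intro!: eventually_mono[OF eventually_nhds_in_open[of "{0<..}"]] simp: flat_def\<close>)
  qed
qed

lemma differentiable_has_derivative_partial:
  fixes \<phi> :: "real^2 => real"
  assumes "\<phi> differentiable (at x)"
  shows "(\<phi> has_derivative (\<lambda>h. \<Sum>i\<in>UNIV. h $ i * partial i \<phi> x)) (at x)"
proof -
  have d: "(\<phi> has_derivative frechet_derivative \<phi> (at x)) (at x)"
    using assms by (simp add: frechet_derivative_works)
  then interpret bounded_linear "frechet_derivative \<phi> (at x)" by (rule has_derivative_bounded_linear)
  have "frechet_derivative \<phi> (at x) h = (\<Sum>i\<in>UNIV. h $ i * partial i \<phi> x)" for h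
  proof -
    have "h = (\<Sum>i\<in>UNIV. h $ i *\<^sub>R axis i 1)"
      by (simp add: vec_eq_iff axis_def if_distrib cong: if_cong)
    then have "frechet_derivative \<phi> (at x) h = frechet_derivative \<phi> (at x) (\<Sum>i\<in>UNIV. h $ i *\<^sub>R axis i 1)" by simp
    also have "\<dots> = (\<Sum>i\<in>UNIV. h $ i * partial i \<phi> x)" by (simp add: sum scale partial_def)
    finally show ?thesis .
  qed
  then show ?thesis using d by (metis (no_types, lifting) ext)
qed

lemma partial_eqI:
  assumes "(\<phi> has_derivative D) (at x)"
  shows "partial i \<phi> x = D (axis i 1)"
  using frechet_derivative_at[OF assms] by (simp add: partial_def)

lemma Ck_differentiable: "Ck (Suc k) \<phi> ==> \<phi> differentiable (at x)"
  by (simp add: differentiable_on_def)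

lemma Ck_Suc_I:
  assumes "\<And>x. \<phi> differentiable (at x)" "\<And>i. Ck k (partial i \<phi>)"
  shows "Ck (Suc k) \<phi>"
  using assms by (simp add: differentiable_on_def)

lemma Ck_continuous: "Ck k \<phi> ==> continuous_on UNIV \<phi>"
  by (cases k) (auto simp: differentiable_imp_continuous_on)

lemma Ck_Suc_imp: "Ck (Suc k) \<phi> ==> Ck k \<phi>"
proof (induction k arbitrary: \<phi>)
  case 0 then show ?case by (auto simp: differentiable_imp_continuous_on)
next
  case (Suc k) then show ?case by (metis Ck.simps(2))
qed

lemma Ck_const: "Ck k (\<lambda>_. c)"
proof (induction k arbitrary: c)
  case (Suc k)
  have "partial i (\<lambda>_. c) = (\<lambda>_. 0)" for i
    using partial_eqI[OF has_derivative_const] by auto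
  then show ?case using Suc by (intro Ck_Suc_I) auto
qed simp

lemma Ck_add: "Ck k f ==> Ck k g ==> Ck k (\<lambda>x. f x + g x)"
proof (induction k arbitrary: f g)
  case (Suc k)
  have "partial i (\<lambda>x. f x + g x) = (\<lambda>x. partial i f x + partial i g x)" for i
  proof
    fix x
    show "partial i (\<lambda>x. f x + g x) x = partial i f x + partial i g x"
      using partial_eqI[OF has_derivative_add[OF frechet_derivative_works[THEN iffD1] frechet_derivative_works[THEN iffD1]],
          OF Ck_differentiable[OF Suc.prems(1)] Ck_differentiable[OF Suc.prems(2)]]
      by (simp add: partial_def)
  qed
  then show ?case using Suc by (intro Ck_Suc_I) (auto simp: differentiable_on_def)
qed (auto intro: continuous_on_add)

lemma Ck_mult: "Ck k f ==> Ck k g ==> Ck k (\<lambda>x. f x * g x)"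
proof (induction k arbitrary: f g)
  case (Suc k)
  have "partial i (\<lambda>x. f x * g x) = (\<lambda>x. f x * partial i g x + partial i f x * g x)" for i
  proof
    fix x
    show "partial i (\<lambda>x. f x * g x) x = f x * partial i g x + partial i f x * g x"
      using partial_eqI[OF has_derivative_mult[OF frechet_derivative_works[THEN iffD1] frechet_derivative_works[THEN iffD1]],
          OF Ck_differentiable[OF Suc.prems(1)] Ck_differentiable[OF Suc.prems(2)]]
      by (simp add: partial_def)
  qed
  then show ?case using Suc Ck_Suc_imp[OF Suc.prems(1)] Ck_Suc_imp[OF Suc.prems(2)]
    by (intro Ck_Suc_I) (auto simp: differentiable_on_def intro!: Ck_add)
qed (auto intro: continuous_on_mult)

lemma Ck_prod: "finite I ==> (\<And>i. i \<in> I ==> Ck k (f i)) ==> Ck k (\<lambda>x. \<Prod>i\<in>I. f i x)"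
  by (induction I rule: finite_induct) (auto simp: Ck_const intro: Ck_mult)

lemma Ck_flat: "Ck k (\<lambda>x. flat p (c * x $ i + d))"
proof (induction k arbitrary: p)
  case 0
  have "continuous_on UNIV (flat p)"
    using DERIV_isCont[OF flat_has_derivative] by (simp add: continuous_at_imp_continuous_on)
  then show ?case
    by (auto intro!: continuous_on_compose2[of UNIV "flat p"] continuous_intros)
next
  case (Suc k)
  let ?q = "[:0,0,1:] * (p - pderiv p)"
  have d: "((\<lambda>x. flat p (c * x $ i + d)) has_derivative (\<lambda>h. (c * h $ i) * flat ?q (c * x $ i + d))) (at x)" for x :: "real^2"
    by (rule has_derivative_eq_rhs, rule has_derivative_compose[OF _ has_field_derivative_imp_has_derivative[OF flat_has_derivative]])
       (auto intro!: derivative_eq_intros bounded_linear_imp_has_derivative bounded_linear_vec_nth)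
  have "partial j (\<lambda>x. flat p (c * x $ i + d)) = (\<lambda>x. (if i = j then c else 0) * flat ?q (c * x $ i + d))" for j
    using partial_eqI[OF d] by (auto simp: axis_def)
  then show ?case using Suc d
    by (intro Ck_Suc_I) (auto simp: differentiable_def intro!: Ck_mult Ck_const)
qed

text \<open>A smooth function supported in a box; as \<open>n\<close> grows it tends to the
  indicator of the box.\<close>

definition bump :: "nat => real^2 => real^2 => real^2 => real" where
  "bump n a b x = (\<Prod>i\<in>UNIV. flat 1 (real n * (x $ i - a $ i) - 1) * flat 1 (real n * (b $ i - x $ i) - 1))"

lemma bump_bounds: "0 <= bump n a b x" "bump n a b x <= 1"
proof -
  have f: "0 <= flat 1 t" "flat 1 t <= 1" for t by (auto simp: flat_def)
  show "0 <= bump n a b x" unfolding bump_def by (intro prod_nonneg) (auto simp: f)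
  show "bump n a b x <= 1" unfolding bump_def by (intro prod_le_1) (auto simp: f intro!: mult_le_one)
qed

lemma bump_outside: "x \<notin> box a b ==> bump n a b x = 0"
proof -
  assume "x \<notin> box a b"
  then obtain i where i: "x $ i <= a $ i \<or> b $ i <= x $ i" by (force simp: mem_box_cart not_less)
  have "real n * (x $ i - a $ i) - 1 <= 0 \<or> real n * (b $ i - x $ i) - 1 <= 0"
    using i mult_nonneg_nonpos[of "real n" "x $ i - a $ i"] mult_nonneg_nonpos[of "real n" "b $ i - x $ i"] by auto
  then have "flat 1 (real n * (x $ i - a $ i) - 1) * flat 1 (real n * (b $ i - x $ i) - 1) = 0"
    by (auto simp: flat_def)
  then show ?thesis unfolding bump_def by (intro prod_zero) auto
qed

lemma bump_test_function:
  assumes "box a b \<subseteq> U"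
  shows "bump n a b \<in> test_functions U"
proof -
  let ?C = "{x. \<forall>i. 1 <= real n * (x $ i - a $ i) \<and> 1 <= real n * (b $ i - x $ i)}"
  have cl: "closed ?C"
    by (intro closed_Collect_all closed_Collect_conj closed_Collect_le continuous_intros)
  have sub: "{x. bump n a b x \<noteq> 0} \<subseteq> ?C"
  proof (clarify, rule ccontr)
    fix x i assume nz: "bump n a b x \<noteq> 0" and "\<not> (1 <= real n * (x $ i - a $ i) \<and> 1 <= real n * (b $ i - x $ i))"
    then have "flat 1 (real n * (x $ i - a $ i) - 1) * flat 1 (real n * (b $ i - x $ i) - 1) = 0"
      by (auto simp: flat_def)
    then have "bump n a b x = 0" unfolding bump_def by (intro prod_zero) auto
    then show False using nz by simp
  qed
  have CU: "?C \<subseteq> box a b"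
  proof
    fix x assume "x \<in> ?C"
    then have "0 < real n * (x $ i - a $ i)" "0 < real n * (b $ i - x $ i)" for i by (auto intro: less_le_trans[of 0 1])
    then show "x \<in> box a b" by (auto simp: mem_box_cart zero_less_mult_iff)
  qed
  have "closure {x. bump n a b x \<noteq> 0} \<subseteq> ?C" using closure_minimal[OF sub cl] .
  moreover have "bounded ?C" using CU bounded_box bounded_subset by blast
  ultimately have "compact (closure {x. bump n a b x \<noteq> 0})" "closure {x. bump n a b x \<noteq> 0} \<subseteq> U"
    using CU assms bounded_subset[OF _ sub] by (simp, blast)
  moreover have "Ck k (bump n a b)" for k
  proof -
    have 1: "Ck k (\<lambda>x. flat 1 (real n * x $ i + (- real n * a $ i - 1)) * flat 1 ((- real n) * x $ i + (real n * b $ i - 1)))" for i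
      by (intro Ck_mult Ck_flat)
    have "bump n a b = (\<lambda>x. \<Prod>i\<in>UNIV. flat 1 (real n * x $ i + (- real n * a $ i - 1)) * flat 1 ((- real n) * x $ i + (real n * b $ i - 1)))"
      by (auto simp: bump_def algebra_simps)
    then show ?thesis using Ck_prod[where I=UNIV, OF finite 1] by simp
  qed
  ultimately show ?thesis by (simp add: test_functions_def)
qed

text \<open>Both factors contain $e^{-1/t}$ with $t\to\infty$ inside the box, and a factor
  vanishes outside.\<close>

lemma bump_tendsto: "(\<lambda>n. bump n a b x) \<longlonglongrightarrow> indicator (box a b) x"
proof (cases "x \<in> box a b")
  case True
  have f: "(\<lambda>n. flat 1 (real n * s - 1)) \<longlonglongrightarrow> 1" if "s > 0" for s
  proof -
    have lim: "filterlim (\<lambda>n. real n * s - 1) at_top sequentially"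
      using filterlim_tendsto_add_at_top[OF tendsto_const[of "-1"]
          filterlim_tendsto_pos_mult_at_top[OF tendsto_const that filterlim_real_sequentially]]
      by (simp add: mult.commute)
    have "((\<lambda>t::real. exp (- (1 / t))) \<longlongrightarrow> exp (- 0)) at_top"
      using tendsto_inverse_0_at_top[OF filterlim_ident] by (intro tendsto_intros) (simp add: inverse_eq_divide)
    then have "((flat 1) \<longlongrightarrow> exp (- 0)) at_top"
      by (rule Lim_transform_eventually) (auto simp: flat_def intro!: eventually_mono[OF eventually_gt_at_top[of 0]])
    then show ?thesis using filterlim_compose[OF _ lim, of "flat 1"] by simp
  qed
  have "(\<lambda>n. bump n a b x) \<longlonglongrightarrow> (\<Prod>i\<in>(UNIV::2 set). 1 * 1)"
    unfolding bump_def by (intro tendsto_prod tendsto_mult f) (use True in \<open>auto simp: mem_box_cart\<close>)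
  then show ?thesis using True by simp
next
  case False
  then show ?thesis by (simp add: bump_outside)
qed

lemma test_function_continuous: "\<phi> \<in> test_functions U ==> continuous_on UNIV \<phi>"
  by (auto simp: test_functions_def intro: Ck_continuous)

lemma test_function_measurable [measurable_dest]: "\<phi> \<in> test_functions U ==> \<phi> \<in> borel_measurable borel"
  by (intro borel_measurable_continuous_onI test_function_continuous)

text \<open>Dominated convergence with the cut-off functions of the box.\<close>

lemma integral_box_zero:
  assumes z: "integrable lborel (z::real^2 => real)" and U: "box a b \<subseteq> U"
    and t: "\<And>\<phi>. \<phi> \<in> test_functions U ==> (LINT x|lborel. z x * \<phi> x) = 0"
  shows "(LINT x|lborel. z x * indicator (box a b) x) = 0"
proof -
  have "(\<lambda>n. LINT x|lborel. z x * bump n a b x) \<longlonglongrightarrow> (LINT x|lborel. z x * indicator (box a b) x)"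
  proof (rule integral_dominated_convergence[where w="\<lambda>x. \<bar>z x\<bar>"])
    show "AE x in lborel. norm (z x * bump i a b x) <= \<bar>z x\<bar>" for i
      using bump_bounds[of i a b] by (auto simp: abs_mult mult_left_le)
    show "AE x in lborel. (\<lambda>i. z x * bump i a b x) \<longlonglongrightarrow> z x * indicator (box a b) x"
      by (intro AE_I2 tendsto_intros bump_tendsto)
    show "(\<lambda>x. z x * bump i a b x) \<in> borel_measurable lborel" for i
      using test_function_measurable[OF bump_test_function[OF order_refl, of i a b]] z by measurable
  qed (use z in auto)
  then have "(\<lambda>n. 0) \<longlonglongrightarrow> (LINT x|lborel. z x * indicator (box a b) x)"
    using t[OF bump_test_function[OF U]] by simp
  then show ?thesis using LIMSEQ_unique tendsto_const by blast
qed

text \<open>The boxes are an intersection-stable generator of the Borel sets, so an integrable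
  function whose integrals over all boxes in an open set vanish is zero there.\<close>

lemma fundamental_lemma:
  assumes z: "integrable lborel (z::real^2 => real)" and U: "open U"
    and t: "\<And>\<phi>. \<phi> \<in> test_functions U ==> (LINT x|lborel. z x * \<phi> x) = 0"
  shows "AE x in lborel. x \<in> U --> z x = 0"
proof -
  obtain \<D> where D: "countable \<D>" "\<D> \<subseteq> Pow U" "\<And>X. X \<in> \<D> ==> \<exists>a b. X = box a b" "\<Union>\<D> = U"
    using open_countable_Union_open_box[OF U] by metis
  have "AE x in lborel. x \<in> X --> z x = 0" if XD: "X \<in> \<D>" for X
  proof -
    obtain c d where X: "X = box c d" "box c d \<subseteq> U" using D(3)[OF XD] D(2) XD by blast
    let ?y = "\<lambda>x. z x * indicator (box c d) x"
    have y: "integrable lborel ?y" using z by (intro integrable_mult_indicator[of _ _ z, simplified mult.commute[of "indicator _ _"] real_scaleR_def]) auto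
    have s: "(LINT x:A|lborel. ?y x) = 0" if "A \<in> sets lborel" for A
    proof -
      have "A \<in> sigma_sets UNIV (range (\<lambda>(a, b). box a (b::real^2)))"
        using that by (simp add: borel_eq_box)
      note A = this
      have "Int_stable (range (\<lambda>(a, b). box a (b::real^2)))"
        unfolding Int_stable_def
      proof (intro ballI)
        fix X Y assume "X \<in> range (\<lambda>(a, b). box a (b::real^2))" "Y \<in> range (\<lambda>(a, b). box a (b::real^2))"
        then obtain a b a' b' where "X = box a b" "Y = box a' b'" by auto
        then show "X \<inter> Y \<in> range (\<lambda>(a, b). box a (b::real^2))"
          by (simp only: box_Int_box) (rule image_eqI[where x="(_, _)"], unfold prod.case, rule refl, rule UNIV_I)
      qed
      moreover have "range (\<lambda>(a, b). box a (b::real^2)) \<subseteq> Pow UNIV" by simp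
      ultimately show ?thesis using A
      proof (induction rule: sigma_sets_induct_disjoint)
        case (basic A)
        then obtain a b where A: "A = box a b" by auto
        obtain e f where ef: "box a b \<inter> box c d = box e f" using box_Int_box by blast
        have "(LINT x:A|lborel. ?y x) = (LINT x|lborel. z x * indicator (box e f) x)"
          unfolding set_lebesgue_integral_def A ef[symmetric]
          by (intro Bochner_Integration.integral_cong) (auto simp: indicator_def)
        also have "\<dots> = 0" using integral_box_zero[OF z, of e f U] t X ef by blast
        finally show ?case .
      next
        case empty then show ?case by (simp add: set_lebesgue_integral_def)
      next
        case (compl A)
        have A: "A \<in> sets lborel" using compl(1) by (simp add: borel_eq_box)
        have yA: "integrable lborel (\<lambda>x. indicator A x *\<^sub>R ?y x)"
          using A y by (rule integrable_mult_indicator)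
        have "(LINT x:(UNIV - A)|lborel. ?y x) = (LINT x|lborel. ?y x - indicator A x *\<^sub>R ?y x)"
          unfolding set_lebesgue_integral_def
          by (intro Bochner_Integration.integral_cong) (auto simp: indicator_def)
        also have "\<dots> = (LINT x|lborel. ?y x) - (LINT x:A|lborel. ?y x)"
          unfolding set_lebesgue_integral_def by (rule Bochner_Integration.integral_diff[OF y yA])
        finally have "(LINT x:(UNIV - A)|lborel. ?y x) = (LINT x|lborel. ?y x) - (LINT x:A|lborel. ?y x)" .
        then show ?case using compl integral_box_zero[OF z X(2)] t by simp
      next
        case (union A)
        have A: "A i \<in> sets lborel" for i using union(2) by (auto simp: borel_eq_box)
        have iA: "integrable lborel (\<lambda>x. indicator (\<Union>i. A i) x *\<^sub>R ?y x)"
          using A y by (intro integrable_mult_indicator) auto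
        have "(LINT x:(\<Union>i. A i)|lborel. ?y x) = (\<Sum>i. LINT x:A i|lborel. ?y x)"
          by (rule lebesgue_integral_countable_add)
             (use A union(1) iA in \<open>auto simp: disjoint_family_on_def set_integrable_def\<close>)
        then show ?case using union by simp
      qed
    qed
    have "AE x in lborel. ?y x = 0"
      by (rule density_unique_real[OF y]) (use s in \<open>auto simp: set_lebesgue_integral_def\<close>)
    then show ?thesis by eventually_elim (auto simp: X)
  qed
  then have "AE x in lborel. \<forall>X\<in>\<D>. x \<in> X --> z x = 0"
    using D(1) by (subst AE_ball_countable) auto
  then show ?thesis by eventually_elim (use D(4) in blast)
qed


section \<open>Weak derivatives\<close>

lemma AE_lebesgue_on_open: "open \<omega> ==> (AE x in leb \<omega>. P x) \<longleftrightarrow> (AE x in lborel. x \<in> \<omega> --> P x)"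
  for \<omega> :: "'a::euclidean_space set"
  by (simp add: AE_restrict_space_iff AE_completion_iff)

lemma lipschitz_domain_open_bounded:
  assumes "bounded_lipschitz_domain \<omega>"
  shows "open \<omega>" "bounded \<omega>"
  using assms by (auto simp: bounded_lipschitz_domain_def)

abbreviation "wdist \<omega> i u w \<equiv> l2sq (leb \<omega>) (\<lambda>x. wpartial \<omega> i u x - wpartial \<omega> i w x)"

lemma borel_imp_lebesgue_on:
  fixes f :: "'a::euclidean_space => 'b::topological_space"
  shows "f \<in> borel_measurable borel ==> f \<in> borel_measurable (leb \<omega>)"
  by (simp add: measurable_completion measurable_restrict_space1)

lemma lebesgue_on_borel_rep:
  fixes u :: "'a::euclidean_space => real"
  assumes \<omega>: "open \<omega>" and u: "u \<in> borel_measurable (leb \<omega>)"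
  obtains u' where "u' \<in> borel_measurable borel" "\<And>x. x \<notin> \<omega> ==> u' x = 0" "AE x in leb \<omega>. u x = u' x"
proof -
  have "(\<lambda>x. indicator \<omega> x * u x) \<in> borel_measurable lebesgue"
    using u \<omega> by (simp add: borel_measurable_restrict_space_iff)
  then obtain g where g: "g \<in> borel_measurable borel" "AE x in lborel. indicator \<omega> x * u x = g x"
    using completion_ex_borel_measurable_real[of "\<lambda>x. indicator \<omega> x * u x" lborel] by auto
  show ?thesis
  proof (rule that[of "\<lambda>x. indicator \<omega> x * g x"])
    show "(\<lambda>x. indicator \<omega> x * g x) \<in> borel_measurable borel"
      using g(1) \<omega> by (intro borel_measurable_times borel_measurable_indicator) auto
    show "AE x in leb \<omega>. u x = indicator \<omega> x * g x"
      unfolding AE_lebesgue_on_open[OF \<omega>] using g(2) by eventually_elim auto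
  qed auto
qed

lemma integral_lebesgue_on_open:
  fixes f :: "'a::euclidean_space => real"
  assumes "open \<omega>" "f \<in> borel_measurable borel" "\<And>x. x \<notin> \<omega> ==> f x = 0"
  shows "(LINT x|leb \<omega>. f x) = (LINT x|lborel. f x)"
proof -
  have "(LINT x|leb \<omega>. f x) = (LINT x|lebesgue. indicator \<omega> x *\<^sub>R f x)"
    using assms by (intro integral_restrict_space) auto
  also have "(\<lambda>x. indicator \<omega> x *\<^sub>R f x) = f" using assms(3) by (auto simp: indicator_def fun_eq_iff)
  finally show ?thesis using assms(2) by (simp add: integral_completion)
qed

lemma integrable_lebesgue_on_open:
  fixes f :: "'a::euclidean_space => real"
  assumes "open \<omega>" "f \<in> borel_measurable borel" "\<And>x. x \<notin> \<omega> ==> f x = 0"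
  shows "integrable (leb \<omega>) f \<longleftrightarrow> integrable lborel f"
proof -
  have "integrable (leb \<omega>) f = integrable lebesgue (\<lambda>x. indicator \<omega> x *\<^sub>R f x)"
    using assms by (intro integrable_restrict_space) auto
  also have "(\<lambda>x. indicator \<omega> x *\<^sub>R f x) = f" using assms(3) by (auto simp: indicator_def fun_eq_iff)
  finally show ?thesis using assms(2) by (simp add: integrable_completion)
qed

lemma finite_measure_lebesgue_on_open:
  "open \<omega> ==> bounded \<omega> ==> finite_measure (lebesgue_on (\<omega> :: 'a::euclidean_space set))"
  by (simp add: finite_measure_lebesgue_on lmeasurable_open)

lemma L2_iff: "u \<in> L2 \<omega> \<longleftrightarrow> sqint (leb \<omega>) u"
  by (simp add: L2_def sqint_def)

lemma l2sq_real: "l2sq M (u :: _ => real) = (LINT x|M. (u x)\<^sup>2)"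
  by (simp add: l2sq_def)

lemma test_function_partial:
  assumes "\<phi> \<in> test_functions U"
  shows "partial i \<phi> \<in> test_functions U"
proof -
  let ?K = "closure {x. \<phi> x \<noteq> 0}"
  have K: "compact ?K" "?K \<subseteq> U" and C: "\<And>k. Ck k \<phi>" using assms by (auto simp: test_functions_def)
  have "partial i \<phi> x = 0" if "x \<notin> ?K" for x
  proof -
    have "(\<phi> has_derivative (\<lambda>_. 0)) (at x)"
      by (rule has_derivative_transform_within_open[OF has_derivative_const[of 0] open_Compl[OF closed_closure[of "{x. \<phi> x \<noteq> 0}"]]])
         (use that closure_subset[of "{x. \<phi> x \<noteq> 0}"] in auto)
    then show ?thesis using partial_eqI by fastforce
  qed
  then have sub: "closure {x. partial i \<phi> x \<noteq> 0} \<subseteq> ?K" by (intro closure_minimal) auto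
  moreover have "compact (closure {x. partial i \<phi> x \<noteq> 0})"
    using compact_Int_closed[OF K(1) closed_closure, of "{x. partial i \<phi> x \<noteq> 0}"] sub by (simp add: Int_absorb1)
  moreover have "Ck k (partial i \<phi>)" for k using C[of "Suc k"] by simp
  ultimately show ?thesis using K
    unfolding test_functions_def by blast
qed

lemma test_function_bounded:
  assumes "\<phi> \<in> test_functions U"
  obtains C where "\<And>x. \<bar>\<phi> x\<bar> <= C"
proof -
  let ?K = "closure {x. \<phi> x \<noteq> 0}"
  have "compact (\<phi> ` ?K)"
    using assms test_function_continuous[OF assms]
    by (intro compact_continuous_image) (auto simp: test_functions_def intro: continuous_on_subset)
  then obtain C where C: "\<And>x. x \<in> ?K ==> \<bar>\<phi> x\<bar> <= C"
    using compact_imp_bounded by (force simp: bounded_iff)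
  have "\<bar>\<phi> x\<bar> <= max C 0" for x
    using C[of x] closure_subset[of "{x. \<phi> x \<noteq> 0}"] by (cases "\<phi> x = 0") auto
  then show ?thesis using that by blast
qed

lemma test_function_sqint:
  assumes "open \<omega>" "bounded \<omega>" "\<phi> \<in> test_functions \<omega>"
  shows "sqint (leb \<omega>) \<phi>"
proof -
  interpret finite_measure "leb \<omega>" using assms finite_measure_lebesgue_on_open by blast
  obtain C where "\<And>x. \<bar>\<phi> x\<bar> <= C" using test_function_bounded[OF assms(3)] by blast
  then show ?thesis
    using assms(3) by (intro sqint_bounded[where C=C]) (auto intro: borel_imp_lebesgue_on test_function_measurable)
qed

lemma is_weak_partial_sqint:
  "is_weak_partial \<omega> i u v ==> sqint (leb \<omega>) u \<and> sqint (leb \<omega>) v"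
  by (auto simp: is_weak_partial_def L2_iff)

lemma is_weak_partial_cong_AE:
  assumes "is_weak_partial \<omega> i u v" "AE x in leb \<omega>. u x = u' x" "AE x in leb \<omega>. v x = v' x"
    "u' \<in> borel_measurable (leb \<omega>)" "v' \<in> borel_measurable (leb \<omega>)"
  shows "is_weak_partial \<omega> i u' v'"
proof -
  have s: "sqint (leb \<omega>) u" "sqint (leb \<omega>) v" using is_weak_partial_sqint[OF assms(1)] by auto
  have "(LINT x|leb \<omega>. u' x * partial i \<phi> x) = (LINT x|leb \<omega>. u x * partial i \<phi> x)"
       "(LINT x|leb \<omega>. v' x * \<phi> x) = (LINT x|leb \<omega>. v x * \<phi> x)"
    if \<phi>: "\<phi> \<in> test_functions \<omega>" for \<phi>
  proof -
    have m: "\<phi> \<in> borel_measurable (leb \<omega>)" "partial i \<phi> \<in> borel_measurable (leb \<omega>)"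
      using \<phi> test_function_partial[OF \<phi>] by (auto intro: borel_imp_lebesgue_on test_function_measurable)
    show "(LINT x|leb \<omega>. u' x * partial i \<phi> x) = (LINT x|leb \<omega>. u x * partial i \<phi> x)"
    proof (rule integral_cong_AE)
      show "AE x in leb \<omega>. u' x * partial i \<phi> x = u x * partial i \<phi> x"
        using assms(2) by eventually_elim simp
    qed (use assms(4) sqintD(1)[OF s(1)] m in \<open>auto intro: borel_measurable_times\<close>)
    show "(LINT x|leb \<omega>. v' x * \<phi> x) = (LINT x|leb \<omega>. v x * \<phi> x)"
    proof (rule integral_cong_AE)
      show "AE x in leb \<omega>. v' x * \<phi> x = v x * \<phi> x"
        using assms(3) by eventually_elim simp
    qed (use assms(5) sqintD(1)[OF s(2)] m in \<open>auto intro: borel_measurable_times\<close>)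
  qed
  note eqs = this
  have "\<forall>\<phi> \<in> test_functions \<omega>.
        (LINT x|leb \<omega>. u x * partial i \<phi> x) = - (LINT x|leb \<omega>. v x * \<phi> x)"
    using assms(1) unfolding is_weak_partial_def by blast
  then show ?thesis
    using sqint_cong_AE[OF s(1) assms(2,4)] sqint_cong_AE[OF s(2) assms(3,5)]
    unfolding is_weak_partial_def L2_iff by (simp add: eqs)
qed

lemma is_weak_partial_unique:
  assumes \<omega>: "open \<omega>" "bounded \<omega>" and v: "is_weak_partial \<omega> i u v" "is_weak_partial \<omega> i u v'"
  shows "AE x in leb \<omega>. v x = v' x"
proof -
  interpret finite_measure "leb \<omega>" using \<omega> finite_measure_lebesgue_on_open by blast
  have s: "sqint (leb \<omega>) v" "sqint (leb \<omega>) v'"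
    using v[THEN is_weak_partial_sqint] by auto
  have d: "sqint (leb \<omega>) (\<lambda>x. v x - v' x)" by (rule sqint_diff[OF s])
  obtain z where z: "z \<in> borel_measurable borel" "\<And>x. x \<notin> \<omega> ==> z x = 0" "AE x in leb \<omega>. v x - v' x = z x"
    using lebesgue_on_borel_rep[OF \<omega>(1) sqintD(1)[OF d]] by metis
  have zm: "z \<in> borel_measurable (leb \<omega>)" using z(1) by (rule borel_imp_lebesgue_on)
  have "integrable (leb \<omega>) z"
    using integrable_sqint[OF sqint_cong_AE[OF d z(3) zm]] .
  then have iz: "integrable lborel z" using integrable_lebesgue_on_open[OF \<omega>(1) z(1,2)] by simp
  have "(LINT x|lborel. z x * \<phi> x) = 0" if \<phi>: "\<phi> \<in> test_functions \<omega>" for \<phi>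
  proof -
    have \<phi>m [measurable]: "\<phi> \<in> borel_measurable borel" using \<phi> by (rule test_function_measurable)
    have \<phi>s: "sqint (leb \<omega>) \<phi>" using \<omega> \<phi> by (rule test_function_sqint)
    have "(LINT x|lborel. z x * \<phi> x) = (LINT x|leb \<omega>. z x * \<phi> x)"
      using z by (intro integral_lebesgue_on_open[OF \<omega>(1), symmetric]) auto
    also have "\<dots> = (LINT x|leb \<omega>. v x * \<phi> x - v' x * \<phi> x)"
    proof (rule integral_cong_AE)
      show "AE x in leb \<omega>. z x * \<phi> x = v x * \<phi> x - v' x * \<phi> x"
        using z(3) by eventually_elim (simp flip: left_diff_distrib)
    qed (use s[THEN sqintD(1)] zm \<phi>s[THEN sqintD(1)] in \<open>auto intro: borel_measurable_times borel_measurable_diff\<close>)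
    also have "\<dots> = (LINT x|leb \<omega>. v x * \<phi> x) - (LINT x|leb \<omega>. v' x * \<phi> x)"
      using s \<phi>s by (intro Bochner_Integration.integral_diff integrable_sqint_mult)
    also have "\<dots> = 0" using v \<phi> by (auto simp: is_weak_partial_def)
    finally show ?thesis .
  qed
  from fundamental_lemma[OF iz \<omega>(1) this] have "AE x in leb \<omega>. z x = 0"
    unfolding AE_lebesgue_on_open[OF \<omega>(1)] .
  with z(3) show ?thesis by eventually_elim auto
qed

lemma is_weak_partial_wpartial:
  "is_weak_partial \<omega> i u v ==> is_weak_partial \<omega> i u (wpartial \<omega> i u)"
  unfolding wpartial_def by (metis someI)

lemma wpartial_AE_eq:
  assumes "open \<omega>" "bounded \<omega>" "is_weak_partial \<omega> i u v"
  shows "AE x in leb \<omega>. wpartial \<omega> i u x = v x"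
  using is_weak_partial_unique[OF assms(1,2) is_weak_partial_wpartial assms(3)] assms(3) by blast

lemma is_weak_partial_lincomb:
  assumes \<omega>: "open \<omega>" "bounded \<omega>" and u: "is_weak_partial \<omega> i u v" and u': "is_weak_partial \<omega> i u' v'"
  shows "is_weak_partial \<omega> i (\<lambda>x. a * u x + b * u' x) (\<lambda>x. a * v x + b * v' x)"
proof -
  note s = is_weak_partial_sqint[OF u, THEN conjunct1] is_weak_partial_sqint[OF u, THEN conjunct2]
    is_weak_partial_sqint[OF u', THEN conjunct1] is_weak_partial_sqint[OF u', THEN conjunct2]
  have "(LINT x|leb \<omega>. (a * u x + b * u' x) * partial i \<phi> x) = - (LINT x|leb \<omega>. (a * v x + b * v' x) * \<phi> x)"
    if \<phi>: "\<phi> \<in> test_functions \<omega>" for \<phi>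
  proof -
    note t = test_function_sqint[OF \<omega> \<phi>] test_function_sqint[OF \<omega> test_function_partial[OF \<phi>]]
    have "(LINT x|leb \<omega>. (a * u x + b * u' x) * partial i \<phi> x)
        = a * (LINT x|leb \<omega>. u x * partial i \<phi> x) + b * (LINT x|leb \<omega>. u' x * partial i \<phi> x)"
      using integrable_sqint_mult[OF s(1) t(2)] integrable_sqint_mult[OF s(3) t(2)]
      by (simp add: distrib_right mult.assoc)
    also have "\<dots> = - (a * (LINT x|leb \<omega>. v x * \<phi> x) + b * (LINT x|leb \<omega>. v' x * \<phi> x))"
      using u u' \<phi> by (simp add: is_weak_partial_def)
    also have "\<dots> = - (LINT x|leb \<omega>. (a * v x + b * v' x) * \<phi> x)"
      using integrable_sqint_mult[OF s(2) t(1)] integrable_sqint_mult[OF s(4) t(1)]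
      by (simp add: distrib_right mult.assoc)
    finally show ?thesis .
  qed
  then show ?thesis using s by (auto simp: is_weak_partial_def L2_iff intro!: sqint_add sqint_cmult)
qed

text \<open>Both sides of the defining identity are $L^2$ inner products with a fixed test
  function.\<close>

lemma is_weak_partial_limit:
  assumes \<omega>: "open \<omega>" "bounded \<omega>" and U: "\<And>k. is_weak_partial \<omega> i (U k) (V k)"
    and s: "sqint (leb \<omega>) u" "sqint (leb \<omega>) v"
    and cu: "(\<lambda>k. l2sq (leb \<omega>) (\<lambda>x. U k x - u x)) \<longlonglongrightarrow> 0"
    and cv: "(\<lambda>k. l2sq (leb \<omega>) (\<lambda>x. V k x - v x)) \<longlonglongrightarrow> 0"
  shows "is_weak_partial \<omega> i u v"
proof -
  have "(LINT x|leb \<omega>. u x * partial i \<phi> x) = - (LINT x|leb \<omega>. v x * \<phi> x)"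
    if \<phi>: "\<phi> \<in> test_functions \<omega>" for \<phi>
  proof -
    note t = test_function_sqint[OF \<omega> \<phi>] test_function_sqint[OF \<omega> test_function_partial[OF \<phi>]]
    have c0: "(\<lambda>k::nat. l2sq (leb \<omega>) (\<lambda>x. f x - f x)) \<longlonglongrightarrow> 0" for f :: "real^2 => real"
      unfolding diff_self l2sq_def by simp
    have sU: "sqint (leb \<omega>) (U k)" "sqint (leb \<omega>) (V k)" for k
      using is_weak_partial_sqint[OF U] by blast+
    have 1: "(\<lambda>k. LINT x|leb \<omega>. U k x * partial i \<phi> x) \<longlonglongrightarrow> (LINT x|leb \<omega>. u x * partial i \<phi> x)"
      using l2sq_tendsto_inner[where U=U and u=u and V="\<lambda>_. partial i \<phi>" and v="partial i \<phi>", OF sU(1) s(1) t(2,2) cu c0]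
      unfolding inner_real_def .
    have 2: "(\<lambda>k. - (LINT x|leb \<omega>. V k x * \<phi> x)) \<longlonglongrightarrow> - (LINT x|leb \<omega>. v x * \<phi> x)"
      using tendsto_minus[OF l2sq_tendsto_inner[where U=V and u=v and V="\<lambda>_. \<phi>" and v="\<phi>", OF sU(2) s(2) t(1,1) cv c0]]
      unfolding inner_real_def .
    have 3: "(LINT x|leb \<omega>. U k x * partial i \<phi> x) = - (LINT x|leb \<omega>. V k x * \<phi> x)" for k
      using U[of k] \<phi> unfolding is_weak_partial_def by blast
    show ?thesis using 1 2 unfolding 3 by (rule LIMSEQ_unique)
  qed
  then show ?thesis using s unfolding is_weak_partial_def L2_iff by blast
qed

lemma sobolevH_Suc_iff: "u \<in> sobolevH (Suc k) \<omega> \<longleftrightarrow> (\<forall>i. \<exists>v\<in>sobolevH k \<omega>. is_weak_partial \<omega> i u v)"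
  by (auto simp: is_weak_partial_def)

lemma sobolevH1_iff: "u \<in> sobolevH 1 \<omega> \<longleftrightarrow> (\<exists>v. \<forall>i. is_weak_partial \<omega> i u (v i))"
proof
  assume "u \<in> sobolevH 1 \<omega>"
  then have "\<forall>i. \<exists>v. is_weak_partial \<omega> i u v" unfolding One_nat_def sobolevH_Suc_iff by blast
  then show "\<exists>v. \<forall>i. is_weak_partial \<omega> i u (v i)" by (rule choice)
next
  assume "\<exists>v. \<forall>i. is_weak_partial \<omega> i u (v i)"
  then obtain v where v: "is_weak_partial \<omega> i u (v i)" for i by auto
  show "u \<in> sobolevH 1 \<omega>"
    unfolding One_nat_def sobolevH_Suc_iff sobolevH.simps(1)
  proof
    fix i show "\<exists>v\<in>L2 \<omega>. is_weak_partial \<omega> i u v"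
      using v[of i] is_weak_partial_sqint[OF v, of i] by (intro bexI[of _ "v i"]) (auto simp: L2_iff)
  qed
qed

lemma sobolevH2_iff: "u \<in> sobolevH 2 \<omega> \<longleftrightarrow> (\<forall>j. \<exists>v\<in>sobolevH 1 \<omega>. is_weak_partial \<omega> j u v)"
  unfolding numeral_2_eq_2 One_nat_def sobolevH_Suc_iff ..

text \<open>Gradient and Hessian as chosen functions, in place of the canonical representatives
  of the weak derivatives, which are not linear in the function.\<close>

definition has_jet :: "(real^2) set => (real^2 => real^3) => (real^2 => real^2^3) => (real^2 => real^2^2^3) => bool" where
  "has_jet \<omega> \<psi> G H \<longleftrightarrow>
     (\<forall>m j. is_weak_partial \<omega> j (\<lambda>x. \<psi> x $ m) (\<lambda>x. G x $ m $ j)) \<and>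
     (\<forall>m i j. is_weak_partial \<omega> i (\<lambda>x. G x $ m $ j) (\<lambda>x. H x $ m $ i $ j))"

lemma sobolevH_vec2_jet:
  assumes "\<psi> \<in> sobolevH_vec 2 \<omega>"
  obtains G H where "has_jet \<omega> \<psi> G H"
proof -
  have "\<exists>v w. is_weak_partial \<omega> j (\<lambda>x. \<psi> x $ m) v \<and> (\<forall>i. is_weak_partial \<omega> i v (w i))" for m j
  proof -
    have "(\<lambda>x. \<psi> x $ m) \<in> sobolevH 2 \<omega>"
      using assms by (simp add: sobolevH_vec_def)
    then obtain v where "v \<in> sobolevH 1 \<omega>" "is_weak_partial \<omega> j (\<lambda>x. \<psi> x $ m) v"
      unfolding sobolevH2_iff by blast
    then show ?thesis unfolding sobolevH1_iff by blast
  qed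
  then have "\<forall>m j. \<exists>v w. is_weak_partial \<omega> j (\<lambda>x. \<psi> x $ m) v \<and> (\<forall>i. is_weak_partial \<omega> i v (w i))" by auto
  then obtain v w where "\<forall>m j. is_weak_partial \<omega> j (\<lambda>x. \<psi> x $ m) (v m j) \<and> (\<forall>i. is_weak_partial \<omega> i (v m j) (w m j i))"
    unfolding choice_iff by (elim exE)
  then have vw: "is_weak_partial \<omega> j (\<lambda>x. \<psi> x $ m) (v m j)" "is_weak_partial \<omega> i (v m j) (w m j i)" for m j i by auto
  show ?thesis
    by (rule that[of "\<lambda>x. \<chi> m j. v m j x" "\<lambda>x. \<chi> m i j. w m j i x"]) (use vw in \<open>simp add: has_jet_def\<close>)
qed

lemma has_jet_sobolevH_vec2: "has_jet \<omega> \<psi> G H ==> \<psi> \<in> sobolevH_vec 2 \<omega>"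
proof -
  assume j: "has_jet \<omega> \<psi> G H"
  have "(\<lambda>x. G x $ m $ j) \<in> sobolevH 1 \<omega>" for m j
    using j unfolding sobolevH1_iff has_jet_def by (intro exI[of _ "\<lambda>i x. H x $ m $ i $ j"]) blast
  then have "(\<lambda>x. \<psi> x $ m) \<in> sobolevH 2 \<omega>" for m
    using j unfolding has_jet_def sobolevH2_iff by blast
  then show ?thesis unfolding sobolevH_vec_def by blast
qed

lemma has_jet_grad_AE:
  assumes "open \<omega>" "bounded \<omega>" "has_jet \<omega> \<psi> G H"
  shows "AE x in leb \<omega>. grad \<omega> \<psi> x = G x"
proof -
  have "AE x in leb \<omega>. \<forall>m j. wpartial \<omega> j (\<lambda>y. \<psi> y $ m) x = G x $ m $ j"
    using assms by (auto simp: AE_all_countable has_jet_def intro!: wpartial_AE_eq)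
  then show ?thesis by eventually_elim (simp add: grad_def vec_eq_iff)
qed

lemma has_jet_hess_AE:
  assumes \<omega>: "open \<omega>" "bounded \<omega>" and j: "has_jet \<omega> \<psi> G H"
  shows "AE x in leb \<omega>. \<forall>m. hess \<omega> (\<lambda>y. \<psi> y $ m) x = H x $ m"
proof -
  have "AE x in leb \<omega>. wpartial \<omega> i (wpartial \<omega> j (\<lambda>y. \<psi> y $ m)) x = H x $ m $ i $ j" for i j m
  proof (rule wpartial_AE_eq[OF \<omega>])
    have 1: "is_weak_partial \<omega> j (\<lambda>x. \<psi> x $ m) (\<lambda>x. G x $ m $ j)"
      and 2: "is_weak_partial \<omega> i (\<lambda>x. G x $ m $ j) (\<lambda>x. H x $ m $ i $ j)" using j by (auto simp: has_jet_def)
    show "is_weak_partial \<omega> i (wpartial \<omega> j (\<lambda>y. \<psi> y $ m)) (\<lambda>x. H x $ m $ i $ j)"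
    proof (rule is_weak_partial_cong_AE[OF 2])
      show "AE x in leb \<omega>. G x $ m $ j = wpartial \<omega> j (\<lambda>y. \<psi> y $ m) x"
        using wpartial_AE_eq[OF \<omega> 1] by eventually_elim simp
    qed (use is_weak_partial_sqint[OF is_weak_partial_wpartial[OF 1]] is_weak_partial_sqint[OF 2] in auto)
  qed
  then have "AE x in leb \<omega>. \<forall>m i j. wpartial \<omega> i (wpartial \<omega> j (\<lambda>y. \<psi> y $ m)) x = H x $ m $ i $ j"
    by (simp add: AE_all_countable)
  then show ?thesis by eventually_elim (simp add: hess_def vec_eq_iff)
qed

section \<open>Classical derivatives\<close>

lemma lborel_distr_shift: "distr lborel borel (\<lambda>x. x + a) = (lborel :: 'a::euclidean_space measure)"
proof -
  have "(\<lambda>x. x + a) = (+) a" by (simp add: fun_eq_iff add.commute)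
  then show ?thesis using lborel_distr_plus[of a] by simp
qed

lemma lborel_integrable_shift:
  fixes f :: "'a::euclidean_space => real"
  assumes "integrable lborel f"
  shows "integrable lborel (\<lambda>x. f (x + a))"
proof -
  have m: "f \<in> borel_measurable borel" using assms by auto
  have "integrable (distr lborel borel (\<lambda>x. x + a)) f = integrable lborel (\<lambda>x. f (x + a))"
    using m by (intro integrable_distr_eq) auto
  then show ?thesis using assms by (simp add: lborel_distr_shift)
qed

lemma lborel_integral_shift:
  fixes f :: "'a::euclidean_space => real"
  assumes "f \<in> borel_measurable borel"
  shows "(LINT x|lborel. f (x + a)) = (LINT x|lborel. f x)"
proof -
  have "(LINT x|distr lborel borel (\<lambda>x. x + a). f x) = (LINT x|lborel. f (x + a))"
    using assms by (intro integral_distr) auto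
  then show ?thesis by (simp add: lborel_distr_shift)
qed

lemma lborel_nn_integral_shift:
  fixes f :: "'a::euclidean_space => ennreal"
  assumes "f \<in> borel_measurable borel"
  shows "(\<integral>\<^sup>+x. f (x + a) \<partial>lborel) = (\<integral>\<^sup>+x. f x \<partial>lborel)"
proof -
  have "(\<integral>\<^sup>+x. f x \<partial>distr lborel borel (\<lambda>x. x + a)) = (\<integral>\<^sup>+x. f (x + a) \<partial>lborel)"
    using assms by (intro nn_integral_distr) auto
  then show ?thesis by (simp add: lborel_distr_shift)
qed

lemma test_function_has_derivative:
  assumes "\<phi> \<in> test_functions U"
  shows "(\<phi> has_derivative (\<lambda>h. \<Sum>i\<in>UNIV. h $ i * partial i \<phi> x)) (at x)"
proof -
  have "Ck (Suc 0) \<phi>" using assms unfolding test_functions_def by blast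
  then show ?thesis by (intro differentiable_has_derivative_partial Ck_differentiable)
qed

text \<open>Outside the support of the test function the product vanishes identically nearby, so
  the extension by zero is differentiable on the whole plane.\<close>

lemma has_derivative_mult_test_function:
  fixes \<psi> :: "real^2 => real"
  assumes \<omega>: "open \<omega>" and d: "\<And>x. x \<in> \<omega> ==> (\<psi> has_derivative (\<lambda>h. \<Sum>i\<in>UNIV. h $ i * G i x)) (at x)"
    and \<phi>: "\<phi> \<in> test_functions \<omega>"
  defines "F \<equiv> \<lambda>x. if x \<in> \<omega> then \<psi> x * \<phi> x else 0"
    and "g \<equiv> \<lambda>i x. if x \<in> \<omega> then \<psi> x * partial i \<phi> x + G i x * \<phi> x else 0"
  shows "(F has_derivative (\<lambda>h. \<Sum>i\<in>UNIV. h $ i * g i x)) (at x)"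
proof (cases "x \<in> \<omega>")
  case True
  have d\<phi>: "(\<phi> has_derivative (\<lambda>h. \<Sum>i\<in>UNIV. h $ i * partial i \<phi> x)) (at x)"
    using \<phi> by (rule test_function_has_derivative)
  have "((\<lambda>x. \<psi> x * \<phi> x) has_derivative (\<lambda>h. \<psi> x * (\<Sum>i\<in>UNIV. h $ i * partial i \<phi> x) + (\<Sum>i\<in>UNIV. h $ i * G i x) * \<phi> x)) (at x)"
    by (rule has_derivative_mult[OF d[OF True] d\<phi>])
  also have "(\<lambda>h. \<psi> x * (\<Sum>i\<in>UNIV. h $ i * partial i \<phi> x) + (\<Sum>i\<in>UNIV. h $ i * G i x) * \<phi> x) = (\<lambda>h. \<Sum>i\<in>UNIV. h $ i * g i x)"
    using True by (simp add: g_def UNIV_2 algebra_simps fun_eq_iff)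
  finally show ?thesis
    by (rule has_derivative_transform_within_open[OF _ \<omega> True]) (simp add: F_def)
next
  case False
  let ?K = "closure {x. \<phi> x \<noteq> 0}"
  have K: "?K \<subseteq> \<omega>" using \<phi> by (simp add: test_functions_def)
  have "(F has_derivative (\<lambda>h. 0)) (at x)"
  proof (rule has_derivative_transform_within_open[OF has_derivative_const[of 0] open_Compl[OF closed_closure[of "{x. \<phi> x \<noteq> 0}"]]])
    show "x \<in> - ?K" using K False by auto
    show "0 = F y" if "y \<in> - ?K" for y
      using that closure_subset[of "{x. \<phi> x \<noteq> 0}"] by (auto simp: F_def)
  qed
  then show ?thesis using False by (simp add: g_def)
qed

text \<open>The product with a test function is a $C^1$ function of compact support in the
  plane; the integral of its partial derivative vanishes by translation invariance of Lebesgue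
  measure.\<close>

lemma C1_is_weak_partial:
  fixes \<psi> :: "real^2 => real"
  assumes \<omega>: "open \<omega>" "bounded \<omega>" and c: "continuous_on (closure \<omega>) \<psi>" "\<And>i. continuous_on (closure \<omega>) (G i)"
    and d: "\<And>x. x \<in> \<omega> ==> (\<psi> has_derivative (\<lambda>h. \<Sum>i\<in>UNIV. h $ i * G i x)) (at x)"
  shows "is_weak_partial \<omega> i \<psi> (G i)"
proof -
  interpret finite_measure "leb \<omega>" using \<omega> finite_measure_lebesgue_on_open by blast
  have cpt: "compact (closure \<omega>)" using \<omega> by simp
  have bdd: "\<exists>C. \<forall>x\<in>\<omega>. \<bar>f x\<bar> <= C" if "continuous_on (closure \<omega>) f" for f :: "real^2 => real"
  proof -
    have "bounded (f ` closure \<omega>)" using that cpt by (intro compact_imp_bounded compact_continuous_image)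
    then show ?thesis using closure_subset[of \<omega>] unfolding bounded_iff by fastforce
  qed
  have s: "sqint (leb \<omega>) f" if cf: "continuous_on (closure \<omega>) f" for f :: "real^2 => real"
  proof -
    obtain C where "\<forall>x\<in>\<omega>. \<bar>f x\<bar> <= C" using bdd[OF cf] by blast
    moreover have "f \<in> borel_measurable (leb \<omega>)"
      using continuous_on_subset[OF cf closure_subset] \<omega>(1)
      by (intro continuous_imp_measurable_on_sets_lebesgue) auto
    ultimately show ?thesis by (intro sqint_bounded[of _ C]) (auto simp: AE_lebesgue_on_open[OF \<omega>(1)])
  qed
  have "(LINT x|leb \<omega>. \<psi> x * partial i \<phi> x) = - (LINT x|leb \<omega>. G i x * \<phi> x)"
    if \<phi>: "\<phi> \<in> test_functions \<omega>" for \<phi>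
  proof -
    define F where "F \<equiv> \<lambda>x. if x \<in> \<omega> then \<psi> x * \<phi> x else 0"
    define g where "g \<equiv> \<lambda>i x. if x \<in> \<omega> then \<psi> x * partial i \<phi> x + G i x * \<phi> x else 0"
    have dF: "(F has_derivative (\<lambda>h. \<Sum>i\<in>UNIV. h $ i * g i x)) (at x)" for x
      unfolding F_def g_def by (rule has_derivative_mult_test_function[OF \<omega>(1) d \<phi>])
    then have contF: "continuous_on UNIV F"
      by (auto simp: continuous_on_eq_continuous_at intro: has_derivative_continuous)
    then have Fm [measurable]: "F \<in> borel_measurable borel" by (rule borel_measurable_continuous_onI)
    note sp = test_function_partial[OF \<phi>]
    have mi: "\<phi> \<in> borel_measurable borel" "partial i \<phi> \<in> borel_measurable borel"
      using \<phi> sp by (auto intro: test_function_measurable)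
    let ?e = "axis i 1 :: real^2"
    define D where "D n x = (F (x + (1 / real (Suc n)) *\<^sub>R ?e) - F x) / (1 / real (Suc n))" for n x
    have [measurable]: "D n \<in> borel_measurable borel" for n unfolding D_def by measurable
    have lim: "(\<lambda>n. D n x) \<longlonglongrightarrow> g i x" for x
    proof -
      have "((\<lambda>t. x + t *\<^sub>R ?e) has_derivative (\<lambda>t. t *\<^sub>R ?e)) (at 0)"
        by (auto intro!: derivative_eq_intros)
      then have "((\<lambda>t. F (x + t *\<^sub>R ?e)) has_derivative (\<lambda>t. \<Sum>j\<in>UNIV. (t *\<^sub>R ?e) $ j * g j x)) (at 0)"
        by (rule has_derivative_compose) (use dF[of x] in simp)
      moreover have "(\<Sum>j\<in>UNIV. (t *\<^sub>R ?e) $ j * g j x) = g i x * t" for t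
        by (simp add: axis_def if_distrib if_distribR mult.commute cong: if_cong)
      ultimately have "((\<lambda>t. F (x + t *\<^sub>R ?e)) has_field_derivative g i x) (at 0)"
        by (simp add: has_field_derivative_def)
      then have "((\<lambda>h. (F (x + h *\<^sub>R ?e) - F x) / h) \<longlongrightarrow> g i x) (at 0)"
        by (simp add: DERIV_def)
      moreover have "filterlim (\<lambda>n. 1 / real (Suc n)) (at 0) sequentially"
        using LIMSEQ_inverse_real_of_nat by (auto simp: filterlim_at inverse_eq_divide)
      ultimately show ?thesis unfolding D_def by (rule filterlim_compose)
    qed
    then have gm [measurable]: "g i \<in> borel_measurable borel"
      using borel_measurable_LIMSEQ_metric[of D borel "g i"] by measurable
    obtain C1 where C1: "\<And>x. \<bar>\<phi> x\<bar> <= C1" using test_function_bounded[OF \<phi>] by blast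
    obtain C2 where C2: "\<And>x. \<bar>partial i \<phi> x\<bar> <= C2" using test_function_bounded[OF sp] by blast
    obtain C3 where C3: "\<And>x. x \<in> \<omega> ==> \<bar>\<psi> x\<bar> <= C3" using bdd[OF c(1)] by blast
    obtain C4 where C4: "\<And>x. x \<in> \<omega> ==> \<bar>G i x\<bar> <= C4" using bdd[OF c(2)] by blast
    define C where "C = \<bar>C3\<bar> * \<bar>C2\<bar> + \<bar>C4\<bar> * \<bar>C1\<bar>"
    have gC: "\<bar>g i x\<bar> <= C" for x
    proof (cases "x \<in> \<omega>")
      case True
      have "\<bar>\<psi> x\<bar> * \<bar>partial i \<phi> x\<bar> <= \<bar>C3\<bar> * \<bar>C2\<bar>" "\<bar>G i x\<bar> * \<bar>\<phi> x\<bar> <= \<bar>C4\<bar> * \<bar>C1\<bar>"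
        using C1[of x] C2[of x] C3[OF True] C4[OF True] by (auto intro!: mult_mono)
      then show ?thesis using True abs_triangle_ineq[of "\<psi> x * partial i \<phi> x" "G i x * \<phi> x"]
        unfolding g_def C_def abs_mult by (simp only: if_True)
    qed (simp add: g_def C_def)
    obtain R where R: "\<omega> \<subseteq> ball 0 R" using \<omega>(2) bounded_subset_ballD by blast
    have DC: "\<bar>D n x\<bar> <= C * indicator (ball 0 (R + 1)) x" for n x
    proof (cases "x \<in> ball 0 (R + 1)")
      case True
      let ?h = "1 / real (Suc n)"
      have "\<exists>t\<in>{0<..<?h}. F (x + ?h *\<^sub>R ?e) - F (x + 0 *\<^sub>R ?e) = (?h - 0) * g i (x + t *\<^sub>R ?e)"
      proof -
        have der: "((\<lambda>t. F (x + t *\<^sub>R ?e)) has_derivative (\<lambda>s. s * g i (x + t *\<^sub>R ?e))) (at t)" for t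
        proof -
          have "((\<lambda>t. x + t *\<^sub>R ?e) has_derivative (\<lambda>t. t *\<^sub>R ?e)) (at t)"
            by (auto intro!: derivative_eq_intros)
          then have "((\<lambda>t. F (x + t *\<^sub>R ?e)) has_derivative (\<lambda>s. \<Sum>j\<in>UNIV. (s *\<^sub>R ?e) $ j * g j (x + t *\<^sub>R ?e))) (at t)"
            by (rule has_derivative_compose[OF _ dF])
          moreover have "(\<Sum>j\<in>UNIV. (s *\<^sub>R ?e) $ j * g j (x + t *\<^sub>R ?e)) = s * g i (x + t *\<^sub>R ?e)" for s
            by (simp add: axis_def if_distrib if_distribR cong: if_cong)
          ultimately show ?thesis by simp
        qed
        show ?thesis
          using mvt_simple[of 0 ?h "\<lambda>t. F (x + t *\<^sub>R ?e)" "\<lambda>t s. s * g i (x + t *\<^sub>R ?e)"]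
            has_derivative_at_withinI[OF der] by auto
      qed
      then obtain t where "F (x + ?h *\<^sub>R ?e) - F x = ?h * g i (x + t *\<^sub>R ?e)" by auto
      then have "D n x = g i (x + t *\<^sub>R ?e)" by (simp add: D_def field_simps)
      then show ?thesis using gC True by simp
    next
      case False
      have "x \<notin> \<omega>" "x + (1 / real (Suc n)) *\<^sub>R ?e \<notin> \<omega>"
      proof -
        have nx: "norm x >= R + 1" using False by (simp add: not_less)
        have "norm ((1 / real (Suc n)) *\<^sub>R ?e) <= 1" by (simp add: norm_axis_1)
        then have "norm (x + (1 / real (Suc n)) *\<^sub>R ?e) >= R"
          using nx norm_diff_ineq[of x "(1 / real (Suc n)) *\<^sub>R ?e"] by linarith
        then show "x + (1 / real (Suc n)) *\<^sub>R ?e \<notin> \<omega>" using R by force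
        show "x \<notin> \<omega>" using nx R by force
      qed
      then show ?thesis using False by (simp add: D_def F_def)
    qed
    have ballfin: "emeasure lborel (ball (0::real^2) r) < top" for r
      using emeasure_bounded_finite[OF bounded_ball[of "0::real^2" r]] by (simp only: infinity_ennreal_def)
    have Ci: "integrable lborel (\<lambda>x. C * indicator (ball (0::real^2) (R + 1)) x)"
      by (intro integrable_mult_right integrable_real_indicator) (auto simp: ballfin)
    have iF: "integrable lborel F"
    proof (rule Bochner_Integration.integrable_bound)
      show "integrable lborel (\<lambda>x. (\<bar>C3\<bar> * \<bar>C1\<bar>) * indicator (ball (0::real^2) R) x)"
        by (intro integrable_mult_right integrable_real_indicator) (auto simp: ballfin)
      have "\<bar>F x\<bar> <= (\<bar>C3\<bar> * \<bar>C1\<bar>) * indicator (ball 0 R) x" for x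
      proof (cases "x \<in> \<omega>")
        case True
        have "\<bar>\<psi> x\<bar> * \<bar>\<phi> x\<bar> <= \<bar>C3\<bar> * \<bar>C1\<bar>" using C1[of x] C3[OF True] by (intro mult_mono) auto
        then show ?thesis using True R by (auto simp: F_def abs_mult)
      qed (simp add: F_def)
      then show "AE x in lborel. norm (F x) <= norm ((\<bar>C3\<bar> * \<bar>C1\<bar>) * indicator (ball 0 R) x)" by auto
    qed simp
    note sh = lborel_integrable_shift[OF iF] lborel_integral_shift[OF Fm]
    have D0: "(LINT x|lborel. D n x) = 0" for n
      using iF sh by (simp add: D_def)
    have "(\<lambda>n. LINT x|lborel. D n x) \<longlonglongrightarrow> (LINT x|lborel. g i x)"
      by (rule integral_dominated_convergence[OF _ _ Ci]) (use lim DC in auto)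
    then have g0: "(LINT x|lborel. g i x) = 0" using D0 LIMSEQ_unique[OF _ tendsto_const[of 0]] by simp
    have "(LINT x|leb \<omega>. \<psi> x * partial i \<phi> x + G i x * \<phi> x) = (LINT x|leb \<omega>. g i x)"
      by (intro Bochner_Integration.integral_cong) (auto simp: g_def)
    also have "\<dots> = (LINT x|lborel. g i x)"
      by (rule integral_lebesgue_on_open[OF \<omega>(1) gm]) (simp add: g_def)
    finally have "(LINT x|leb \<omega>. \<psi> x * partial i \<phi> x + G i x * \<phi> x) = 0" using g0 by simp
    moreover have "integrable (leb \<omega>) (\<lambda>x. \<psi> x * partial i \<phi> x)" "integrable (leb \<omega>) (\<lambda>x. G i x * \<phi> x)"
      by (intro integrable_sqint_mult s c test_function_sqint[OF \<omega>] \<phi> sp)+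
    ultimately show ?thesis by simp
  qed
  then show ?thesis using s[OF c(1)] s[OF c(2)] unfolding is_weak_partial_def L2_iff by blast
qed

section \<open>Increments along segments\<close>

text \<open>Borel representatives that vanish outside the domain. Unlike Lebesgue measurability,
  Borel measurability survives composition with translations and charts, and integrals can be
  taken over the whole plane.\<close>

definition borel_H1 :: "(real^2) set => (real^2 => real) => (2 => real^2 => real) => bool" where
  "borel_H1 \<omega> u v \<longleftrightarrow> u \<in> borel_measurable borel \<and> (\<forall>i. v i \<in> borel_measurable borel) \<and>
     (\<forall>x. x \<notin> \<omega> --> u x = 0 \<and> (\<forall>i. v i x = 0)) \<and> (\<forall>i. is_weak_partial \<omega> i u (v i))"

lemma borel_H1_rep:
  assumes \<omega>: "open \<omega>" and w: "\<And>i. is_weak_partial \<omega> i u (v i)"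
  obtains u' v' where "borel_H1 \<omega> u' v'" "AE x in leb \<omega>. u x = u' x" "\<And>i. AE x in leb \<omega>. v i x = v' i x"
proof -
  have s: "sqint (leb \<omega>) u" "sqint (leb \<omega>) (v i)" for i
    using is_weak_partial_sqint[OF w] by auto
  obtain u' where u': "u' \<in> borel_measurable borel" "\<And>x. x \<notin> \<omega> ==> u' x = 0" "AE x in leb \<omega>. u x = u' x"
    using lebesgue_on_borel_rep[OF \<omega> sqintD(1)[OF s(1)]] by blast
  have "\<forall>i. \<exists>v'. v' \<in> borel_measurable borel \<and> (\<forall>x. x \<notin> \<omega> --> v' x = 0) \<and> (AE x in leb \<omega>. v i x = v' x)"
    using lebesgue_on_borel_rep[OF \<omega> sqintD(1)[OF s(2)]] by metis
  then obtain v' where v': "\<forall>i. v' i \<in> borel_measurable borel \<and> (\<forall>x. x \<notin> \<omega> --> v' i x = 0) \<and> (AE x in leb \<omega>. v i x = v' i x)"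
    unfolding choice_iff by (elim exE)
  have "is_weak_partial \<omega> i u' (v' i)" for i
    by (rule is_weak_partial_cong_AE[OF w]) (use u' v' in \<open>auto intro: borel_imp_lebesgue_on\<close>)
  then have "borel_H1 \<omega> u' v'" using u' v' unfolding borel_H1_def by auto
  then show ?thesis using that u'(3) v' by blast
qed

lemma borel_H1_integrable:
  assumes \<omega>: "open \<omega>" "bounded \<omega>" and H: "borel_H1 \<omega> u v"
  shows "integrable lborel u" "integrable lborel (v i)" "integrable lborel (\<lambda>x. (u x)\<^sup>2)" "integrable lborel (\<lambda>x. (v i x)\<^sup>2)"
proof -
  interpret finite_measure "leb \<omega>" using \<omega> finite_measure_lebesgue_on_open by blast
  have *: "integrable lborel f \<and> integrable lborel (\<lambda>x. (f x)\<^sup>2)"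
    if "f \<in> borel_measurable borel" "\<And>x. x \<notin> \<omega> ==> f x = 0" "sqint (leb \<omega>) f" for f :: "real^2 => real"
    using integrable_sqint[OF that(3)] sqintD(2)[OF that(3)]
      integrable_lebesgue_on_open[OF \<omega>(1) that(1,2)] integrable_lebesgue_on_open[OF \<omega>(1), of "\<lambda>x. (f x)\<^sup>2"] that(1,2)
    by auto
  have w: "is_weak_partial \<omega> i u (v i)" for i using H by (simp add: borel_H1_def)
  have "integrable lborel u \<and> integrable lborel (\<lambda>x. (u x)\<^sup>2)"
    using H is_weak_partial_sqint[OF w] by (intro *) (auto simp: borel_H1_def)
  moreover have "integrable lborel (v i) \<and> integrable lborel (\<lambda>x. (v i x)\<^sup>2)"
    using H is_weak_partial_sqint[OF w] by (intro *) (auto simp: borel_H1_def)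
  ultimately show "integrable lborel u" "integrable lborel (v i)" "integrable lborel (\<lambda>x. (u x)\<^sup>2)" "integrable lborel (\<lambda>x. (v i x)\<^sup>2)"
    by auto
qed

text \<open>Convolution of \<open>\<phi>\<close> with the uniform distribution on the segment
  from $0$ to $e$.\<close>

definition segment_mean :: "real^2 => (real^2 => real) => real^2 => real" where
  "segment_mean e \<phi> x = integral (cbox 0 1) (\<lambda>s::real. \<phi> (x - s *\<^sub>R e))"

lemma sum_axis: "(\<Sum>j\<in>UNIV. axis i (1::real) $ j * f j) = f i" for i :: 2
  using exhaust_2[of i] by (auto simp: sum_2 axis_def)

lemma continuous_on_shift:
  assumes "continuous_on UNIV (\<phi> :: real^2 => real)"
  shows "continuous_on S (\<lambda>(x, s::real). \<phi> (x - s *\<^sub>R e))" "continuous_on T (\<lambda>s::real. \<phi> (x - s *\<^sub>R e))"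
  by (auto simp: split_beta intro!: continuous_on_compose2[OF assms] continuous_intros)

lemma segment_mean_has_derivative:
  assumes "Ck (Suc k) \<phi>"
  shows "(segment_mean e \<phi> has_derivative (\<lambda>h. \<Sum>i\<in>UNIV. h $ i * segment_mean e (partial i \<phi>) x)) (at x)"
proof -
  define L where "L i = Blinfun (\<lambda>h::real^2. h $ i)" for i
  have L: "blinfun_apply (L i) h = h $ i" for i h
    unfolding L_def by (simp add: bounded_linear_Blinfun_apply bounded_linear_vec_nth)
  define fx where "fx x t = (\<Sum>i\<in>UNIV. partial i \<phi> (x - t *\<^sub>R e) *\<^sub>R L i)" for x and t :: real
  have fx: "blinfun_apply (fx x t) h = (\<Sum>i\<in>UNIV. h $ i * partial i \<phi> (x - t *\<^sub>R e))" for x t h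
    by (simp add: fx_def blinfun.sum_left blinfun.scaleR_left L mult.commute)
  have c: "continuous_on UNIV (partial i \<phi>)" for i using assms Ck_continuous by auto
  have d: "((\<lambda>x. \<phi> (x - t *\<^sub>R e)) has_derivative blinfun_apply (fx x t)) (at x)" for x t
  proof -
    have "((\<lambda>x. \<phi> (x - t *\<^sub>R e)) has_derivative (\<lambda>h. \<Sum>i\<in>UNIV. h $ i * partial i \<phi> (x - t *\<^sub>R e))) (at x)"
      by (rule has_derivative_compose[where f="\<lambda>x. x - t *\<^sub>R e" and f'="\<lambda>h. h" and g=\<phi>])
        (auto intro!: derivative_eq_intros differentiable_has_derivative_partial Ck_differentiable[OF assms])
    then show ?thesis by (simp add: fx[abs_def])
  qed
  have ccont: "continuous_on S (\<lambda>(x, t). fx x t)" for S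
    unfolding fx_def split_beta
    by (intro continuous_intros continuous_on_compose2[OF c]) auto
  have "(segment_mean e \<phi> has_derivative blinfun_apply (integral (cbox 0 1) (fx x))) (at x within UNIV)"
    unfolding segment_mean_def
  proof (rule leibniz_rule)
    show "(\<lambda>s. \<phi> (x - s *\<^sub>R e)) integrable_on cbox 0 1" for x
      by (intro integrable_continuous continuous_on_shift Ck_continuous[OF assms])
  qed (auto intro!: d ccont)
  moreover have "blinfun_apply (integral (cbox 0 1) (fx x)) h = (\<Sum>i\<in>UNIV. h $ i * segment_mean e (partial i \<phi>) x)" for h
  proof -
    have "fx x integrable_on cbox 0 1"
      unfolding fx_def[abs_def]
      by (intro integrable_continuous continuous_intros continuous_on_shift c)
    then have "blinfun_apply (integral (cbox 0 1) (fx x)) h = integral (cbox 0 1) (\<lambda>t. blinfun_apply (fx x t) h)"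
      by (rule blinfun_apply_integral)
    also have "\<dots> = (\<Sum>i\<in>UNIV. integral (cbox 0 1) (\<lambda>t. h $ i * partial i \<phi> (x - t *\<^sub>R e)))"
      unfolding fx
      by (intro integral_sum) (intro finite integrable_continuous continuous_on_mult[OF continuous_on_const continuous_on_shift(2)[OF c]])+
    finally show ?thesis by (simp add: segment_mean_def)
  qed
  ultimately show ?thesis by (metis (no_types, lifting) ext)
qed

lemma Ck_segment_mean: "Ck k \<phi> ==> Ck k (segment_mean e \<phi>)"
proof (induction k arbitrary: \<phi>)
  case 0
  then have c: "continuous_on UNIV \<phi>" by simp
  show ?case unfolding Ck.simps segment_mean_def
    by (rule integral_continuous_on_param) (use continuous_on_shift(1)[OF c] in auto)
next
  case (Suc k)
  have "partial i (segment_mean e \<phi>) = segment_mean e (partial i \<phi>)" for i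
    using partial_eqI[OF segment_mean_has_derivative[OF Suc.prems]]
    by (simp add: fun_eq_iff sum_axis)
  then show ?case
    using Suc by (intro Ck_Suc_I differentiableI[OF segment_mean_has_derivative[OF Suc.prems]]) auto
qed

lemma partial_segment_mean: "Ck (Suc k) \<phi> ==> partial i (segment_mean e \<phi>) x = segment_mean e (partial i \<phi>) x"
  using partial_eqI[OF segment_mean_has_derivative] by (simp add: sum_axis)

text \<open>The support of the average lies in the union of the translates $\mathrm{supp}\,\phi
  + [0,1]e$, which is compact and contained in the larger set.\<close>

lemma segment_mean_test_function:
  assumes \<phi>: "\<phi> \<in> test_functions U" and seg: "\<And>x s. x \<in> U ==> 0 <= s ==> s <= 1 ==> x + s *\<^sub>R e \<in> \<omega>"
  shows "segment_mean e \<phi> \<in> test_functions \<omega>"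
proof -
  let ?K = "closure {x. \<phi> x \<noteq> 0}"
  have K: "compact ?K" "?K \<subseteq> U" and C: "\<And>k. Ck k \<phi>" using \<phi> by (auto simp: test_functions_def)
  define K' where "K' = (\<lambda>(x, s). x + s *\<^sub>R e) ` (?K \<times> {0..1::real})"
  have K': "compact K'" unfolding K'_def split_beta
    by (intro compact_continuous_image continuous_intros compact_Times K(1)) auto
  have K'\<omega>: "K' \<subseteq> \<omega>" unfolding K'_def using seg K(2) by auto
  have "segment_mean e \<phi> x = 0" if "x \<notin> K'" for x
  proof -
    have "\<phi> (x - s *\<^sub>R e) = 0" if "s \<in> cbox 0 1" for s :: real
    proof (rule ccontr)
      assume "\<phi> (x - s *\<^sub>R e) \<noteq> 0"
      then have "x - s *\<^sub>R e \<in> ?K" using closure_subset[of "{x. \<phi> x \<noteq> 0}"] by auto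
      then have "x \<in> K'" unfolding K'_def using that by (intro image_eqI[of _ _ "(x - s *\<^sub>R e, s)"]) auto
      then show False using \<open>x \<notin> K'\<close> by simp
    qed
    then have "segment_mean e \<phi> x = integral (cbox 0 1) (\<lambda>s::real. 0::real)"
      unfolding segment_mean_def by (intro Henstock_Kurzweil_Integration.integral_cong) auto
    then show ?thesis by simp
  qed
  then have sub: "closure {x. segment_mean e \<phi> x \<noteq> 0} \<subseteq> K'"
    by (intro closure_minimal compact_imp_closed K') auto
  moreover have "compact (closure {x. segment_mean e \<phi> x \<noteq> 0})"
    using compact_Int_closed[OF K' closed_closure, of "{x. segment_mean e \<phi> x \<noteq> 0}"] sub by (simp add: Int_absorb1)
  ultimately show ?thesis using K'\<omega> C Ck_segment_mean unfolding test_functions_def by blast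
qed

text \<open>The derivative of $s\mapsto\phi(x-se)$ is integrated over the unit interval.\<close>

lemma segment_mean_telescope:
  assumes "Ck (Suc 0) \<phi>"
  shows "(\<Sum>i\<in>UNIV. e $ i * segment_mean e (partial i \<phi>) x) = \<phi> x - \<phi> (x - e)"
proof -
  have c: "continuous_on UNIV (partial i \<phi>)" for i using assms by auto
  have "((\<lambda>s. (\<Sum>i\<in>UNIV. e $ i * partial i \<phi> (x - s *\<^sub>R e))) has_integral (- \<phi> (x - 1 *\<^sub>R e) - - \<phi> (x - 0 *\<^sub>R e))) {0..1}"
  proof (rule fundamental_theorem_of_calculus)
    fix s :: real
    have "((\<lambda>s. x - s *\<^sub>R e) has_derivative (\<lambda>t. - (t *\<^sub>R e))) (at s)"
      by (auto intro!: derivative_eq_intros)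
    then have "((\<lambda>s. \<phi> (x - s *\<^sub>R e)) has_derivative (\<lambda>t. \<Sum>i\<in>UNIV. (- (t *\<^sub>R e)) $ i * partial i \<phi> (x - s *\<^sub>R e))) (at s)"
      by (rule has_derivative_compose) (intro differentiable_has_derivative_partial Ck_differentiable[OF assms])
    then have "((\<lambda>s. - \<phi> (x - s *\<^sub>R e)) has_derivative (\<lambda>t. - (\<Sum>i\<in>UNIV. (- (t *\<^sub>R e)) $ i * partial i \<phi> (x - s *\<^sub>R e)))) (at s)"
      by (rule has_derivative_minus)
    then have "((\<lambda>s. - \<phi> (x - s *\<^sub>R e)) has_vector_derivative (\<Sum>i\<in>UNIV. e $ i * partial i \<phi> (x - s *\<^sub>R e))) (at s)"
      by (simp add: has_vector_derivative_def sum_negf sum_distrib_left mult.assoc)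
    then show "((\<lambda>s. - \<phi> (x - s *\<^sub>R e)) has_vector_derivative (\<Sum>i\<in>UNIV. e $ i * partial i \<phi> (x - s *\<^sub>R e))) (at s within {0..1})"
      by (rule has_vector_derivative_at_within)
  qed simp
  then have "integral (cbox 0 1) (\<lambda>s. (\<Sum>i\<in>UNIV. e $ i * partial i \<phi> (x - s *\<^sub>R e))) = \<phi> x - \<phi> (x - e)"
    by (simp add: integral_unique)
  moreover have "integral (cbox 0 1) (\<lambda>s::real. (\<Sum>i\<in>UNIV. e $ i * partial i \<phi> (x - s *\<^sub>R e)))
     = (\<Sum>i\<in>UNIV. integral (cbox 0 1) (\<lambda>s. e $ i * partial i \<phi> (x - s *\<^sub>R e)))"
    by (intro integral_sum) (intro finite integrable_continuous continuous_on_mult[OF continuous_on_const continuous_on_shift(2)[OF c]])+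
  ultimately show ?thesis by (simp add: segment_mean_def)
qed

lemma segment_mean_lborel:
  assumes "continuous_on UNIV (\<phi> :: real^2 => real)"
  shows "segment_mean e \<phi> x = (LINT s|lborel. indicator {0..1} s * \<phi> (x - s *\<^sub>R e))"
proof -
  have "set_integrable lborel {0..1} (\<lambda>s. \<phi> (x - s *\<^sub>R e))"
    by (intro borel_integrable_atLeastAtMost' continuous_on_shift assms)
  then show ?thesis
    using set_borel_integral_eq_integral(2)[of "{0..1}" "\<lambda>s. \<phi> (x - s *\<^sub>R e)"]
    by (simp add: segment_mean_def set_lebesgue_integral_def)
qed

text \<open>Testing the weak derivatives with the average of a test function
  \<open>\<phi>\<close> along the segment, and summing with weights $e_i$, produces the
  increment $\phi - \phi(\cdot - e)$ on one side by \<open>segment_mean_telescope\<close>. After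
  a translation both sides are integrals against \<open>\<phi>\<close> itself, and the
  fundamental lemma applies.\<close>

lemma increment_identity:
  assumes \<omega>: "open \<omega>" "bounded \<omega>" and H: "borel_H1 \<omega> u v" and U: "open U"
    and seg: "\<And>x s. x \<in> U ==> 0 <= s ==> s <= 1 ==> x + s *\<^sub>R e \<in> \<omega>"
  shows "AE x in lborel. x \<in> U -->
    u (x + e) - u x = (LINT s|lborel. indicator {0..1} s * (\<Sum>i\<in>UNIV. e $ i * v i (x + s *\<^sub>R e)))"
proof -
  define w where "w x = (\<Sum>i\<in>UNIV. e $ i * v i x)" for x
  have um [measurable]: "u \<in> borel_measurable borel" and vm [measurable]: "v i \<in> borel_measurable borel" for i
    using H by (auto simp: borel_H1_def)
  have z0: "u x = 0" "v i x = 0" if "x \<notin> \<omega>" for x i using H that by (auto simp: borel_H1_def)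
  have wm [measurable]: "w \<in> borel_measurable borel" unfolding w_def by measurable
  have iu: "integrable lborel u" and iv: "integrable lborel (v i)" for i
    using borel_H1_integrable[OF \<omega> H] by auto
  have iw: "integrable lborel w" unfolding w_def
    by (intro Bochner_Integration.integrable_sum integrable_mult_right iv)
  \<comment> \<open>the increment kernel, as a function of the parameter and the point\<close>
  let ?P = "lborel \<Otimes>\<^sub>M lborel :: (real \<times> (real^2)) measure"
  have i2: "integrable ?P (\<lambda>(s, x). indicator {0..1} s * w (x + s *\<^sub>R e))"
  proof (rule lborel_pair.Fubini_integrable)
    have "(LINT y|lborel. norm (case (s, y) of (s, x) => indicator {0..1} s * w (x + s *\<^sub>R e)))
      = indicator {0..1} s * (LINT x|lborel. \<bar>w x\<bar>)" for s :: real
      using lborel_integral_shift[of "\<lambda>x. \<bar>w x\<bar>" "s *\<^sub>R e"] by (simp add: abs_mult)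
    moreover have "integrable lborel (\<lambda>s::real. indicator {0..1} s * (LINT x|lborel. \<bar>w x\<bar>))"
      by (intro integrable_mult_left integrable_real_indicator) auto
    ultimately show "integrable lborel (\<lambda>s. LINT y|lborel. norm (case (s, y) of (s::real, x) => indicator {0..1} s * w (x + s *\<^sub>R e)))"
      by simp
    show "AE s in lborel. integrable lborel (\<lambda>y. case (s, y) of (s::real, x) => indicator {0..1} s * w (x + s *\<^sub>R e))"
      using lborel_integrable_shift[OF iw] by auto
  qed measurable
  have i1: "integrable ?P (\<lambda>(s, x). indicator {0..1} s * w x)"
  proof (rule lborel_pair.Fubini_integrable)
    have "(LINT y|lborel. norm (case (s, y) of (s, x) => indicator {0..1} s * w x))
      = indicator {0..1} s * (LINT x|lborel. \<bar>w x\<bar>)" for s :: real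
      by (simp add: abs_mult)
    moreover have "integrable lborel (\<lambda>s::real. indicator {0..1} s * (LINT x|lborel. \<bar>w x\<bar>))"
      by (intro integrable_mult_left integrable_real_indicator) auto
    ultimately show "integrable lborel (\<lambda>s. LINT y|lborel. norm (case (s, y) of (s::real, x) => indicator {0..1} s * w x))"
      by simp
    show "AE s in lborel. integrable lborel (\<lambda>y. case (s, y) of (s::real, x) => indicator {0..1} s * w x)"
      using iw by auto
  qed measurable
  define W where "W x = (LINT s|lborel. indicator {0..1} s * w (x + s *\<^sub>R e))" for x
  have iW: "integrable lborel W"
    using lborel_pair.integrable_snd[OF i2] by (simp add: W_def[abs_def])
  define z where "z x = u (x + e) - u x - W x" for x
  have iz: "integrable lborel z"
    unfolding z_def by (intro Bochner_Integration.integrable_diff iu iW lborel_integrable_shift)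
  have "(LINT x|lborel. z x * \<phi> x) = 0" if \<phi>: "\<phi> \<in> test_functions U" for \<phi>
  proof -
    have C: "Ck k \<phi>" for k using \<phi> by (auto simp: test_functions_def)
    have \<phi>c: "continuous_on UNIV \<phi>" by (rule test_function_continuous[OF \<phi>])
    have \<phi>m [measurable]: "\<phi> \<in> borel_measurable borel" by (rule test_function_measurable[OF \<phi>])
    obtain B where B: "\<And>x. \<bar>\<phi> x\<bar> <= B" using test_function_bounded[OF \<phi>] by blast
    have ib: "integrable M (\<lambda>x. f x * g x)" if "integrable M f" "g \<in> borel_measurable M" "\<And>x. \<bar>g x\<bar> <= B"
      for M :: "'z measure" and f g :: "'z => real"
    proof (rule Bochner_Integration.integrable_bound[of M "\<lambda>x. B * f x"])
      have "\<bar>f x * g x\<bar> <= \<bar>B * f x\<bar>" for x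
        using mult_left_mono[OF that(3), of "\<bar>f x\<bar>" x] order_trans[OF abs_ge_zero that(3)]
        by (simp add: abs_mult mult.commute)
      then show "AE x in M. norm (f x * g x) <= norm (B * f x)" by auto
    qed (use that in auto)
    let ?\<Phi> = "segment_mean e \<phi>"
    have \<Phi>t: "?\<Phi> \<in> test_functions \<omega>" by (rule segment_mean_test_function[OF \<phi> seg])
    have \<Phi>m [measurable]: "?\<Phi> \<in> borel_measurable borel" by (rule test_function_measurable[OF \<Phi>t])
    have \<Phi>p [measurable]: "partial i ?\<Phi> \<in> borel_measurable borel" for i
      by (rule test_function_measurable[OF test_function_partial[OF \<Phi>t]])
    have weak: "(LINT x|lborel. u x * partial i ?\<Phi> x) = - (LINT x|lborel. v i x * ?\<Phi> x)" for i
    proof -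
      have "(LINT x|leb \<omega>. u x * partial i ?\<Phi> x) = - (LINT x|leb \<omega>. v i x * ?\<Phi> x)"
        using H \<Phi>t by (auto simp: borel_H1_def is_weak_partial_def)
      moreover have "(LINT x|leb \<omega>. u x * partial i ?\<Phi> x) = (LINT x|lborel. u x * partial i ?\<Phi> x)"
        by (rule integral_lebesgue_on_open[OF \<omega>(1)]) (auto simp: z0)
      moreover have "(LINT x|leb \<omega>. v i x * ?\<Phi> x) = (LINT x|lborel. v i x * ?\<Phi> x)"
        by (rule integral_lebesgue_on_open[OF \<omega>(1)]) (auto simp: z0)
      ultimately show ?thesis by simp
    qed
    obtain B' where B': "\<And>x. \<bar>?\<Phi> x\<bar> <= B'" using test_function_bounded[OF \<Phi>t] by blast
    have int\<Phi>: "integrable lborel (\<lambda>x. v i x * ?\<Phi> x)" for i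
    proof (rule Bochner_Integration.integrable_bound[of lborel "\<lambda>x. B' * v i x"])
      have "\<bar>v i x * ?\<Phi> x\<bar> <= \<bar>B' * v i x\<bar>" for x
        using mult_left_mono[OF B', of "\<bar>v i x\<bar>" x] order_trans[OF abs_ge_zero B'] by (simp add: abs_mult mult.commute)
      then show "AE x in lborel. norm (v i x * ?\<Phi> x) <= norm (B' * v i x)" by auto
    qed (use iv in auto)
    have intu: "integrable lborel (\<lambda>x. u x * partial i ?\<Phi> x)" for i
    proof -
      obtain B'' where B'': "\<And>x. \<bar>partial i ?\<Phi> x\<bar> <= B''" using test_function_bounded[OF test_function_partial[OF \<Phi>t]] by blast
      show ?thesis
      proof (rule Bochner_Integration.integrable_bound[of lborel "\<lambda>x. B'' * u x"])
        have "\<bar>u x * partial i ?\<Phi> x\<bar> <= \<bar>B'' * u x\<bar>" for x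
          using mult_left_mono[OF B'', of "\<bar>u x\<bar>" x] order_trans[OF abs_ge_zero B''] by (simp add: abs_mult mult.commute)
        then show "AE x in lborel. norm (u x * partial i ?\<Phi> x) <= norm (B'' * u x)" by auto
      qed (use iu in auto)
    qed
    have "(LINT x|lborel. u x * (\<phi> x - \<phi> (x - e))) = (LINT x|lborel. (\<Sum>i\<in>UNIV. e $ i * (u x * partial i ?\<Phi> x)))"
      unfolding segment_mean_telescope[OF C, of e, symmetric] partial_segment_mean[OF C]
      by (simp add: sum_distrib_left mult.left_commute)
    also have "\<dots> = (\<Sum>i\<in>UNIV. e $ i * (LINT x|lborel. u x * partial i ?\<Phi> x))"
      using intu by (subst Bochner_Integration.integral_sum) auto
    also have "\<dots> = - (\<Sum>i\<in>UNIV. e $ i * (LINT x|lborel. v i x * ?\<Phi> x))"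
      by (simp add: weak sum_negf)
    also have "(\<Sum>i\<in>UNIV. e $ i * (LINT x|lborel. v i x * ?\<Phi> x)) = (LINT x|lborel. (\<Sum>i\<in>UNIV. e $ i * (v i x * ?\<Phi> x)))"
      using int\<Phi> by (subst Bochner_Integration.integral_sum) auto
    also have "\<dots> = (LINT x|lborel. w x * ?\<Phi> x)"
      by (simp add: w_def sum_distrib_right mult.assoc)
    also have "\<dots> = (LINT x|lborel. LINT s|lborel. indicator {0..1} s * w x * \<phi> (x - s *\<^sub>R e))"
      unfolding segment_mean_lborel[OF \<phi>c] by (simp flip: integral_mult_right_zero add: mult.assoc mult.left_commute)
    also have "\<dots> = (LINT s|lborel. LINT x|lborel. indicator {0..1} s * w x * \<phi> (x - s *\<^sub>R e))"
    proof (rule lborel_pair.Fubini_integral)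
      have "integrable ?P (\<lambda>p. (case p of (s, x) => indicator {0..1} s * w x) * (case p of (s, x) => \<phi> (x - s *\<^sub>R e)))"
        by (rule ib[OF i1]) (use B in auto)
      then show "integrable ?P (\<lambda>(s, x). indicator {0..1} s * w x * \<phi> (x - s *\<^sub>R e))"
        by (simp add: case_prod_beta')
    qed
    also have "\<dots> = (LINT s|lborel. LINT x|lborel. indicator {0..1} s * w (x + s *\<^sub>R e) * \<phi> x)"
    proof (rule Bochner_Integration.integral_cong[OF refl])
      fix s :: real
      show "(LINT x|lborel. indicator {0..1} s * w x * \<phi> (x - s *\<^sub>R e)) = (LINT x|lborel. indicator {0..1} s * w (x + s *\<^sub>R e) * \<phi> x)"
        using lborel_integral_shift[of "\<lambda>x. indicator {0..1} s * w x * \<phi> (x - s *\<^sub>R e)" "s *\<^sub>R e"] by simp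
    qed
    also have "\<dots> = (LINT x|lborel. LINT s|lborel. indicator {0..1} s * w (x + s *\<^sub>R e) * \<phi> x)"
    proof -
      have "integrable ?P (\<lambda>p. (case p of (s, x) => indicator {0..1} s * w (x + s *\<^sub>R e)) * (case p of (s, x) => \<phi> x))"
        by (rule ib[OF i2]) (use B in auto)
      then have "integrable ?P (\<lambda>(s, x). indicator {0..1} s * w (x + s *\<^sub>R e) * \<phi> x)"
        by (simp add: case_prod_beta')
      from lborel_pair.Fubini_integral[OF this] show ?thesis by simp
    qed
    also have "\<dots> = (LINT x|lborel. W x * \<phi> x)" by (simp add: W_def)
    finally have key: "(LINT x|lborel. u x * (\<phi> x - \<phi> (x - e))) = - (LINT x|lborel. W x * \<phi> x)" .
    have j1: "integrable lborel (\<lambda>x. u x * \<phi> x)" by (rule ib[OF iu]) (use B in auto)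
    have j2: "integrable lborel (\<lambda>x. u x * \<phi> (x - e))" by (rule ib[OF iu]) (use B in auto)
    have j3: "integrable lborel (\<lambda>x. W x * \<phi> x)" by (rule ib[OF iW]) (use B in auto)
    have j4: "integrable lborel (\<lambda>x. u (x + e) * \<phi> x)" "(LINT x|lborel. u (x + e) * \<phi> x) = (LINT x|lborel. u x * \<phi> (x - e))"
      using lborel_integrable_shift[OF j2, of e] lborel_integral_shift[of "\<lambda>x. u x * \<phi> (x - e)" e] by auto
    have "(LINT x|lborel. z x * \<phi> x) = (LINT x|lborel. u (x + e) * \<phi> x - u x * \<phi> x - W x * \<phi> x)"
      by (simp add: z_def algebra_simps)
    also have "\<dots> = (LINT x|lborel. u x * \<phi> (x - e)) - (LINT x|lborel. u x * \<phi> x) - (LINT x|lborel. W x * \<phi> x)"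
      using j1 j3 j4 by simp
    also have "\<dots> = 0" using key j1 j2 by (simp add: right_diff_distrib)
    finally show ?thesis .
  qed
  then have "AE x in lborel. x \<in> U --> z x = 0" by (rule fundamental_lemma[OF iz U])
  then show ?thesis
    by eventually_elim (simp add: z_def W_def w_def)
qed

text \<open>Cauchy--Schwarz in the increment identity, first in the components of
  \<open>e\<close> and then in the parameter of the segment.\<close>

lemma increment_bound:
  assumes \<omega>: "open \<omega>" "bounded \<omega>" and H: "borel_H1 \<omega> u v" and U: "open U"
    and seg: "\<And>x s. x \<in> U ==> 0 <= s ==> s <= 1 ==> x + s *\<^sub>R e \<in> \<omega>"
  shows "AE x in lborel. x \<in> U -->
    ennreal ((u (x + e) - u x)\<^sup>2)
      <= ennreal ((norm e)\<^sup>2) * (\<integral>\<^sup>+s. indicator {0..1} s * ennreal (sumsq v (x + s *\<^sub>R e)) \<partial>lborel)"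
proof (rule eventually_mono)
  show "AE x in lborel. x \<in> U -->
    u (x + e) - u x = (LINT s|lborel. indicator {0..1} s * (\<Sum>i\<in>UNIV. e $ i * v i (x + s *\<^sub>R e)))"
    by (rule increment_identity[OF \<omega> H U seg])
next
  fix x
  assume elim: "x \<in> U -->
    u (x + e) - u x = (LINT s|lborel. indicator {0..1} s * (\<Sum>i\<in>UNIV. e $ i * v i (x + s *\<^sub>R e)))"
  show "x \<in> U --> ennreal ((u (x + e) - u x)\<^sup>2)
      <= ennreal ((norm e)\<^sup>2) * (\<integral>\<^sup>+s. indicator {0..1} s * ennreal (sumsq v (x + s *\<^sub>R e)) \<partial>lborel)"
  proof
    assume x: "x \<in> U"
    have vm [measurable]: "v i \<in> borel_measurable borel" for i using H by (auto simp: borel_H1_def)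
    define V where "V s = (sumsq v (x + s *\<^sub>R e))" for s
    have V: "V s >= 0" for s unfolding V_def by (intro sum_nonneg) auto
    have Vm [measurable]: "V \<in> borel_measurable borel" unfolding V_def by measurable
    define g where "g s = (\<Sum>i\<in>UNIV. e $ i * v i (x + s *\<^sub>R e))" for s
    have gm [measurable]: "g \<in> borel_measurable borel" unfolding g_def by measurable
    have gV: "\<bar>g s\<bar> <= norm e * sqrt (V s)" for s
    proof -
      have "g s = e \<bullet> (\<chi> i. v i (x + s *\<^sub>R e))" by (simp add: g_def inner_vec_def)
      moreover have "norm (\<chi> i. v i (x + s *\<^sub>R e)) = sqrt (V s)" by (simp add: V_def norm_vec_def L2_set_def)
      ultimately show ?thesis using Cauchy_Schwarz_ineq2[of e "\<chi> i. v i (x + s *\<^sub>R e)"] by simp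
    qed
    have e: "u (x + e) - u x = (LINT s|lborel. indicator {0..1} s * g s)" using elim x by (simp add: g_def)
    have "ennreal \<bar>u (x + e) - u x\<bar> <= (\<integral>\<^sup>+s. ennreal (norm (indicator {0..1} s * g s)) \<partial>lborel)"
      unfolding e using integral_norm_bound_ennreal[of lborel "\<lambda>s. indicator {0..1} s * g s"]
      by (cases "integrable lborel (\<lambda>s. indicator {0..1} s * g s)") (auto simp: not_integrable_integral_eq)
    also have "\<dots> <= (\<integral>\<^sup>+s. ennreal (norm e * indicator {0..1} s) * ennreal (indicator {0..1} s * sqrt (V s)) \<partial>lborel)"
    proof (rule nn_integral_mono)
      fix s :: real
      show "ennreal (norm (indicator {0..1} s * g s)) <= ennreal (norm e * indicator {0..1} s) * ennreal (indicator {0..1} s * sqrt (V s))"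
        using gV[of s] V[of s] by (auto simp: indicator_def simp flip: ennreal_mult intro: ennreal_leI)
    qed
    finally have "(ennreal \<bar>u (x + e) - u x\<bar>)\<^sup>2 <= (\<integral>\<^sup>+s. ennreal (norm e * indicator {0..1} s) * ennreal (indicator {0..1} s * sqrt (V s)) \<partial>lborel)\<^sup>2"
      by (rule power_mono_ennreal)
    also have "\<dots> <= (\<integral>\<^sup>+s. (ennreal (norm e * indicator {0..1::real} s))\<^sup>2 \<partial>lborel) * (\<integral>\<^sup>+s. (ennreal (indicator {0..1} s * sqrt (V s)))\<^sup>2 \<partial>lborel)"
      using Cauchy_Schwarz_nn_integral[of "\<lambda>s::real. ennreal (norm e * indicator {0..1} s)" lborel "\<lambda>s. ennreal (indicator {0..1} s * sqrt (V s))"]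
      by measurable
    also have "(\<integral>\<^sup>+s. (ennreal (norm e * indicator {0..1::real} s))\<^sup>2 \<partial>lborel) = ennreal ((norm e)\<^sup>2)"
    proof -
      have "(ennreal (norm e * indicator {0..1} s))\<^sup>2 = ennreal ((norm e)\<^sup>2) * indicator {0..1} s" for s :: real
        by (auto simp: indicator_def ennreal_power)
      then show ?thesis by (simp add: nn_integral_cmult_indicator)
    qed
    also have "(\<integral>\<^sup>+s. (ennreal (indicator {0..1} s * sqrt (V s)))\<^sup>2 \<partial>lborel) = (\<integral>\<^sup>+s. indicator {0..1} s * ennreal (V s) \<partial>lborel)"
      by (intro nn_integral_cong) (use V in \<open>auto simp: indicator_def ennreal_power\<close>)
    also have "(ennreal \<bar>u (x + e) - u x\<bar>)\<^sup>2 = ennreal ((u (x + e) - u x)\<^sup>2)"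
      by (simp add: ennreal_power)
    finally show "ennreal ((u (x + e) - u x)\<^sup>2)
      <= ennreal ((norm e)\<^sup>2) * (\<integral>\<^sup>+s. indicator {0..1} s * ennreal (sumsq v (x + s *\<^sub>R e)) \<partial>lborel)"
      by (simp add: V_def)
  qed
qed

lemma increment_L2:
  assumes \<omega>: "open \<omega>" "bounded \<omega>" and H: "borel_H1 \<omega> u v" and U: "open U" and W: "open W" "W \<subseteq> \<omega>"
    and seg: "\<And>x s. x \<in> U ==> 0 <= s ==> s <= 1 ==> x + s *\<^sub>R e \<in> W"
  shows "(\<integral>\<^sup>+x. indicator U x * ennreal ((u (x + e) - u x)\<^sup>2) \<partial>lborel)
     <= ennreal ((norm e)\<^sup>2) * (\<integral>\<^sup>+x. indicator W x * ennreal (sumsq v x) \<partial>lborel)"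
proof -
  have vm [measurable]: "v i \<in> borel_measurable borel" for i using H by (auto simp: borel_H1_def)
  have Wm [measurable]: "W \<in> sets borel" using W by auto
  define V where "V x = indicator W x * ennreal (sumsq v x)" for x
  have Vm [measurable]: "V \<in> borel_measurable borel" unfolding V_def by measurable
  have "(\<integral>\<^sup>+x. indicator U x * ennreal ((u (x + e) - u x)\<^sup>2) \<partial>lborel)
     <= (\<integral>\<^sup>+x. ennreal ((norm e)\<^sup>2) * (\<integral>\<^sup>+s. indicator {0..1::real} s * V (x + s *\<^sub>R e) \<partial>lborel) \<partial>lborel)"
  proof (rule nn_integral_mono_AE)
    have "AE x in lborel. x \<in> U -->
      ennreal ((u (x + e) - u x)\<^sup>2)
      <= ennreal ((norm e)\<^sup>2) * (\<integral>\<^sup>+s. indicator {0..1} s * ennreal (sumsq v (x + s *\<^sub>R e)) \<partial>lborel)"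
      by (rule increment_bound[OF \<omega> H U]) (use seg W in blast)
    then show "AE x in lborel. indicator U x * ennreal ((u (x + e) - u x)\<^sup>2)
      <= ennreal ((norm e)\<^sup>2) * (\<integral>\<^sup>+s. indicator {0..1} s * V (x + s *\<^sub>R e) \<partial>lborel)"
    proof eventually_elim
      case (elim x)
      show ?case
      proof (cases "x \<in> U")
        case True
        have "(\<integral>\<^sup>+s. indicator {0..1} s * ennreal (sumsq v (x + s *\<^sub>R e)) \<partial>lborel)
          = (\<integral>\<^sup>+s. indicator {0..1} s * V (x + s *\<^sub>R e) \<partial>lborel)"
          by (rule nn_integral_cong) (use seg[OF True] in \<open>auto simp: indicator_def V_def\<close>)
        then show ?thesis using elim True by simp
      qed simp
    qed
  qed
  also have "\<dots> = ennreal ((norm e)\<^sup>2) * (\<integral>\<^sup>+x. \<integral>\<^sup>+s. indicator {0..1::real} s * V (x + s *\<^sub>R e) \<partial>lborel \<partial>lborel)"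
    by (rule nn_integral_cmult) measurable
  also have "(\<integral>\<^sup>+x. \<integral>\<^sup>+s. indicator {0..1::real} s * V (x + s *\<^sub>R e) \<partial>lborel \<partial>lborel)
     = (\<integral>\<^sup>+s. \<integral>\<^sup>+x. indicator {0..1::real} s * V (x + s *\<^sub>R e) \<partial>lborel \<partial>lborel)"
    by (rule lborel_pair.Fubini') measurable
  also have "\<dots> = (\<integral>\<^sup>+s. indicator {0..1::real} s * (\<integral>\<^sup>+x. V x \<partial>lborel) \<partial>lborel)"
  proof (rule nn_integral_cong)
    fix s :: real
    have "(\<integral>\<^sup>+x. indicator {0..1} s * V (x + s *\<^sub>R e) \<partial>lborel) = indicator {0..1} s * (\<integral>\<^sup>+x. V (x + s *\<^sub>R e) \<partial>lborel)"
      by (rule nn_integral_cmult) measurable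
    then show "(\<integral>\<^sup>+x. indicator {0..1} s * V (x + s *\<^sub>R e) \<partial>lborel) = indicator {0..1} s * (\<integral>\<^sup>+x. V x \<partial>lborel)"
      by (simp add: lborel_nn_integral_shift)
  qed
  also have "\<dots> = (\<integral>\<^sup>+x. V x \<partial>lborel)"
    by (simp add: nn_integral_multc)
  finally show ?thesis by (simp add: V_def)
qed

section \<open>Interior compactness\<close>

text \<open>The variance is half the mean square difference of two independent copies. This
  turns increment bounds into a Poincare inequality.\<close>

lemma (in finite_measure) nn_integral_square_differences:
  fixes f :: "'a => real"
  assumes f: "sqint M f"
  shows "(\<integral>\<^sup>+x. \<integral>\<^sup>+y. ennreal ((f y - f x)\<^sup>2) \<partial>M \<partial>M)
     = ennreal (2 * measure M (space M) * l2sq M f - 2 * (LINT x|M. f x)\<^sup>2)"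
proof -
  have i1: "integrable M f" by (rule integrable_sqint[OF f])
  have i2: "integrable M (\<lambda>x. (f x)\<^sup>2)" using sqintD(2)[OF f] by simp
  define m F S where "m = measure M (space M)" and "F = (LINT x|M. f x)" and "S = (LINT x|M. (f x)\<^sup>2)"
  have inner: "integrable M (\<lambda>y. (f y - c)\<^sup>2)" "(LINT y|M. (f y - c)\<^sup>2) = S - 2 * c * F + m * c\<^sup>2" for c
  proof -
    have e: "(f y - c)\<^sup>2 = (f y)\<^sup>2 - 2 * c * f y + c\<^sup>2" for y by (simp add: power2_diff)
    show "integrable M (\<lambda>y. (f y - c)\<^sup>2)" unfolding e using i1 i2 by simp
    show "(LINT y|M. (f y - c)\<^sup>2) = S - 2 * c * F + m * c\<^sup>2"
      unfolding e using i1 i2 by (simp add: m_def F_def S_def)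
  qed
  have "(\<integral>\<^sup>+x. \<integral>\<^sup>+y. ennreal ((f y - f x)\<^sup>2) \<partial>M \<partial>M) = (\<integral>\<^sup>+x. ennreal (S - 2 * f x * F + m * (f x)\<^sup>2) \<partial>M)"
    by (intro nn_integral_cong) (subst nn_integral_eq_integral, auto simp: inner)
  also have "\<dots> = ennreal (LINT x|M. S - 2 * f x * F + m * (f x)\<^sup>2)"
  proof (rule nn_integral_eq_integral)
    show "integrable M (\<lambda>x. S - 2 * f x * F + m * (f x)\<^sup>2)" using i1 i2 by simp
    have "0 <= S - 2 * c * F + m * c\<^sup>2" for c unfolding inner(2)[symmetric] by simp
    then show "AE x in M. 0 <= S - 2 * f x * F + m * (f x)\<^sup>2" by simp
  qed
  also have "(LINT x|M. S - 2 * f x * F + m * (f x)\<^sup>2) = 2 * m * S - 2 * F\<^sup>2"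
  proof -
    have "(LINT x|M. S - 2 * f x * F + m * (f x)\<^sup>2) = (LINT x|M. S) - (LINT x|M. 2 * f x * F) + (LINT x|M. m * (f x)\<^sup>2)"
      using i1 i2 by simp
    also have "\<dots> = m * S - 2 * F * F + m * S"
      using i1 i2 by (simp add: m_def F_def S_def mult.commute)
    finally show ?thesis by (simp add: power2_eq_square)
  qed
  finally show ?thesis by (simp add: m_def F_def S_def l2sq_real)
qed

text \<open>By \<open>nn_integral_square_differences\<close> the mean square differences of
  pairs $(x, x+e)$ in the square have to be estimated. For each \<open>e\<close> such
  \<open>x\<close> form a rectangle to which \<open>increment_L2\<close> applies, and
  \<open>e\<close> ranges over a square of twice the side length.\<close>

lemma poincare_square:
  assumes \<omega>: "open \<omega>" "bounded \<omega>" and H: "borel_H1 \<omega> u v" and Q: "box a b \<subseteq> \<omega>"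
    and h: "h > 0" "\<And>i. b $ i - a $ i = h"
  shows "(LINT x|lborel. indicator (box a b) x * (u x)\<^sup>2)
    <= (LINT x|lborel. indicator (box a b) x * u x)\<^sup>2 / h\<^sup>2
       + 4 * h\<^sup>2 * (LINT x|lborel. indicator (box a b) x * sumsq v x)"
proof -
  let ?Q = "box a b"
  have um [measurable]: "u \<in> borel_measurable borel" and vm [measurable]: "v i \<in> borel_measurable borel" for i
    using H by (auto simp: borel_H1_def)
  define V where "V x = indicator ?Q x * sumsq v x" for x
  have Vm [measurable]: "V \<in> borel_measurable borel" unfolding V_def by measurable
  have V0: "V x >= 0" for x unfolding V_def by (intro mult_nonneg_nonneg sum_nonneg) auto
  note I = borel_H1_integrable[OF \<omega> H]
  have iV: "integrable lborel V" unfolding V_def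
    using integrable_mult_indicator[of ?Q lborel "\<lambda>x. \<Sum>i\<in>UNIV. (v i x)\<^sup>2"] I(4) by simp
  have vol: "measure lborel ?Q = h\<^sup>2" "emeasure lborel ?Q = ennreal (h\<^sup>2)"
  proof -
    have "a \<bullet> i <= b \<bullet> i" if "i \<in> Basis" for i
      using that h by (auto simp: Basis_vec_def inner_axis) (metis diff_ge_0_iff_ge less_imp_le)
    then have "emeasure lborel ?Q = ennreal (\<Prod>i\<in>Basis. (b - a) \<bullet> i)" by (rule emeasure_lborel_box)
    also have "(\<Prod>i\<in>Basis. (b - a) \<bullet> i) = (\<Prod>i\<in>(Basis::(real^2) set). h)"
      by (rule prod.cong) (use h in \<open>auto simp: Basis_vec_def inner_axis\<close>)
    also have "\<dots> = h\<^sup>2" by simp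
    finally show "emeasure lborel ?Q = ennreal (h\<^sup>2)" .
    then show "measure lborel ?Q = h\<^sup>2" by (simp add: measure_def)
  qed
  let ?N = "restrict_space lborel ?Q"
  interpret N: finite_measure ?N
    by (rule finite_measureI) (simp add: emeasure_restrict_space vol)
  have mN: "measure ?N (space ?N) = h\<^sup>2"
    by (simp add: measure_restrict_space vol)
  have uN: "u \<in> borel_measurable ?N" by (rule measurable_restrict_space1) measurable
  have "integrable ?N (\<lambda>x. (u x)\<^sup>2)"
    by (subst integrable_restrict_space) (use I(3) in \<open>auto intro!: integrable_mult_indicator[where f="\<lambda>x. (u x)\<^sup>2", simplified]\<close>)
  then have sN: "sqint ?N u" using uN by (simp add: sqint_def)
  have l2: "l2sq ?N u = (LINT x|lborel. indicator ?Q x * (u x)\<^sup>2)"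
    unfolding l2sq_real by (subst integral_restrict_space) auto
  have l1: "(LINT x|?N. u x) = (LINT x|lborel. indicator ?Q x * u x)"
    by (subst integral_restrict_space) auto
  have inner: "(\<integral>\<^sup>+x. indicator ?Q x * (indicator ?Q (x + e) * ennreal ((u (x + e) - u x)\<^sup>2)) \<partial>lborel)
      <= ennreal (2 * h\<^sup>2 * (LINT x|lborel. V x)) * indicator (box (\<chi> i. - h) (\<chi> i. h)) e" for e
  proof (cases "e \<in> box (\<chi> i. - h) (\<chi> i. h)")
    case True
    let ?U = "?Q \<inter> (\<lambda>x. x - e) ` ?Q"
    have Ueq: "x \<in> (\<lambda>x. x - e) ` ?Q \<longleftrightarrow> x + e \<in> ?Q" for x by (auto simp: image_iff) (metis add_diff_cancel)
    have oU: "open ?U" by (intro open_Int open_box open_translation_subtract)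
    have "(\<integral>\<^sup>+x. indicator ?U x * ennreal ((u (x + e) - u x)\<^sup>2) \<partial>lborel)
       <= ennreal ((norm e)\<^sup>2) * (\<integral>\<^sup>+x. indicator ?Q x * ennreal (sumsq v x) \<partial>lborel)"
    proof (rule increment_L2[OF \<omega> H oU open_box Q])
      fix x and s :: real assume x: "x \<in> ?U" and s: "0 <= s" "s <= 1"
      then have "x \<in> ?Q" "x + e \<in> ?Q" using Ueq by auto
      moreover have "x + s *\<^sub>R e = (1 - s) *\<^sub>R x + s *\<^sub>R (x + e)" by (simp add: algebra_simps)
      ultimately show "x + s *\<^sub>R e \<in> ?Q"
        using convex_box(2)[of a b] s by (simp add: convexD_alt)
    qed
    also have "(\<integral>\<^sup>+x. indicator ?Q x * ennreal (sumsq v x) \<partial>lborel) = (\<integral>\<^sup>+x. ennreal (V x) \<partial>lborel)"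
      by (rule nn_integral_cong) (auto simp: V_def indicator_def)
    also have "\<dots> = ennreal (LINT x|lborel. V x)" using iV V0 by (intro nn_integral_eq_integral) auto
    also have "ennreal ((norm e)\<^sup>2) * ennreal (LINT x|lborel. V x) <= ennreal (2 * h\<^sup>2) * ennreal (LINT x|lborel. V x)"
    proof (intro mult_right_mono ennreal_leI)
      have "\<bar>e $ i\<bar> <= h" for i using True by (auto simp: mem_box_cart abs_le_iff less_imp_le minus_le_iff)
      then have "(e $ i)\<^sup>2 <= h\<^sup>2" for i using abs_le_square_iff[of "e $ i" h] h by simp
      then show "(norm e)\<^sup>2 <= 2 * h\<^sup>2"
        using add_mono[of "(e$1)\<^sup>2" "h\<^sup>2" "(e$2)\<^sup>2" "h\<^sup>2"]
        unfolding power2_norm_eq_inner by (simp add: inner_vec_def sum_2 power2_eq_square)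
    qed auto
    also have "\<dots> = ennreal (2 * h\<^sup>2 * (LINT x|lborel. V x))"
      using V0 by (simp add: ennreal_mult integral_nonneg_AE)
    finally have "(\<integral>\<^sup>+x. indicator ?U x * ennreal ((u (x + e) - u x)\<^sup>2) \<partial>lborel) <= ennreal (2 * h\<^sup>2 * (LINT x|lborel. V x))" .
    moreover have "indicator ?U x = (indicator ?Q x * indicator ?Q (x + e) :: ennreal)" for x
      using Ueq[of x] by (auto simp: indicator_def)
    ultimately show ?thesis using True by (simp add: mult.assoc)
  next
    case False
    have "indicator ?Q x * (indicator ?Q (x + e) :: ennreal) = 0" for x
    proof (rule ccontr)
      assume "indicator ?Q x * (indicator ?Q (x + e) :: ennreal) \<noteq> 0"
      then have "x \<in> ?Q" "x + e \<in> ?Q" by (auto simp: indicator_def split: if_splits)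
      then have "- h < e $ i \<and> e $ i < h" for i using h(2)[of i] by (auto simp: mem_box_cart) (smt (verit))+
      then show False using False by (simp add: mem_box_cart)
    qed
    then have "indicator ?Q x * (indicator ?Q (x + e) * ennreal ((u (x + e) - u x)\<^sup>2)) = 0" for x
      unfolding mult.assoc[symmetric] by (simp only: mult_zero_left)
    then have "(\<integral>\<^sup>+x. indicator ?Q x * (indicator ?Q (x + e) * ennreal ((u (x + e) - u x)\<^sup>2)) \<partial>lborel) = (\<integral>\<^sup>+(x::real^2). 0 \<partial>lborel)"
      by (intro nn_integral_cong)
    then show ?thesis by (simp only: nn_integral_const mult_zero_left zero_le)
  qed
  have "(\<integral>\<^sup>+x. \<integral>\<^sup>+y. ennreal ((u y - u x)\<^sup>2) \<partial>?N \<partial>?N)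
    = (\<integral>\<^sup>+x. (\<integral>\<^sup>+y. ennreal ((u y - u x)\<^sup>2) * indicator ?Q y \<partial>lborel) * indicator ?Q x \<partial>lborel)"
    by (simp add: nn_integral_restrict_space)
  also have "\<dots> = (\<integral>\<^sup>+x. (\<integral>\<^sup>+e. indicator ?Q x * (indicator ?Q (x + e) * ennreal ((u (x + e) - u x)\<^sup>2)) \<partial>lborel) \<partial>lborel)"
  proof (rule nn_integral_cong)
    fix x
    have "(\<integral>\<^sup>+y. ennreal ((u y - u x)\<^sup>2) * indicator ?Q y \<partial>lborel) = (\<integral>\<^sup>+e. ennreal ((u (e + x) - u x)\<^sup>2) * indicator ?Q (e + x) \<partial>lborel)"
      using lborel_nn_integral_shift[of "\<lambda>y. ennreal ((u y - u x)\<^sup>2) * indicator ?Q y" x] by simp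
    also have "\<dots> * indicator ?Q x = (\<integral>\<^sup>+e. ennreal ((u (e + x) - u x)\<^sup>2) * indicator ?Q (e + x) * indicator ?Q x \<partial>lborel)"
      by (rule nn_integral_multc[symmetric]) measurable
    finally show "(\<integral>\<^sup>+y. ennreal ((u y - u x)\<^sup>2) * indicator ?Q y \<partial>lborel) * indicator ?Q x
      = (\<integral>\<^sup>+e. indicator ?Q x * (indicator ?Q (x + e) * ennreal ((u (x + e) - u x)\<^sup>2)) \<partial>lborel)"
      by (simp add: mult.commute mult.left_commute add.commute)
  qed
  also have "\<dots> = (\<integral>\<^sup>+e. (\<integral>\<^sup>+x. indicator ?Q x * (indicator ?Q (x + e) * ennreal ((u (x + e) - u x)\<^sup>2)) \<partial>lborel) \<partial>lborel)"
    by (rule lborel_pair.Fubini') measurable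
  also have "\<dots> <= (\<integral>\<^sup>+e. ennreal (2 * h\<^sup>2 * (LINT x|lborel. V x)) * indicator (box (\<chi> i. - h) ((\<chi> i. h) :: real^2)) e \<partial>lborel)"
    by (intro nn_integral_mono inner)
  also have "\<dots> = ennreal (2 * h\<^sup>2 * (LINT x|lborel. V x)) * emeasure lborel (box (\<chi> i. - h) ((\<chi> i. h) :: real^2))"
    by (rule nn_integral_cmult_indicator) auto
  also have "emeasure lborel (box (\<chi> i. - h) ((\<chi> i. h) :: real^2)) = ennreal (4 * h\<^sup>2)"
  proof -
    have "emeasure lborel (box (\<chi> i. - h) ((\<chi> i. h) :: real^2)) = ennreal (\<Prod>i\<in>Basis. ((\<chi> i. h) - (\<chi> i. - h) :: real^2) \<bullet> i)"
      by (rule emeasure_lborel_box) (use h in \<open>auto simp: Basis_vec_def inner_axis\<close>)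
    also have "(\<Prod>i\<in>Basis. ((\<chi> i. h) - (\<chi> i. - h) :: real^2) \<bullet> i) = (\<Prod>i\<in>(Basis::(real^2) set). 2 * h)"
      by (rule prod.cong) (auto simp: Basis_vec_def inner_axis)
    also have "\<dots> = 4 * h\<^sup>2" by (simp add: power2_eq_square)
    finally show ?thesis .
  qed
  also have "ennreal (2 * h\<^sup>2 * (LINT x|lborel. V x)) * ennreal (4 * h\<^sup>2) = ennreal (2 * h\<^sup>2 * (LINT x|lborel. V x) * (4 * h\<^sup>2))"
    using V0 by (intro ennreal_mult[symmetric] mult_nonneg_nonneg integral_nonneg_AE) auto
  finally have le: "ennreal (2 * h\<^sup>2 * l2sq ?N u - 2 * (LINT x|?N. u x)\<^sup>2) <= ennreal (2 * h\<^sup>2 * (LINT x|lborel. V x) * (4 * h\<^sup>2))"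
    unfolding N.nn_integral_square_differences[OF sN] mN .
  have "0 <= 2 * h\<^sup>2 * (LINT x|lborel. V x) * (4 * h\<^sup>2)"
    using V0 by (intro mult_nonneg_nonneg integral_nonneg_AE) auto
  with le have "2 * h\<^sup>2 * l2sq ?N u - 2 * (LINT x|?N. u x)\<^sup>2 <= 2 * h\<^sup>2 * (LINT x|lborel. V x) * (4 * h\<^sup>2)"
    by (simp only: ennreal_le_iff)
  then have "l2sq ?N u * h\<^sup>2 <= (LINT x|?N. u x)\<^sup>2 + 4 * h\<^sup>2 * (LINT x|lborel. V x) * h\<^sup>2"
    by (simp add: mult.commute mult.left_commute)
  then have "l2sq ?N u <= ((LINT x|?N. u x)\<^sup>2 + 4 * h\<^sup>2 * (LINT x|lborel. V x) * h\<^sup>2) / h\<^sup>2"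
    using h(1) by (subst pos_le_divide_eq) auto
  also have "\<dots> = (LINT x|?N. u x)\<^sup>2 / h\<^sup>2 + 4 * h\<^sup>2 * (LINT x|lborel. V x)"
    using h(1) by (simp add: add_divide_distrib)
  finally have "l2sq ?N u <= (LINT x|?N. u x)\<^sup>2 / h\<^sup>2 + 4 * h\<^sup>2 * (LINT x|lborel. V x)" .
  then show ?thesis unfolding l2 l1 V_def .
qed

definition grid_square :: "real => int^2 => (real^2) set" where
  "grid_square h a = box (\<chi> i. h * of_int (a $ i)) (\<chi> i. h * (of_int (a $ i) + 1))"

lemma grid_square_disjoint:
  assumes "h > 0" "x \<in> grid_square h a" "x \<in> grid_square h b"
  shows "a = b"
proof -
  have "a $ i = b $ i" for i
  proof -
    have "h * of_int (a $ i) < h * (of_int (b $ i) + 1)" "h * of_int (b $ i) < h * (of_int (a $ i) + 1)"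
      using assms(2,3) by (auto simp: grid_square_def mem_box_cart intro: less_trans)
    then have "real_of_int (a $ i) < of_int (b $ i) + 1" "real_of_int (b $ i) < of_int (a $ i) + 1"
      using assms(1) by auto
    then show ?thesis by linarith
  qed
  then show ?thesis by (simp add: vec_eq_iff)
qed

lemma finite_grid_squares:
  assumes "bounded \<omega>" "h > 0"
  shows "finite {a. grid_square h a \<subseteq> \<omega>}"
proof -
  obtain R where R: "\<And>x. x \<in> \<omega> ==> norm x <= R" using assms(1) by (auto simp: bounded_iff)
  define N where "N = \<lceil>R / h\<rceil> + 1"
  have "a $ i \<in> {-N..N}" if "grid_square h a \<subseteq> \<omega>" for a i
  proof -
    let ?x = "(\<chi> i. h * (of_int (a $ i) + 1/2)) :: real^2"
    have "?x \<in> grid_square h a" using assms(2) by (simp add: grid_square_def mem_box_cart)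
    then have "norm ?x <= R" using that R by blast
    then have "\<bar>h * (of_int (a $ i) + 1/2)\<bar> <= R" using component_le_norm_cart[of ?x i] by simp
    then have "h * \<bar>of_int (a $ i) + 1/2\<bar> <= R" using assms(2) by (simp only: abs_mult abs_of_pos)
    then have "\<bar>of_int (a $ i) + 1/2\<bar> <= R / h" using assms(2) by (subst pos_le_divide_eq) (simp_all only: mult.commute)
    then have "\<bar>of_int (a $ i) + 1/2\<bar> <= real_of_int \<lceil>R / h\<rceil>" by linarith
    then show ?thesis unfolding N_def by (simp add: abs_le_iff)
  qed
  then have "(\<lambda>a. (a $ 1, a $ 2)) ` {a. grid_square h a \<subseteq> \<omega>} \<subseteq> {-N..N} \<times> {-N..N}" by auto
  then have "finite ((\<lambda>a. (a $ 1, a $ 2)) ` {a. grid_square h a \<subseteq> \<omega>})" by (rule finite_subset) simp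
  moreover have "inj_on (\<lambda>a. (a $ 1, a $ 2)) {a :: int^2. grid_square h a \<subseteq> \<omega>}"
    by (rule inj_onI) (simp add: vec_eq_iff forall_2)
  ultimately show ?thesis by (rule finite_imageD)
qed

lemma AE_in_grid_square: "AE x in lborel. \<exists>a. x \<in> grid_square h a" if h: "h > 0"
proof -
  have 1: "AE x in lborel. (x::real^2) $ i \<noteq> c" for i c
  proof -
    have "negligible {x::real^2. x \<bullet> axis i 1 = c}"
      by (rule negligible_standard_hyperplane) (simp add: axis_in_Basis_iff)
    then have "{x::real^2. x $ i = c} \<in> null_sets lebesgue"
      by (simp add: inner_axis negligible_iff_null_sets)
    then have "AE x in lebesgue. x \<notin> {x::real^2. x $ i = c}" by (rule AE_not_in)
    then show ?thesis by (simp add: AE_completion_iff)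
  qed
  have "AE x in lborel. \<forall>i. \<forall>c::int. (x::real^2) $ i \<noteq> h * of_int c"
    by (intro AE_all_countable[THEN iffD2] allI 1)
  then show ?thesis
  proof eventually_elim
    case (elim x)
    have "x \<in> grid_square h (\<chi> i. \<lfloor>x $ i / h\<rfloor>)"
    proof -
      have "h * of_int \<lfloor>x $ i / h\<rfloor> < x $ i" "x $ i < h * (of_int \<lfloor>x $ i / h\<rfloor> + 1)" for i
      proof -
        have "h * of_int \<lfloor>x $ i / h\<rfloor> <= x $ i" "x $ i < h * (of_int \<lfloor>x $ i / h\<rfloor> + 1)"
          using floor_divide_lower[OF h, of "x $ i"] floor_divide_upper[OF h, of "x $ i"] by (simp_all add: mult.commute)
        then show "h * of_int \<lfloor>x $ i / h\<rfloor> < x $ i" "x $ i < h * (of_int \<lfloor>x $ i / h\<rfloor> + 1)"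
          using elim[rule_format, of i "\<lfloor>x $ i / h\<rfloor>"] by linarith+
      qed
      then show ?thesis by (simp add: grid_square_def mem_box_cart)
    qed
    then show ?case by blast
  qed
qed

lemma grid_square_diameter:
  assumes "h > 0" "x \<in> grid_square h a" "y \<in> grid_square h a"
  shows "dist x y < 2 * h"
proof -
  have c: "\<bar>(x - y) $ i\<bar> < h" for i
  proof -
    have "h * of_int (a $ i) < x $ i" "x $ i < h * of_int (a $ i) + h" "h * of_int (a $ i) < y $ i" "y $ i < h * of_int (a $ i) + h"
      using assms(2,3) by (auto simp: grid_square_def mem_box_cart algebra_simps)
    then show ?thesis by (simp add: abs_less_iff)
  qed
  then have "norm (x - y) < h + h"
    using norm_le_l1_cart[of "x - y"] c[of 1] c[of 2] unfolding sum_2 by linarith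
  then show ?thesis by (simp add: dist_norm)
qed

text \<open>Almost every point of an open set lies in a small grid square contained in the set
  once the mesh is finer than its distance to the complement.\<close>

lemma grid_leftover_tendsto_0:
  assumes \<omega>: "open \<omega>" "bounded \<omega>"
  shows "(\<lambda>n. measure lborel (\<omega> - (\<Union>a\<in>{a. grid_square (1 / real (Suc n)) a \<subseteq> \<omega>}. grid_square (1 / real (Suc n)) a))) \<longlonglongrightarrow> 0"
proof -
  define R where "R n = \<omega> - (\<Union>a\<in>{a. grid_square (1 / real (Suc n)) a \<subseteq> \<omega>}. grid_square (1 / real (Suc n)) a)" for n
  have R [measurable]: "R n \<in> sets borel" for n unfolding R_def grid_square_def
    using \<omega>(1) by (intro sets.Diff borel_open open_UN) auto
  have fin: "emeasure lborel \<omega> < \<infinity>" using \<omega>(2) by (rule emeasure_bounded_finite)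
  have "(\<lambda>n. LINT x|lborel. indicator (R n) x :: real) \<longlonglongrightarrow> (LINT x|(lborel::(real^2) measure). (0::real))"
  proof (rule integral_dominated_convergence[where w="indicator \<omega>"])
    show "integrable lborel (indicator \<omega> :: _ => real)" using \<omega>(1) fin by (intro integrable_real_indicator) auto
    show "AE x in lborel. norm (indicator (R i) x :: real) <= indicator \<omega> x" for i
      by (auto simp: R_def indicator_def)
    have "AE x in lborel. \<forall>n. \<exists>a. x \<in> grid_square (1 / real (Suc n)) a"
      by (intro AE_all_countable[THEN iffD2] allI AE_in_grid_square) simp
    then show "AE x in lborel. (\<lambda>i. indicator (R i) x :: real) \<longlonglongrightarrow> 0"
    proof eventually_elim
      case (elim x)
      show ?case
      proof (cases "x \<in> \<omega>")
        case True
        then obtain e where e: "e > 0" "ball x e \<subseteq> \<omega>" using \<omega>(1) open_contains_ball by blast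
        obtain N where N: "1 / real (Suc N) < e / 2" using reals_Archimedean[of "e/2"] e by (auto simp: inverse_eq_divide)
        have "indicator (R n) x = (0::real)" if "n >= N" for n
        proof -
          obtain a where a: "x \<in> grid_square (1 / real (Suc n)) a" using elim by blast
          have "1 / real (Suc n) <= 1 / real (Suc N)" using that by (intro divide_left_mono) auto
          then have "2 * (1 / real (Suc n)) < e" using N by linarith
          then have "grid_square (1 / real (Suc n)) a \<subseteq> ball x e"
            using grid_square_diameter[OF _ a] by (force simp: dist_commute)
          then have "x \<notin> R n" unfolding R_def using a e(2) by blast
          then show ?thesis by simp
        qed
        then have "\<forall>\<^sub>F n in sequentially. indicator (R n) x = (0::real)" by (auto simp: eventually_sequentially)
        then show ?thesis by (simp add: tendsto_eventually)
      qed (simp add: R_def)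
    qed
  qed auto
  then show ?thesis unfolding R_def[symmetric] by simp
qed

lemma borel_H1_ex:
  assumes "open \<omega>" and w: "\<And>i. is_weak_partial \<omega> i u (v i)"
  shows "\<exists>u' v'. borel_H1 \<omega> u' v' \<and> (AE x in leb \<omega>. u x = u' x) \<and> (\<forall>i. AE x in leb \<omega>. v i x = v' i x)"
  by (rule borel_H1_rep[OF assms]) blast

text \<open>The pointwise bound is used where no grid square fits, and the Poincare inequality
  on every grid square inside the domain.\<close>

lemma interior_estimate:
  assumes \<omega>: "open \<omega>" "bounded \<omega>" and w: "\<And>i. is_weak_partial \<omega> i f (v i)"
    and C: "AE x in leb \<omega>. \<bar>f x\<bar> <= C" and h: "h > 0"
  shows "l2sq (leb \<omega>) f <= C\<^sup>2 * measure lborel (\<omega> - (\<Union>a\<in>{a. grid_square h a \<subseteq> \<omega>}. grid_square h a))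
    + (\<Sum>a\<in>{a. grid_square h a \<subseteq> \<omega>}. (LINT x|leb \<omega>. indicator (grid_square h a) x * f x)\<^sup>2 / h\<^sup>2)
    + 4 * h\<^sup>2 * (\<Sum>i\<in>UNIV. l2sq (leb \<omega>) (v i))"
proof -
  define I where "I = {a. grid_square h a \<subseteq> \<omega>}"
  define R where "R = \<omega> - (\<Union>a\<in>I. grid_square h a)"
  have fI: "finite I" unfolding I_def by (rule finite_grid_squares[OF \<omega>(2) h])
  have Qm [measurable]: "grid_square h a \<in> sets borel" for a by (simp add: grid_square_def)
  have Rm [measurable]: "R \<in> sets borel" unfolding R_def using \<omega>(1) fI by (intro sets.Diff sets.finite_UN) auto
  obtain f' v' where H: "borel_H1 \<omega> f' v'" and ae: "AE x in leb \<omega>. f x = f' x" "\<And>i. AE x in leb \<omega>. v i x = v' i x"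
    using borel_H1_ex[OF \<omega>(1) w] by blast
  have fm [measurable]: "f' \<in> borel_measurable borel" and vm [measurable]: "v' i \<in> borel_measurable borel"
    and z: "\<And>x. x \<notin> \<omega> ==> f' x = 0" "\<And>x. x \<notin> \<omega> ==> v' i x = 0" for i
    using H by (auto simp: borel_H1_def)
  let ?q = "\<lambda>a x. indicator (grid_square h a) x :: real"
  note J = borel_H1_integrable[OF \<omega> H]
  have mf: "f \<in> borel_measurable (leb \<omega>)" "v i \<in> borel_measurable (leb \<omega>)" for i
    using is_weak_partial_sqint[OF w] by auto
  have iR: "integrable lborel (\<lambda>x. indicator R x * (f' x)\<^sup>2)" and iQ: "integrable lborel (\<lambda>x. ?q a x * (f' x)\<^sup>2)"
    and iV: "integrable lborel (\<lambda>x. ?q a x * sumsq v' x)" for a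
    using integrable_mult_indicator[of R lborel "\<lambda>x. (f' x)\<^sup>2"] integrable_mult_indicator[of "grid_square h a" lborel "\<lambda>x. (f' x)\<^sup>2"]
      integrable_mult_indicator[of "grid_square h a" lborel "\<lambda>x. \<Sum>i\<in>UNIV. (v' i x)\<^sup>2"] J by auto
  have sumQ: "(\<Sum>a\<in>I. ?q a x) = (indicator (\<Union>a\<in>I. grid_square h a) x :: real)" for x
  proof (rule indicator_UN_disjoint[OF fI, symmetric])
    show "disjoint_family_on (grid_square h) I"
      unfolding disjoint_family_on_def using grid_square_disjoint[OF h] by blast
  qed
  have "l2sq (leb \<omega>) f = l2sq (leb \<omega>) f'"
    using ae(1) mf(1) borel_imp_lebesgue_on[OF fm] by (rule l2sq_cong_AE)
  also have "\<dots> = (LINT x|lborel. (f' x)\<^sup>2)"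
    unfolding l2sq_real by (rule integral_lebesgue_on_open[OF \<omega>(1)]) (auto simp: z)
  also have "\<dots> = (LINT x|lborel. indicator R x * (f' x)\<^sup>2 + (\<Sum>a\<in>I. ?q a x * (f' x)\<^sup>2))"
  proof (rule Bochner_Integration.integral_cong[OF refl])
    fix x show "(f' x)\<^sup>2 = indicator R x * (f' x)\<^sup>2 + (\<Sum>a\<in>I. ?q a x * (f' x)\<^sup>2)"
      using z(1)[of x] unfolding sum_distrib_right[symmetric] sumQ
      by (cases "x \<in> \<omega>"; cases "x \<in> (\<Union>a\<in>I. grid_square h a)") (simp_all add: R_def)
  qed
  also have "\<dots> = (LINT x|lborel. indicator R x * (f' x)\<^sup>2) + (\<Sum>a\<in>I. LINT x|lborel. ?q a x * (f' x)\<^sup>2)"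
    using iR iQ by simp
  also have "\<dots> <= C\<^sup>2 * measure lborel R + (\<Sum>a\<in>I. (LINT x|leb \<omega>. ?q a x * f x)\<^sup>2 / h\<^sup>2
      + 4 * h\<^sup>2 * (LINT x|lborel. ?q a x * sumsq v' x))"
  proof (intro add_mono sum_mono)
    have fin: "emeasure lborel R < \<infinity>"
      using emeasure_bounded_finite[OF bounded_subset[OF \<omega>(2), of R]] by (auto simp: R_def)
    have "(LINT x|lborel. indicator R x * (f' x)\<^sup>2) <= (LINT x|lborel. C\<^sup>2 * indicator R x)"
    proof (rule integral_mono_AE[OF iR])
      show "integrable lborel (\<lambda>x. C\<^sup>2 * indicator R x)" using fin by (intro integrable_mult_right integrable_real_indicator) auto
      have "AE x in leb \<omega>. \<bar>f' x\<bar> <= C" using C ae(1) by eventually_elim simp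
      then have "AE x in lborel. x \<in> \<omega> --> \<bar>f' x\<bar> <= C" by (simp add: AE_lebesgue_on_open[OF \<omega>(1)])
      then show "AE x in lborel. indicator R x * (f' x)\<^sup>2 <= C\<^sup>2 * indicator R x"
      proof eventually_elim
        case (elim x)
        show ?case
        proof (cases "x \<in> R")
          case True
          then have "\<bar>f' x\<bar> <= C" using elim by (auto simp: R_def)
          then have "\<bar>f' x\<bar>\<^sup>2 <= C\<^sup>2" by (intro power_mono) auto
          then show ?thesis using True by simp
        qed simp
      qed
    qed
    then show "(LINT x|lborel. indicator R x * (f' x)\<^sup>2) <= C\<^sup>2 * measure lborel R" by simp
  next
    fix a assume a: "a \<in> I"
    have "(LINT x|leb \<omega>. ?q a x * f x) = (LINT x|leb \<omega>. ?q a x * f' x)"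
    proof (rule integral_cong_AE)
      show "AE x in leb \<omega>. ?q a x * f x = ?q a x * f' x"
        using ae(1) by eventually_elim simp
      show "(\<lambda>x. ?q a x * f x) \<in> borel_measurable (leb \<omega>)"
        by (rule borel_measurable_times[OF borel_imp_lebesgue_on mf(1)]) measurable
      show "(\<lambda>x. ?q a x * f' x) \<in> borel_measurable (leb \<omega>)"
        by (intro borel_imp_lebesgue_on) measurable
    qed
    also have "\<dots> = (LINT x|lborel. ?q a x * f' x)"
      by (rule integral_lebesgue_on_open[OF \<omega>(1)]) (auto simp: z)
    finally have e: "(LINT x|leb \<omega>. ?q a x * f x) = (LINT x|lborel. ?q a x * f' x)" .
    show "(LINT x|lborel. ?q a x * (f' x)\<^sup>2)
      <= (LINT x|leb \<omega>. ?q a x * f x)\<^sup>2 / h\<^sup>2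
      + 4 * h\<^sup>2 * (LINT x|lborel. ?q a x * sumsq v' x)"
      unfolding e unfolding grid_square_def
      by (rule poincare_square[OF \<omega> H _ h]) (use a in \<open>auto simp: I_def grid_square_def algebra_simps\<close>)
  qed
  also have "\<dots> = C\<^sup>2 * measure lborel R + (\<Sum>a\<in>I. (LINT x|leb \<omega>. ?q a x * f x)\<^sup>2 / h\<^sup>2)
      + 4 * h\<^sup>2 * (\<Sum>a\<in>I. (LINT x|lborel. ?q a x * sumsq v' x))"
    by (simp add: sum.distrib sum_distrib_left)
  also have "(\<Sum>a\<in>I. (LINT x|lborel. ?q a x * sumsq v' x)) <= (\<Sum>i\<in>UNIV. l2sq (leb \<omega>) (v i))"
  proof -
    have "(\<Sum>a\<in>I. (LINT x|lborel. ?q a x * sumsq v' x))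
       = (LINT x|lborel. indicator (\<Union>a\<in>I. grid_square h a) x * sumsq v' x)"
      unfolding sumQ[symmetric] sum_distrib_right by (rule Bochner_Integration.integral_sum[symmetric]) (rule iV)
    also have "\<dots> <= (LINT x|lborel. (sumsq v' x))"
    proof (rule integral_mono_AE')
      show "integrable lborel (\<lambda>x. \<Sum>i\<in>UNIV. (v' i x)\<^sup>2)" using J(4) by simp
      show "AE x in lborel. indicator (\<Union>a\<in>I. grid_square h a) x * sumsq v' x <= (sumsq v' x)"
        by (intro AE_I2 mult_left_le_one_le sum_nonneg) (auto simp: indicator_def)
      show "AE x in lborel. 0 <= (sumsq v' x)" by (intro AE_I2 sum_nonneg) auto
    qed
    also have "\<dots> = (\<Sum>i\<in>UNIV. LINT x|lborel. (v' i x)\<^sup>2)" using J(4) by (intro Bochner_Integration.integral_sum)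
    also have "\<dots> = (\<Sum>i\<in>UNIV. l2sq (leb \<omega>) (v i))"
    proof (rule sum.cong[OF refl])
      fix i
      have "l2sq (leb \<omega>) (v i) = l2sq (leb \<omega>) (v' i)"
        using ae(2) mf(2) borel_imp_lebesgue_on[OF vm] by (rule l2sq_cong_AE)
      also have "\<dots> = (LINT x|lborel. (v' i x)\<^sup>2)"
        unfolding l2sq_real by (rule integral_lebesgue_on_open[OF \<omega>(1)]) (auto simp: z)
      finally show "(LINT x|lborel. (v' i x)\<^sup>2) = l2sq (leb \<omega>) (v i)" ..
    qed
    finally show ?thesis .
  qed
  finally show ?thesis using h unfolding R_def I_def by (simp add: mult_left_mono)
qed

text \<open>Apart from two terms that are small uniformly in the sequence when the mesh is fine,
  \<open>interior_estimate\<close> controls a function by finitely many averages. A diagonal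
  subsequence makes all averages on all grids converge.\<close>

lemma interior_compactness:
  fixes u :: "nat => 'c::countable => real^2 => real"
  assumes \<omega>: "open \<omega>" "bounded \<omega>" and w: "\<And>k c i. is_weak_partial \<omega> i (u k c) (v k c i)"
    and M: "\<And>k c. AE x in leb \<omega>. \<bar>u k c x\<bar> <= M"
    and B: "\<And>k c i. l2sq (leb \<omega>) (v k c i) <= B"
  obtains r where "strict_mono (r :: nat => nat)"
    "\<And>c e. e > 0 ==> \<exists>N. \<forall>k\<ge>N. \<forall>l\<ge>N. l2sq (leb \<omega>) (\<lambda>x. u (r k) c x - u (r l) c x) < e"
proof -
  interpret finite_measure "leb \<omega>" using \<omega> finite_measure_lebesgue_on_open by blast
  let ?L = "leb \<omega>"
  define h where "h n = 1 / real (Suc n)" for n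
  define F where "F k p = (case p of (c, n, a, b) => LINT x|?L. indicator (grid_square (h n) (vector [a, b])) x * u k c x)"
    for k and p :: "'c \<times> nat \<times> int \<times> int"
  have su: "sqint ?L (u k c)" "sqint ?L (v k c i)" for k c i using is_weak_partial_sqint[OF w] by auto
  have Qm: "indicator (grid_square h a) \<in> borel_measurable ?L" for h a
    by (intro borel_imp_lebesgue_on) (simp add: grid_square_def)
  have bound: "norm (F k p) <= M * measure ?L (space ?L)" for k p
  proof -
    obtain c n a b where p: "p = (c, n, a, b)" by (cases p)
    let ?f = "\<lambda>x. indicator (grid_square (h n) (vector [a, b])) x * u k c x"
    have "norm (LINT x|?L. ?f x) <= (LINT x|?L. norm (?f x))" by (rule integral_norm_bound)
    also have "\<dots> <= (LINT x|?L. M)"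
    proof (rule integral_mono_AE')
      show "AE x in ?L. norm (?f x) <= M" using M[of k c]
        by eventually_elim (auto simp: indicator_def abs_mult)
      then show "AE x in ?L. 0 <= M" by eventually_elim (use order_trans[OF norm_ge_zero] in blast)
    qed simp
    finally show ?thesis by (simp add: F_def p mult.commute)
  qed
  obtain r where r: "strict_mono (r :: nat => nat)" "\<And>p. \<exists>l. (\<lambda>n. F (r n) p) \<longlonglongrightarrow> l"
    using function_convergent_subsequence[of UNIV F, OF _ bound] by auto
  have "\<exists>N. \<forall>k\<ge>N. \<forall>l\<ge>N. l2sq ?L (\<lambda>x. u (r k) c x - u (r l) c x) < e" if e: "e > 0" for c e
  proof -
    have B0: "B >= 0" using order_trans[OF l2sq_nonneg B] .
    define m where "m n = measure lborel (\<omega> - (\<Union>a\<in>{a. grid_square (h n) a \<subseteq> \<omega>}. grid_square (h n) a))" for n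
    have m0: "m \<longlonglongrightarrow> 0" using grid_leftover_tendsto_0[OF \<omega>] by (simp add: m_def[abs_def] h_def)
    have h0: "h \<longlonglongrightarrow> 0" using LIMSEQ_inverse_real_of_nat by (simp add: h_def[abs_def] inverse_eq_divide)
    have "(\<lambda>n. (2 * M)\<^sup>2 * m n + 4 * (h n)\<^sup>2 * (8 * B)) \<longlonglongrightarrow> (2 * M)\<^sup>2 * 0 + 4 * 0\<^sup>2 * (8 * B)"
      by (intro tendsto_intros m0 h0)
    then have "\<forall>\<^sub>F n in sequentially. (2 * M)\<^sup>2 * m n + 4 * (h n)\<^sup>2 * (8 * B) < e / 2"
      using e by (intro order_tendstoD) auto
    then obtain n where n: "(2 * M)\<^sup>2 * m n + 4 * (h n)\<^sup>2 * (8 * B) < e / 2" by (auto simp: eventually_sequentially)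
    have hn: "h n > 0" by (simp add: h_def)
    let ?I = "{a. grid_square (h n) a \<subseteq> \<omega>}"
    have fI: "finite ?I" by (rule finite_grid_squares[OF \<omega>(2) hn])
    define G where "G k a = (LINT x|?L. indicator (grid_square (h n) a) x * u (r k) c x)" for k a
    have Gc: "Cauchy (\<lambda>k. G k a)" for a
    proof -
      have "vector [a $ 1, a $ 2] = a" by (simp add: vec_eq_iff forall_2)
      then have "(\<lambda>k. G k a) = (\<lambda>k. F (r k) (c, n, a $ 1, a $ 2))" by (simp add: G_def F_def)
      then show ?thesis using r(2)[of "(c, n, a $ 1, a $ 2)"] by (metis convergentI convergent_Cauchy)
    qed
    have "\<exists>N. \<forall>k\<ge>N. \<forall>l\<ge>N. \<forall>a\<in>?I. (G k a - G l a)\<^sup>2 / (h n)\<^sup>2 < e / (2 * (real (card ?I) + 1))"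
    proof -
      define d where "d = e / (2 * (real (card ?I) + 1))"
      have d: "d > 0" using e by (simp add: d_def)
      have "\<exists>N. \<forall>k\<ge>N. \<forall>l\<ge>N. (G k a - G l a)\<^sup>2 / (h n)\<^sup>2 < d" for a
      proof -
        obtain N where N: "\<And>k l. k >= N ==> l >= N ==> norm (G k a - G l a) < h n * sqrt d"
          using CauchyD[OF Gc, of "h n * sqrt d"] hn d by (metis mult_pos_pos real_sqrt_gt_zero)
        have "(G k a - G l a)\<^sup>2 / (h n)\<^sup>2 < d" if "k >= N" "l >= N" for k l
        proof -
          have "\<bar>G k a - G l a\<bar>\<^sup>2 < (h n * sqrt d)\<^sup>2" using N[OF that] by (intro power_strict_mono) auto
          then show ?thesis using hn d by (simp add: power_mult_distrib field_simps)
        qed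
        then show ?thesis by blast
      qed
      then obtain N where N: "\<And>a k l. k >= N a ==> l >= N a ==> (G k a - G l a)\<^sup>2 / (h n)\<^sup>2 < d" by metis
      have "N a <= Max (insert 0 (N ` ?I))" if "a \<in> ?I" for a using fI that by (intro Max_ge) auto
      then show ?thesis unfolding d_def[symmetric] using N by (meson order_trans)
    qed
    then obtain N where N: "\<And>k l a. k >= N ==> l >= N ==> a \<in> ?I ==> (G k a - G l a)\<^sup>2 / (h n)\<^sup>2 < e / (2 * (real (card ?I) + 1))"
      by blast
    have "l2sq ?L (\<lambda>x. u (r k) c x - u (r l) c x) < e" if kl: "k >= N" "l >= N" for k l
    proof -
      let ?f = "\<lambda>x. u (r k) c x - u (r l) c x" and ?v = "\<lambda>i x. v (r k) c i x - v (r l) c i x"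
      have wf: "is_weak_partial \<omega> i ?f (?v i)" for i
        using is_weak_partial_lincomb[OF \<omega> w[of i "r k" c] w[of i "r l" c], of 1 "-1"] by simp
      have Cf: "AE x in ?L. \<bar>?f x\<bar> <= 2 * M"
        using M[of "r k" c] M[of "r l" c] by eventually_elim linarith
      have "l2sq ?L (?v i) <= 4 * B" for i
        using l2sq_diff_le[OF su(2) su(2), of "r k" c i "r l" c i] B[of "r k" c i] B[of "r l" c i] by linarith
      then have "(\<Sum>i\<in>UNIV. l2sq ?L (?v i)) <= (\<Sum>i\<in>(UNIV::2 set). 4 * B)" by (rule sum_mono)
      then have vB: "(\<Sum>i\<in>UNIV. l2sq ?L (?v i)) <= 8 * B" by simp
      have Gf: "(LINT x|?L. indicator (grid_square (h n) a) x * ?f x) = G k a - G l a" for a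
      proof -
        have "integrable ?L (\<lambda>x. indicator (grid_square (h n) a) x * u k' c x)" for k'
        proof (rule Bochner_Integration.integrable_bound[OF integrable_sqint[OF su(1)[of k' c]]])
          show "(\<lambda>x. indicator (grid_square (h n) a) x * u k' c x) \<in> borel_measurable ?L"
            by (rule borel_measurable_times[OF Qm sqintD(1)[OF su(1)]])
        qed (auto simp: indicator_def)
        then show ?thesis by (simp add: G_def right_diff_distrib)
      qed
      have "l2sq ?L ?f <= (2 * M)\<^sup>2 * m n + (\<Sum>a\<in>?I. (G k a - G l a)\<^sup>2 / (h n)\<^sup>2) + 4 * (h n)\<^sup>2 * (\<Sum>i\<in>UNIV. l2sq ?L (?v i))"
        using interior_estimate[OF \<omega> wf Cf hn] unfolding m_def Gf .
      also have "\<dots> <= (2 * M)\<^sup>2 * m n + (\<Sum>a\<in>?I. e / (2 * (real (card ?I) + 1))) + 4 * (h n)\<^sup>2 * (8 * B)"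
        by (intro add_mono sum_mono mult_left_mono vB order_refl less_imp_le[OF N[OF kl]]) auto
      also have "(\<Sum>a\<in>?I. e / (2 * (real (card ?I) + 1))) < e / 2"
        using e by (simp add: field_simps)
      finally show ?thesis using n by linarith
    qed
    then show ?thesis by blast
  qed
  then show ?thesis using that r(1) by blast
qed

section \<open>Oscillation of functions with bounded gradient\<close>

text \<open>Points strictly below the graph have a neighbourhood that misses the domain.\<close>

lemma chart_facts:
  assumes \<omega>: "open \<omega>" and T: "orthogonal_transformation (T :: real^2 => real^2)" and L: "L-lipschitz_on UNIV (\<gamma> :: real => real)"
    and eq: "\<omega> \<inter> ball p r = {x \<in> ball p r. \<gamma> (T x $ 1) < T x $ 2}"
    and z: "z \<in> frontier \<omega>" "z \<in> ball p r"
  shows "\<gamma> (T z $ 1) = T z $ 2"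
proof -
  have "z \<notin> \<omega>" using z(1) \<omega> by (simp add: frontier_def interior_open)
  then have "T z $ 2 <= \<gamma> (T z $ 1)" using z(2) eq by fastforce
  moreover have "\<not> T z $ 2 < \<gamma> (T z $ 1)"
  proof
    assume lt: "T z $ 2 < \<gamma> (T z $ 1)"
    have cT: "continuous_on UNIV T"
      using orthogonal_transformation_linear[OF T] by (simp add: linear_continuous_on linear_conv_bounded_linear)
    have cg: "continuous_on UNIV \<gamma>" using lipschitz_on_continuous_on[OF L] .
    have "open {x. T x $ 2 < \<gamma> (T x $ 1)}"
      by (intro open_Collect_less continuous_intros cT continuous_on_compose2[OF cg]) auto
    then have "open ({x. T x $ 2 < \<gamma> (T x $ 1)} \<inter> ball p r)" by auto
    moreover have "({x. T x $ 2 < \<gamma> (T x $ 1)} \<inter> ball p r) \<inter> \<omega> = {}"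
    proof (rule equals0I, elim IntE)
      fix x assume x: "x \<in> {x. T x $ 2 < \<gamma> (T x $ 1)}" "x \<in> ball p r" "x \<in> \<omega>"
      then have "x \<in> {x \<in> ball p r. \<gamma> (T x $ 1) < T x $ 2}" using eq by blast
      then show False using x(1) by simp
    qed
    ultimately have "({x. T x $ 2 < \<gamma> (T x $ 1)} \<inter> ball p r) \<inter> closure \<omega> = {}"
      using open_Int_closure_eq_empty by blast
    then show False using z lt by (auto simp: frontier_def)
  qed
  ultimately show ?thesis by simp
qed

lemma orthogonal_inverse_axis:
  assumes T: "orthogonal_transformation (T :: real^2 => real^2)"
  obtains e where "norm e = 1" "\<And>x s. T (x + s *\<^sub>R e) = T x + s *\<^sub>R axis 2 1"
proof -
  have "surj T" using T by (rule orthogonal_transformation_surj)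
  then obtain e where e: "T e = axis 2 1" by (metis surjD)
  have "norm e = 1" using T e by (metis norm_axis_1 orthogonal_transformation)
  moreover have "T (x + s *\<^sub>R e) = T x + s *\<^sub>R axis 2 1" for x s
    using orthogonal_transformation_linear[OF T] e by (simp add: linear_add linear_scale)
  ultimately show ?thesis using that by blast
qed

lemma orthogonal_component_le:
  assumes T: "orthogonal_transformation (T :: real^2 => real^2)"
  shows "\<bar>T x $ i - T y $ i\<bar> <= dist x y"
proof -
  have "T x - T y = T (x - y)" using orthogonal_transformation_linear[OF T] by (simp add: linear_diff)
  then have "norm (T x - T y) = dist x y" using T by (simp add: orthogonal_transformation dist_norm)
  then show ?thesis using component_le_norm_cart[of "T x - T y" i] by simp
qed

text \<open>The direction is the vertical one of the boundary chart, and the translation moves a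
  boundary neighbourhood onto an interior ball.\<close>

lemma boundary_inward:
  assumes D: "bounded_lipschitz_domain \<omega>" and p: "p \<in> frontier \<omega>"
  shows "\<exists>e r. r > 0 \<and> ball (p + e) r \<subseteq> \<omega> \<and>
    (\<forall>x s. x \<in> \<omega> \<inter> ball p r --> 0 <= s --> s <= 1 --> x + s *\<^sub>R e \<in> \<omega>)"
proof -
  have \<omega>: "open \<omega>" using D by (simp add: bounded_lipschitz_domain_def)
  obtain T :: "real^2 => real^2" and R \<gamma> L where T: "orthogonal_transformation T" and R: "R > 0" and L: "L-lipschitz_on UNIV (\<gamma> :: real => real)"
    and eq: "\<omega> \<inter> ball p R = {x \<in> ball p R. \<gamma> (T x $ 1) < T x $ 2}"
    using D p unfolding bounded_lipschitz_domain_def by blast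
  obtain e where e: "norm e = 1" "\<And>x s. T (x + s *\<^sub>R e) = T x + s *\<^sub>R axis 2 1"
    using orthogonal_inverse_axis[OF T] by blast
  have L0: "L >= 0" using L by (rule lipschitz_on_nonneg)
  define \<delta> where "\<delta> = R / 2"
  define r where "r = \<delta> / (L + 2)"
  have \<delta>: "\<delta> > 0" using R by (simp add: \<delta>_def)
  have r: "r > 0" "r * (L + 2) = \<delta>" using \<delta> L0 by (auto simp: r_def)
  have "0 <= r * L" using r L0 by simp
  moreover have "r * L + r * 2 = \<delta>" using r(2) by (simp only: distrib_left)
  ultimately have rl: "2 * r <= \<delta>" by linarith
  have pf: "\<gamma> (T p $ 1) = T p $ 2" by (rule chart_facts[OF \<omega> T L eq p]) (use R in simp)
  show ?thesis
  proof (intro exI[of _ "\<delta> *\<^sub>R e"] exI[of _ r] conjI allI impI)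
    show "r > 0" by (rule r)
    show "ball (p + \<delta> *\<^sub>R e) r \<subseteq> \<omega>"
    proof
      fix y assume "y \<in> ball (p + \<delta> *\<^sub>R e) r"
      then have y: "dist (p + \<delta> *\<^sub>R e) y < r" by simp
      have "dist p (p + \<delta> *\<^sub>R e) = \<delta>" using e(1) \<delta> by (simp add: dist_norm)
      then have "dist p y < \<delta> + r" using y dist_triangle[of p y "p + \<delta> *\<^sub>R e"] by linarith
      then have yR: "y \<in> ball p R" using rl \<delta> by (simp add: \<delta>_def)
      have "\<bar>T y $ 1 - T p $ 1\<bar> <= dist y (p + \<delta> *\<^sub>R e)" "\<bar>T y $ 2 - (T p $ 2 + \<delta>)\<bar> <= dist y (p + \<delta> *\<^sub>R e)"
        using orthogonal_component_le[OF T, of y 1 "p + \<delta> *\<^sub>R e"] orthogonal_component_le[OF T, of y 2 "p + \<delta> *\<^sub>R e"] e(2)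
        by (auto simp: axis_def)
      then have c: "\<bar>T y $ 1 - T p $ 1\<bar> <= r" "T y $ 2 > T p $ 2 + \<delta> - r" using y by (auto simp: dist_commute)
      have "\<bar>\<gamma> (T y $ 1) - \<gamma> (T p $ 1)\<bar> <= L * \<bar>T y $ 1 - T p $ 1\<bar>"
        using lipschitz_onD[OF L, of "T y $ 1" "T p $ 1"] by (simp add: dist_real_def)
      also have "\<dots> <= L * r" using c(1) L0 by (rule mult_left_mono)
      finally have "\<gamma> (T y $ 1) <= T p $ 2 + L * r" using pf by linarith
      also have "\<dots> <= T p $ 2 + \<delta> - r" using r by (simp add: algebra_simps)
      finally have "\<gamma> (T y $ 1) < T y $ 2" using c(2) by linarith
      then show "y \<in> \<omega>" using eq yR by blast
    qed
    fix x and s :: real assume x: "x \<in> \<omega> \<inter> ball p r" and s: "0 <= s" "s <= 1"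
    have xR: "x \<in> ball p R" using x rl \<delta> by (auto simp: \<delta>_def)
    then have "\<gamma> (T x $ 1) < T x $ 2" using x eq by blast
    moreover have "T (x + s *\<^sub>R \<delta> *\<^sub>R e) = T x + (s * \<delta>) *\<^sub>R axis 2 1" using e(2)[of x "s * \<delta>"] by simp
    ultimately have "\<gamma> (T (x + s *\<^sub>R \<delta> *\<^sub>R e) $ 1) < T (x + s *\<^sub>R \<delta> *\<^sub>R e) $ 2"
      using s \<delta> by (simp add: axis_def add_pos_nonneg less_le_trans)
    moreover have "x + s *\<^sub>R \<delta> *\<^sub>R e \<in> ball p R"
    proof -
      have "dist x (x + s *\<^sub>R \<delta> *\<^sub>R e) = s * \<delta>" using e(1) s \<delta> by (simp add: dist_norm)
      also have "\<dots> <= \<delta>" using s \<delta> by (simp add: mult_left_le_one_le)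
      finally have "dist p (x + s *\<^sub>R \<delta> *\<^sub>R e) < r + \<delta>"
        using x dist_triangle[of p "x + s *\<^sub>R \<delta> *\<^sub>R e" x] by auto
      then show ?thesis using rl \<delta> by (simp add: \<delta>_def)
    qed
    ultimately show "x + s *\<^sub>R \<delta> *\<^sub>R e \<in> \<omega>" using eq by blast
  qed
qed

lemma AE_shift: "AE x in lborel. P x ==> AE x in lborel. P (x + a)" for a :: "'a::euclidean_space"
proof -
  assume "AE x in lborel. P x"
  then have "AE x in distr lborel borel (\<lambda>x. x + a). P x" unfolding lborel_distr_shift .
  then show ?thesis by (rule AE_distrD[rotated]) simp
qed

lemma increment_le:
  assumes \<omega>: "open \<omega>" "bounded \<omega>" and H: "borel_H1 \<omega> u v" and U: "open U"
    and seg: "\<And>x s. x \<in> U ==> 0 <= s ==> s <= 1 ==> x + s *\<^sub>R e \<in> \<omega>"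
    and C: "C >= 0" "AE x in lborel. (sumsq v x) <= C\<^sup>2"
  shows "AE x in lborel. x \<in> U --> \<bar>u (x + e) - u x\<bar> <= norm e * C"
proof -
  have vm [measurable]: "v i \<in> borel_measurable borel" for i using H by (auto simp: borel_H1_def)
  have "AE s in (lborel::real measure). AE x in lborel. (sumsq v (x + s *\<^sub>R e)) <= C\<^sup>2"
    by (intro AE_I2 AE_shift[OF C(2)])
  then have "AE x in lborel. AE s in (lborel::real measure). (sumsq v (x + s *\<^sub>R e)) <= C\<^sup>2"
    by (subst (asm) lborel_pair.AE_commute) measurable
  moreover have "AE x in lborel. x \<in> U -->
    ennreal ((u (x + e) - u x)\<^sup>2)
      <= ennreal ((norm e)\<^sup>2) * (\<integral>\<^sup>+s. indicator {0..1} s * ennreal (sumsq v (x + s *\<^sub>R e)) \<partial>lborel)"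
    by (rule increment_bound[OF \<omega> H U seg])
  ultimately show ?thesis
  proof eventually_elim
    case (elim x)
    show ?case
    proof
      assume "x \<in> U"
      then have "ennreal ((u (x + e) - u x)\<^sup>2)
        <= ennreal ((norm e)\<^sup>2) * (\<integral>\<^sup>+s. indicator {0..1} s * ennreal (sumsq v (x + s *\<^sub>R e)) \<partial>lborel)"
        using elim(2) by blast
      also have "(\<integral>\<^sup>+s. indicator {0..1} s * ennreal (sumsq v (x + s *\<^sub>R e)) \<partial>lborel)
        <= (\<integral>\<^sup>+s. ennreal (C\<^sup>2) * indicator {0..1::real} s \<partial>lborel)"
      proof (rule nn_integral_mono_AE)
        show "AE s in lborel. indicator {0..1} s * ennreal (sumsq v (x + s *\<^sub>R e)) <= ennreal (C\<^sup>2) * indicator {0..1::real} s"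
          using elim(1) by eventually_elim (auto simp: indicator_def intro: ennreal_leI)
      qed
      also have "\<dots> = ennreal (C\<^sup>2)" by (subst nn_integral_cmult_indicator) auto
      finally have "ennreal ((u (x + e) - u x)\<^sup>2) <= ennreal ((norm e)\<^sup>2) * ennreal (C\<^sup>2)"
        by (simp add: mult_left_mono)
      then have "(u (x + e) - u x)\<^sup>2 <= (norm e * C)\<^sup>2"
        by (simp flip: ennreal_mult add: power_mult_distrib)
      then show "\<bar>u (x + e) - u x\<bar> <= norm e * C"
        using C(1) by (simp add: abs_le_square_iff[symmetric])
    qed
  qed
qed

text \<open>The constant must not depend on the function: the property is used for a whole
  minimizing sequence.\<close>

definition osc_controlled :: "(real^2) set => (real^2) set => bool" where
  "osc_controlled \<omega> N \<longleftrightarrow> (\<exists>K. \<forall>u v C. borel_H1 \<omega> u v \<and> C >= 0 \<and> (AE x in lborel. (sumsq v x) <= C\<^sup>2)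
      --> (\<exists>c. AE x in lborel. x \<in> N --> \<bar>u x - c\<bar> <= K * C))"

lemma AE_ex_in_open:
  fixes U :: "'a::euclidean_space set"
  assumes "open U" "U \<noteq> {}" "AE x in lborel. P x"
  obtains x where "x \<in> U" "P x"
proof -
  have "\<not> (AE x in lborel. x \<notin> U)"
  proof
    assume "AE x in lborel. x \<notin> U"
    then have "emeasure lborel U = 0" using assms(1) by (subst (asm) AE_iff_measurable[of U]) auto
    then have "U \<in> null_sets lebesgue" using assms(1) by (auto intro!: null_setsI simp: )
    then show False using open_not_negligible[OF assms(1,2)] by (simp add: negligible_iff_null_sets)
  qed
  moreover have "AE x in lborel. x \<notin> U" if "\<not> (\<exists>x\<in>U. P x)"
    using assms(3) by eventually_elim (use that in blast)
  ultimately show ?thesis using that by blast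
qed

text \<open>Two points of a ball are joined by a segment, so that the increment bound applies
  for almost every pair.\<close>

lemma osc_controlled_ball:
  assumes \<omega>: "open \<omega>" "bounded \<omega>" and B: "ball p r \<subseteq> \<omega>" "r > 0"
  shows "osc_controlled \<omega> (ball p r)"
  unfolding osc_controlled_def
proof (rule exI[of _ "2 * r"], intro allI impI, elim conjE)
  fix u v C assume H: "borel_H1 \<omega> u v" and C: "C >= 0" "AE x in lborel. (sumsq v x) <= C\<^sup>2"
  let ?B = "ball p r"
  have [measurable]: "?B \<in> sets borel" by simp
  have um [measurable]: "u \<in> borel_measurable borel" using H by (auto simp: borel_H1_def)
  have "AE x in lborel. x \<in> ?B --> x + e \<in> ?B --> \<bar>u (x + e) - u x\<bar> <= 2 * r * C" for e
  proof -
    let ?U = "?B \<inter> (\<lambda>x. x - e) ` ?B"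
    have Ueq: "x \<in> (\<lambda>x. x - e) ` ?B \<longleftrightarrow> x + e \<in> ?B" for x by (force simp: image_iff)
    have "AE x in lborel. x \<in> ?U --> \<bar>u (x + e) - u x\<bar> <= norm e * C"
    proof (rule increment_le[OF \<omega> H _ _ C])
      show "open ?U" by (intro open_Int open_ball open_translation_subtract)
      fix x and s :: real assume x: "x \<in> ?U" and s: "0 <= s" "s <= 1"
      then have "x \<in> ?B" "x + e \<in> ?B" using Ueq by auto
      moreover have "x + s *\<^sub>R e = (1 - s) *\<^sub>R x + s *\<^sub>R (x + e)" by (simp add: algebra_simps)
      ultimately have "x + s *\<^sub>R e \<in> ?B"
        using convexD_alt[OF convex_ball[of p r] _ _ s] by metis
      then show "x + s *\<^sub>R e \<in> \<omega>" using B by blast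
    qed
    then show ?thesis
    proof eventually_elim
      case (elim x)
      show ?case
      proof (intro impI)
        assume x: "x \<in> ?B" "x + e \<in> ?B"
        have "norm e = dist x (x + e)" by (simp add: dist_norm)
        also have "\<dots> <= 2 * r" using x dist_triangle2[of x "x + e" p] by (simp add: dist_commute)
        finally have "norm e * C <= 2 * r * C" using C(1) by (rule mult_right_mono)
        moreover have "\<bar>u (x + e) - u x\<bar> <= norm e * C" using elim x Ueq by blast
        ultimately show "\<bar>u (x + e) - u x\<bar> <= 2 * r * C" by linarith
      qed
    qed
  qed
  then have "AE e in lborel. AE x in lborel. x \<in> ?B --> x + e \<in> ?B --> \<bar>u (x + e) - u x\<bar> <= 2 * r * C"
    by (rule AE_I2)
  then have "AE x in lborel. AE e in lborel. x \<in> ?B --> x + e \<in> ?B --> \<bar>u (x + e) - u x\<bar> <= 2 * r * C"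
    by (subst (asm) lborel_pair.AE_commute) measurable
  note ae = this
  have ne: "?B \<noteq> {}" using B(2) by simp
  obtain x where x: "x \<in> ?B" "AE e in lborel. x \<in> ?B --> x + e \<in> ?B --> \<bar>u (x + e) - u x\<bar> <= 2 * r * C"
    by (rule AE_ex_in_open[OF open_ball ne ae])
  have "AE e in lborel. x \<in> ?B --> x + (e + - x) \<in> ?B --> \<bar>u (x + (e + - x)) - u x\<bar> <= 2 * r * C"
    by (rule AE_shift[OF x(2), of "- x"])
  then have "AE y in lborel. y \<in> ?B --> \<bar>u y - u x\<bar> <= 2 * r * C"
    by eventually_elim (use x(1) in simp)
  then show "\<exists>c. AE y in lborel. y \<in> ?B --> \<bar>u y - c\<bar> <= 2 * r * C" by blast
qed

text \<open>A boundary neighbourhood is translated into an interior ball along segments that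
  stay in the domain.\<close>

lemma osc_controlled_boundary:
  assumes D: "bounded_lipschitz_domain \<omega>" and p: "p \<in> frontier \<omega>"
  obtains r where "r > 0" "osc_controlled \<omega> (\<omega> \<inter> ball p r)"
proof -
  note \<omega> = lipschitz_domain_open_bounded[OF D]
  obtain e r where r: "r > 0" "ball (p + e) r \<subseteq> \<omega>"
    and seg: "\<forall>x s. x \<in> \<omega> \<inter> ball p r --> 0 <= s --> s <= 1 --> x + s *\<^sub>R e \<in> \<omega>"
    using boundary_inward[OF D p] by blast
  obtain K where K: "\<forall>u v C. borel_H1 \<omega> u v \<and> C >= 0 \<and> (AE x in lborel. (sumsq v x) <= C\<^sup>2)
      --> (\<exists>c. AE x in lborel. x \<in> ball (p + e) r --> \<bar>u x - c\<bar> <= K * C)"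
    using osc_controlled_ball[OF \<omega> r(2,1)] unfolding osc_controlled_def by (elim exE)
  have "osc_controlled \<omega> (\<omega> \<inter> ball p r)"
    unfolding osc_controlled_def
  proof (rule exI[of _ "K + norm e"], intro allI impI, elim conjE)
    fix u v C assume H: "borel_H1 \<omega> u v" and C: "C >= 0" "AE x in lborel. (sumsq v x) <= C\<^sup>2"
    obtain c where c: "AE x in lborel. x \<in> ball (p + e) r --> \<bar>u x - c\<bar> <= K * C" using K H C by blast
    have "AE x in lborel. x \<in> \<omega> \<inter> ball p r --> \<bar>u (x + e) - u x\<bar> <= norm e * C"
      by (rule increment_le[OF \<omega> H _ seg[rule_format] C]) (use \<omega> in auto)
    then have "AE x in lborel. x \<in> \<omega> \<inter> ball p r --> \<bar>u x - c\<bar> <= (K + norm e) * C"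
      using AE_shift[OF c, of e]
    proof eventually_elim
      case (elim x)
      show ?case
      proof
        assume x: "x \<in> \<omega> \<inter> ball p r"
        then have "x + e \<in> ball (p + e) r" by (simp add: dist_norm)
        then show "\<bar>u x - c\<bar> <= (K + norm e) * C" using elim x unfolding distrib_right by fastforce
      qed
    qed
    then show "\<exists>c. AE x in lborel. x \<in> \<omega> \<inter> ball p r --> \<bar>u x - c\<bar> <= (K + norm e) * C" by blast
  qed
  then show ?thesis using that r(1) by blast
qed

text \<open>On the open overlap the two constants can be compared at a common point.\<close>

lemma osc_controlled_Un:
  assumes N: "osc_controlled \<omega> N1" "osc_controlled \<omega> N2" and o: "open N1" "open N2" "N1 \<inter> N2 \<noteq> {}"
  shows "osc_controlled \<omega> (N1 \<union> N2)"
proof -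
  obtain K1 where K1: "\<forall>u v C. borel_H1 \<omega> u v \<and> C >= 0 \<and> (AE x in lborel. (sumsq v x) <= C\<^sup>2)
      --> (\<exists>c. AE x in lborel. x \<in> N1 --> \<bar>u x - c\<bar> <= K1 * C)"
    using N(1) unfolding osc_controlled_def by (elim exE)
  obtain K2 where K2: "\<forall>u v C. borel_H1 \<omega> u v \<and> C >= 0 \<and> (AE x in lborel. (sumsq v x) <= C\<^sup>2)
      --> (\<exists>c. AE x in lborel. x \<in> N2 --> \<bar>u x - c\<bar> <= K2 * C)"
    using N(2) unfolding osc_controlled_def by (elim exE)
  show ?thesis
    unfolding osc_controlled_def
  proof (rule exI[of _ "\<bar>K1\<bar> + 2 * \<bar>K2\<bar>"], intro allI impI, elim conjE)
    fix u v C assume H: "borel_H1 \<omega> u v" and C: "C >= 0" "AE x in lborel. (sumsq v x) <= C\<^sup>2"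
    obtain c1 where c1: "AE x in lborel. x \<in> N1 --> \<bar>u x - c1\<bar> <= K1 * C" using K1 H C by blast
    obtain c2 where c2: "AE x in lborel. x \<in> N2 --> \<bar>u x - c2\<bar> <= K2 * C" using K2 H C by blast
    have "AE x in lborel. (x \<in> N1 --> \<bar>u x - c1\<bar> <= K1 * C) \<and> (x \<in> N2 --> \<bar>u x - c2\<bar> <= K2 * C)"
      using c1 c2 by eventually_elim blast
    then obtain x where "x \<in> N1 \<inter> N2" "(x \<in> N1 --> \<bar>u x - c1\<bar> <= K1 * C) \<and> (x \<in> N2 --> \<bar>u x - c2\<bar> <= K2 * C)"
      by (rule AE_ex_in_open[OF open_Int[OF o(1,2)] o(3)])
    then have c12: "\<bar>c1 - c2\<bar> <= K1 * C + K2 * C" by auto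
    have K: "K1 * C <= \<bar>K1\<bar> * C" "K2 * C <= \<bar>K2\<bar> * C" "0 <= \<bar>K1\<bar> * C" "0 <= \<bar>K2\<bar> * C" using C(1) by (auto intro: mult_right_mono)
    have "AE x in lborel. x \<in> N1 \<union> N2 --> \<bar>u x - c1\<bar> <= (\<bar>K1\<bar> + 2 * \<bar>K2\<bar>) * C"
      using c1 c2
    proof eventually_elim
      case (elim x)
      have e: "(\<bar>K1\<bar> + 2 * \<bar>K2\<bar>) * C = \<bar>K1\<bar> * C + 2 * (\<bar>K2\<bar> * C)" by (simp add: distrib_right)
      show ?case
      proof
        assume "x \<in> N1 \<union> N2"
        then have "\<bar>u x - c1\<bar> <= K1 * C \<or> \<bar>u x - c2\<bar> <= K2 * C" using elim by blast
        then show "\<bar>u x - c1\<bar> <= (\<bar>K1\<bar> + 2 * \<bar>K2\<bar>) * C"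
          unfolding e using c12 K by linarith
      qed
    qed
    then show "\<exists>c. AE x in lborel. x \<in> N1 \<union> N2 --> \<bar>u x - c\<bar> <= (\<bar>K1\<bar> + 2 * \<bar>K2\<bar>) * C" by blast
  qed
qed

text \<open>Balls and boundary neighbourhoods form a finite cover of the compact closure, and by
  connectedness they can be merged one after the other along overlaps.\<close>

lemma osc_controlled_domain:
  assumes D: "bounded_lipschitz_domain \<omega>"
  shows "osc_controlled \<omega> \<omega>"
proof (cases "\<omega> = {}")
  case True
  then show ?thesis by (simp add: osc_controlled_def)
next
  case False
  have \<omega>: "open \<omega>" "bounded \<omega>" and con: "connected \<omega>" using D by (auto simp: bounded_lipschitz_domain_def)
  \<comment> \<open>Two points are related if they lie in one controlled open set; by connectedness all are.\<close>
  define R where "R x y \<longleftrightarrow> (\<exists>N. open N \<and> N \<subseteq> \<omega> \<and> x \<in> N \<and> y \<in> N \<and> osc_controlled \<omega> N)" for x y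
  have R: "R x y" if "x \<in> \<omega>" "y \<in> \<omega>" for x y
  proof (rule connected_equivalence_relation[OF con that])
    show "R y x" if "R x y" for x y using that unfolding R_def by blast
    show "R x z" if xy: "R x y" and yz: "R y z" for x y z
    proof -
      obtain N where N: "open N" "N \<subseteq> \<omega>" "x \<in> N" "y \<in> N" "osc_controlled \<omega> N" using xy unfolding R_def by blast
      obtain N' where N': "open N'" "N' \<subseteq> \<omega>" "y \<in> N'" "z \<in> N'" "osc_controlled \<omega> N'" using yz unfolding R_def by blast
      have "osc_controlled \<omega> (N \<union> N')" using N N' by (intro osc_controlled_Un) auto
      then show ?thesis unfolding R_def using N N' by (intro exI[of _ "N \<union> N'"]) auto
    qed
    show "\<exists>T. openin (top_of_set \<omega>) T \<and> a \<in> T \<and> (\<forall>x\<in>T. R a x)" if "a \<in> \<omega>" for a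
    proof -
      obtain e where e: "e > 0" "ball a e \<subseteq> \<omega>" using \<omega>(1) \<open>a \<in> \<omega>\<close> open_contains_ball by blast
      have "R a x" if "x \<in> ball a e" for x unfolding R_def
        using osc_controlled_ball[OF \<omega> e(2,1)] e that by (intro exI[of _ "ball a e"]) auto
      then show ?thesis using e \<omega> by (intro exI[of _ "ball a e"]) (auto simp: openin_open_eq)
    qed
  qed
  have loc: "\<exists>r>0. osc_controlled \<omega> (\<omega> \<inter> ball p r)" if "p \<in> closure \<omega>" for p
  proof (cases "p \<in> \<omega>")
    case True
    then obtain e where e: "e > 0" "ball p e \<subseteq> \<omega>" using \<omega>(1) open_contains_ball by blast
    then have "\<omega> \<inter> ball p e = ball p e" by blast
    then show ?thesis using osc_controlled_ball[OF \<omega> e(2,1)] e(1) by metis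
  next
    case False
    then have "p \<in> frontier \<omega>" using that \<omega>(1) by (simp add: frontier_def interior_open)
    then show ?thesis using osc_controlled_boundary[OF D] by metis
  qed
  then obtain \<rho> where \<rho>: "\<And>p. p \<in> closure \<omega> ==> \<rho> p > 0 \<and> osc_controlled \<omega> (\<omega> \<inter> ball p (\<rho> p))" by metis
  have cpt: "compact (closure \<omega>)" using \<omega>(2) by simp
  have cov: "closure \<omega> \<subseteq> (\<Union>p\<in>closure \<omega>. ball p (\<rho> p))" using \<rho> by force
  obtain F where F: "F \<subseteq> closure \<omega>" "finite F" "closure \<omega> \<subseteq> (\<Union>p\<in>F. ball p (\<rho> p))"
    by (rule compactE_image[OF cpt _ cov]) auto
  obtain x0 where x0: "x0 \<in> \<omega>" using False by blast
  from F(2,1) have "\<exists>N. open N \<and> N \<subseteq> \<omega> \<and> x0 \<in> N \<and> osc_controlled \<omega> N \<and> (\<forall>p\<in>F. \<omega> \<inter> ball p (\<rho> p) \<subseteq> N)"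
  proof (induction F)
    case empty
    then show ?case using R[OF x0 x0] unfolding R_def by auto
  next
    case (insert p F)
    then obtain N where N: "open N" "N \<subseteq> \<omega>" "x0 \<in> N" "osc_controlled \<omega> N" "\<forall>p\<in>F. \<omega> \<inter> ball p (\<rho> p) \<subseteq> N" by auto
    show ?case
    proof (cases "\<omega> \<inter> ball p (\<rho> p) = {}")
      case True
      then show ?thesis using N by (intro exI[of _ N]) auto
    next
      case False
      then obtain y where y: "y \<in> \<omega>" "y \<in> ball p (\<rho> p)" by blast
      obtain N' where N': "open N'" "N' \<subseteq> \<omega>" "x0 \<in> N'" "y \<in> N'" "osc_controlled \<omega> N'" using R[OF x0 y(1)] unfolding R_def by blast
      have 1: "osc_controlled \<omega> (N \<union> N')" using N N' by (intro osc_controlled_Un) auto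
      have "osc_controlled \<omega> ((N \<union> N') \<union> (\<omega> \<inter> ball p (\<rho> p)))"
        using N N' \<omega> y \<rho>[of p] insert.prems by (intro osc_controlled_Un[OF 1]) auto
      then show ?thesis using N N' \<omega> by (intro exI[of _ "(N \<union> N') \<union> (\<omega> \<inter> ball p (\<rho> p))"]) auto
    qed
  qed
  then obtain N where N: "N \<subseteq> \<omega>" "osc_controlled \<omega> N" "\<forall>p\<in>F. \<omega> \<inter> ball p (\<rho> p) \<subseteq> N" by blast
  have "\<omega> \<subseteq> N" using N(3) F(3) closure_subset by fastforce
  then show ?thesis using N by (metis subset_antisym)
qed

text \<open>Borel representatives transfer \<open>osc_controlled_domain\<close> to arbitrary
  ones.\<close>

lemma oscillation_bound:
  assumes D: "bounded_lipschitz_domain \<omega>"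
  shows "\<exists>K. \<forall>u v C. (\<forall>i. is_weak_partial \<omega> i u (v i)) --> C >= 0 --> (AE x in leb \<omega>. (sumsq v x) <= C\<^sup>2)
     --> (\<exists>c. AE x in leb \<omega>. \<bar>u x - c\<bar> <= K * C)"
proof -
  note \<omega> = lipschitz_domain_open_bounded[OF D]
  obtain K where K: "\<forall>u v C. borel_H1 \<omega> u v \<and> C >= 0 \<and> (AE x in lborel. (sumsq v x) <= C\<^sup>2)
      --> (\<exists>c. AE x in lborel. x \<in> \<omega> --> \<bar>u x - c\<bar> <= K * C)"
    using osc_controlled_domain[OF D] unfolding osc_controlled_def by (elim exE)
  show ?thesis
  proof (rule exI[of _ K], intro allI impI)
    fix u v and C :: real assume w: "\<forall>i. is_weak_partial \<omega> i u (v i)" and C: "C >= 0" "AE x in leb \<omega>. (sumsq v x) <= C\<^sup>2"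
    obtain u' v' where H: "borel_H1 \<omega> u' v'" and ae: "AE x in leb \<omega>. u x = u' x" "\<forall>i. AE x in leb \<omega>. v i x = v' i x"
      using borel_H1_ex[OF \<omega>(1) w[rule_format]] by (elim exE conjE)
    have "AE x in leb \<omega>. \<forall>i. v i x = v' i x" using ae(2) by (simp add: AE_all_countable)
    then have "AE x in leb \<omega>. (sumsq v' x) <= C\<^sup>2" using C(2) by eventually_elim simp
    then have "AE x in lborel. x \<in> \<omega> --> (sumsq v' x) <= C\<^sup>2" by (simp add: AE_lebesgue_on_open[OF \<omega>(1)])
    then have "AE x in lborel. (sumsq v' x) <= C\<^sup>2"
    proof eventually_elim
      case (elim x)
      then show ?case using H C(1) by (cases "x \<in> \<omega>") (auto simp: borel_H1_def)
    qed
    then obtain c where "AE x in lborel. x \<in> \<omega> --> \<bar>u' x - c\<bar> <= K * C" using K H C(1) by blast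
    then have "AE x in leb \<omega>. \<bar>u' x - c\<bar> <= K * C" by (simp add: AE_lebesgue_on_open[OF \<omega>(1)])
    then have "AE x in leb \<omega>. \<bar>u x - c\<bar> <= K * C" using ae(1) by eventually_elim simp
    then show "\<exists>c. AE x in leb \<omega>. \<bar>u x - c\<bar> <= K * C" by blast
  qed
qed

section \<open>Hausdorff measure on Lipschitz graphs\<close>

text \<open>A Lipschitz map sends an interval to a set whose diameter is at most the Lipschitz
  constant times its length; Borel sets are covered by short intervals of almost the same total
  length.\<close>

lemma hausdorff_outer_lipschitz_curve:
  fixes G :: "real => real^2"
  assumes G: "\<Lambda>-lipschitz_on UNIV G" and B: "B \<in> sets borel" "B \<subseteq> cbox a b" and ab: "a < b"
  shows "hausdorff_outer (G ` B) <= ennreal \<Lambda> * emeasure lborel B"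
  unfolding hausdorff_outer_def
proof (rule SUP_least)
  fix \<delta> :: real assume "\<delta> \<in> {0<..}"
  then have \<delta>: "\<delta> > 0" by simp
  have \<Lambda>: "\<Lambda> >= 0" using G by (rule lipschitz_on_nonneg)
  show "hausdorff_pre \<delta> (G ` B) <= ennreal \<Lambda> * emeasure lborel B"
  proof (rule ennreal_le_epsilon)
    fix \<epsilon> :: real assume \<epsilon>: "\<epsilon> > 0"
    define \<eta> where "\<eta> = \<epsilon> / (\<Lambda> + 1)"
    have \<eta>: "\<eta> > 0" "\<Lambda> * \<eta> <= \<epsilon>" using \<epsilon> \<Lambda> by (auto simp: \<eta>_def field_simps)
    obtain W where W: "open W" "B \<subseteq> W" "emeasure lborel (W - B) < ennreal \<eta>"
      using outer_regular_lborel[OF B(1), of \<eta>] \<eta>(1) by auto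
    have Om: "W \<in> sets borel" using W(1) by simp
    have EO: "emeasure lborel W <= emeasure lborel B + ennreal \<eta>"
    proof -
      have "emeasure lborel W = emeasure lborel (B \<union> (W - B))" using W(2) by (simp add: Un_absorb1)
      also have "\<dots> <= emeasure lborel B + emeasure lborel (W - B)"
        using B(1) Om by (intro emeasure_subadditive) auto
      finally show ?thesis using W(3) by (meson add_left_mono less_imp_le order_trans)
    qed
    define d where "d = \<delta> / (2 * (\<Lambda> + 1))"
    have d: "d > 0" "\<Lambda> * (2 * d) <= \<delta>" using \<delta> \<Lambda> by (auto simp: d_def field_simps)
    define g where "g x = (if x \<in> W then W \<inter> ball x d else ball x d)" for x
    have g: "gauge g" unfolding gauge_def g_def using W(1) d(1) by auto
    have box: "box a b \<noteq> {}" using ab by (simp add: box_real)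
    obtain \<D> where D: "countable \<D>" "\<Union>\<D> \<subseteq> cbox a b"
      "\<And>K. K \<in> \<D> ==> interior K \<noteq> {} \<and> (\<exists>c d. K = cbox c d)"
      "pairwise (\<lambda>A B. interior A \<inter> interior B = {}) \<D>"
      "\<And>K. K \<in> \<D> ==> \<exists>x \<in> B \<inter> K. K \<subseteq> g x" "B \<subseteq> \<Union>\<D>"
      using covering_lemma[OF B(2) box g] by metis
    have K1: "\<exists>c d'. K = {c..d'} \<and> c <= d'" "K \<subseteq> W" "d' - c <= 2 * d" if KD: "K \<in> \<D>" "K = {c..d'}" "c <= d'" for K c d'
    proof -
      obtain x where x: "x \<in> B" "x \<in> K" "K \<subseteq> g x" using D(5)[OF KD(1)] by blast
      moreover have "x \<in> W" using x(1) W(2) by blast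
      ultimately have "K \<subseteq> W \<inter> ball x d" by (simp add: g_def)
      then show "K \<subseteq> W" by blast
      have "c \<in> ball x d" "d' \<in> ball x d" using \<open>K \<subseteq> W \<inter> ball x d\<close> KD by auto
      then show "d' - c <= 2 * d" by (auto simp: dist_real_def)
      show "\<exists>c d'. K = {c..d'} \<and> c <= d'" using KD by blast
    qed
    have K0: "\<exists>c d'. K = {c..d'} \<and> c <= d'" if KD: "K \<in> \<D>" for K
    proof -
      obtain c d' where "K = {c..d'}" using D(3)[OF KD] by auto
      moreover have "K \<noteq> {}" using D(3)[OF KD] by auto
      ultimately show ?thesis by auto
    qed
    define C where "C n = (if n \<in> to_nat_on \<D> ` \<D> then from_nat_into \<D> n else {})" for n
    have C: "C n = {} \<or> C n \<in> \<D>" for n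
    proof (cases "n \<in> to_nat_on \<D> ` \<D>")
      case True
      then have "\<D> \<noteq> {}" by auto
      then show ?thesis using True by (simp add: C_def from_nat_into)
    qed (simp add: C_def)
    have CU: "\<Union>\<D> \<subseteq> (\<Union>n. C n)"
    proof
      fix x assume "x \<in> \<Union>\<D>"
      then obtain K where K: "K \<in> \<D>" "x \<in> K" by blast
      have "C (to_nat_on \<D> K) = K" using K(1) D(1) by (simp add: C_def)
      then show "x \<in> (\<Union>n. C n)" using K(2) by blast
    qed
    have Cinj: "C m \<noteq> C n" if "m \<noteq> n" "C m \<noteq> {}" for m n
    proof
      assume eq: "C m = C n"
      have m: "m \<in> to_nat_on \<D> ` \<D>" "n \<in> to_nat_on \<D> ` \<D>" using that(2) eq by (auto simp: C_def split: if_splits)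
      then have "from_nat_into \<D> m = from_nat_into \<D> n" using eq by (simp add: C_def)
      then show False using m that(1) D(1) by auto
    qed
    have disj: "disjoint_family (\<lambda>n. interior (C n))"
      unfolding disjoint_family_on_def
    proof (intro ballI impI)
      fix m n :: nat assume "m \<noteq> n"
      show "interior (C m) \<inter> interior (C n) = {}"
      proof (cases "C m = {} \<or> C n = {}")
        case False
        then have "C m \<in> \<D>" "C n \<in> \<D>" "C m \<noteq> C n" using C Cinj \<open>m \<noteq> n\<close> by blast+
        then show ?thesis using D(4) by (auto simp: pairwise_def)
      qed auto
    qed
    have diam: "bounded (G ` C n) \<and> diameter (G ` C n) <= \<delta> \<and> ennreal (diameter (G ` C n)) <= ennreal \<Lambda> * emeasure lborel (interior (C n))" for n
    proof (cases "C n = {}")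
      case False
      then have CD: "C n \<in> \<D>" using C by blast
      then obtain c d' where K: "C n = {c..d'}" "c <= d'" using K0 by blast
      have len: "d' - c <= 2 * d" using K1(3)[OF CD K] .
      have le: "dist (G s) (G t) <= \<Lambda> * (d' - c)" if "s \<in> {c..d'}" "t \<in> {c..d'}" for s t
      proof -
        have "dist (G s) (G t) <= \<Lambda> * dist s t" using lipschitz_onD[OF G] by simp
        also have "\<dots> <= \<Lambda> * (d' - c)" using that \<Lambda> by (intro mult_left_mono) (auto simp: dist_real_def)
        finally show ?thesis .
      qed
      have "diameter (G ` C n) <= \<Lambda> * (d' - c)"
        using le K \<Lambda> by (intro diameter_le) (auto simp: dist_norm)
      moreover have "\<Lambda> * (d' - c) <= \<delta>" using mult_left_mono[OF len \<Lambda>] d(2) by linarith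
      moreover have "bounded (G ` C n)"
        unfolding K(1) using lipschitz_on_continuous_on[OF G]
        by (intro compact_imp_bounded compact_continuous_image) (auto intro: continuous_on_subset)
      moreover have "ennreal (\<Lambda> * (d' - c)) = ennreal \<Lambda> * emeasure lborel (interior (C n))"
        using K \<Lambda> by (simp add: ennreal_mult)
      ultimately show ?thesis by (metis ennreal_leI order_trans)
    qed (simp add: \<delta> less_imp_le)
    have "hausdorff_pre \<delta> (G ` B) <= (\<Sum>n. ennreal (diameter (G ` C n)))"
    proof (intro hausdorff_pre_le)
      show "G ` B \<subseteq> (\<Union>n. G ` C n)" using D(6) CU unfolding image_UN[symmetric] by (intro image_mono) blast
    qed (use diam in auto)
    also have "\<dots> <= (\<Sum>n. ennreal \<Lambda> * emeasure lborel (interior (C n)))"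
      using diam by (intro suminf_le) auto
    also have "\<dots> = ennreal \<Lambda> * (\<Sum>n. emeasure lborel (interior (C n)))"
      by (rule ennreal_suminf_cmult)
    also have "(\<Sum>n. emeasure lborel (interior (C n))) = emeasure lborel (\<Union>n. interior (C n))"
      using disj by (intro suminf_emeasure) auto
    also have "ennreal \<Lambda> * emeasure lborel (\<Union>n. interior (C n)) <= ennreal \<Lambda> * emeasure lborel W"
    proof (intro mult_left_mono emeasure_mono)
      show "(\<Union>n. interior (C n)) \<subseteq> W"
      proof (rule UN_least)
        fix n
        show "interior (C n) \<subseteq> W"
        proof (cases "C n = {}")
          case False
          then have CD: "C n \<in> \<D>" using C by blast
          then obtain c d' where K: "C n = {c..d'}" "c <= d'" using K0 by blast
          show ?thesis using K1(2)[OF CD K] interior_subset by blast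
        qed simp
      qed
    qed (use Om in auto)
    also have "\<dots> <= ennreal \<Lambda> * (emeasure lborel B + ennreal \<eta>)" by (intro mult_left_mono EO) auto
    also have "\<dots> = ennreal \<Lambda> * emeasure lborel B + ennreal (\<Lambda> * \<eta>)"
      using \<Lambda> \<eta> by (simp add: distrib_left ennreal_mult)
    also have "\<dots> <= ennreal \<Lambda> * emeasure lborel B + ennreal \<epsilon>"
      by (intro add_left_mono ennreal_leI \<eta>)
    finally show "hausdorff_pre \<delta> (G ` B) <= ennreal \<Lambda> * emeasure lborel B + ennreal \<epsilon>" .
  qed
qed

text \<open>From sets to functions: the image measure of Lebesgue measure under the curve
  dominates the length measure on its range, up to the Lipschitz constant.\<close>

lemma nn_integral_lipschitz_curve:
  fixes G :: "real => real^2" and g :: "real^2 => ennreal"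
  assumes G: "\<Lambda>-lipschitz_on UNIV G" and ab: "a < b" and g [measurable]: "g \<in> borel_measurable borel"
  shows "(\<integral>\<^sup>+z. indicator (G ` {a..b}) z * g z \<partial>hausdorff1) <= ennreal \<Lambda> * (\<integral>\<^sup>+x. indicator {a..b} x * g (G x) \<partial>lborel)"
proof -
  have cG: "continuous_on UNIV G" using lipschitz_on_continuous_on[OF G] .
  have Gm [measurable]: "G \<in> borel_measurable borel" using cG by (rule borel_measurable_continuous_onI)
  have "compact (G ` {a..b})" using cG by (intro compact_continuous_image) (auto intro: continuous_on_subset)
  then have I [measurable]: "G ` {a..b} \<in> sets borel" by (simp add: borel_closed compact_imp_closed)
  have [measurable]: "G ` {a..b} \<in> sets hausdorff1" by simp
  have mH: "f \<in> borel_measurable hausdorff1 \<longleftrightarrow> f \<in> borel_measurable borel" for f :: "real^2 => ennreal"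
    by (rule measurable_cong_sets[THEN arg_cong[where f="\<lambda>S. f \<in> S"]]) auto
  let ?M = "density hausdorff1 (indicator (G ` {a..b}))"
  let ?N = "distr (density lborel (\<lambda>x. ennreal \<Lambda> * indicator {a..b} x)) borel G"
  have iH: "(indicator (G ` {a..b}) :: _ => ennreal) \<in> borel_measurable hausdorff1" by (simp add: mH)
  have "?M <= ?N"
  proof (subst le_measure)
    show "\<forall>A\<in>sets ?M. emeasure ?M A <= emeasure ?N A"
    proof
      fix A assume "A \<in> sets ?M"
      then have A [measurable]: "A \<in> sets borel" by simp
      let ?B = "{a..b} \<inter> G -` A"
      have Bm [measurable]: "?B \<in> sets borel" using measurable_sets[OF Gm A] by simp
      have "emeasure ?M A = (\<integral>\<^sup>+z. indicator (G ` {a..b}) z * indicator A z \<partial>hausdorff1)"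
        using A by (intro emeasure_density iH) simp
      also have "\<dots> = (\<integral>\<^sup>+z. indicator (G ` {a..b} \<inter> A) z \<partial>hausdorff1)"
        by (intro nn_integral_cong) (auto simp: indicator_def)
      also have "\<dots> = emeasure hausdorff1 (G ` {a..b} \<inter> A)" by (intro nn_integral_indicator) auto
      also have "\<dots> = hausdorff_outer (G ` {a..b} \<inter> A)" by (intro emeasure_hausdorff1) auto
      also have "G ` {a..b} \<inter> A = G ` ?B" by auto
      also have "hausdorff_outer (G ` ?B) <= ennreal \<Lambda> * emeasure lborel ?B"
        by (rule hausdorff_outer_lipschitz_curve[OF G Bm _ ab]) auto
      also have "\<dots> = (\<integral>\<^sup>+x. ennreal \<Lambda> * indicator ?B x \<partial>lborel)"
        by (rule nn_integral_cmult_indicator[symmetric]) simp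
      also have "\<dots> = (\<integral>\<^sup>+x. ennreal \<Lambda> * indicator {a..b} x * indicator (G -` A) x \<partial>lborel)"
        by (intro nn_integral_cong) (auto simp: indicator_def)
      also have "\<dots> = emeasure (density lborel (\<lambda>x. ennreal \<Lambda> * indicator {a..b} x)) (G -` A)"
        using measurable_sets[OF Gm A] by (intro emeasure_density[symmetric]) auto
      also have "\<dots> = emeasure ?N A"
        by (subst emeasure_distr) auto
      finally show "emeasure ?M A <= emeasure ?N A" .
    qed
  qed simp
  then have "nn_integral ?M g <= nn_integral ?N g" by (intro nn_integral_mono_measure) auto
  moreover have "nn_integral ?M g = (\<integral>\<^sup>+z. indicator (G ` {a..b}) z * g z \<partial>hausdorff1)"
    using g by (intro nn_integral_density iH) (simp add: mH)
  moreover have "nn_integral ?N g = (\<integral>\<^sup>+x. g (G x) \<partial>density lborel (\<lambda>x. ennreal \<Lambda> * indicator {a..b} x))"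
    by (rule nn_integral_distr) auto
  moreover have "\<dots> = (\<integral>\<^sup>+x. (ennreal \<Lambda> * indicator {a..b} x) * g (G x) \<partial>lborel)"
    by (rule nn_integral_density) auto
  moreover have "\<dots> = ennreal \<Lambda> * (\<integral>\<^sup>+x. indicator {a..b} x * g (G x) \<partial>lborel)"
    unfolding mult.assoc by (rule nn_integral_cmult) auto
  ultimately show ?thesis by simp
qed

lemma lborel_vec2: "distr (lborel \<Otimes>\<^sub>M lborel) borel (\<lambda>(x, y). vector [x, y]) = (lborel :: (real^2) measure)"
proof (rule lborel_eqI[symmetric])
  have cont: "continuous_on UNIV (\<lambda>p::real\<times>real. vector [fst p, snd p] :: real^2)"
  proof -
    have "(\<lambda>p::real\<times>real. vector [fst p, snd p] :: real^2) = (\<lambda>p. fst p *\<^sub>R axis 1 1 + snd p *\<^sub>R axis 2 1)"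
      by (auto simp: vec_eq_iff forall_2 axis_def fun_eq_iff)
    then show ?thesis by (simp only:) (intro continuous_intros)
  qed
  have m: "(\<lambda>(x, y). vector [x, y] :: real^2) \<in> lborel \<Otimes>\<^sub>M lborel \<rightarrow>\<^sub>M borel"
    using borel_measurable_continuous_onI[OF cont] by (simp add: lborel_prod case_prod_beta')
  fix l u :: "real^2" assume lu: "\<And>b. b \<in> Basis ==> l \<bullet> b <= u \<bullet> b"
  have lu': "l $ i <= u $ i" for i using lu[of "axis i 1"] by (simp add: inner_axis axis_in_Basis_iff)
  have "(\<lambda>(x, y). vector [x, y] :: real^2) -` box l u \<inter> space (lborel \<Otimes>\<^sub>M lborel) = {l$1<..<u$1} \<times> {l$2<..<u$2}"
    by (auto simp: mem_box_cart forall_2 space_pair_measure)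
  then have "emeasure (distr (lborel \<Otimes>\<^sub>M lborel) borel (\<lambda>(x, y). vector [x, y] :: real^2)) (box l u)
     = emeasure (lborel \<Otimes>\<^sub>M lborel) ({l$1<..<u$1} \<times> {l$2<..<u$2})"
    by (subst emeasure_distr[OF m]) auto
  also have "\<dots> = ennreal (u$1 - l$1) * ennreal (u$2 - l$2)"
    using lu' by (subst lborel.emeasure_pair_measure_Times) auto
  also have "\<dots> = ennreal ((u$1 - l$1) * (u$2 - l$2))" using lu' by (intro ennreal_mult[symmetric]) auto
  also have "(u$1 - l$1) * (u$2 - l$2) = (\<Prod>b\<in>Basis. (u - l) \<bullet> b)"
  proof -
    have B: "(Basis :: (real^2) set) = {axis 1 1, axis 2 1}"
      using exhaust_2 by (auto simp: Basis_vec_def) metis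
    have "axis 1 (1::real) \<noteq> (axis 2 1 :: real^2)" by (simp add: axis_eq_axis)
    then show ?thesis unfolding B by (simp add: inner_axis)
  qed
  finally show "emeasure (distr (lborel \<Otimes>\<^sub>M lborel) borel (\<lambda>(x, y). vector [x, y] :: real^2)) (box l u) = (\<Prod>b\<in>Basis. (u - l) \<bullet> b)" .
qed simp

lemma lborel_orthogonal:
  assumes T: "orthogonal_transformation (T :: real^2 => real^2)"
  shows "distr lborel borel T = lborel"
proof (rule lborel_eqI[symmetric])
  have lin: "linear T" using T by (rule orthogonal_transformation_linear)
  have m [measurable]: "T \<in> borel_measurable borel"
    using lin by (intro borel_measurable_continuous_onI linear_continuous_on) (simp add: linear_conv_bounded_linear)
  fix l u :: "real^2" assume lu: "\<And>b. b \<in> Basis ==> l \<bullet> b <= u \<bullet> b"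
  have bij: "bij T" using T by (rule orthogonal_transformation_bij)
  have iT: "orthogonal_transformation (inv T)" using T by (rule orthogonal_transformation_inv)
  have im: "T -` box l u = inv T ` box l u" using bij by (simp add: bij_vimage_eq_inv_image)
  have lm: "box l u \<in> lmeasurable" by simp
  have "emeasure (distr lborel borel T) (box l u) = emeasure lborel (T -` box l u)"
    by (subst emeasure_distr) auto
  also have "\<dots> = emeasure lebesgue (T -` box l u)"
    using measurable_sets[OF m, of "box l u"] by (simp add: emeasure_completion)
  also have "\<dots> = ennreal (measure lebesgue (inv T ` box l u))"
    unfolding im using measurable_orthogonal_image[OF iT lm] by (simp add: emeasure_eq_measure2 fmeasurableD2 emeasure_eq_ennreal_measure)
  also have "\<dots> = ennreal (measure lebesgue (box l u))" using measure_orthogonal_image[OF iT lm] by simp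
  also have "\<dots> = ennreal (\<Prod>b\<in>Basis. (u - l) \<bullet> b)" using lu by (simp add: measure_lborel_box)
  finally show "emeasure (distr lborel borel T) (box l u) = (\<Prod>b\<in>Basis. (u - l) \<bullet> b)" .
qed simp

section \<open>The trace inequality\<close>

text \<open>In the rotated frame the shear $(x,t)\mapsto(x,\gamma(x)+t)$ preserves Lebesgue
  measure by Tonelli, so integrals near the boundary become iterated integrals along the
  vertical lines through the points of the graph.\<close>

lemma boundary_chart:
  assumes D: "bounded_lipschitz_domain \<omega>" and p: "p \<in> frontier \<omega>"
  shows "\<exists>(G :: real => real^2) e \<Lambda> a b \<delta> \<tau> \<rho> r.
    \<Lambda>-lipschitz_on UNIV G \<and> norm e = 1 \<and> a < b \<and> \<delta> > 0 \<and> \<tau> > 0 \<and> \<rho> > 0 \<and>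
    (\<forall>F :: real^2 => ennreal. F \<in> borel_measurable borel -->
       (\<integral>\<^sup>+z. F z \<partial>lborel) = (\<integral>\<^sup>+x. \<integral>\<^sup>+t. F (G x + t *\<^sub>R e) \<partial>lborel \<partial>lborel)) \<and>
    (\<forall>x t. x \<in> {a..b} --> 0 < t --> t <= \<tau> --> G x + t *\<^sub>R e \<in> \<omega> \<inter> ball p r) \<and>
    (\<forall>z s. z \<in> \<omega> \<inter> ball p r --> 0 <= s --> s <= \<delta> --> z + s *\<^sub>R e \<in> \<omega>) \<and>
    frontier \<omega> \<inter> ball p \<rho> \<subseteq> G ` {a..b}"
proof -
  have \<omega>: "open \<omega>" using D by (simp add: bounded_lipschitz_domain_def)
  obtain T :: "real^2 => real^2" and R \<gamma> L where T: "orthogonal_transformation T" and R: "R > 0" and L: "L-lipschitz_on UNIV (\<gamma> :: real => real)"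
    and eq: "\<omega> \<inter> ball p R = {x \<in> ball p R. \<gamma> (T x $ 1) < T x $ 2}"
    using D p unfolding bounded_lipschitz_domain_def by blast
  have lin: "linear T" using T by (rule orthogonal_transformation_linear)
  have L0: "L >= 0" using L by (rule lipschitz_on_nonneg)
  have bij: "bij T" using T by (rule orthogonal_transformation_bij)
  define S where "S = inv T"
  have S: "orthogonal_transformation S" unfolding S_def using T by (rule orthogonal_transformation_inv)
  have TS: "T (S w) = w" and ST: "S (T w) = w" for w
    unfolding S_def using bij by (auto simp: bij_is_surj surj_f_inv_f bij_is_inj)
  have linS: "linear S" using S by (rule orthogonal_transformation_linear)
  have dT: "dist (T x) (T y) = dist x y" for x y
    using T lin by (simp add: dist_norm linear_diff[symmetric] orthogonal_transformation)
  have dS: "dist (S x) (S y) = dist x y" for x y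
    using S linS by (simp add: dist_norm linear_diff[symmetric] orthogonal_transformation)
  define e where "e = S (axis 2 1)"
  have e: "norm e = 1" unfolding e_def using S by (simp add: orthogonal_transformation norm_axis_1)
  have Te: "T (z + s *\<^sub>R e) = T z + s *\<^sub>R axis 2 1" for z s
    using lin TS by (simp add: e_def linear_add linear_scale)
  define G where "G x = S (vector [x, \<gamma> x])" for x
  have TG: "T (G x + t *\<^sub>R e) = vector [x, \<gamma> x + t]" for x t
    unfolding Te unfolding G_def TS by (simp add: vec_eq_iff forall_2 axis_def)
  have SG: "S (vector [x, \<gamma> x + t]) = G x + t *\<^sub>R e" for x t
    using ST[of "G x + t *\<^sub>R e"] by (simp add: TG)
  have dv: "dist (vector [x, y] :: real^2) w <= \<bar>x - w $ 1\<bar> + \<bar>y - w $ 2\<bar>" for x y w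
    using norm_le_l1_cart[of "vector [x, y] - w"] by (simp add: dist_norm sum_2)
  have \<gamma>L: "\<bar>\<gamma> x - \<gamma> y\<bar> <= L * \<bar>x - y\<bar>" for x y
    using lipschitz_onD[OF L, of x y] by (simp add: dist_real_def)
  have pf: "\<gamma> (T p $ 1) = T p $ 2" by (rule chart_facts[OF \<omega> T L eq p]) (use R in simp)
  define \<eta> where "\<eta> = R / (8 * (1 + L))"
  have \<eta>: "\<eta> > 0" "(1 + L) * \<eta> = R / 8" using R L0 by (auto simp: \<eta>_def field_simps)
  have \<eta>R: "\<eta> <= R / 8" using mult_right_mono[of 1 "1 + L" \<eta>] \<eta> L0 by linarith
  let ?a = "T p $ 1 - \<eta>" and ?b = "T p $ 1 + \<eta>"
  show ?thesis
  proof (rule exI[of _ G], rule exI[of _ e], rule exI[of _ "1 + L"], rule exI[of _ ?a], rule exI[of _ ?b], rule exI[of _ "R/2"],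
      rule exI[of _ "R/8"], rule exI[of _ \<eta>], rule exI[of _ "R/2"], intro conjI allI impI)
    show "(1 + L)-lipschitz_on UNIV G"
    proof (rule lipschitz_onI)
      fix x y
      have "dist (G x) (G y) <= \<bar>x - y\<bar> + \<bar>\<gamma> x - \<gamma> y\<bar>"
        unfolding G_def dS using dv[of x "\<gamma> x" "vector [y, \<gamma> y]"] by simp
      also have "\<dots> <= (1 + L) * dist x y" using \<gamma>L[of x y] by (simp add: dist_real_def distrib_right)
      finally show "dist (G x) (G y) <= (1 + L) * dist x y" .
    qed (use L0 in simp)
    show "norm e = 1" by (rule e)
    show "?a < ?b" "R / 2 > 0" "R / 8 > 0" "\<eta> > 0" using \<eta> R by auto
  next
    fix F :: "real^2 => ennreal" assume F: "F \<in> borel_measurable borel"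
    have Sm [measurable]: "S \<in> borel_measurable borel"
      using linS by (intro borel_measurable_continuous_onI linear_continuous_on) (simp add: linear_conv_bounded_linear)
    have FS: "(\<lambda>w. F (S w)) \<in> borel_measurable borel" using F by measurable
    have cont: "continuous_on UNIV (\<lambda>p::real\<times>real. vector [fst p, snd p] :: real^2)"
    proof -
      have "(\<lambda>p::real\<times>real. vector [fst p, snd p] :: real^2) = (\<lambda>p. fst p *\<^sub>R axis 1 1 + snd p *\<^sub>R axis 2 1)"
        by (auto simp: vec_eq_iff forall_2 axis_def fun_eq_iff)
      then show ?thesis by (simp only:) (intro continuous_intros)
    qed
    have m: "(\<lambda>(x, y). vector [x, y] :: real^2) \<in> lborel \<Otimes>\<^sub>M lborel \<rightarrow>\<^sub>M borel"
      using borel_measurable_continuous_onI[OF cont] by (simp add: lborel_prod case_prod_beta')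
    have m2: "(\<lambda>y. vector [x, y] :: real^2) \<in> borel_measurable borel" for x
      by (intro borel_measurable_continuous_onI continuous_on_compose2[OF cont, of _ "\<lambda>y. (x, y)", simplified] continuous_intros)
    have "(\<integral>\<^sup>+z. F z \<partial>lborel) = (\<integral>\<^sup>+z. F z \<partial>distr lborel borel S)" by (simp only: lborel_orthogonal[OF S])
    also have "\<dots> = (\<integral>\<^sup>+w. F (S w) \<partial>lborel)" using F by (intro nn_integral_distr) auto
    also have "\<dots> = (\<integral>\<^sup>+w. F (S w) \<partial>distr (lborel \<Otimes>\<^sub>M lborel) borel (\<lambda>(x, y). vector [x, y]))"
      by (simp only: lborel_vec2)
    also have "\<dots> = (\<integral>\<^sup>+q. F (S (case q of (x, y) => vector [x, y])) \<partial>(lborel \<Otimes>\<^sub>M lborel))"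
      using FS by (intro nn_integral_distr m) simp
    also have "\<dots> = (\<integral>\<^sup>+x. \<integral>\<^sup>+y. F (S (vector [x, y])) \<partial>lborel \<partial>lborel)"
    proof -
      have "(\<lambda>q. F (S (case q of (x, y) => vector [x, y]))) \<in> borel_measurable (lborel \<Otimes>\<^sub>M lborel)"
        using measurable_compose[OF m FS] by simp
      from lborel.nn_integral_fst[OF this] show ?thesis by simp
    qed
    also have "\<dots> = (\<integral>\<^sup>+x. \<integral>\<^sup>+t. F (G x + t *\<^sub>R e) \<partial>lborel \<partial>lborel)"
    proof (rule nn_integral_cong)
      fix x :: real
      have "(\<integral>\<^sup>+t. F (S (vector [x, t + \<gamma> x])) \<partial>lborel) = (\<integral>\<^sup>+y. F (S (vector [x, y])) \<partial>lborel)"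
        by (rule lborel_nn_integral_shift) (use measurable_compose[OF m2 FS] in simp)
      then show "(\<integral>\<^sup>+y. F (S (vector [x, y])) \<partial>lborel) = (\<integral>\<^sup>+t. F (G x + t *\<^sub>R e) \<partial>lborel)"
        by (simp add: SG[symmetric] add.commute)
    qed
    finally show "(\<integral>\<^sup>+z. F z \<partial>lborel) = (\<integral>\<^sup>+x. \<integral>\<^sup>+t. F (G x + t *\<^sub>R e) \<partial>lborel \<partial>lborel)" .
  next
    fix x t assume x: "x \<in> {?a..?b}" and t: "0 < t" "t <= R / 8"
    have xp: "\<bar>x - T p $ 1\<bar> <= \<eta>" using x by auto
    have "dist (G x + t *\<^sub>R e) p = dist (vector [x, \<gamma> x + t]) (T p)" using dT[of "G x + t *\<^sub>R e" p] by (simp add: TG)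
    also have "\<dots> <= \<bar>x - T p $ 1\<bar> + \<bar>\<gamma> x + t - T p $ 2\<bar>" by (rule dv)
    also have "\<dots> <= \<bar>x - T p $ 1\<bar> + L * \<bar>x - T p $ 1\<bar> + t" using \<gamma>L[of x "T p $ 1"] t pf by linarith
    also have "\<dots> <= (1 + L) * \<eta> + R / 8"
      using mult_left_mono[OF xp, of "1 + L"] L0 t by (simp add: distrib_right)
    finally have d: "dist (G x + t *\<^sub>R e) p < R / 2" using \<eta>(2) R by linarith
    moreover have "G x + t *\<^sub>R e \<in> \<omega>"
    proof -
      have "G x + t *\<^sub>R e \<in> {x \<in> ball p R. \<gamma> (T x $ 1) < T x $ 2}"
        using d R t by (simp add: TG dist_commute)
      then show ?thesis using eq by blast
    qed
    ultimately show "G x + t *\<^sub>R e \<in> \<omega> \<inter> ball p (R / 2)" by (simp add: dist_commute)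
  next
    fix z s assume z: "z \<in> \<omega> \<inter> ball p (R / 2)" and s: "0 <= s" "s <= R / 2"
    have "z \<in> {x \<in> ball p R. \<gamma> (T x $ 1) < T x $ 2}" unfolding eq[symmetric] using z R by auto
    then have "\<gamma> (T (z + s *\<^sub>R e) $ 1) < T (z + s *\<^sub>R e) $ 2" using s by (simp add: Te axis_def)
    moreover have "dist z (z + s *\<^sub>R e) <= R / 2" using s e by (simp add: dist_norm)
    then have "z + s *\<^sub>R e \<in> ball p R" using z dist_triangle[of p "z + s *\<^sub>R e" z] by auto
    ultimately show "z + s *\<^sub>R e \<in> \<omega>" using eq by blast
  next
    show "frontier \<omega> \<inter> ball p \<eta> \<subseteq> G ` {?a..?b}"
    proof
      fix z assume z: "z \<in> frontier \<omega> \<inter> ball p \<eta>"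
      have "\<gamma> (T z $ 1) = T z $ 2" by (rule chart_facts[OF \<omega> T L eq]) (use z \<eta>R R in auto)
      then have "vector [T z $ 1, \<gamma> (T z $ 1)] = T z" by (simp add: vec_eq_iff forall_2)
      then have "G (T z $ 1) = z" by (simp add: G_def ST)
      moreover have "\<bar>T z $ 1 - T p $ 1\<bar> < \<eta>" using orthogonal_component_le[OF T, of z 1 p] z by (simp add: dist_commute)
      then have "T z $ 1 \<in> {?a..?b}" by auto
      ultimately show "z \<in> G ` {?a..?b}" by (metis imageI)
    qed
  qed
qed


text \<open>Null sets of the plane meet almost every vertical line in a null set of the line.\<close>

lemma chart_AE:
  fixes G :: "real => real^2"
  assumes G [measurable]: "G \<in> borel_measurable borel"
    and F: "\<And>F :: real^2 => ennreal. F \<in> borel_measurable borel ==>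
       (\<integral>\<^sup>+z. F z \<partial>lborel) = (\<integral>\<^sup>+x. \<integral>\<^sup>+t. F (G x + t *\<^sub>R e) \<partial>lborel \<partial>lborel)"
    and P: "AE z in lborel. P z"
  shows "AE x in lborel. AE t in lborel. P (G x + t *\<^sub>R e)"
proof -
  obtain N where N: "{z \<in> space lborel. \<not> P z} \<subseteq> N" "emeasure lborel N = 0" "N \<in> sets lborel"
    by (rule AE_E[OF P])
  have [measurable]: "N \<in> sets borel" using N(3) by simp
  have "(\<integral>\<^sup>+x. \<integral>\<^sup>+t. indicator N (G x + t *\<^sub>R e) \<partial>lborel \<partial>lborel) = (\<integral>\<^sup>+z. indicator N z \<partial>lborel)"
    by (rule F[symmetric]) measurable
  also have "\<dots> = 0" using N by simp
  finally have "AE x in lborel. (\<integral>\<^sup>+t. indicator N (G x + t *\<^sub>R e) \<partial>lborel) = 0"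
    by (subst (asm) nn_integral_0_iff_AE) auto
  then show ?thesis
  proof eventually_elim
    case (elim x)
    then have "AE t in lborel. indicator N (G x + t *\<^sub>R e) = (0::ennreal)"
      by (subst (asm) nn_integral_0_iff_AE) auto
    then show ?case
      by eventually_elim (use N(1) in \<open>auto simp: indicator_def split: if_splits\<close>)
  qed
qed

text \<open>On almost every vertical line, the value near the boundary is bounded by the value a
  distance $s$ further inside plus the integral of the gradient over the line. The resulting
  estimate is averaged over a thin slab above the graph and over $0<s\le\delta$; as the
  thickness of the slab tends to zero, continuity up to the boundary gives the bound on the
  graph.\<close>

lemma trace_inequality_local:
  assumes D: "bounded_lipschitz_domain \<omega>" and p: "p \<in> frontier \<omega>"
  shows "\<exists>\<rho> C. \<rho> > 0 \<and> C >= 0 \<and> (\<forall>w v. continuous_on (closure \<omega>) w --> (\<forall>i. is_weak_partial \<omega> i w (v i)) -->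
     (\<integral>\<^sup>+z. indicator (frontier \<omega> \<inter> ball p \<rho>) z * ennreal ((w z)\<^sup>2) \<partial>hausdorff1)
       <= ennreal (C * (l2sq (leb \<omega>) w + (\<Sum>i\<in>UNIV. l2sq (leb \<omega>) (v i)))))"
proof -
  note \<omega> = lipschitz_domain_open_bounded[OF D]
  obtain G :: "real => real^2" and e \<Lambda> a b \<delta> \<tau> \<rho> r where
    GL: "\<Lambda>-lipschitz_on UNIV G" and e: "norm e = 1" and ab: "a < b" and pos: "\<delta> > 0" "\<tau> > 0" "\<rho> > 0"
    and coord: "\<And>F :: real^2 => ennreal. F \<in> borel_measurable borel ==>
       (\<integral>\<^sup>+z. F z \<partial>lborel) = (\<integral>\<^sup>+x. \<integral>\<^sup>+t. F (G x + t *\<^sub>R e) \<partial>lborel \<partial>lborel)"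
    and near: "\<And>x t. x \<in> {a..b} ==> 0 < t ==> t <= \<tau> ==> G x + t *\<^sub>R e \<in> \<omega> \<inter> ball p r"
    and inward: "\<And>z s. z \<in> \<omega> \<inter> ball p r ==> 0 <= s ==> s <= \<delta> ==> z + s *\<^sub>R e \<in> \<omega>"
    and cover: "frontier \<omega> \<inter> ball p \<rho> \<subseteq> G ` {a..b}"
    using boundary_chart[OF D p] by (elim exE conjE) blast
  have \<Lambda>: "\<Lambda> >= 0" using GL by (rule lipschitz_on_nonneg)
  have cG: "continuous_on UNIV G" using lipschitz_on_continuous_on[OF GL] .
  have Gm [measurable]: "G \<in> borel_measurable borel" using cG by (rule borel_measurable_continuous_onI)
  define C where "C = \<Lambda> * (2 / \<delta> + 2 * \<delta>)"
  have Gcl: "G x \<in> closure \<omega>" if "x \<in> {a..b}" for x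
  proof (rule closure_approachable[THEN iffD2, rule_format])
    fix \<epsilon> :: real assume "\<epsilon> > 0"
    then have "G x + min (\<epsilon> / 2) \<tau> *\<^sub>R e \<in> \<omega>" using near[OF that, of "min (\<epsilon> / 2) \<tau>"] pos by auto
    moreover have "dist (G x + min (\<epsilon> / 2) \<tau> *\<^sub>R e) (G x) < \<epsilon>" using \<open>\<epsilon> > 0\<close> pos e by (simp add: dist_norm)
    ultimately show "\<exists>y\<in>\<omega>. dist y (G x) < \<epsilon>" by blast
  qed
  have main: "(\<integral>\<^sup>+z. indicator (frontier \<omega> \<inter> ball p \<rho>) z * ennreal ((w z)\<^sup>2) \<partial>hausdorff1)
       <= ennreal (C * (l2sq (leb \<omega>) w + (\<Sum>i\<in>UNIV. l2sq (leb \<omega>) (v i))))"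
    if cw: "continuous_on (closure \<omega>) w" and wp: "\<And>i. is_weak_partial \<omega> i w (v i)" for w v
  proof -
    define u where "u z = indicator \<omega> z * w z" for z
    have um [measurable]: "u \<in> borel_measurable borel"
      using borel_measurable_continuous_on_indicator[of \<omega> w] continuous_on_subset[OF cw closure_subset] \<omega>(1)
      by (simp add: u_def[abs_def])
    obtain u0 v' where H0: "borel_H1 \<omega> u0 v'" and ae0: "\<forall>i. AE x in leb \<omega>. v i x = v' i x"
      using borel_H1_ex[OF \<omega>(1) wp] by (elim exE conjE)
    have vm [measurable]: "v' i \<in> borel_measurable borel" for i using H0 by (simp add: borel_H1_def)
    have uw: "AE x in leb \<omega>. w x = u x" by (auto simp: AE_lebesgue_on_open[OF \<omega>(1)] u_def)
    have wpu: "is_weak_partial \<omega> i u (v' i)" for i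
      by (rule is_weak_partial_cong_AE[OF wp uw ae0[rule_format]]) (intro borel_imp_lebesgue_on um vm)+
    have H: "borel_H1 \<omega> u v'"
      using H0 wpu um unfolding borel_H1_def by (auto simp: u_def)
    note J = borel_H1_integrable[OF \<omega> H]
    define U where "U = \<omega> \<inter> ball p r"
    have U: "open U" unfolding U_def using \<omega>(1) by auto
    define W where "W z = ennreal ((u z)\<^sup>2)" for z
    define V where "V z = ennreal (sumsq v' z)" for z
    have Wm [measurable]: "W \<in> borel_measurable borel" and Vm [measurable]: "V \<in> borel_measurable borel"
      unfolding W_def V_def by measurable
    define A0 B0 where "A0 = l2sq (leb \<omega>) w" and "B0 = (\<Sum>i\<in>UNIV. l2sq (leb \<omega>) (v i))"
    have AB: "A0 >= 0" "B0 >= 0" by (auto simp: A0_def B0_def intro: sum_nonneg)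
    have WA: "(\<integral>\<^sup>+z. W z \<partial>lborel) = ennreal A0"
    proof -
      have "A0 = l2sq (leb \<omega>) u" unfolding A0_def
        using uw sqintD(1)[OF is_weak_partial_sqint[OF wp, THEN conjunct1]] borel_imp_lebesgue_on[OF um] by (rule l2sq_cong_AE)
      also have "\<dots> = (LINT x|lborel. (u x)\<^sup>2)"
        unfolding l2sq_real
      proof (rule integral_lebesgue_on_open[OF \<omega>(1)])
        show "(\<lambda>x. (u x)\<^sup>2) \<in> borel_measurable borel" by measurable
      qed (simp add: u_def)
      finally show ?thesis unfolding W_def using J(3) by (subst nn_integral_eq_integral) auto
    qed
    have VB: "(\<integral>\<^sup>+z. V z \<partial>lborel) = ennreal B0"
    proof -
      have z0: "v' i x = 0" if "x \<notin> \<omega>" for x i using H that by (auto simp: borel_H1_def)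
      have "l2sq (leb \<omega>) (v i) = (LINT x|lborel. (v' i x)\<^sup>2)" for i
      proof -
        have "l2sq (leb \<omega>) (v i) = l2sq (leb \<omega>) (v' i)"
          using ae0[rule_format, of i] sqintD(1)[OF is_weak_partial_sqint[OF wp, THEN conjunct2]] borel_imp_lebesgue_on[OF vm] by (rule l2sq_cong_AE)
        also have "\<dots> = (LINT x|lborel. (v' i x)\<^sup>2)"
          unfolding l2sq_real by (rule integral_lebesgue_on_open[OF \<omega>(1)]) (auto simp: z0)
        finally show ?thesis .
      qed
      then have "B0 = (LINT x|lborel. (sumsq v' x))" unfolding B0_def using J(4) by simp
      then show ?thesis unfolding V_def using J(4) by (subst nn_integral_eq_integral) (auto intro!: sum_nonneg)
    qed
    define \<alpha> where "\<alpha> x = (\<integral>\<^sup>+t. W (G x + t *\<^sub>R e) \<partial>lborel)" for x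
    define \<beta> where "\<beta> x = (\<integral>\<^sup>+t. V (G x + t *\<^sub>R e) \<partial>lborel)" for x
    have \<alpha>m [measurable]: "\<alpha> \<in> borel_measurable borel" and \<beta>m [measurable]: "\<beta> \<in> borel_measurable borel"
      unfolding \<alpha>_def \<beta>_def by measurable
    have \<alpha>A: "(\<integral>\<^sup>+x. \<alpha> x \<partial>lborel) = ennreal A0" and \<beta>B: "(\<integral>\<^sup>+x. \<beta> x \<partial>lborel) = ennreal B0"
      unfolding \<alpha>_def \<beta>_def coord[OF Wm, symmetric] coord[OF Vm, symmetric] by (rule WA VB)+
    \<comment> \<open>the increment bound along the inward direction, on almost every vertical line\<close>
    have step: "AE x in lborel. AE t in lborel. G x + t *\<^sub>R e \<in> U -->
        W (G x + t *\<^sub>R e) <= 2 * W (G x + (t + s) *\<^sub>R e) + ennreal (2 * s) * \<beta> x" if s: "0 < s" "s <= \<delta>" for s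
    proof -
      have "AE z in lborel. z \<in> U -->
        ennreal ((u (z + s *\<^sub>R e) - u z)\<^sup>2)
          <= ennreal ((norm (s *\<^sub>R e))\<^sup>2) * (\<integral>\<^sup>+\<sigma>. indicator {0..1} \<sigma> * ennreal (sumsq v' (z + \<sigma> *\<^sub>R s *\<^sub>R e)) \<partial>lborel)"
      proof (rule increment_bound[OF \<omega> H U])
        fix z and \<sigma> :: real assume "z \<in> U" "0 <= \<sigma>" "\<sigma> <= 1"
        then have "z + (\<sigma> * s) *\<^sub>R e \<in> \<omega>" using s mult_mono[of \<sigma> 1 s \<delta>] by (intro inward) (auto simp: U_def)
        then show "z + \<sigma> *\<^sub>R s *\<^sub>R e \<in> \<omega>" by simp
      qed
      note inc = this
      have "AE x in lborel. AE t in lborel. G x + t *\<^sub>R e \<in> U -->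
        ennreal ((u (G x + t *\<^sub>R e + s *\<^sub>R e) - u (G x + t *\<^sub>R e))\<^sup>2)
          <= ennreal ((norm (s *\<^sub>R e))\<^sup>2) * (\<integral>\<^sup>+\<sigma>. indicator {0..1} \<sigma> * ennreal (sumsq v' (G x + t *\<^sub>R e + \<sigma> *\<^sub>R s *\<^sub>R e)) \<partial>lborel)"
        by (rule chart_AE[OF Gm coord inc])
      then show ?thesis
      proof eventually_elim
        case (elim x)
        then show ?case
        proof eventually_elim
          case (elim t)
          show ?case
          proof
            assume "G x + t *\<^sub>R e \<in> U"
            then have 1: "ennreal ((u (G x + t *\<^sub>R e + s *\<^sub>R e) - u (G x + t *\<^sub>R e))\<^sup>2)
              <= ennreal (s\<^sup>2) * (\<integral>\<^sup>+\<sigma>. indicator {0..1} \<sigma> * V (G x + t *\<^sub>R e + \<sigma> *\<^sub>R s *\<^sub>R e) \<partial>lborel)"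
              using elim e s by (simp add: V_def power_mult_distrib)
            have "(\<integral>\<^sup>+\<sigma>. indicator {0..1} \<sigma> * V (G x + t *\<^sub>R e + \<sigma> *\<^sub>R s *\<^sub>R e) \<partial>lborel)
              <= (\<integral>\<^sup>+\<sigma>. V (G x + (t + s * \<sigma>) *\<^sub>R e) \<partial>lborel)"
              by (intro nn_integral_mono) (auto simp: indicator_def algebra_simps)
            then have "ennreal s * (\<integral>\<^sup>+\<sigma>. indicator {0..1} \<sigma> * V (G x + t *\<^sub>R e + \<sigma> *\<^sub>R s *\<^sub>R e) \<partial>lborel)
              <= ennreal s * (\<integral>\<^sup>+\<sigma>. V (G x + (t + s * \<sigma>) *\<^sub>R e) \<partial>lborel)"
              by (intro mult_left_mono) auto
            also have "\<dots> = \<beta> x"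
              unfolding \<beta>_def using nn_integral_real_affine[of "\<lambda>t. V (G x + t *\<^sub>R e)" s t] s by simp
            finally have "ennreal s * (ennreal s * (\<integral>\<^sup>+\<sigma>. indicator {0..1} \<sigma> * V (G x + t *\<^sub>R e + \<sigma> *\<^sub>R s *\<^sub>R e) \<partial>lborel))
              <= ennreal s * \<beta> x" by (intro mult_left_mono) auto
            moreover have "ennreal (s\<^sup>2) = ennreal s * ennreal s" using s by (simp add: power2_eq_square ennreal_mult)
            ultimately have 2: "ennreal ((u (G x + t *\<^sub>R e + s *\<^sub>R e) - u (G x + t *\<^sub>R e))\<^sup>2) <= ennreal s * \<beta> x"
              using 1 by (simp add: mult.assoc)
            define A B where "A = u (G x + t *\<^sub>R e)" and "B = u (G x + t *\<^sub>R e + s *\<^sub>R e)"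
            have "A\<^sup>2 <= 2 * B\<^sup>2 + 2 * (B - A)\<^sup>2"
              using norm_add_sq_le[of B "A - B"] by (simp add: power2_commute)
            then have "ennreal (A\<^sup>2) <= ennreal (2 * B\<^sup>2 + 2 * (B - A)\<^sup>2)" by (rule ennreal_leI)
            also have "\<dots> = 2 * ennreal (B\<^sup>2) + 2 * ennreal ((B - A)\<^sup>2)" by (simp add: ennreal_mult)
            also have "\<dots> <= 2 * ennreal (B\<^sup>2) + 2 * (ennreal s * \<beta> x)"
              using 2 unfolding A_def B_def by (intro add_left_mono mult_left_mono) auto
            finally show "W (G x + t *\<^sub>R e) <= 2 * W (G x + (t + s) *\<^sub>R e) + ennreal (2 * s) * \<beta> x"
              using s unfolding A_def B_def W_def by (simp add: ennreal_mult mult.assoc scaleR_add_left add.assoc)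
          qed
        qed
      qed
    qed
    let ?I = "{a..b}" and ?slab = "\<lambda>\<tau>1 x. \<integral>\<^sup>+t. indicator {0<..<\<tau>1} t * W (G x + t *\<^sub>R e) \<partial>lborel"
      and ?shifted = "\<lambda>\<tau>1 s x. \<integral>\<^sup>+t. indicator {0<..<\<tau>1} t * (2 * W (G x + (t + s) *\<^sub>R e)) \<partial>lborel"
    have slab: "ennreal \<delta> * (\<integral>\<^sup>+x. indicator ?I x * ?slab \<tau>1 x \<partial>lborel)
        <= ennreal \<tau>1 * ennreal (2 * A0 + 2 * \<delta>\<^sup>2 * B0)" if \<tau>1: "0 < \<tau>1" "\<tau>1 <= \<tau>" for \<tau>1
    proof -
      define X where "X = (\<integral>\<^sup>+x. indicator ?I x * ?slab \<tau>1 x \<partial>lborel)"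
      have "X <= (\<integral>\<^sup>+x. ?shifted \<tau>1 s x + ennreal (2 * \<delta> * \<tau>1) * \<beta> x \<partial>lborel)"
        if s: "s \<in> {0<..\<delta>}" for s
        unfolding X_def
      proof (rule nn_integral_mono_AE)
        have "0 < s" "s <= \<delta>" using s by auto
        from step[OF this] show "AE x in lborel. indicator ?I x * ?slab \<tau>1 x
          <= ?shifted \<tau>1 s x + ennreal (2 * \<delta> * \<tau>1) * \<beta> x"
        proof eventually_elim
          case (elim x)
          show ?case
          proof (cases "x \<in> ?I")
            case True
            have "?slab \<tau>1 x
              <= (\<integral>\<^sup>+t. indicator {0<..<\<tau>1} t * (2 * W (G x + (t + s) *\<^sub>R e)) + ennreal (2 * \<delta>) * \<beta> x * indicator {0<..<\<tau>1} t \<partial>lborel)"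
            proof (rule nn_integral_mono_AE)
              show "AE t in lborel. indicator {0<..<\<tau>1} t * W (G x + t *\<^sub>R e)
                <= indicator {0<..<\<tau>1} t * (2 * W (G x + (t + s) *\<^sub>R e)) + ennreal (2 * \<delta>) * \<beta> x * indicator {0<..<\<tau>1} t"
                using elim
              proof eventually_elim
                case (elim t)
                show ?case
                proof (cases "t \<in> {0<..<\<tau>1}")
                  case t: True
                  then have "G x + t *\<^sub>R e \<in> U" using near[OF True, of t] \<tau>1 by (auto simp: U_def)
                  then have "W (G x + t *\<^sub>R e) <= 2 * W (G x + (t + s) *\<^sub>R e) + ennreal (2 * s) * \<beta> x" using elim by blast
                  also have "\<dots> <= 2 * W (G x + (t + s) *\<^sub>R e) + ennreal (2 * \<delta>) * \<beta> x"
                    using s by (intro add_left_mono mult_right_mono ennreal_leI) auto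
                  finally show ?thesis using t by simp
                qed simp
              qed
            qed
            also have "\<dots> = ?shifted \<tau>1 s x + ennreal (2 * \<delta>) * \<beta> x * ennreal \<tau>1"
              using \<tau>1 by (subst nn_integral_add) (auto simp: nn_integral_cmult_indicator)
            also have "ennreal (2 * \<delta>) * \<beta> x * ennreal \<tau>1 = ennreal (2 * \<delta> * \<tau>1) * \<beta> x"
              using pos \<tau>1 by (simp add: ennreal_mult mult.commute mult.left_commute)
            finally show ?thesis using True by simp
          qed simp
        qed
      qed
      then have "(\<integral>\<^sup>+s. X * indicator {0<..\<delta>} s \<partial>lborel)
         <= (\<integral>\<^sup>+s. indicator {0<..\<delta>} s * (\<integral>\<^sup>+x. ?shifted \<tau>1 s x + ennreal (2 * \<delta> * \<tau>1) * \<beta> x \<partial>lborel) \<partial>lborel)"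
        by (intro nn_integral_mono) (auto simp: indicator_def)
      also have "\<dots> = (\<integral>\<^sup>+s. indicator {0<..\<delta>} s * (\<integral>\<^sup>+x. ?shifted \<tau>1 s x \<partial>lborel)
          + indicator {0<..\<delta>} s * (ennreal (2 * \<delta> * \<tau>1) * ennreal B0) \<partial>lborel)"
        by (intro nn_integral_cong) (subst nn_integral_add, auto simp: nn_integral_cmult \<beta>B distrib_left)
      also have "\<dots> = (\<integral>\<^sup>+s. indicator {0<..\<delta>} s * (\<integral>\<^sup>+x. ?shifted \<tau>1 s x \<partial>lborel) \<partial>lborel)
          + (\<integral>\<^sup>+s. indicator {0<..\<delta>} s * (ennreal (2 * \<delta> * \<tau>1) * ennreal B0) \<partial>lborel)"
        by (rule nn_integral_add) auto
      also have "(\<integral>\<^sup>+s. indicator {0<..\<delta>} s * (ennreal (2 * \<delta> * \<tau>1) * ennreal B0) \<partial>lborel) = ennreal \<tau>1 * ennreal (2 * \<delta>\<^sup>2 * B0)"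
      proof -
        have "(\<integral>\<^sup>+s. indicator {0<..\<delta>} s * (ennreal (2 * \<delta> * \<tau>1) * ennreal B0) \<partial>lborel) = ennreal \<delta> * (ennreal (2 * \<delta> * \<tau>1) * ennreal B0)"
          using pos by (subst nn_integral_multc) auto
        also have "\<dots> = ennreal (\<delta> * (2 * \<delta> * \<tau>1 * B0))" using pos \<tau>1 AB by (simp add: ennreal_mult)
        also have "\<delta> * (2 * \<delta> * \<tau>1 * B0) = \<tau>1 * (2 * \<delta>\<^sup>2 * B0)" by (simp add: power2_eq_square)
        finally show ?thesis using pos \<tau>1 AB by (simp add: ennreal_mult)
      qed
      also have "(\<integral>\<^sup>+s. indicator {0<..\<delta>} s * (\<integral>\<^sup>+x. ?shifted \<tau>1 s x \<partial>lborel) \<partial>lborel)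
         <= ennreal \<tau>1 * ennreal (2 * A0)"
      proof -
        have "(\<integral>\<^sup>+s. indicator {0<..\<delta>} s * (\<integral>\<^sup>+x. ?shifted \<tau>1 s x \<partial>lborel) \<partial>lborel)
          <= (\<integral>\<^sup>+s. (\<integral>\<^sup>+x. ?shifted \<tau>1 s x \<partial>lborel) \<partial>lborel)"
          by (intro nn_integral_mono) (auto simp: indicator_def)
        also have "\<dots> = (\<integral>\<^sup>+x. (\<integral>\<^sup>+s. ?shifted \<tau>1 s x \<partial>lborel) \<partial>lborel)"
          by (rule lborel_pair.Fubini') measurable
        also have "\<dots> = (\<integral>\<^sup>+x. (\<integral>\<^sup>+t. (\<integral>\<^sup>+s. indicator {0<..<\<tau>1} t * (2 * W (G x + (t + s) *\<^sub>R e)) \<partial>lborel) \<partial>lborel) \<partial>lborel)"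
          by (intro nn_integral_cong lborel_pair.Fubini') measurable
        also have "\<dots> = (\<integral>\<^sup>+x. (\<integral>\<^sup>+t. indicator {0<..<\<tau>1} t * (2 * \<alpha> x) \<partial>lborel) \<partial>lborel)"
        proof (intro nn_integral_cong)
          fix x t :: real
          have "(\<integral>\<^sup>+s. W (G x + (s + t) *\<^sub>R e) \<partial>lborel) = \<alpha> x"
            unfolding \<alpha>_def by (rule lborel_nn_integral_shift) measurable
          then show "(\<integral>\<^sup>+s. indicator {0<..<\<tau>1} t * (2 * W (G x + (t + s) *\<^sub>R e)) \<partial>lborel) = indicator {0<..<\<tau>1} t * (2 * \<alpha> x)"
            by (simp add: nn_integral_cmult add.commute)
        qed
        also have "\<dots> = (\<integral>\<^sup>+x. ennreal \<tau>1 * (2 * \<alpha> x) \<partial>lborel)"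
          using \<tau>1 by (intro nn_integral_cong) (subst nn_integral_multc, auto)
        also have "\<dots> = ennreal \<tau>1 * (2 * ennreal A0)" by (simp add: nn_integral_cmult \<alpha>A)
        also have "2 * ennreal A0 = ennreal (2 * A0)" using AB by (simp add: ennreal_mult)
        finally show ?thesis .
      qed
      finally have "(\<integral>\<^sup>+s. X * indicator {0<..\<delta>} s \<partial>lborel) <= ennreal \<tau>1 * ennreal (2 * A0) + ennreal \<tau>1 * ennreal (2 * \<delta>\<^sup>2 * B0)"
        by (simp add: add_right_mono)
      moreover have "(\<integral>\<^sup>+s. X * indicator {0<..\<delta>} s \<partial>lborel) = X * ennreal \<delta>"
        using pos by (subst nn_integral_cmult_indicator) auto
      moreover have "ennreal \<tau>1 * ennreal (2 * A0) + ennreal \<tau>1 * ennreal (2 * \<delta>\<^sup>2 * B0) = ennreal \<tau>1 * ennreal (2 * A0 + 2 * \<delta>\<^sup>2 * B0)"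
        using AB by (simp add: distrib_left)
      ultimately show ?thesis unfolding X_def[symmetric] by (simp add: mult.commute)
    qed
    define Y where "Y = (\<integral>\<^sup>+x. indicator ?I x * ennreal ((w (G x))\<^sup>2) \<partial>lborel)"
    define wc where "wc z = indicator (closure \<omega>) z * w z" for z
    have wcm [measurable]: "wc \<in> borel_measurable borel"
      using borel_measurable_continuous_on_indicator[OF _ cw] by (simp add: wc_def[abs_def])
    have Yeq: "Y = (\<integral>\<^sup>+x. indicator ?I x * ennreal ((wc (G x))\<^sup>2) \<partial>lborel)"
      unfolding Y_def wc_def by (intro nn_integral_cong) (use Gcl in \<open>auto simp: indicator_def\<close>)
    have "ennreal \<delta> * Y <= ennreal (2 * A0 + 2 * \<delta>\<^sup>2 * B0)"
    proof (rule ennreal_le_epsilon)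
      fix \<epsilon>' :: real assume \<epsilon>': "\<epsilon>' > 0"
      define \<epsilon> where "\<epsilon> = \<epsilon>' / (\<delta> * (b - a))"
      have \<epsilon>: "\<epsilon> > 0" "\<delta> * (\<epsilon> * (b - a)) = \<epsilon>'" using \<epsilon>' pos ab by (auto simp: \<epsilon>_def)
      let ?q = "\<lambda>(x, t). (w (G x + t *\<^sub>R e))\<^sup>2"
      have inc: "G x + t *\<^sub>R e \<in> closure \<omega>" if "x \<in> ?I" "t \<in> {0..\<tau>}" for x t
        using near[OF that(1), of t] Gcl[OF that(1)] that(2) closure_subset by (cases "t = 0") auto
      have "uniformly_continuous_on (?I \<times> {0..\<tau>}) ?q"
      proof (rule compact_uniformly_continuous)
        show "continuous_on (?I \<times> {0..\<tau>}) ?q"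
          unfolding split_beta
          by (intro continuous_intros continuous_on_compose2[OF cw] continuous_on_compose2[OF cG]) (use inc in auto)
      qed (intro compact_Times compact_Icc)
      then obtain d where d: "d > 0" and dq: "\<And>q q'. q \<in> ?I \<times> {0..\<tau>} ==> q' \<in> ?I \<times> {0..\<tau>} ==> dist q' q < d ==> dist (?q q') (?q q) < \<epsilon>"
        unfolding uniformly_continuous_on_def using \<epsilon>(1) by meson
      define \<tau>1 where "\<tau>1 = min (d / 2) \<tau>"
      have \<tau>1: "0 < \<tau>1" "\<tau>1 <= \<tau>" "\<tau>1 < d" using d pos by (auto simp: \<tau>1_def)
      have pw: "ennreal ((wc (G x))\<^sup>2) <= W (G x + t *\<^sub>R e) + ennreal \<epsilon>" if x: "x \<in> ?I" and t: "t \<in> {0<..<\<tau>1}" for x t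
      proof -
        have "dist (?q (x, t)) (?q (x, 0)) < \<epsilon>"
          by (rule dq) (use x t \<tau>1 in \<open>auto simp: dist_prod_def\<close>)
        then have "(w (G x))\<^sup>2 <= (w (G x + t *\<^sub>R e))\<^sup>2 + \<epsilon>" by (auto simp: dist_real_def abs_less_iff)
        moreover have "G x + t *\<^sub>R e \<in> \<omega>" using near[OF x, of t] t \<tau>1 by auto
        moreover have "wc (G x) = w (G x)" using Gcl[OF x] by (simp add: wc_def)
        ultimately have "(wc (G x))\<^sup>2 <= (u (G x + t *\<^sub>R e))\<^sup>2 + \<epsilon>" by (simp add: u_def)
        then have "ennreal ((wc (G x))\<^sup>2) <= ennreal ((u (G x + t *\<^sub>R e))\<^sup>2 + \<epsilon>)" by (rule ennreal_leI)
        then show ?thesis using \<epsilon> by (simp add: W_def)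
      qed
      have "ennreal \<tau>1 * Y = (\<integral>\<^sup>+x. indicator ?I x * (\<integral>\<^sup>+t. ennreal ((wc (G x))\<^sup>2) * indicator {0<..<\<tau>1} t \<partial>lborel) \<partial>lborel)"
      proof -
        have c: "(\<integral>\<^sup>+t. c * indicator {0<..<\<tau>1} t \<partial>lborel) = c * ennreal \<tau>1" for c
          using \<tau>1 by (subst nn_integral_cmult_indicator) auto
        have "ennreal \<tau>1 * Y = (\<integral>\<^sup>+x. ennreal \<tau>1 * (indicator ?I x * ennreal ((wc (G x))\<^sup>2)) \<partial>lborel)"
          unfolding Yeq by (rule nn_integral_cmult[symmetric]) measurable
        also have "\<dots> = (\<integral>\<^sup>+x. indicator ?I x * (\<integral>\<^sup>+t. ennreal ((wc (G x))\<^sup>2) * indicator {0<..<\<tau>1} t \<partial>lborel) \<partial>lborel)"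
          unfolding c by (simp add: mult.commute mult.left_commute)
        finally show ?thesis .
      qed
      also have "\<dots> <= (\<integral>\<^sup>+x. indicator ?I x * (\<integral>\<^sup>+t. indicator {0<..<\<tau>1} t * W (G x + t *\<^sub>R e) + ennreal \<epsilon> * indicator {0<..<\<tau>1} t \<partial>lborel) \<partial>lborel)"
      proof (rule nn_integral_mono)
        fix x
        show "indicator ?I x * (\<integral>\<^sup>+t. ennreal ((wc (G x))\<^sup>2) * indicator {0<..<\<tau>1} t \<partial>lborel)
          <= indicator ?I x * (\<integral>\<^sup>+t. indicator {0<..<\<tau>1} t * W (G x + t *\<^sub>R e) + ennreal \<epsilon> * indicator {0<..<\<tau>1} t \<partial>lborel)"
        proof (cases "x \<in> ?I")
          case True
          have "(\<integral>\<^sup>+t. ennreal ((wc (G x))\<^sup>2) * indicator {0<..<\<tau>1} t \<partial>lborel)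
            <= (\<integral>\<^sup>+t. indicator {0<..<\<tau>1} t * W (G x + t *\<^sub>R e) + ennreal \<epsilon> * indicator {0<..<\<tau>1} t \<partial>lborel)"
          proof (rule nn_integral_mono)
            fix t
            show "ennreal ((wc (G x))\<^sup>2) * indicator {0<..<\<tau>1} t <= indicator {0<..<\<tau>1} t * W (G x + t *\<^sub>R e) + ennreal \<epsilon> * indicator {0<..<\<tau>1} t"
              using pw[OF True, of t] by (cases "t \<in> {0<..<\<tau>1}") auto
          qed
          then show ?thesis using True by simp
        qed simp
      qed
      also have "\<dots> = (\<integral>\<^sup>+x. indicator ?I x * ?slab \<tau>1 x + ennreal (\<epsilon> * \<tau>1) * indicator ?I x \<partial>lborel)"
      proof (rule nn_integral_cong)
        fix x
        have "(\<integral>\<^sup>+t. indicator {0<..<\<tau>1} t * W (G x + t *\<^sub>R e) + ennreal \<epsilon> * indicator {0<..<\<tau>1} t \<partial>lborel)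
          = ?slab \<tau>1 x + ennreal \<epsilon> * ennreal \<tau>1"
          using \<tau>1 by (subst nn_integral_add) (auto simp: nn_integral_cmult_indicator)
        then show "indicator ?I x * (\<integral>\<^sup>+t. indicator {0<..<\<tau>1} t * W (G x + t *\<^sub>R e) + ennreal \<epsilon> * indicator {0<..<\<tau>1} t \<partial>lborel)
          = indicator ?I x * ?slab \<tau>1 x + ennreal (\<epsilon> * \<tau>1) * indicator ?I x"
          using \<epsilon> \<tau>1 by (simp add: distrib_left ennreal_mult mult.commute)
      qed
      also have "\<dots> = (\<integral>\<^sup>+x. indicator ?I x * ?slab \<tau>1 x \<partial>lborel) + ennreal (\<epsilon> * \<tau>1) * ennreal (b - a)"
        using ab by (subst nn_integral_add) (auto simp: nn_integral_cmult_indicator)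
      finally have "ennreal \<delta> * (ennreal \<tau>1 * Y) <= ennreal \<delta> * ((\<integral>\<^sup>+x. indicator ?I x * ?slab \<tau>1 x \<partial>lborel) + ennreal (\<epsilon> * \<tau>1) * ennreal (b - a))"
        by (rule mult_left_mono) simp
      also have "\<dots> <= ennreal \<tau>1 * ennreal (2 * A0 + 2 * \<delta>\<^sup>2 * B0) + ennreal \<delta> * (ennreal (\<epsilon> * \<tau>1) * ennreal (b - a))"
        unfolding distrib_left by (intro add_right_mono slab \<tau>1)
      also have "ennreal \<delta> * (ennreal (\<epsilon> * \<tau>1) * ennreal (b - a)) = ennreal \<tau>1 * ennreal \<epsilon>'"
      proof -
        have "ennreal \<delta> * (ennreal (\<epsilon> * \<tau>1) * ennreal (b - a)) = ennreal (\<delta> * (\<epsilon> * \<tau>1 * (b - a)))"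
          using pos \<epsilon> \<tau>1 ab by (simp add: ennreal_mult)
        also have "\<delta> * (\<epsilon> * \<tau>1 * (b - a)) = \<tau>1 * \<epsilon>'" unfolding \<epsilon>(2)[symmetric] by (simp add: algebra_simps)
        finally show ?thesis using \<tau>1 \<epsilon>' by (simp add: ennreal_mult)
      qed
      finally have "ennreal \<tau>1 * (ennreal \<delta> * Y) <= ennreal \<tau>1 * (ennreal (2 * A0 + 2 * \<delta>\<^sup>2 * B0) + ennreal \<epsilon>')"
        by (simp add: distrib_left mult.left_commute)
      then show "ennreal \<delta> * Y <= ennreal (2 * A0 + 2 * \<delta>\<^sup>2 * B0) + ennreal \<epsilon>'"
        using \<tau>1 by (subst (asm) ennreal_mult_le_mult_iff) auto
    qed
    then have "ennreal (1 / \<delta>) * (ennreal \<delta> * Y) <= ennreal (1 / \<delta>) * ennreal (2 * A0 + 2 * \<delta>\<^sup>2 * B0)" by (rule mult_left_mono) simp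
    also have "\<dots> = ennreal (1 / \<delta> * (2 * A0 + 2 * \<delta>\<^sup>2 * B0))"
      using pos AB by (intro ennreal_mult[symmetric]) auto
    also have "ennreal (1 / \<delta>) * (ennreal \<delta> * Y) = ennreal (1 / \<delta> * \<delta>) * Y"
      using pos unfolding mult.assoc[symmetric] by (subst ennreal_mult) auto
    finally have Y: "Y <= ennreal ((2 * A0 + 2 * \<delta>\<^sup>2 * B0) / \<delta>)"
      using pos by simp
    have "(\<integral>\<^sup>+z. indicator (frontier \<omega> \<inter> ball p \<rho>) z * ennreal ((w z)\<^sup>2) \<partial>hausdorff1)
      <= (\<integral>\<^sup>+z. indicator (G ` ?I) z * ennreal ((wc z)\<^sup>2) \<partial>hausdorff1)"
    proof (rule nn_integral_mono)
      fix z
      show "indicator (frontier \<omega> \<inter> ball p \<rho>) z * ennreal ((w z)\<^sup>2) <= indicator (G ` ?I) z * ennreal ((wc z)\<^sup>2)"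
      proof (cases "z \<in> frontier \<omega> \<inter> ball p \<rho>")
        case True
        then have "z \<in> G ` ?I" "z \<in> closure \<omega>" using cover by (auto simp: frontier_def)
        then show ?thesis by (simp add: wc_def indicator_def)
      qed simp
    qed
    also have "\<dots> <= ennreal \<Lambda> * (\<integral>\<^sup>+x. indicator ?I x * ennreal ((wc (G x))\<^sup>2) \<partial>lborel)"
      by (rule nn_integral_lipschitz_curve[OF GL ab]) measurable
    also have "\<dots> <= ennreal \<Lambda> * ennreal ((2 * A0 + 2 * \<delta>\<^sup>2 * B0) / \<delta>)"
      unfolding Yeq[symmetric] by (intro mult_left_mono Y) simp
    also have "\<dots> = ennreal (\<Lambda> * ((2 * A0 + 2 * \<delta>\<^sup>2 * B0) / \<delta>))"
      using \<Lambda> AB pos by (intro ennreal_mult[symmetric]) auto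
    also have "\<dots> <= ennreal (C * (A0 + B0))"
    proof (rule ennreal_leI)
      have "(2 * A0 + 2 * \<delta>\<^sup>2 * B0) / \<delta> = 2 / \<delta> * A0 + 2 * \<delta> * B0" using pos by (simp add: field_simps power2_eq_square)
      also have "\<dots> <= (2 / \<delta> + 2 * \<delta>) * A0 + (2 / \<delta> + 2 * \<delta>) * B0"
        using AB pos by (intro add_mono mult_right_mono) auto
      finally show "\<Lambda> * ((2 * A0 + 2 * \<delta>\<^sup>2 * B0) / \<delta>) <= C * (A0 + B0)"
        unfolding C_def mult.assoc using \<Lambda> by (intro mult_left_mono) (auto simp: distrib_left)
    qed
    finally show ?thesis by (simp only: A0_def B0_def)
  qed
  have "C >= 0" unfolding C_def using \<Lambda> pos by simp
  then show ?thesis using pos(3) main by (intro exI[of _ \<rho>] exI[of _ C] conjI allI impI) auto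
qed


text \<open>Finitely many boundary charts cover the compact boundary.\<close>

lemma trace_inequality:
  assumes D: "bounded_lipschitz_domain \<omega>"
  shows "\<exists>C. C >= 0 \<and> (\<forall>w v. continuous_on (closure \<omega>) w --> (\<forall>i. is_weak_partial \<omega> i w (v i)) -->
     (\<integral>\<^sup>+z\<in>frontier \<omega>. ennreal ((w z)\<^sup>2) \<partial>hausdorff1)
       <= ennreal (C * (l2sq (leb \<omega>) w + (\<Sum>i\<in>UNIV. l2sq (leb \<omega>) (v i)))))"
proof -
  note \<omega> = lipschitz_domain_open_bounded[OF D]
  let ?N = "\<lambda>w v. l2sq (leb \<omega>) w + (\<Sum>i\<in>(UNIV::2 set). l2sq (leb \<omega>) (v i))"
  have "\<forall>p. \<exists>\<rho> C. p \<in> frontier \<omega> --> \<rho> > 0 \<and> C >= 0 \<and> (\<forall>w v. continuous_on (closure \<omega>) w --> (\<forall>i. is_weak_partial \<omega> i w (v i)) -->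
     (\<integral>\<^sup>+z. indicator (frontier \<omega> \<inter> ball p \<rho>) z * ennreal ((w z)\<^sup>2) \<partial>hausdorff1) <= ennreal (C * ?N w v))"
  proof
    fix p
    show "\<exists>\<rho> C. p \<in> frontier \<omega> --> \<rho> > 0 \<and> C >= 0 \<and> (\<forall>w v. continuous_on (closure \<omega>) w --> (\<forall>i. is_weak_partial \<omega> i w (v i)) -->
     (\<integral>\<^sup>+z. indicator (frontier \<omega> \<inter> ball p \<rho>) z * ennreal ((w z)\<^sup>2) \<partial>hausdorff1) <= ennreal (C * ?N w v))"
    proof (cases "p \<in> frontier \<omega>")
      case True
      from trace_inequality_local[OF D True] show ?thesis by (elim exE) (intro exI impI, assumption)
    qed simp
  qed
  then obtain \<rho> C where "\<forall>p. p \<in> frontier \<omega> --> \<rho> p > 0 \<and> C p >= 0 \<and> (\<forall>w v. continuous_on (closure \<omega>) w --> (\<forall>i. is_weak_partial \<omega> i w (v i)) -->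
     (\<integral>\<^sup>+z. indicator (frontier \<omega> \<inter> ball p (\<rho> p)) z * ennreal ((w z)\<^sup>2) \<partial>hausdorff1) <= ennreal (C p * ?N w v))"
    unfolding choice_iff by (elim exE)
  then have \<rho>: "\<And>p. p \<in> frontier \<omega> ==> \<rho> p > 0" and C: "\<And>p. p \<in> frontier \<omega> ==> C p >= 0"
    and T: "\<And>p w v. p \<in> frontier \<omega> ==> continuous_on (closure \<omega>) w ==> (\<forall>i. is_weak_partial \<omega> i w (v i)) ==>
     (\<integral>\<^sup>+z. indicator (frontier \<omega> \<inter> ball p (\<rho> p)) z * ennreal ((w z)\<^sup>2) \<partial>hausdorff1) <= ennreal (C p * ?N w v)"
    by auto
  have cpt: "compact (frontier \<omega>)" using \<omega>(2) by (rule compact_frontier_bounded)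
  have cov: "frontier \<omega> \<subseteq> (\<Union>p\<in>frontier \<omega>. ball p (\<rho> p))" using \<rho> by force
  obtain F where F: "F \<subseteq> frontier \<omega>" "finite F" "frontier \<omega> \<subseteq> (\<Union>p\<in>F. ball p (\<rho> p))"
    by (rule compactE_image[OF cpt _ cov]) auto
  show ?thesis
  proof (intro exI[of _ "\<Sum>p\<in>F. C p"] conjI allI impI)
    show "(\<Sum>p\<in>F. C p) >= 0" using C F(1) by (intro sum_nonneg) auto
    fix w v assume cw: "continuous_on (closure \<omega>) w" and wp: "\<forall>i. is_weak_partial \<omega> i w (v i)"
    define wc where "wc z = indicator (closure \<omega>) z * w z" for z
    have wcm [measurable]: "wc \<in> borel_measurable borel"
      using borel_measurable_continuous_on_indicator[OF _ cw] by (simp add: wc_def[abs_def])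
    have mH: "f \<in> borel_measurable hausdorff1 \<longleftrightarrow> f \<in> borel_measurable borel" for f :: "real^2 => ennreal"
      by (rule measurable_cong_sets[THEN arg_cong[where f="\<lambda>S. f \<in> S"]]) auto
    have fm [measurable]: "frontier \<omega> \<in> sets borel" by (simp add: borel_closed)
    have e: "indicator (frontier \<omega> \<inter> ball p (\<rho> p)) z * ennreal ((w z)\<^sup>2) = indicator (frontier \<omega> \<inter> ball p (\<rho> p)) z * ennreal ((wc z)\<^sup>2)" for p z
      by (auto simp: indicator_def wc_def frontier_def)
    have "(\<integral>\<^sup>+z\<in>frontier \<omega>. ennreal ((w z)\<^sup>2) \<partial>hausdorff1)
      <= (\<integral>\<^sup>+z. (\<Sum>p\<in>F. indicator (frontier \<omega> \<inter> ball p (\<rho> p)) z * ennreal ((w z)\<^sup>2)) \<partial>hausdorff1)"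
    proof (rule nn_integral_mono)
      fix z
      show "ennreal ((w z)\<^sup>2) * indicator (frontier \<omega>) z <= (\<Sum>p\<in>F. indicator (frontier \<omega> \<inter> ball p (\<rho> p)) z * ennreal ((w z)\<^sup>2))"
      proof (cases "z \<in> frontier \<omega>")
        case True
        then obtain p where p: "p \<in> F" "z \<in> ball p (\<rho> p)" using F(3) by blast
        have "ennreal ((w z)\<^sup>2) = indicator (frontier \<omega> \<inter> ball p (\<rho> p)) z * ennreal ((w z)\<^sup>2)" using True p by simp
        also have "\<dots> <= (\<Sum>p\<in>F. indicator (frontier \<omega> \<inter> ball p (\<rho> p)) z * ennreal ((w z)\<^sup>2))"
          using F(2) p by (intro member_le_sum) auto
        finally show ?thesis using True by simp
      qed simp
    qed
    also have "\<dots> = (\<Sum>p\<in>F. \<integral>\<^sup>+z. indicator (frontier \<omega> \<inter> ball p (\<rho> p)) z * ennreal ((w z)\<^sup>2) \<partial>hausdorff1)"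
      unfolding e
    proof (rule nn_integral_sum)
      fix p
      have [measurable]: "ball p (\<rho> p) \<in> sets borel" by simp
      show "(\<lambda>z. indicator (frontier \<omega> \<inter> ball p (\<rho> p)) z * ennreal ((wc z)\<^sup>2)) \<in> borel_measurable hausdorff1"
        unfolding mH by measurable
    qed
    also have "\<dots> <= (\<Sum>p\<in>F. ennreal (C p * ?N w v))"
      using F(1) by (intro sum_mono T cw wp) auto
    also have "\<dots> = ennreal (\<Sum>p\<in>F. C p * ?N w v)"
      using C F(1) by (intro sum_ennreal mult_nonneg_nonneg add_nonneg_nonneg sum_nonneg) auto
    finally show "(\<integral>\<^sup>+z\<in>frontier \<omega>. ennreal ((w z)\<^sup>2) \<partial>hausdorff1) <= ennreal ((\<Sum>p\<in>F. C p) * ?N w v)"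
      by (simp add: sum_distrib_right)
  qed
qed

section \<open>Traces\<close>

definition bd :: "(real^2) set => (real^2) measure" where
  "bd \<omega> = restrict_space hausdorff1 (frontier \<omega>)"

definition h1sq :: "(real^2) set => (real^2 => real) => real" where
  "h1sq \<omega> u = l2sq (leb \<omega>) u + (\<Sum>i\<in>UNIV. l2sq (leb \<omega>) (wpartial \<omega> i u))"

abbreviation "bdist \<omega> s t \<equiv> \<integral>\<^sup>+z. ennreal ((s z - t z)\<^sup>2) \<partial>bd \<omega>"

lemma h1sq_nonneg: "0 <= h1sq \<omega> u"
  by (auto simp: h1sq_def intro!: add_nonneg_nonneg sum_nonneg)

lemma sets_bd: "frontier \<omega> \<in> sets hausdorff1"
  by (simp add: borel_closed)

lemma borel_imp_bd: "f \<in> borel_measurable borel ==> f \<in> borel_measurable (bd \<omega>)" for f :: "real^2 => 'b::topological_space"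
  unfolding bd_def by (intro measurable_restrict_space1) (simp cong: measurable_cong_sets)

lemma continuous_imp_bd:
  fixes w :: "real^2 => real"
  assumes "continuous_on (closure \<omega>) w"
  shows "w \<in> borel_measurable (bd \<omega>)"
proof -
  have m: "(\<lambda>z. indicator (closure \<omega>) z * w z) \<in> borel_measurable borel"
    using borel_measurable_continuous_on_indicator[OF _ assms] by simp
  show ?thesis
    by (rule measurable_cong[THEN iffD1, OF _ borel_imp_bd[OF m]])
       (auto simp: bd_def space_restrict_space frontier_def)
qed

lemma bd_nn: "(\<integral>\<^sup>+z\<in>frontier \<omega>. f z \<partial>hausdorff1) = (\<integral>\<^sup>+z. f z \<partial>bd \<omega>)"
  unfolding bd_def using sets_bd by (simp add: nn_integral_restrict_space)

lemma nn_sq_triangle: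
  fixes f g :: "'a => real"
  assumes "f \<in> borel_measurable M" "g \<in> borel_measurable M"
  shows "(\<integral>\<^sup>+z. ennreal ((f z + g z)\<^sup>2) \<partial>M) <= 2 * (\<integral>\<^sup>+z. ennreal ((f z)\<^sup>2) \<partial>M) + 2 * (\<integral>\<^sup>+z. ennreal ((g z)\<^sup>2) \<partial>M)"
proof -
  have "(\<integral>\<^sup>+z. ennreal ((f z + g z)\<^sup>2) \<partial>M) <= (\<integral>\<^sup>+z. 2 * ennreal ((f z)\<^sup>2) + 2 * ennreal ((g z)\<^sup>2) \<partial>M)"
  proof (rule nn_integral_mono)
    fix z
    have "ennreal ((f z + g z)\<^sup>2) <= ennreal (2 * (f z)\<^sup>2 + 2 * (g z)\<^sup>2)"
      using norm_add_sq_le[of "f z" "g z"] by (intro ennreal_leI) simp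
    then show "ennreal ((f z + g z)\<^sup>2) <= 2 * ennreal ((f z)\<^sup>2) + 2 * ennreal ((g z)\<^sup>2)"
      by (simp add: ennreal_mult)
  qed
  also have "\<dots> = 2 * (\<integral>\<^sup>+z. ennreal ((f z)\<^sup>2) \<partial>M) + 2 * (\<integral>\<^sup>+z. ennreal ((g z)\<^sup>2) \<partial>M)"
    using assms by (simp add: nn_integral_add nn_integral_cmult)
  finally show ?thesis .
qed

lemma sobolevH1_weak: "u \<in> sobolevH 1 \<omega> ==> is_weak_partial \<omega> i u (wpartial \<omega> i u)"
  unfolding sobolevH1_iff by (elim exE) (rule is_weak_partial_wpartial, erule spec)

lemma sobolevH1_lincomb:
  assumes \<omega>: "open \<omega>" "bounded \<omega>" and u: "u \<in> sobolevH 1 \<omega>" "u' \<in> sobolevH 1 \<omega>"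
  shows "(\<lambda>x. a * u x + b * u' x) \<in> sobolevH 1 \<omega>"
    and "AE x in leb \<omega>. wpartial \<omega> i (\<lambda>x. a * u x + b * u' x) x = a * wpartial \<omega> i u x + b * wpartial \<omega> i u' x"
proof -
  have w: "is_weak_partial \<omega> i (\<lambda>x. a * u x + b * u' x) (\<lambda>x. a * wpartial \<omega> i u x + b * wpartial \<omega> i u' x)" for i
    by (rule is_weak_partial_lincomb[OF \<omega> sobolevH1_weak[OF u(1)] sobolevH1_weak[OF u(2)]])
  show "(\<lambda>x. a * u x + b * u' x) \<in> sobolevH 1 \<omega>"
    unfolding sobolevH1_iff by (rule exI[of _ "\<lambda>i x. a * wpartial \<omega> i u x + b * wpartial \<omega> i u' x"]) (use w in blast)
  show "AE x in leb \<omega>. wpartial \<omega> i (\<lambda>x. a * u x + b * u' x) x = a * wpartial \<omega> i u x + b * wpartial \<omega> i u' x"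
    by (rule wpartial_AE_eq[OF \<omega> w])
qed

lemma sobolevH1_sqint:
  assumes "u \<in> sobolevH 1 \<omega>"
  shows "sqint (leb \<omega>) u" "sqint (leb \<omega>) (wpartial \<omega> i u)"
  using is_weak_partial_sqint[OF sobolevH1_weak[OF assms, of i]] by auto

lemma h1sq_diff:
  assumes \<omega>: "open \<omega>" "bounded \<omega>" and u: "u \<in> sobolevH 1 \<omega>" "u' \<in> sobolevH 1 \<omega>"
  shows "(\<lambda>x. u x - u' x) \<in> sobolevH 1 \<omega>"
    and "h1sq \<omega> (\<lambda>x. u x - u' x) = l2sq (leb \<omega>) (\<lambda>x. u x - u' x)
      + (\<Sum>i\<in>UNIV. wdist \<omega> i u u')"
proof -
  have e: "(\<lambda>x. 1 * u x + (-1) * u' x) = (\<lambda>x. u x - u' x)" by auto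
  note L = sobolevH1_lincomb[OF \<omega> u, where a=1 and b="-1", unfolded e]
  show *: "(\<lambda>x. u x - u' x) \<in> sobolevH 1 \<omega>" by (rule L(1))
  have "l2sq (leb \<omega>) (wpartial \<omega> i (\<lambda>x. u x - u' x)) = wdist \<omega> i u u'" for i
  proof (rule l2sq_cong_AE)
    show "AE x in leb \<omega>. wpartial \<omega> i (\<lambda>x. u x - u' x) x = wpartial \<omega> i u x - wpartial \<omega> i u' x"
      using L(2)[of i] by eventually_elim simp
    show "wpartial \<omega> i (\<lambda>x. u x - u' x) \<in> borel_measurable (leb \<omega>)" by (rule sqintD(1)[OF sobolevH1_sqint(2)[OF *]])
    show "(\<lambda>x. wpartial \<omega> i u x - wpartial \<omega> i u' x) \<in> borel_measurable (leb \<omega>)"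
      by (rule sqintD(1)[OF sqint_diff[OF sobolevH1_sqint(2)[OF u(1)] sobolevH1_sqint(2)[OF u(2)]]])
  qed
  then show "h1sq \<omega> (\<lambda>x. u x - u' x) = l2sq (leb \<omega>) (\<lambda>x. u x - u' x)
      + (\<Sum>i\<in>UNIV. wdist \<omega> i u u')"
    by (simp add: h1sq_def)
qed

lemma h1sq_triangle:
  assumes \<omega>: "open \<omega>" "bounded \<omega>" and u: "u \<in> sobolevH 1 \<omega>" "v \<in> sobolevH 1 \<omega>" "w \<in> sobolevH 1 \<omega>"
  shows "h1sq \<omega> (\<lambda>x. u x - w x) <= 2 * h1sq \<omega> (\<lambda>x. u x - v x) + 2 * h1sq \<omega> (\<lambda>x. v x - w x)"
proof -
  let ?L = "leb \<omega>"
  have "l2sq ?L (\<lambda>x. u x - w x) <= 2 * l2sq ?L (\<lambda>x. u x - v x) + 2 * l2sq ?L (\<lambda>x. v x - w x)"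
    by (intro l2sq_triangle sobolevH1_sqint(1) u)
  moreover have "(\<Sum>i\<in>UNIV. wdist \<omega> i u w)
    <= (\<Sum>i\<in>UNIV. 2 * wdist \<omega> i u v + 2 * wdist \<omega> i v w)"
    by (intro sum_mono l2sq_triangle sobolevH1_sqint(2) u)
  ultimately show ?thesis
    unfolding h1sq_diff(2)[OF \<omega> u(1,3)] h1sq_diff(2)[OF \<omega> u(1,2)] h1sq_diff(2)[OF \<omega> u(2,3)]
    by (simp add: sum.distrib sum_distrib_left[symmetric])
qed

lemma is_trace_iff:
  assumes \<omega>: "open \<omega>" "bounded \<omega>"
  shows "is_trace \<omega> u t \<longleftrightarrow> u \<in> sobolevH 1 \<omega> \<and> t \<in> borel_measurable borel \<and>
     (\<exists>w :: nat => real^2 => real. (\<forall>k. w k \<in> sobolevH 1 \<omega> \<and> continuous_on (closure \<omega>) (w k)) \<and>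
        (\<lambda>k. h1sq \<omega> (\<lambda>x. w k x - u x)) \<longlonglongrightarrow> 0 \<and>
        (\<lambda>k. bdist \<omega> (w k) t) \<longlonglongrightarrow> 0)"
proof -
  have eq: "((\<lambda>k. LINT x|leb \<omega>. (w k x - u x)\<^sup>2) \<longlonglongrightarrow> 0 \<and>
        (\<forall>i. (\<lambda>k. LINT x|leb \<omega>. (wpartial \<omega> i (w k) x - wpartial \<omega> i u x)\<^sup>2) \<longlonglongrightarrow> 0))
      \<longleftrightarrow> (\<lambda>k. h1sq \<omega> (\<lambda>x. w k x - u x)) \<longlonglongrightarrow> 0"
    if u: "u \<in> sobolevH 1 \<omega>" and w: "\<forall>k. w k \<in> sobolevH 1 \<omega>" for w :: "nat => real^2 => real"
  proof
    assume "(\<lambda>k. LINT x|leb \<omega>. (w k x - u x)\<^sup>2) \<longlonglongrightarrow> 0 \<and>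
        (\<forall>i. (\<lambda>k. LINT x|leb \<omega>. (wpartial \<omega> i (w k) x - wpartial \<omega> i u x)\<^sup>2) \<longlonglongrightarrow> 0)"
    then have "(\<lambda>k. l2sq (leb \<omega>) (\<lambda>x. w k x - u x)
      + (\<Sum>i\<in>UNIV. wdist \<omega> i (w k) u)) \<longlonglongrightarrow> 0 + (\<Sum>i\<in>(UNIV::2 set). 0)"
      unfolding l2sq_real by (intro tendsto_add tendsto_sum) auto
    then show "(\<lambda>k. h1sq \<omega> (\<lambda>x. w k x - u x)) \<longlonglongrightarrow> 0"
      using h1sq_diff(2)[OF \<omega> _ u] w by simp
  next
    assume h: "(\<lambda>k. h1sq \<omega> (\<lambda>x. w k x - u x)) \<longlonglongrightarrow> 0"
    have le: "l2sq (leb \<omega>) (\<lambda>x. w k x - u x) <= h1sq \<omega> (\<lambda>x. w k x - u x)"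
      "wdist \<omega> i (w k) u <= h1sq \<omega> (\<lambda>x. w k x - u x)" for k i
    proof -
      have m: "wdist \<omega> i (w k) u
        <= (\<Sum>i\<in>UNIV. wdist \<omega> i (w k) u)"
        by (intro member_le_sum) auto
      have "(0::real) <= (\<Sum>i\<in>UNIV. wdist \<omega> i (w k) u)"
        by (intro sum_nonneg) auto
      then show "l2sq (leb \<omega>) (\<lambda>x. w k x - u x) <= h1sq \<omega> (\<lambda>x. w k x - u x)"
        "wdist \<omega> i (w k) u <= h1sq \<omega> (\<lambda>x. w k x - u x)"
        using m l2sq_nonneg[of "leb \<omega>" "\<lambda>x. w k x - u x"] h1sq_diff(2)[OF \<omega> w[rule_format, of k] u] by linarith+
    qed
    show "(\<lambda>k. LINT x|leb \<omega>. (w k x - u x)\<^sup>2) \<longlonglongrightarrow> 0 \<and>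
        (\<forall>i. (\<lambda>k. LINT x|leb \<omega>. (wpartial \<omega> i (w k) x - wpartial \<omega> i u x)\<^sup>2) \<longlonglongrightarrow> 0)"
      unfolding l2sq_real[symmetric]
    proof (intro conjI allI)
      show "(\<lambda>k. l2sq (leb \<omega>) (\<lambda>x. w k x - u x)) \<longlonglongrightarrow> 0"
        by (rule tendsto_sandwich[OF _ _ tendsto_const h]) (auto intro!: always_eventually le)
      show "(\<lambda>k. wdist \<omega> i (w k) u) \<longlonglongrightarrow> 0" for i
        by (rule tendsto_sandwich[OF _ _ tendsto_const h]) (auto intro!: always_eventually le)
    qed
  qed
  show ?thesis
    unfolding is_trace_def bd_nn
  proof (intro iffI; elim conjE exE; intro conjI exI)
    fix w :: "nat => real^2 => real"
    assume u: "u \<in> sobolevH 1 \<omega>" and w: "\<forall>k. w k \<in> sobolevH 1 \<omega> \<and> continuous_on (closure \<omega>) (w k)"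
    have wH: "\<forall>k. w k \<in> sobolevH 1 \<omega>" using w by blast
    { assume "(\<lambda>k. LINT x|leb \<omega>. (w k x - u x)\<^sup>2) \<longlonglongrightarrow> 0"
        "\<forall>i. (\<lambda>k. LINT x|leb \<omega>. (wpartial \<omega> i (w k) x - wpartial \<omega> i u x)\<^sup>2) \<longlonglongrightarrow> 0"
      then show "(\<lambda>k. h1sq \<omega> (\<lambda>x. w k x - u x)) \<longlonglongrightarrow> 0" using eq[OF u wH] by blast }
    { assume "(\<lambda>k. h1sq \<omega> (\<lambda>x. w k x - u x)) \<longlonglongrightarrow> 0"
      then show "(\<lambda>k. LINT x|leb \<omega>. (w k x - u x)\<^sup>2) \<longlonglongrightarrow> 0"
        "\<forall>i. (\<lambda>k. LINT x|leb \<omega>. (wpartial \<omega> i (w k) x - wpartial \<omega> i u x)\<^sup>2) \<longlonglongrightarrow> 0"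
        using eq[OF u wH] by blast+ }
  qed
qed

lemma trace_inequality_h1:
  assumes D: "bounded_lipschitz_domain \<omega>"
  shows "\<exists>C. C >= 0 \<and> (\<forall>w \<in> sobolevH 1 \<omega>. continuous_on (closure \<omega>) w -->
     (\<integral>\<^sup>+z. ennreal ((w z)\<^sup>2) \<partial>bd \<omega>) <= ennreal (C * h1sq \<omega> w))"
proof -
  obtain C where C: "C >= 0" and T: "\<forall>w v. continuous_on (closure \<omega>) w --> (\<forall>i. is_weak_partial \<omega> i w (v i)) -->
     (\<integral>\<^sup>+z\<in>frontier \<omega>. ennreal ((w z)\<^sup>2) \<partial>hausdorff1)
       <= ennreal (C * (l2sq (leb \<omega>) w + (\<Sum>i\<in>UNIV. l2sq (leb \<omega>) (v i))))"
    using trace_inequality[OF D] by (elim exE conjE)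
  show ?thesis
  proof (intro exI[of _ C] conjI C ballI impI)
    fix w assume w: "w \<in> sobolevH 1 \<omega>" "continuous_on (closure \<omega>) w"
    show "(\<integral>\<^sup>+z. ennreal ((w z)\<^sup>2) \<partial>bd \<omega>) <= ennreal (C * h1sq \<omega> w)"
      using T[rule_format, OF w(2), of "\<lambda>i. wpartial \<omega> i w"] sobolevH1_weak[OF w(1)] by (simp add: h1sq_def bd_nn)
  qed
qed

lemma trace_bound:
  assumes D: "bounded_lipschitz_domain \<omega>"
  shows "\<exists>C. C >= 0 \<and> (\<forall>u t. is_trace \<omega> u t --> (\<integral>\<^sup>+z. ennreal ((t z)\<^sup>2) \<partial>bd \<omega>) <= ennreal (C * h1sq \<omega> u))"
proof -
  note \<omega> = lipschitz_domain_open_bounded[OF D]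
  obtain C where C: "C >= 0" and T: "\<forall>w \<in> sobolevH 1 \<omega>. continuous_on (closure \<omega>) w -->
     (\<integral>\<^sup>+z. ennreal ((w z)\<^sup>2) \<partial>bd \<omega>) <= ennreal (C * h1sq \<omega> w)"
    using trace_inequality_h1[OF D] by (elim exE conjE)
  show ?thesis
  proof (intro exI[of _ "4 * C"] conjI allI impI)
    show "0 <= 4 * C" using C by simp
    fix u t assume "is_trace \<omega> u t"
    then obtain w where u: "u \<in> sobolevH 1 \<omega>" and t: "t \<in> borel_measurable borel"
      and w: "\<forall>k. w k \<in> sobolevH 1 \<omega> \<and> continuous_on (closure \<omega>) (w k)"
      and wu: "(\<lambda>k. h1sq \<omega> (\<lambda>x. w k x - u x)) \<longlonglongrightarrow> 0"
      and wt: "(\<lambda>k. bdist \<omega> (w k) t) \<longlonglongrightarrow> 0"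
      unfolding is_trace_iff[OF \<omega>] by blast
    have z: "(\<lambda>x. 0) \<in> sobolevH 1 \<omega>"
      using sobolevH1_lincomb(1)[OF \<omega> u u, where a=0 and b=0] by simp
    have le: "(\<integral>\<^sup>+z. ennreal ((t z)\<^sup>2) \<partial>bd \<omega>)
      <= 2 * (bdist \<omega> (w k) t) + 2 * ennreal (C * (2 * h1sq \<omega> (\<lambda>x. w k x - u x) + 2 * h1sq \<omega> u))" for k
    proof -
      have wk: "w k \<in> sobolevH 1 \<omega>" "continuous_on (closure \<omega>) (w k)" using w by auto
      have wm: "w k \<in> borel_measurable (bd \<omega>)" by (rule continuous_imp_bd[OF wk(2)])
      have tm: "t \<in> borel_measurable (bd \<omega>)" by (rule borel_imp_bd[OF t])
      have "(\<integral>\<^sup>+z. ennreal ((t z)\<^sup>2) \<partial>bd \<omega>) = (\<integral>\<^sup>+z. ennreal (((t z - w k z) + w k z)\<^sup>2) \<partial>bd \<omega>)" by simp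
      also have "\<dots> <= 2 * (bdist \<omega> t (w k)) + 2 * (\<integral>\<^sup>+z. ennreal ((w k z)\<^sup>2) \<partial>bd \<omega>)"
        using wm tm by (intro nn_sq_triangle) auto
      also have "(bdist \<omega> t (w k)) = (bdist \<omega> (w k) t)"
        by (simp add: power2_commute)
      also have "(\<integral>\<^sup>+z. ennreal ((w k z)\<^sup>2) \<partial>bd \<omega>) <= ennreal (C * h1sq \<omega> (w k))" using T wk by blast
      also have "h1sq \<omega> (w k) <= 2 * h1sq \<omega> (\<lambda>x. w k x - u x) + 2 * h1sq \<omega> u"
        using h1sq_triangle[OF \<omega> wk(1) u z] by simp
      finally show ?thesis using C by (simp add: add_left_mono mult_left_mono ennreal_leI)
    qed
    have "(\<lambda>k. 2 * (bdist \<omega> (w k) t) + 2 * ennreal (C * (2 * h1sq \<omega> (\<lambda>x. w k x - u x) + 2 * h1sq \<omega> u)))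
      \<longlonglongrightarrow> 2 * 0 + 2 * ennreal (C * (2 * 0 + 2 * h1sq \<omega> u))"
      by (intro tendsto_add ennreal_tendsto_cmult tendsto_ennrealI tendsto_mult tendsto_const wt wu) auto
    then have "(\<integral>\<^sup>+z. ennreal ((t z)\<^sup>2) \<partial>bd \<omega>) <= 2 * 0 + 2 * ennreal (C * (2 * 0 + 2 * h1sq \<omega> u))"
      by (rule LIMSEQ_le_const) (use le in auto)
    also have "\<dots> = ennreal (2 * (C * (2 * h1sq \<omega> u)))"
      using C h1sq_nonneg[of \<omega> u] by (subst ennreal_mult) auto
    finally show "(\<integral>\<^sup>+z. ennreal ((t z)\<^sup>2) \<partial>bd \<omega>) <= ennreal (4 * C * h1sq \<omega> u)" by (simp add: mult.assoc)
  qed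
qed

lemma is_trace_continuous:
  assumes \<omega>: "open \<omega>" "bounded \<omega>" and u: "u \<in> sobolevH 1 \<omega>" and w: "w \<in> sobolevH 1 \<omega>" "continuous_on (closure \<omega>) w"
    and uw: "AE x in leb \<omega>. u x = w x"
  shows "is_trace \<omega> u (\<lambda>z. indicator (closure \<omega>) z * w z)"
proof -
  have h0: "h1sq \<omega> (\<lambda>x. w x - u x) = 0"
  proof -
    have "AE x in leb \<omega>. wpartial \<omega> i w x - wpartial \<omega> i u x = 0" for i
    proof -
      have "is_weak_partial \<omega> i w (wpartial \<omega> i u)"
        by (rule is_weak_partial_cong_AE[OF sobolevH1_weak[OF u] uw])
           (auto intro: sqintD(1)[OF sobolevH1_sqint(1)[OF w(1)]] sqintD(1)[OF sobolevH1_sqint(2)[OF u]])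
      from wpartial_AE_eq[OF \<omega> this] show ?thesis by eventually_elim simp
    qed
    then have "wdist \<omega> i w u = 0" for i
      unfolding l2sq_real by (intro integral_eq_zero_AE) (auto elim!: eventually_mono)
    moreover have "AE x in leb \<omega>. w x - u x = 0" using uw by eventually_elim simp
    then have "l2sq (leb \<omega>) (\<lambda>x. w x - u x) = 0"
      unfolding l2sq_real by (intro integral_eq_zero_AE) (auto elim!: eventually_mono)
    ultimately show ?thesis unfolding h1sq_diff(2)[OF \<omega> w(1) u] by simp
  qed
  have "(\<integral>\<^sup>+z. ennreal ((w z - indicator (closure \<omega>) z * w z)\<^sup>2) \<partial>bd \<omega>) = (\<integral>\<^sup>+z. 0 \<partial>bd \<omega>)"
    by (rule nn_integral_cong) (auto simp: bd_def space_restrict_space frontier_def)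
  then have "(\<integral>\<^sup>+z. ennreal ((w z - indicator (closure \<omega>) z * w z)\<^sup>2) \<partial>bd \<omega>) = 0" by simp
  moreover have "(\<lambda>z. indicator (closure \<omega>) z * w z) \<in> borel_measurable borel"
    using borel_measurable_continuous_on_indicator[OF _ w(2)] by simp
  ultimately show ?thesis
    unfolding is_trace_iff[OF \<omega>] using u w h0 by (intro conjI exI[of _ "\<lambda>_. w"]) auto
qed

lemma is_trace_lincomb:
  assumes \<omega>: "open \<omega>" "bounded \<omega>" and 1: "is_trace \<omega> u s" and 2: "is_trace \<omega> v t"
  shows "is_trace \<omega> (\<lambda>x. a * u x + b * v x) (\<lambda>z. a * s z + b * t z)"
proof -
  obtain w where u: "u \<in> sobolevH 1 \<omega>" and s: "s \<in> borel_measurable borel"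
    and w: "\<forall>k. w k \<in> sobolevH 1 \<omega> \<and> continuous_on (closure \<omega>) (w k)"
    and wu: "(\<lambda>k. h1sq \<omega> (\<lambda>x. w k x - u x)) \<longlonglongrightarrow> 0"
    and ws: "(\<lambda>k. bdist \<omega> (w k) s) \<longlonglongrightarrow> 0"
    using 1 unfolding is_trace_iff[OF \<omega>] by blast
  obtain w' where v: "v \<in> sobolevH 1 \<omega>" and t: "t \<in> borel_measurable borel"
    and w': "\<forall>k. w' k \<in> sobolevH 1 \<omega> \<and> continuous_on (closure \<omega>) (w' k)"
    and wv: "(\<lambda>k. h1sq \<omega> (\<lambda>x. w' k x - v x)) \<longlonglongrightarrow> 0"
    and wt: "(\<lambda>k. bdist \<omega> (w' k) t) \<longlonglongrightarrow> 0"
    using 2 unfolding is_trace_iff[OF \<omega>] by blast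
  let ?L = "leb \<omega>"
  have uv: "(\<lambda>x. a * u x + b * v x) \<in> sobolevH 1 \<omega>" by (rule sobolevH1_lincomb(1)[OF \<omega> u v])
  have ww: "(\<lambda>x. a * w k x + b * w' k x) \<in> sobolevH 1 \<omega>" for k using w w' by (intro sobolevH1_lincomb(1)[OF \<omega>]) auto
  have hle: "h1sq \<omega> (\<lambda>x. (a * w k x + b * w' k x) - (a * u x + b * v x))
      <= 2 * a\<^sup>2 * h1sq \<omega> (\<lambda>x. w k x - u x) + 2 * b\<^sup>2 * h1sq \<omega> (\<lambda>x. w' k x - v x)" for k
  proof -
    have wk: "w k \<in> sobolevH 1 \<omega>" "w' k \<in> sobolevH 1 \<omega>" using w w' by auto
    have gen: "l2sq ?L f <= 2 * a\<^sup>2 * l2sq ?L f1 + 2 * b\<^sup>2 * l2sq ?L f2"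
      if "sqint ?L f" "sqint ?L f1" "sqint ?L f2" "AE x in ?L. f x = a * f1 x + b * f2 x" for f f1 f2 :: "real^2 => real"
    proof -
      have sq: "sqint ?L (\<lambda>x. a * f1 x)" "sqint ?L (\<lambda>x. b * f2 x)" using that by (auto intro: sqint_cmult)
      have "l2sq ?L f = l2sq ?L (\<lambda>x. a * f1 x + b * f2 x)"
        using that(4) sqintD(1)[OF that(1)] sqintD(1)[OF sqint_add[OF sq]] by (rule l2sq_cong_AE)
      also have "\<dots> <= 2 * l2sq ?L (\<lambda>x. a * f1 x) + 2 * l2sq ?L (\<lambda>x. b * f2 x)" by (rule l2sq_add_le[OF sq])
      finally show ?thesis by (simp add: l2sq_cmult)
    qed
    have 1: "l2sq ?L (\<lambda>x. (a * w k x + b * w' k x) - (a * u x + b * v x)) <= 2 * a\<^sup>2 * l2sq ?L (\<lambda>x. w k x - u x) + 2 * b\<^sup>2 * l2sq ?L (\<lambda>x. w' k x - v x)"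
      by (intro gen sqint_diff sobolevH1_sqint(1) ww uv wk u v) (auto simp: algebra_simps)
    have 2: "wdist \<omega> i (\<lambda>x. a * w k x + b * w' k x) (\<lambda>x. a * u x + b * v x)
       <= 2 * a\<^sup>2 * wdist \<omega> i (w k) u + 2 * b\<^sup>2 * wdist \<omega> i (w' k) v" for i
    proof (intro gen sqint_diff sobolevH1_sqint(2) ww uv wk u v)
      show "AE x in ?L. wpartial \<omega> i (\<lambda>x. a * w k x + b * w' k x) x - wpartial \<omega> i (\<lambda>x. a * u x + b * v x) x
        = a * (wpartial \<omega> i (w k) x - wpartial \<omega> i u x) + b * (wpartial \<omega> i (w' k) x - wpartial \<omega> i v x)"
        using sobolevH1_lincomb(2)[OF \<omega> wk, where i=i and a=a and b=b] sobolevH1_lincomb(2)[OF \<omega> u v, where i=i and a=a and b=b]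
        by eventually_elim (simp add: algebra_simps)
    qed
    have "(\<Sum>i\<in>UNIV. wdist \<omega> i (\<lambda>x. a * w k x + b * w' k x) (\<lambda>x. a * u x + b * v x))
      <= (\<Sum>i\<in>UNIV. 2 * a\<^sup>2 * wdist \<omega> i (w k) u + 2 * b\<^sup>2 * wdist \<omega> i (w' k) v)"
      by (intro sum_mono 2)
    then show ?thesis using 1
      unfolding h1sq_diff(2)[OF \<omega> ww uv] h1sq_diff(2)[OF \<omega> wk(1) u] h1sq_diff(2)[OF \<omega> wk(2) v]
      by (simp add: sum.distrib sum_distrib_left[symmetric] distrib_left)
  qed
  have h: "(\<lambda>k. h1sq \<omega> (\<lambda>x. (a * w k x + b * w' k x) - (a * u x + b * v x))) \<longlonglongrightarrow> 0"
  proof (rule tendsto_sandwich[OF _ _ tendsto_const])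
    show "(\<lambda>k. 2 * a\<^sup>2 * h1sq \<omega> (\<lambda>x. w k x - u x) + 2 * b\<^sup>2 * h1sq \<omega> (\<lambda>x. w' k x - v x)) \<longlonglongrightarrow> 0"
      using tendsto_add[OF tendsto_mult_right_zero[OF wu] tendsto_mult_right_zero[OF wv]] by simp
  qed (auto intro!: always_eventually hle h1sq_nonneg)
  have t0: "(\<lambda>k. \<integral>\<^sup>+z. ennreal (((a * w k z + b * w' k z) - (a * s z + b * t z))\<^sup>2) \<partial>bd \<omega>) \<longlonglongrightarrow> 0"
  proof (rule tendsto_sandwich[OF _ _ tendsto_const])
    have "(\<lambda>k. 2 * (ennreal (a\<^sup>2) * (bdist \<omega> (w k) s)) + 2 * (ennreal (b\<^sup>2) * (bdist \<omega> (w' k) t)))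
      \<longlonglongrightarrow> 2 * (ennreal (a\<^sup>2) * 0) + 2 * (ennreal (b\<^sup>2) * 0)"
      by (intro tendsto_add ennreal_tendsto_cmult ws wt) auto
    then show "(\<lambda>k. 2 * (ennreal (a\<^sup>2) * (bdist \<omega> (w k) s)) + 2 * (ennreal (b\<^sup>2) * (bdist \<omega> (w' k) t))) \<longlonglongrightarrow> 0"
      by simp
    have "(\<integral>\<^sup>+z. ennreal (((a * w k z + b * w' k z) - (a * s z + b * t z))\<^sup>2) \<partial>bd \<omega>)
      <= 2 * (ennreal (a\<^sup>2) * (bdist \<omega> (w k) s)) + 2 * (ennreal (b\<^sup>2) * (bdist \<omega> (w' k) t))" for k
    proof -
      have m: "(\<lambda>z. w k z - s z) \<in> borel_measurable (bd \<omega>)" "(\<lambda>z. w' k z - t z) \<in> borel_measurable (bd \<omega>)"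
        using borel_measurable_diff[OF continuous_imp_bd borel_imp_bd[OF s], of \<omega> "w k"]
          borel_measurable_diff[OF continuous_imp_bd borel_imp_bd[OF t], of \<omega> "w' k"] w w' by auto
      have "(a * w k z + b * w' k z) - (a * s z + b * t z) = a * (w k z - s z) + b * (w' k z - t z)" for z
        by (simp add: algebra_simps)
      then have "(\<integral>\<^sup>+z. ennreal (((a * w k z + b * w' k z) - (a * s z + b * t z))\<^sup>2) \<partial>bd \<omega>)
        <= 2 * (\<integral>\<^sup>+z. ennreal ((a * (w k z - s z))\<^sup>2) \<partial>bd \<omega>) + 2 * (\<integral>\<^sup>+z. ennreal ((b * (w' k z - t z))\<^sup>2) \<partial>bd \<omega>)"
        using m by (simp only:) (intro nn_sq_triangle borel_measurable_times borel_measurable_const)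
      then show ?thesis
        using m by (simp add: power_mult_distrib ennreal_mult nn_integral_cmult)
    qed
    then show "\<forall>\<^sub>F k in sequentially. (\<integral>\<^sup>+z. ennreal (((a * w k z + b * w' k z) - (a * s z + b * t z))\<^sup>2) \<partial>bd \<omega>)
      <= 2 * (ennreal (a\<^sup>2) * (bdist \<omega> (w k) s)) + 2 * (ennreal (b\<^sup>2) * (bdist \<omega> (w' k) t))"
      by (intro always_eventually allI)
  qed auto
  show ?thesis
    unfolding is_trace_iff[OF \<omega>]
  proof (intro conjI exI[of _ "\<lambda>k x. a * w k x + b * w' k x"] allI uv ww h t0)
    show "(\<lambda>z. a * s z + b * t z) \<in> borel_measurable borel" using s t by measurable
    show "continuous_on (closure \<omega>) (\<lambda>x. a * w k x + b * w' k x)" for k using w w' by (intro continuous_intros) auto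
  qed
qed

text \<open>The length measure is defined on the Borel sets only; an exceptional set is
  contained in a Borel null set, which gives back a statement on the outer measure.\<close>

lemma AE_bd_hausdorff_outer:
  assumes "AE z in bd \<omega>. P z"
  shows "hausdorff_outer {z \<in> frontier \<omega>. \<not> P z} = 0"
proof -
  obtain N where N: "{z \<in> space (bd \<omega>). \<not> P z} \<subseteq> N" "emeasure (bd \<omega>) N = 0" "N \<in> sets (bd \<omega>)"
    by (rule AE_E[OF assms])
  have sp: "space (bd \<omega>) = frontier \<omega>" by (simp add: bd_def space_restrict_space hausdorff1_def)
  have NB: "N \<in> sets borel" "N \<subseteq> frontier \<omega>"
    using N(3) sets_bd[of \<omega>] sets.sets_into_space[OF N(3)] by (auto simp: bd_def sets_restrict_space sp[unfolded bd_def])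
  have "emeasure (bd \<omega>) N = hausdorff_outer N"
    unfolding bd_def using NB sets_bd[of \<omega>] by (simp add: emeasure_restrict_space emeasure_hausdorff1)
  then have "hausdorff_outer N = 0" using N by simp
  then show ?thesis using hausdorff_outer_mono[OF N(1)] by (simp add: sp)
qed

text \<open>By linearity the difference of two traces is a trace of zero, and the trace bound
  applies to it.\<close>

lemma is_trace_unique:
  assumes D: "bounded_lipschitz_domain \<omega>" and st: "is_trace \<omega> u s" "is_trace \<omega> u t"
  shows "hausdorff_outer {z \<in> frontier \<omega>. s z \<noteq> t z} = 0"
proof -
  note \<omega> = lipschitz_domain_open_bounded[OF D]
  obtain C where T: "\<forall>u t. is_trace \<omega> u t --> (\<integral>\<^sup>+z. ennreal ((t z)\<^sup>2) \<partial>bd \<omega>) <= ennreal (C * h1sq \<omega> u)"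
    using trace_bound[OF D] by (elim exE conjE)
  have u: "u \<in> sobolevH 1 \<omega>" using st by (simp add: is_trace_def)
  have m: "s \<in> borel_measurable (bd \<omega>)" "t \<in> borel_measurable (bd \<omega>)"
    using st by (auto simp: is_trace_def intro: borel_imp_bd)
  have "is_trace \<omega> (\<lambda>x. u x - u x) (\<lambda>z. s z - t z)"
    using is_trace_lincomb[OF \<omega> st, where a=1 and b="-1"] by simp
  then have "(bdist \<omega> s t) <= ennreal (C * h1sq \<omega> (\<lambda>x. u x - u x))" using T by blast
  also have "h1sq \<omega> (\<lambda>x. u x - u x) = 0" unfolding h1sq_diff(2)[OF \<omega> u u] by (simp add: l2sq_def)
  finally have "(bdist \<omega> s t) = 0" by simp
  then have "AE z in bd \<omega>. s z = t z"
    using m by (subst (asm) nn_integral_0_iff_AE) auto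
  from AE_bd_hausdorff_outer[OF this] show ?thesis .
qed

lemma l2sq_nn:
  fixes f :: "'a => real"
  assumes "sqint M f"
  shows "(\<integral>\<^sup>+z. ennreal ((f z)\<^sup>2) \<partial>M) = ennreal (l2sq M f)"
  unfolding l2sq_real using sqintD(2)[OF assms] by (intro nn_integral_eq_integral) auto

text \<open>Each term is replaced by a continuous function close to it both in $H^1$ and in
  $L^2$ of the boundary. By the trace inequality the boundary values of these form a Cauchy
  sequence, and its limit is the trace.\<close>

lemma is_trace_limit:
  assumes D: "bounded_lipschitz_domain \<omega>" and tr: "\<And>k. is_trace \<omega> (U k) (S k)"
    and u: "u \<in> sobolevH 1 \<omega>" and lim: "(\<lambda>k. h1sq \<omega> (\<lambda>x. U k x - u x)) \<longlonglongrightarrow> 0"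
  shows "\<exists>t. is_trace \<omega> u t \<and> (\<lambda>k. bdist \<omega> (S k) t) \<longlonglongrightarrow> 0"
proof -
  note \<omega> = lipschitz_domain_open_bounded[OF D]
  obtain C where C: "C >= 0" and T: "\<forall>w \<in> sobolevH 1 \<omega>. continuous_on (closure \<omega>) w -->
     (\<integral>\<^sup>+z. ennreal ((w z)\<^sup>2) \<partial>bd \<omega>) <= ennreal (C * h1sq \<omega> w)"
    using trace_inequality_h1[OF D] by (elim exE conjE)
  have UH: "U k \<in> sobolevH 1 \<omega>" and SB: "S k \<in> borel_measurable borel" for k using tr[of k] unfolding is_trace_iff[OF \<omega>] by blast+
  have Sm: "S k \<in> borel_measurable (bd \<omega>)" for k by (rule borel_imp_bd[OF SB])
  have "\<exists>w. w \<in> sobolevH 1 \<omega> \<and> continuous_on (closure \<omega>) w \<and> h1sq \<omega> (\<lambda>x. w x - U k x) < 1 / real (Suc k) \<and>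
     (bdist \<omega> w (S k)) < ennreal (1 / real (Suc k))" for k
  proof -
    obtain w where w: "\<forall>j. w j \<in> sobolevH 1 \<omega> \<and> continuous_on (closure \<omega>) (w j)"
      and 1: "(\<lambda>j. h1sq \<omega> (\<lambda>x. w j x - U k x)) \<longlonglongrightarrow> 0"
      and 2: "(\<lambda>j. bdist \<omega> (w j) (S k)) \<longlonglongrightarrow> 0"
      using tr[of k] unfolding is_trace_iff[OF \<omega>] by blast
    have "\<forall>\<^sub>F j in sequentially. h1sq \<omega> (\<lambda>x. w j x - U k x) < 1 / real (Suc k) \<and>
      (bdist \<omega> (w j) (S k)) < ennreal (1 / real (Suc k))"
      using order_tendstoD(2)[OF 1, of "1 / real (Suc k)"] order_tendstoD(2)[OF 2, of "ennreal (1 / real (Suc k))"]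
      by (intro eventually_conj) auto
    then obtain j where "h1sq \<omega> (\<lambda>x. w j x - U k x) < 1 / real (Suc k) \<and>
      (bdist \<omega> (w j) (S k)) < ennreal (1 / real (Suc k))"
      by (auto simp: eventually_sequentially)
    then show ?thesis using w by (intro exI[of _ "w j"]) auto
  qed
  then have "\<forall>k. \<exists>w. w \<in> sobolevH 1 \<omega> \<and> continuous_on (closure \<omega>) w \<and> h1sq \<omega> (\<lambda>x. w x - U k x) < 1 / real (Suc k) \<and>
     (bdist \<omega> w (S k)) < ennreal (1 / real (Suc k))" by (rule allI)
  then obtain w where W: "\<forall>k. w k \<in> sobolevH 1 \<omega> \<and> continuous_on (closure \<omega>) (w k) \<and> h1sq \<omega> (\<lambda>x. w k x - U k x) < 1 / real (Suc k) \<and>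
     (bdist \<omega> (w k) (S k)) < ennreal (1 / real (Suc k))"
    unfolding choice_iff by (elim exE)
  have wH: "w k \<in> sobolevH 1 \<omega>" and wc: "continuous_on (closure \<omega>) (w k)"
    and wU: "h1sq \<omega> (\<lambda>x. w k x - U k x) < 1 / real (Suc k)"
    and wS: "(bdist \<omega> (w k) (S k)) < ennreal (1 / real (Suc k))" for k
    using W by auto
  have wm: "w k \<in> borel_measurable (bd \<omega>)" for k by (rule continuous_imp_bd[OF wc])
  have inv0: "(\<lambda>k. 1 / real (Suc k)) \<longlonglongrightarrow> 0" using LIMSEQ_inverse_real_of_nat by (simp add: inverse_eq_divide)
  have wu: "(\<lambda>k. h1sq \<omega> (\<lambda>x. w k x - u x)) \<longlonglongrightarrow> 0"
  proof (rule tendsto_sandwich[OF _ _ tendsto_const])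
    show "(\<lambda>k. 2 * (1 / real (Suc k)) + 2 * h1sq \<omega> (\<lambda>x. U k x - u x)) \<longlonglongrightarrow> 0"
      using tendsto_add[OF tendsto_mult_right_zero[OF inv0] tendsto_mult_right_zero[OF lim]] by simp
    have "h1sq \<omega> (\<lambda>x. w k x - u x) <= 2 * (1 / real (Suc k)) + 2 * h1sq \<omega> (\<lambda>x. U k x - u x)" for k
      using h1sq_triangle[OF \<omega> wH[of k] UH[of k] u] wU[of k] by linarith
    then show "\<forall>\<^sub>F k in sequentially. h1sq \<omega> (\<lambda>x. w k x - u x) <= 2 * (1 / real (Suc k)) + 2 * h1sq \<omega> (\<lambda>x. U k x - u x)"
      by (intro always_eventually allI)
  qed (auto intro!: always_eventually h1sq_nonneg)
  have sq: "sqint (bd \<omega>) (w k)" for k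
  proof -
    have "(\<integral>\<^sup>+z. ennreal ((w k z)\<^sup>2) \<partial>bd \<omega>) < \<infinity>" using T wH[of k] wc[of k] by (auto intro: le_less_trans)
    then show ?thesis unfolding sqint_def integrable_iff_bounded using wm[of k] by auto
  qed
  have Cau: "l2sq (bd \<omega>) (\<lambda>z. w m z - w n z) <= C * h1sq \<omega> (\<lambda>x. w m x - w n x)" for m n
  proof -
    have "(bdist \<omega> (w m) (w n)) <= ennreal (C * h1sq \<omega> (\<lambda>x. w m x - w n x))"
      using T h1sq_diff(1)[OF \<omega> wH wH, of m n] continuous_on_diff[OF wc wc, of m n] by blast
    then show ?thesis
      unfolding l2sq_nn[OF sqint_diff[OF sq sq]] using C h1sq_nonneg by (subst (asm) ennreal_le_iff) auto
  qed
  have "\<exists>N. \<forall>m\<ge>N. \<forall>n\<ge>N. l2sq (bd \<omega>) (\<lambda>z. w m z - w n z) < e" if e: "e > 0" for e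
  proof -
    define d where "d = e / (4 * C + 1)"
    have d: "d > 0" "C * (4 * d) < e" using e C by (auto simp: d_def field_simps add_pos_nonneg)
    obtain N where N: "\<And>n. n >= N ==> h1sq \<omega> (\<lambda>x. w n x - u x) < d"
      using order_tendstoD(2)[OF wu d(1)] by (auto simp: eventually_sequentially)
    have "l2sq (bd \<omega>) (\<lambda>z. w m z - w n z) < e" if "m >= N" "n >= N" for m n
    proof -
      have sym: "h1sq \<omega> (\<lambda>x. u x - w n x) = h1sq \<omega> (\<lambda>x. w n x - u x)"
        unfolding h1sq_diff(2)[OF \<omega> u wH] h1sq_diff(2)[OF \<omega> wH u] by (simp add: l2sq_minus_commute[of _ u] l2sq_minus_commute[of _ "wpartial \<omega> _ u"])
      have "h1sq \<omega> (\<lambda>x. w m x - w n x) <= 2 * h1sq \<omega> (\<lambda>x. w m x - u x) + 2 * h1sq \<omega> (\<lambda>x. w n x - u x)"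
        using h1sq_triangle[OF \<omega> wH[of m] u wH[of n]] sym by simp
      also have "\<dots> <= 4 * d" using N[OF that(1)] N[OF that(2)] by linarith
      finally have "C * h1sq \<omega> (\<lambda>x. w m x - w n x) <= C * (4 * d)" using C by (rule mult_left_mono)
      then show ?thesis using Cau[of m n] d(2) by linarith
    qed
    then show ?thesis by blast
  qed
  then obtain t0 where t0: "sqint (bd \<omega>) t0" "(\<lambda>k. l2sq (bd \<omega>) (\<lambda>z. w k z - t0 z)) \<longlonglongrightarrow> 0"
    by (rule l2_complete[OF sq])
  define t where "t z = indicator (frontier \<omega>) z * t0 z" for z
  have tB: "t \<in> borel_measurable borel"
  proof -
    have "t0 \<in> borel_measurable (restrict_space hausdorff1 (frontier \<omega>))" using sqintD(1)[OF t0(1)] by (simp add: bd_def)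
    then have "t \<in> borel_measurable hausdorff1"
      using sets_bd[of \<omega>] by (subst (asm) borel_measurable_restrict_space_iff) (auto simp: t_def[abs_def])
    then show ?thesis by (simp cong: measurable_cong_sets)
  qed
  have tm: "t \<in> borel_measurable (bd \<omega>)" by (rule borel_imp_bd[OF tB])
  have wt: "(\<lambda>k. bdist \<omega> (w k) t) \<longlonglongrightarrow> 0"
  proof -
    have "(bdist \<omega> (w k) t) = ennreal (l2sq (bd \<omega>) (\<lambda>z. w k z - t0 z))" for k
      unfolding l2sq_nn[OF sqint_diff[OF sq t0(1)], symmetric]
      by (rule nn_integral_cong) (simp add: t_def bd_def space_restrict_space)
    then show ?thesis using tendsto_ennrealI[OF t0(2)] by simp
  qed
  have "is_trace \<omega> u t"
    unfolding is_trace_iff[OF \<omega>] using u tB wH wc wu wt by (intro conjI exI[of _ w]) auto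
  moreover have "(\<lambda>k. bdist \<omega> (S k) t) \<longlonglongrightarrow> 0"
  proof (rule tendsto_sandwich[OF _ _ tendsto_const])
    have "(\<lambda>k. 2 * ennreal (1 / real (Suc k)) + 2 * (bdist \<omega> (w k) t)) \<longlonglongrightarrow> 2 * ennreal 0 + 2 * 0"
      by (intro tendsto_add ennreal_tendsto_cmult tendsto_ennrealI inv0 wt) auto
    then show "(\<lambda>k. 2 * ennreal (1 / real (Suc k)) + 2 * (bdist \<omega> (w k) t)) \<longlonglongrightarrow> 0" by simp
    have "(bdist \<omega> (S k) t) <= 2 * ennreal (1 / real (Suc k)) + 2 * (bdist \<omega> (w k) t)" for k
    proof -
      have "(bdist \<omega> (S k) t) = (\<integral>\<^sup>+z. ennreal (((S k z - w k z) + (w k z - t z))\<^sup>2) \<partial>bd \<omega>)" by simp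
      also have "\<dots> <= 2 * (bdist \<omega> (S k) (w k)) + 2 * (bdist \<omega> (w k) t)"
        by (intro nn_sq_triangle borel_measurable_diff Sm wm tm)
      also have "(bdist \<omega> (S k) (w k)) <= ennreal (1 / real (Suc k))"
        using wS[of k] by (simp add: power2_commute less_imp_le)
      finally show ?thesis by (simp add: add_right_mono mult_left_mono)
    qed
    then show "\<forall>\<^sub>F k in sequentially. (bdist \<omega> (S k) t) <= 2 * ennreal (1 / real (Suc k)) + 2 * (bdist \<omega> (w k) t)"
      by (intro always_eventually allI)
  qed auto
  ultimately show ?thesis by blast
qed

text \<open>Boundary conditions hold up to sets that are null for the outer measure, which need
  not be Borel.\<close>

lemma hausdorff_outer_null_UN:
  assumes "\<And>i::nat. hausdorff_outer (A i) = 0" "B \<subseteq> (\<Union>i. A i)"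
  shows "hausdorff_outer B = 0"
  using order_trans[OF hausdorff_outer_mono[OF assms(2)] hausdorff_outer_UN[of A]] assms(1) by simp

lemma hausdorff_outer_null_Un:
  assumes "hausdorff_outer A = 0" "hausdorff_outer B = 0" "X \<subseteq> A \<union> B"
  shows "hausdorff_outer X = 0"
  using order_trans[OF hausdorff_outer_mono[OF assms(3)] hausdorff_outer_Un[of A B]] assms(1,2) by simp

text \<open>By uniqueness of traces, the same trace of the right-hand side can be used in all boundary
  conditions.\<close>

lemma trace_eq_on_fixed:
  assumes D: "bounded_lipschitz_domain \<omega>" and \<Gamma>: "\<Gamma> \<subseteq> frontier \<omega>" and g: "is_trace \<omega> g t"
    and eq: "trace_eq_on \<omega> \<Gamma> u g"
  shows "\<exists>s. is_trace \<omega> u s \<and> hausdorff_outer {x \<in> \<Gamma>. s x \<noteq> t x} = 0"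
proof -
  obtain s t' where st: "is_trace \<omega> u s" "is_trace \<omega> g t'" "hausdorff_outer {x \<in> \<Gamma>. s x \<noteq> t' x} = 0"
    using eq unfolding trace_eq_on_def by blast
  have "hausdorff_outer {x \<in> \<Gamma>. s x \<noteq> t x} = 0"
    by (rule hausdorff_outer_null_Un[OF st(3) is_trace_unique[OF D st(2) g]]) (use \<Gamma> in auto)
  then show ?thesis using st(1) by blast
qed

lemma trace_eq_on_midpoint:
  assumes D: "bounded_lipschitz_domain \<omega>" and \<Gamma>: "\<Gamma> \<subseteq> frontier \<omega>"
    and eq: "trace_eq_on \<omega> \<Gamma> u g" "trace_eq_on \<omega> \<Gamma> v g"
  shows "trace_eq_on \<omega> \<Gamma> (\<lambda>x. (1/2) * u x + (1/2) * v x) g"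
proof -
  note \<omega> = lipschitz_domain_open_bounded[OF D]
  obtain s t where st: "is_trace \<omega> u s" "is_trace \<omega> g t" "hausdorff_outer {x \<in> \<Gamma>. s x \<noteq> t x} = 0"
    using eq(1) unfolding trace_eq_on_def by blast
  obtain s' where s': "is_trace \<omega> v s'" "hausdorff_outer {x \<in> \<Gamma>. s' x \<noteq> t x} = 0"
    using trace_eq_on_fixed[OF D \<Gamma> st(2) eq(2)] by blast
  have "hausdorff_outer {x \<in> \<Gamma>. (1/2) * s x + (1/2) * s' x \<noteq> t x} = 0"
    by (rule hausdorff_outer_null_Un[OF st(3) s'(2)]) auto
  then show ?thesis unfolding trace_eq_on_def using is_trace_lincomb[OF \<omega> st(1) s'(1), of "1/2" "1/2"] st(2) by blast
qed

text \<open>The traces converge in $L^2$ of the boundary. Since all of them agree with the same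
  function up to a null set, so does the limit.\<close>

lemma trace_eq_on_limit:
  assumes D: "bounded_lipschitz_domain \<omega>" and \<Gamma>: "\<Gamma> \<subseteq> frontier \<omega>"
    and eq: "\<And>k. trace_eq_on \<omega> \<Gamma> (U k) g" and u: "u \<in> sobolevH 1 \<omega>"
    and lim: "(\<lambda>k. h1sq \<omega> (\<lambda>x. U k x - u x)) \<longlonglongrightarrow> 0"
  shows "trace_eq_on \<omega> \<Gamma> u g"
proof -
  note \<omega> = lipschitz_domain_open_bounded[OF D]
  obtain t where g: "is_trace \<omega> g t" using eq[of 0] unfolding trace_eq_on_def by blast
  have "\<forall>k. \<exists>s. is_trace \<omega> (U k) s \<and> hausdorff_outer {x \<in> \<Gamma>. s x \<noteq> t x} = 0"
    using trace_eq_on_fixed[OF D \<Gamma> g eq] by blast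
  then obtain S where S: "\<forall>k. is_trace \<omega> (U k) (S k) \<and> hausdorff_outer {x \<in> \<Gamma>. S k x \<noteq> t x} = 0"
    unfolding choice_iff by (elim exE)
  obtain s where s: "is_trace \<omega> u s" and Ss: "(\<lambda>k. bdist \<omega> (S k) s) \<longlonglongrightarrow> 0"
    using is_trace_limit[OF D _ u lim, of S] S by blast
  have m: "S k \<in> borel_measurable (bd \<omega>)" "s \<in> borel_measurable (bd \<omega>)" "t \<in> borel_measurable (bd \<omega>)" for k
    using S s g by (auto simp: is_trace_def intro: borel_imp_bd)
  \<comment> \<open>the traces agree with \<open>t\<close> outside a single null set\<close>
  define N where "N = (\<Union>k. {x \<in> \<Gamma>. S k x \<noteq> t x})"
  have N0: "hausdorff_outer N = 0" using hausdorff_outer_null_UN[of "\<lambda>k. {x \<in> \<Gamma>. S k x \<noteq> t x}" N] S by (auto simp: N_def)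
  define Z where "Z = {z \<in> frontier \<omega>. \<forall>k. S k z = t z}"
  have ZB: "Z \<in> sets borel"
  proof -
    have [measurable]: "S k \<in> borel_measurable borel" "t \<in> borel_measurable borel" for k using S g by (auto simp: is_trace_def)
    have [measurable]: "frontier \<omega> \<in> sets borel" by (simp add: borel_closed)
    show ?thesis unfolding Z_def by measurable
  qed
  have Zm: "(indicator Z :: real^2 => ennreal) \<in> borel_measurable (bd \<omega>)" using ZB by (intro borel_imp_bd) auto
  have le: "(\<integral>\<^sup>+z. indicator Z z * ennreal ((t z - s z)\<^sup>2) \<partial>bd \<omega>) <= (bdist \<omega> (S k) s)" for k
    by (rule nn_integral_mono) (auto simp: indicator_def Z_def)
  have "(\<integral>\<^sup>+z. indicator Z z * ennreal ((t z - s z)\<^sup>2) \<partial>bd \<omega>) <= 0"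
    by (rule LIMSEQ_le_const[OF Ss]) (use le in auto)
  then have "AE z in bd \<omega>. indicator Z z * ennreal ((t z - s z)\<^sup>2) = 0"
    using m Zm by (subst nn_integral_0_iff_AE[symmetric]) auto
  then have "hausdorff_outer {z \<in> frontier \<omega>. \<not> (indicator Z z * ennreal ((t z - s z)\<^sup>2) = 0)} = 0"
    by (rule AE_bd_hausdorff_outer)
  then have "hausdorff_outer {x \<in> \<Gamma>. s x \<noteq> t x} = 0"
    by (rule hausdorff_outer_null_Un[OF N0]) (use \<Gamma> in \<open>auto simp: N_def Z_def indicator_def\<close>)
  then show ?thesis unfolding trace_eq_on_def using s g by blast
qed

lemma const_sobolevH1:
  assumes \<omega>: "open \<omega>" "bounded \<omega>"
  shows "(\<lambda>_. c) \<in> sobolevH 1 \<omega>" "AE x in leb \<omega>. wpartial \<omega> i (\<lambda>_. c) x = 0"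
proof -
  have w: "is_weak_partial \<omega> i (\<lambda>_. c) (\<lambda>_. 0)" for i
    using C1_is_weak_partial[OF \<omega>, of "\<lambda>_. c" "\<lambda>_ _. 0" i] by simp
  show "(\<lambda>_. c) \<in> sobolevH 1 \<omega>" unfolding sobolevH1_iff using w by (intro exI[of _ "\<lambda>_ _. 0"] allI)
  show "AE x in leb \<omega>. wpartial \<omega> i (\<lambda>_. c) x = 0" by (rule wpartial_AE_eq[OF \<omega> w])
qed

text \<open>On the set where the boundary condition holds, the trace of $u-g-c$ is the constant
  $-c$, so the trace bound controls $c^2$ times the length of that set by the $H^1$ norm.
  Positivity of the length enters here, and only the outer measure of a set that need not be
  Borel is available.\<close>

lemma trace_eq_on_const_bound:
  assumes D: "bounded_lipschitz_domain \<omega>" and \<Gamma>: "\<Gamma> \<subseteq> frontier \<omega>" "hausdorff_outer \<Gamma> > 0"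
  shows "\<exists>C. C >= 0 \<and> (\<forall>u g c. trace_eq_on \<omega> \<Gamma> u g -->
    c\<^sup>2 <= C * (l2sq (leb \<omega>) (\<lambda>x. u x - g x - c) + (\<Sum>i\<in>UNIV. wdist \<omega> i u g)))"
proof -
  note \<omega> = lipschitz_domain_open_bounded[OF D]
  obtain C where C: "C >= 0" and T: "\<forall>u t. is_trace \<omega> u t --> (\<integral>\<^sup>+z. ennreal ((t z)\<^sup>2) \<partial>bd \<omega>) <= ennreal (C * h1sq \<omega> u)"
    using trace_bound[OF D] by (elim exE conjE)
  obtain m where m: "m > 0" "ennreal m <= hausdorff_outer \<Gamma>"
  proof (cases "hausdorff_outer \<Gamma>")
    case (real r)
    then show ?thesis using that[of r] \<Gamma>(2) by auto
  next
    case top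
    then show ?thesis using that[of 1] by auto
  qed
  show ?thesis
  proof (intro exI[of _ "C / m"] conjI allI impI)
    show "0 <= C / m" using C m by simp
    fix u g c assume eq: "trace_eq_on \<omega> \<Gamma> u g"
    obtain s t where st: "is_trace \<omega> u s" "is_trace \<omega> g t" "hausdorff_outer {x \<in> \<Gamma>. s x \<noteq> t x} = 0"
      using eq unfolding trace_eq_on_def by blast
    have ug: "u \<in> sobolevH 1 \<omega>" "g \<in> sobolevH 1 \<omega>" using st unfolding is_trace_def by blast+
    note cH = const_sobolevH1[OF \<omega>]
    have tc: "is_trace \<omega> (\<lambda>_. c) (\<lambda>z. indicator (closure \<omega>) z * c)"
      by (rule is_trace_continuous[OF \<omega> cH(1) cH(1)]) auto
    have "is_trace \<omega> (\<lambda>x. 1 * (1 * u x + (-1) * g x) + (-1) * c) (\<lambda>z. 1 * (1 * s z + (-1) * t z) + (-1) * (indicator (closure \<omega>) z * c))"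
      by (intro is_trace_lincomb[OF \<omega>] st tc)
    then have tr: "is_trace \<omega> (\<lambda>x. (u x - g x) - c) (\<lambda>z. s z - t z - indicator (closure \<omega>) z * c)" by (simp add: algebra_simps)
    have dH: "(\<lambda>x. u x - g x) \<in> sobolevH 1 \<omega>" by (rule h1sq_diff(1)[OF \<omega> ug])
    have wd: "AE x in leb \<omega>. wpartial \<omega> i (\<lambda>x. u x - g x) x = wpartial \<omega> i u x - wpartial \<omega> i g x" for i
    proof -
      have "AE x in leb \<omega>. wpartial \<omega> i (\<lambda>x. 1 * u x + (-1) * g x) x = 1 * wpartial \<omega> i u x + (-1) * wpartial \<omega> i g x"
        by (rule sobolevH1_lincomb(2)[OF \<omega> ug])
      then show ?thesis by simp
    qed
    have "wdist \<omega> i (\<lambda>x. u x - g x) (\<lambda>_. c)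
      = wdist \<omega> i u g" for i
    proof (rule l2sq_cong_AE)
      show "AE x in leb \<omega>. wpartial \<omega> i (\<lambda>x. u x - g x) x - wpartial \<omega> i (\<lambda>_. c) x = wpartial \<omega> i u x - wpartial \<omega> i g x"
        using wd[of i] cH(2)[of i c] by eventually_elim simp
    qed (intro borel_measurable_diff sqintD(1)[OF sobolevH1_sqint(2)] dH cH ug)+
    then have hs: "h1sq \<omega> (\<lambda>x. (u x - g x) - c) = l2sq (leb \<omega>) (\<lambda>x. u x - g x - c) + (\<Sum>i\<in>UNIV. wdist \<omega> i u g)"
      unfolding h1sq_diff(2)[OF \<omega> dH cH(1)] by simp
    define A where "A = {z \<in> frontier \<omega>. s z = t z}"
    have AB [measurable]: "A \<in> sets borel"
    proof -
      have [measurable]: "s \<in> borel_measurable borel" "t \<in> borel_measurable borel" using st by (auto simp: is_trace_def)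
      have [measurable]: "frontier \<omega> \<in> sets borel" by (simp add: borel_closed)
      show ?thesis unfolding A_def by measurable
    qed
    have "hausdorff_outer \<Gamma> <= hausdorff_outer ({x \<in> \<Gamma>. s x \<noteq> t x} \<union> A)" using \<Gamma>(1) by (intro hausdorff_outer_mono) (auto simp: A_def)
    also have "\<dots> <= hausdorff_outer {x \<in> \<Gamma>. s x \<noteq> t x} + hausdorff_outer A" by (rule hausdorff_outer_Un)
    finally have mA: "ennreal m <= hausdorff_outer A" using m(2) st(3) by simp
    have "ennreal (c\<^sup>2) * ennreal m <= ennreal (c\<^sup>2) * hausdorff_outer A" using mA by (rule mult_left_mono) simp
    also have "hausdorff_outer A = emeasure hausdorff1 A" by (rule emeasure_hausdorff1[OF AB, symmetric])
    also have "ennreal (c\<^sup>2) * emeasure hausdorff1 A = (\<integral>\<^sup>+z. ennreal (c\<^sup>2) * indicator A z \<partial>hausdorff1)"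
      by (rule nn_integral_cmult_indicator[symmetric]) simp
    also have "\<dots> <= (\<integral>\<^sup>+z\<in>frontier \<omega>. ennreal ((s z - t z - indicator (closure \<omega>) z * c)\<^sup>2) \<partial>hausdorff1)"
      by (rule nn_integral_mono) (auto simp: A_def indicator_def frontier_def)
    also have "\<dots> <= ennreal (C * h1sq \<omega> (\<lambda>x. (u x - g x) - c))" unfolding bd_nn using T tr by blast
    finally have "ennreal (c\<^sup>2 * m) <= ennreal (C * h1sq \<omega> (\<lambda>x. (u x - g x) - c))"
      using m by (simp add: ennreal_mult)
    then have "c\<^sup>2 * m <= C * h1sq \<omega> (\<lambda>x. (u x - g x) - c)"
      using C h1sq_nonneg by (subst (asm) ennreal_le_iff) auto
    then show "c\<^sup>2 <= C / m * (l2sq (leb \<omega>) (\<lambda>x. u x - g x - c) + (\<Sum>i\<in>UNIV. wdist \<omega> i u g))"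
      unfolding hs[symmetric] using m by (simp add: field_simps)
  qed
qed

section \<open>Square roots of two-by-two matrices\<close>

text \<open>The adjugate formula, for its continuity in the entries.\<close>

definition inv2 :: "real^2^2 => real^2^2" where
  "inv2 A = (1 / det A) *\<^sub>R (trace A *\<^sub>R mat 1 - A)"

definition sqrt2 :: "real^2^2 => real^2^2" where
  "sqrt2 B = (1 / sqrt (trace B + 2 * sqrt (det B))) *\<^sub>R (B + sqrt (det B) *\<^sub>R mat 1)"

lemma mat2_eq_iff: "A = B \<longleftrightarrow> A$1$1 = B$1$1 \<and> A$1$2 = B$1$2 \<and> A$2$1 = B$2$1 \<and> A$2$2 = B$2$2" for A B :: "real^2^2"
  by (auto simp: vec_eq_iff forall_2)

lemma mat2_simps:
  "(A ** B) $ i $ j = A$i$1 * B$1$j + A$i$2 * B$2$j" "(mat 1 :: real^2^2)$1$1 = 1" "(mat 1 :: real^2^2)$1$2 = 0"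
  "(mat 1 :: real^2^2)$2$1 = 0" "(mat 1 :: real^2^2)$2$2 = 1" "trace A = A$1$1 + A$2$2" for A B :: "real^2^2"
  by (auto simp: matrix_matrix_mult_def sum_2 mat_def trace_def)

text \<open>Sylvester's criterion.\<close>

lemma spd_2_iff: "spd A \<longleftrightarrow> A$1$2 = A$2$1 \<and> A$1$1 > 0 \<and> det A > 0" for A :: "real^2^2"
proof
  assume s: "spd A"
  then have pos: "\<And>x. x \<noteq> 0 ==> x \<bullet> (A *v x) > 0" and sym: "transpose A = A" by (auto simp: spd_def)
  have 12: "A$1$2 = A$2$1" using arg_cong[OF sym, of "\<lambda>M. M$1$2"] by (simp add: transpose_def)
  have 11: "A$1$1 > 0" 
  proof -
    have "axis 1 1 \<noteq> (0::real^2)" by (simp add: axis_eq_0_iff)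
    from pos[OF this] show ?thesis by (simp add: inner_vec_def sum_2 matrix_vector_mult_def axis_def)
  qed
  let ?x = "vector [- (A$1$2), A$1$1] :: real^2"
  have "?x \<noteq> 0" using 11 by (auto simp: vec_eq_iff forall_2)
  then have "?x \<bullet> (A *v ?x) > 0" by (rule pos)
  moreover have "?x \<bullet> (A *v ?x) = A$1$1 * det A"
    using 12 by (simp add: inner_vec_def sum_2 matrix_vector_mult_def det_2 algebra_simps)
  ultimately show "A$1$2 = A$2$1 \<and> A$1$1 > 0 \<and> det A > 0" using 11 12 by (simp add: zero_less_mult_iff)
next
  assume a: "A$1$2 = A$2$1 \<and> A$1$1 > 0 \<and> det A > 0"
  have "x \<bullet> (A *v x) > 0" if "x \<noteq> 0" for x
  proof -
    have "A$1$1 * (x \<bullet> (A *v x)) = (A$1$1 * x$1 + A$1$2 * x$2)\<^sup>2 + det A * (x$2)\<^sup>2"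
      using a by (simp add: inner_vec_def sum_2 matrix_vector_mult_def det_2 algebra_simps power2_eq_square)
    also have "\<dots> > 0"
    proof (cases "x$2 = 0")
      case True
      then have "x$1 \<noteq> 0" using that by (auto simp: vec_eq_iff forall_2)
      then show ?thesis using True a by simp
    next
      case False
      then show ?thesis using a by (intro add_nonneg_pos) auto
    qed
    finally show ?thesis using a by (simp add: zero_less_mult_iff)
  qed
  then show "spd A" using a by (auto simp: spd_def vec_eq_iff forall_2 transpose_def)
qed

lemma spd_diag: "spd A ==> A$2$2 > 0" for A :: "real^2^2"
proof -
  assume "spd A"
  then have a: "A$1$2 = A$2$1" "A$1$1 > 0" "det A > 0" by (auto simp: spd_2_iff)
  have "A$1$1 * A$2$2 > (A$1$2)\<^sup>2" using a(1,3) by (simp add: det_2 power2_eq_square)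
  then have "A$1$1 * A$2$2 > 0" using zero_le_power2[of "A$1$2"] by linarith
  then show ?thesis using a(2) by (simp add: zero_less_mult_iff)
qed

lemma scaleR_matmul: "A ** (c *\<^sub>R B) = c *\<^sub>R (A ** B)" "(c *\<^sub>R A) ** B = c *\<^sub>R (A ** B)" for A B :: "real^2^2"
  by (auto simp: mat2_eq_iff mat2_simps(1) algebra_simps)

lemma inv2:
  assumes "det A \<noteq> 0"
  shows "A ** inv2 A = mat 1" "inv2 A ** A = mat 1"
proof -
  have "A ** (trace A *\<^sub>R mat 1 - A) = det A *\<^sub>R mat 1" "(trace A *\<^sub>R mat 1 - A) ** A = det A *\<^sub>R mat 1"
    by (auto simp: mat2_eq_iff mat2_simps det_2 algebra_simps)
  then show "A ** inv2 A = mat 1" "inv2 A ** A = mat 1" using assms by (auto simp: inv2_def scaleR_matmul)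
qed

lemma matrix_inv_inv2:
  assumes "det A \<noteq> 0"
  shows "matrix_inv A = inv2 A"
proof -
  have "\<exists>A'. A ** A' = mat 1 \<and> A' ** A = mat 1" using inv2[OF assms] by blast
  then have "matrix_inv A ** A = mat 1" unfolding matrix_inv_def by (rule someI2_ex) blast
  then have "matrix_inv A ** (A ** inv2 A) = inv2 A" by (simp add: matrix_mul_assoc)
  then show ?thesis using inv2[OF assms] by simp
qed

lemma spd_inv2: "spd A ==> spd (inv2 A)"
proof -
  assume "spd A"
  then have a: "A$1$2 = A$2$1" "A$1$1 > 0" "det A > 0" by (auto simp: spd_2_iff)
  have 22: "A$2$2 > 0" by (rule spd_diag[OF \<open>spd A\<close>])
  have "det (A ** inv2 A) = 1" using a(3) by (simp add: inv2)
  then have "det A * det (inv2 A) = 1" by (simp add: det_mul)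
  then have "det (inv2 A) > 0" using a(3) by (metis zero_less_mult_pos zero_less_one)
  then show ?thesis using a 22 by (simp add: spd_2_iff) (simp add: inv2_def mat2_simps)
qed

text \<open>By the Cayley--Hamilton theorem a square root $S$ satisfies $(\mathrm{tr}\,S)\,S = B
  + (\det S)\,I$, where $\det S=\sqrt{\det B}$ and $(\mathrm{tr}\,S)^2 = \mathrm{tr}\,B + 2\det
  S$. So the square root is unique and has a closed form that depends continuously on $B$.\<close>

lemma sqrt2_spd:
  assumes "spd B"
  shows "spd (sqrt2 B)" "sqrt2 B ** sqrt2 B = B"
proof -
  have b: "B$1$2 = B$2$1" "B$1$1 > 0" "det B > 0" using assms by (auto simp: spd_2_iff)
  have 22: "B$2$2 > 0" by (rule spd_diag[OF assms])
  define d where "d = sqrt (det B)"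
  define \<tau> where "\<tau> = sqrt (trace B + 2 * d)"
  have d: "d > 0" "d * d = B$1$1 * B$2$2 - B$1$2 * B$2$1" using b(3) by (auto simp: d_def det_2)
  have \<tau>: "\<tau> > 0" "\<tau> * \<tau> = B$1$1 + B$2$2 + 2 * d" using b 22 d by (auto simp: \<tau>_def mat2_simps)
  have S: "sqrt2 B = (1 / \<tau>) *\<^sub>R (B + d *\<^sub>R mat 1)" by (simp add: sqrt2_def \<tau>_def d_def)
  show sq: "sqrt2 B ** sqrt2 B = B"
  proof -
    have "(B + d *\<^sub>R mat 1) ** (B + d *\<^sub>R mat 1) = (\<tau> * \<tau>) *\<^sub>R B"
      unfolding \<tau>(2) by (simp add: mat2_eq_iff mat2_simps algebra_simps d(2))
    then show ?thesis using \<tau>(1) by (simp add: S scaleR_matmul)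
  qed
  have "det (sqrt2 B) = (1 / (\<tau> * \<tau>)) * ((B$1$1 + d) * (B$2$2 + d) - B$1$2 * B$2$1)"
    by (simp add: S det_2 mat2_simps diff_divide_distrib)
  also have "(B$1$1 + d) * (B$2$2 + d) - B$1$2 * B$2$1 = d * (\<tau> * \<tau>)" unfolding \<tau>(2) using d(2) by (simp add: algebra_simps)
  finally have "det (sqrt2 B) = d" using \<tau>(1) by simp
  then show "spd (sqrt2 B)" using b d \<tau> by (simp add: spd_2_iff) (simp add: S mat2_simps)
qed

lemma sqrt2_unique:
  assumes S: "spd S" "S ** S = B"
  shows "S = sqrt2 B"
proof -
  have s: "S$1$2 = S$2$1" "S$1$1 > 0" "det S > 0" using S(1) by (auto simp: spd_2_iff)
  have 22: "S$2$2 > 0" by (rule spd_diag[OF S(1)])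
  have "det B = det S * det S" unfolding S(2)[symmetric] by (rule det_mul)
  then have d: "sqrt (det B) = det S" using s(3) by simp
  have "trace B + 2 * det S = (S$1$1 + S$2$2)\<^sup>2"
    unfolding S(2)[symmetric] using s(1) by (simp add: mat2_simps det_2 power2_eq_square algebra_simps)
  then have t: "sqrt (trace B + 2 * det S) = S$1$1 + S$2$2" using s(2) 22 by simp
  have "S ** S + det S *\<^sub>R mat 1 = (S$1$1 + S$2$2) *\<^sub>R S"
    by (simp add: mat2_eq_iff mat2_simps det_2 algebra_simps)
  then show ?thesis
    unfolding sqrt2_def d t unfolding S(2)[symmetric] using s(2) 22 by simp
qed

lemma inv_sqrt_eq: "spd A ==> inv_sqrt A = sqrt2 (inv2 A)"
proof -
  assume A: "spd A"
  then have "det A \<noteq> 0" by (simp add: spd_2_iff)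
  then have i: "matrix_inv A = inv2 A" by (rule matrix_inv_inv2)
  show ?thesis unfolding inv_sqrt_def i
  proof (rule the_equality)
    show "spd (sqrt2 (inv2 A)) \<and> sqrt2 (inv2 A) ** sqrt2 (inv2 A) = inv2 A" using sqrt2_spd[OF spd_inv2[OF A]] by (rule conjI)
    show "S = sqrt2 (inv2 A)" if "spd S \<and> S ** S = inv2 A" for S
      by (rule sqrt2_unique[OF that[THEN conjunct1] that[THEN conjunct2]])
  qed
qed

section \<open>The first fundamental form\<close>

definition gram :: "real^2^3 => real^2^2" where "gram M = transpose M ** M"

definition cross_cols :: "real^2^3 => real^3" where "cross_cols M = cross3 (column 1 M) (column 2 M)"

lemma gram_component: "gram M $ i $ j = (\<Sum>m\<in>UNIV. M$m$i * M$m$j)"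
  by (simp add: gram_def matrix_matrix_mult_def transpose_def)

text \<open>Lagrange's identity.\<close>

lemma det_gram: "det (gram M) = (norm (cross_cols M))\<^sup>2"
proof -
  have c: "column i M \<bullet> column j M = gram M $ i $ j" for i j
    by (simp add: gram_component inner_vec_def column_def)
  have "gram M $ 2 $ 1 = gram M $ 1 $ 2" by (simp add: gram_component mult.commute)
  moreover have "(norm (column i M))\<^sup>2 = gram M $ i $ i" for i by (simp add: power2_norm_eq_inner c)
  ultimately show ?thesis unfolding cross_cols_def norm_cross det_2 by (simp add: c power2_eq_square)
qed

lemma norm_gram: "(norm M)\<^sup>2 = trace (gram M)"
  unfolding power2_norm_eq_inner
  by (simp add: inner_vec_def trace_def gram_component sum.swap[of _ "UNIV::2 set"] power2_eq_square)

lemma spd_gram: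
  assumes "rank (M :: real^2^3) = 2"
  shows "spd (gram M)"
proof -
  have inj: "inj ((*v) M)" using assms full_rank_injective[of M] by simp
  have q: "x \<bullet> (gram M *v x) = (norm (M *v x))\<^sup>2" for x
    unfolding gram_def matrix_vector_mul_assoc[symmetric] power2_norm_eq_inner
    by (metis dot_lmul_matrix inner_commute transpose_matrix_vector)
  have "x \<bullet> (gram M *v x) > 0" if "x \<noteq> 0" for x
  proof -
    have "M *v x \<noteq> M *v 0" using that inj by (metis injD)
    then show ?thesis by (simp add: q)
  qed
  moreover have "transpose (gram M) = gram M" by (simp add: gram_def matrix_transpose_mul)
  ultimately show ?thesis by (simp add: spd_def)
qed

lemma continuous_on_vec_componentwise:
  fixes f :: "'a::topological_space => ('b::real_normed_vector)^'n"
  assumes "\<And>i. continuous_on S (\<lambda>x. f x $ i)"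
  shows "continuous_on S f"
  using continuous_on_vec_lambda[of S "\<lambda>i x. f x $ i", OF assms] by simp

lemma continuous_on_gram:
  assumes "continuous_on S G"
  shows "continuous_on S (\<lambda>x. gram (G x))"
  by (intro continuous_on_vec_componentwise) (unfold gram_component, intro continuous_intros assms)

lemma continuous_on_det2: "continuous_on S A ==> continuous_on S (\<lambda>x. det (A x :: real^2^2))"
  unfolding det_2 by (intro continuous_intros)

lemma continuous_on_trace2: "continuous_on S A ==> continuous_on S (\<lambda>x. trace (A x :: real^2^2))"
  unfolding mat2_simps by (intro continuous_intros)

lemma continuous_on_inv2:
  assumes "continuous_on S A" "\<And>x. x \<in> S ==> spd (A x)"
  shows "continuous_on S (\<lambda>x. inv2 (A x))"
proof -
  have "\<forall>x\<in>S. det (A x) \<noteq> 0"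
  proof
    fix x assume "x \<in> S"
    then have "spd (A x)" by (rule assms(2))
    then show "det (A x) \<noteq> 0" by (simp add: spd_2_iff)
  qed
  then show ?thesis unfolding inv2_def by (intro continuous_intros continuous_on_det2 continuous_on_trace2 assms) auto
qed

lemma trace_pos: "spd B ==> trace (B :: real^2^2) > 0"
proof -
  assume "spd B"
  then have b: "B$1$2 = B$2$1" "B$1$1 > 0" "det B > 0" by (auto simp: spd_2_iff)
  moreover have "B$2$2 > 0" by (rule spd_diag[OF \<open>spd B\<close>])
  ultimately show ?thesis using b by (simp add: mat2_simps)
qed

lemma continuous_on_sqrt2:
  assumes "continuous_on S A" "\<And>x. x \<in> S ==> spd (A x)"
  shows "continuous_on S (\<lambda>x. sqrt2 (A x))"
proof -
  have "sqrt (trace (A x) + 2 * sqrt (det (A x))) \<noteq> 0" if "x \<in> S" for x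
  proof -
    have "trace (A x) > 0" "det (A x) > 0" using trace_pos[OF assms(2)[OF that]] assms(2)[OF that] by (auto simp: spd_2_iff)
    then have "trace (A x) + 2 * sqrt (det (A x)) > 0" by (intro add_pos_nonneg) auto
    then show ?thesis by simp
  qed
  then show ?thesis unfolding sqrt2_def
    by (intro continuous_intros continuous_on_det2 continuous_on_trace2 assms) auto
qed

lemma continuous_on_matmul:
  assumes "continuous_on S A" "continuous_on S (B :: _ => real^2^2)"
  shows "continuous_on S (\<lambda>x. (A x :: real^2^2) ** B x)"
  by (intro continuous_on_vec_componentwise) (unfold mat2_simps(1), intro continuous_intros assms)

section \<open>The reference surface\<close>

lemma sobolevH_Suc_subset: "u \<in> sobolevH (Suc k) \<omega> ==> u \<in> sobolevH k \<omega>"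
proof (induction k arbitrary: u)
  case 0 then show ?case by simp
next
  case (Suc k)
  show ?case unfolding sobolevH_Suc_iff
  proof
    fix i
    obtain v where "v \<in> sobolevH (Suc k) \<omega>" "is_weak_partial \<omega> i u v"
      using Suc.prems unfolding sobolevH_Suc_iff[of u "Suc k"] by blast
    then show "\<exists>v\<in>sobolevH k \<omega>. is_weak_partial \<omega> i u v" using Suc.IH by blast
  qed
qed

text \<open>Gradients and Hessians are only determined up to null sets; these facts identify the
  canonical representatives with the components of a given jet.\<close>

lemma jet_components_H1:
  assumes \<omega>: "open \<omega>" "bounded \<omega>" and j: "has_jet \<omega> \<psi> G H"
  shows "(\<lambda>x. \<psi> x $ m) \<in> sobolevH 1 \<omega>" "(\<lambda>x. G x $ m $ j) \<in> sobolevH 1 \<omega>" "(\<lambda>x. grad \<omega> \<psi> x $ m $ j) \<in> sobolevH 1 \<omega>"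
    "AE x in leb \<omega>. wpartial \<omega> j (\<lambda>x. \<psi> x $ m) x = G x $ m $ j"
    "AE x in leb \<omega>. wpartial \<omega> i (\<lambda>x. grad \<omega> \<psi> x $ m $ j) x = H x $ m $ i $ j"
proof -
  have 1: "is_weak_partial \<omega> j (\<lambda>x. \<psi> x $ m) (\<lambda>x. G x $ m $ j)"
    and 2: "is_weak_partial \<omega> i (\<lambda>x. G x $ m $ j) (\<lambda>x. H x $ m $ i $ j)" for i j using j by (auto simp: has_jet_def)
  have e: "(\<lambda>x. grad \<omega> \<psi> x $ m $ j) = wpartial \<omega> j (\<lambda>x. \<psi> x $ m)" for j by (simp add: grad_def fun_eq_iff)
  show "AE x in leb \<omega>. wpartial \<omega> j (\<lambda>x. \<psi> x $ m) x = G x $ m $ j" by (rule wpartial_AE_eq[OF \<omega> 1])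
  then have ae: "AE x in leb \<omega>. G x $ m $ j = wpartial \<omega> j (\<lambda>x. \<psi> x $ m) x" by eventually_elim simp
  have 3: "is_weak_partial \<omega> i (\<lambda>x. grad \<omega> \<psi> x $ m $ j) (\<lambda>x. H x $ m $ i $ j)" for i
    unfolding e
    by (rule is_weak_partial_cong_AE[OF 2 ae])
       (use is_weak_partial_sqint[OF is_weak_partial_wpartial[OF 1]] is_weak_partial_sqint[OF 2] in \<open>auto intro: sqintD(1)\<close>)
  show "(\<lambda>x. \<psi> x $ m) \<in> sobolevH 1 \<omega>" unfolding sobolevH1_iff using 1 by (intro exI[of _ "\<lambda>j x. G x $ m $ j"] allI)
  show "(\<lambda>x. G x $ m $ j) \<in> sobolevH 1 \<omega>" unfolding sobolevH1_iff using 2 by (intro exI[of _ "\<lambda>i x. H x $ m $ i $ j"] allI)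
  show "(\<lambda>x. grad \<omega> \<psi> x $ m $ j) \<in> sobolevH 1 \<omega>" unfolding sobolevH1_iff using 3 by (intro exI[of _ "\<lambda>i x. H x $ m $ i $ j"] allI)
  show "AE x in leb \<omega>. wpartial \<omega> i (\<lambda>x. grad \<omega> \<psi> x $ m $ j) x = H x $ m $ i $ j" by (rule wpartial_AE_eq[OF \<omega> 3])
qed

text \<open>The classical gradient of a regular parametrization is also its weak gradient, which
  provides a representative that is continuous up to the boundary.\<close>

lemma regular_param_jet:
  assumes \<omega>: "open \<omega>" "bounded \<omega>" and \<psi>: "injective_regular_param \<omega> \<psi>"
  obtains G H where "has_jet \<omega> \<psi> G H" "continuous_on (closure \<omega>) G" "continuous_on (closure \<omega>) \<psi>"
    "\<And>x. x \<in> closure \<omega> ==> rank (G x) = 2"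
proof -
  obtain G where G: "continuous_on (closure \<omega>) G" "\<forall>x\<in>\<omega>. (\<psi> has_derivative (\<lambda>h. G x *v h)) (at x)" "\<forall>x\<in>closure \<omega>. rank (G x) = 2"
    and c: "continuous_on (closure \<omega>) \<psi>" and S: "\<psi> \<in> sobolevH_vec 3 \<omega>"
    using \<psi> unfolding injective_regular_param_def by blast
  have "\<psi> \<in> sobolevH_vec 2 \<omega>" using S sobolevH_Suc_subset[of _ 2 \<omega>] by (simp add: sobolevH_vec_def)
  then obtain G0 H where j: "has_jet \<omega> \<psi> G0 H" using sobolevH_vec2_jet by blast
  have w: "is_weak_partial \<omega> j (\<lambda>x. \<psi> x $ m) (\<lambda>x. G x $ m $ j)" for m j
  proof (rule C1_is_weak_partial[OF \<omega>, where G="\<lambda>j x. G x $ m $ j"])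
    fix x assume "x \<in> \<omega>"
    then have "((\<lambda>x. \<psi> x $ m) has_derivative (\<lambda>h. (G x *v h) $ m)) (at x)"
      using G(2) bounded_linear.has_derivative[OF bounded_linear_vec_nth] by blast
    then show "((\<lambda>x. \<psi> x $ m) has_derivative (\<lambda>h. \<Sum>i\<in>UNIV. h $ i * G x $ m $ i)) (at x)"
      by (simp add: matrix_vector_mult_def mult.commute)
  qed (intro continuous_intros c G)+
  have "is_weak_partial \<omega> i (\<lambda>x. G x $ m $ j) (\<lambda>x. H x $ m $ i $ j)" for m i j
  proof -
    have 1: "is_weak_partial \<omega> j (\<lambda>x. \<psi> x $ m) (\<lambda>x. G0 x $ m $ j)"
      and 2: "is_weak_partial \<omega> i (\<lambda>x. G0 x $ m $ j) (\<lambda>x. H x $ m $ i $ j)" using j by (auto simp: has_jet_def)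
    show ?thesis
      by (rule is_weak_partial_cong_AE[OF 2 is_weak_partial_unique[OF \<omega> 1 w]])
         (use is_weak_partial_sqint[OF w] is_weak_partial_sqint[OF 2] in \<open>auto intro: sqintD(1)\<close>)
  qed
  then have "has_jet \<omega> \<psi> G H" using w by (simp add: has_jet_def)
  then show ?thesis using that G c by blast
qed

text \<open>The infimum is taken over a nonempty set because the reference surface is
  admissible. Its trace exists since it and its gradient are continuous on the closure.\<close>

lemma reference_admissible:
  assumes \<omega>: "open \<omega>" "bounded \<omega>" and \<psi>: "injective_regular_param \<omega> \<psi>"
  shows "\<psi> \<in> admissible \<omega> \<Gamma> \<psi>"
proof -
  obtain G H where j: "has_jet \<omega> \<psi> G H" and c: "continuous_on (closure \<omega>) G" "continuous_on (closure \<omega>) \<psi>"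
    using regular_param_jet[OF \<omega> \<psi>] by metis
  note J = jet_components_H1[OF \<omega> j]
  have self: "trace_eq_on \<omega> \<Gamma> u u" if "is_trace \<omega> u s" for u s
    unfolding trace_eq_on_def by (intro exI[of _ s] conjI that) (simp add: hausdorff_outer_empty)
  have 1: "trace_eq_on \<omega> \<Gamma> (\<lambda>x. \<psi> x $ m) (\<lambda>x. \<psi> x $ m)" for m
    by (rule self[OF is_trace_continuous[OF \<omega> J(1)[of m] J(1)[of m]]]) (intro continuous_intros c AE_I2 refl)+
  have 2: "trace_eq_on \<omega> \<Gamma> (\<lambda>x. grad \<omega> \<psi> x $ m $ j) (\<lambda>x. grad \<omega> \<psi> x $ m $ j)" for m j
  proof (rule self[OF is_trace_continuous[OF \<omega> J(3) J(2)]])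
    show "continuous_on (closure \<omega>) (\<lambda>x. G x $ m $ j)" by (intro continuous_intros c)
    show "AE x in leb \<omega>. grad \<omega> \<psi> x $ m $ j = G x $ m $ j"
      using has_jet_grad_AE[OF \<omega> j] by eventually_elim simp
  qed
  show ?thesis unfolding admissible_def using 1 2 has_jet_sobolevH_vec2[OF j] by simp
qed

section \<open>The bending energy as a quadratic form in the Hessian\<close>

lemma norm_vec_sq: "(norm (v :: 'b::real_inner^'n))\<^sup>2 = (\<Sum>i\<in>UNIV. (norm (v $ i))\<^sup>2)"
  by (simp add: power2_norm_eq_inner inner_vec_def)

lemma measurable_vec_nth:
  fixes f :: "'a => ('b::euclidean_space)^'n"
  assumes "f \<in> borel_measurable M"
  shows "(\<lambda>x. f x $ i) \<in> borel_measurable M"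
  by (rule measurable_compose[OF assms borel_measurable_continuous_onI]) (intro continuous_intros)

lemma measurable_vec:
  fixes f :: "'a => ('b::euclidean_space)^'n"
  assumes "\<And>i. (\<lambda>x. f x $ i) \<in> borel_measurable M"
  shows "f \<in> borel_measurable M"
  unfolding borel_measurable_euclidean_space[of f]
proof
  fix b :: "'b^'n" assume "b \<in> Basis"
  then obtain i c where b: "b = axis i c" unfolding Basis_vec_def by blast
  show "(\<lambda>x. f x \<bullet> b) \<in> borel_measurable M"
    unfolding b inner_axis by (intro borel_measurable_inner assms borel_measurable_const)
qed

lemma sqint_vec:
  fixes f :: "'a => ('b::euclidean_space)^'n"
  assumes "\<And>i. sqint M (\<lambda>x. f x $ i)"
  shows "sqint M f"
  unfolding sqint_def norm_vec_sq
  by (intro conjI measurable_vec Bochner_Integration.integrable_sum sqintD assms)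

lemma sqint_nth:
  fixes f :: "'a => ('b::euclidean_space)^'n"
  assumes "sqint M f"
  shows "sqint M (\<lambda>x. f x $ i)"
  by (rule sqint_bound[OF measurable_vec_nth[OF sqintD(1)[OF assms]] sqintD(2)[OF assms]])
     (intro AE_I2 power_mono norm_ge_zero Finite_Cartesian_Product.norm_nth_le)

lemma l2sq_vec:
  fixes f :: "'a => ('b::euclidean_space)^'n"
  assumes "sqint M f"
  shows "l2sq M f = (\<Sum>i\<in>UNIV. l2sq M (\<lambda>x. f x $ i))"
  unfolding l2sq_def norm_vec_sq using sqintD(2)[OF sqint_nth[OF assms]]
  by (intro Bochner_Integration.integral_sum)

text \<open>The vector whose squared norm is the quadratic part of the energy density; the area
  element is distributed into it as a square root.\<close>

definition hess_form :: "real^2^2 => real^2^2^3 => real^2^2^3" where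
  "hess_form g H = (\<chi> m. sqrt (sqrt (det g)) *\<^sub>R (sqrt2 (inv2 g) ** (H $ m) ** sqrt2 (inv2 g)))"

lemma hess_form_linear:
  "hess_form g (H + H') = hess_form g H + hess_form g H'"
  "hess_form g (c *\<^sub>R H) = c *\<^sub>R hess_form g H"
  "hess_form g (H - H') = hess_form g H - hess_form g H'"
  by (auto simp: hess_form_def vec_eq_iff mat2_simps(1) algebra_simps)

lemma hess_form_eq_0:
  assumes g: "spd g" and "hess_form g H = 0"
  shows "H = 0"
proof -
  have d: "det g > 0" using g by (simp add: spd_2_iff)
  define s where "s = sqrt2 (inv2 g)"
  have ss: "s ** s = inv2 g" unfolding s_def by (rule sqrt2_spd[OF spd_inv2[OF g]])
  have l: "(g ** s) ** s = mat 1" and r: "s ** (s ** g) = mat 1"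
    using d by (simp_all add: matrix_mul_assoc[symmetric] ss inv2) (simp add: matrix_mul_assoc ss inv2)
  have "H $ m = 0" for m
  proof -
    have "sqrt (sqrt (det g)) *\<^sub>R (s ** (H $ m) ** s) = 0"
      using arg_cong[OF assms(2), of "\<lambda>X. X $ m"] by (simp add: hess_form_def s_def)
    then have "s ** (H $ m) ** s = 0" using d by simp
    then have "(g ** s) ** (s ** (H $ m) ** s) ** (s ** g) = 0" by (simp add: mat2_eq_iff mat2_simps(1))
    moreover have "(g ** s) ** (s ** (H $ m) ** s) ** (s ** g) = ((g ** s) ** s) ** (H $ m) ** (s ** (s ** g))"
      by (simp add: matrix_mul_assoc)
    ultimately show ?thesis unfolding l r by simp
  qed
  then show ?thesis by (simp add: vec_eq_iff)
qed

text \<open>The form vanishes at no unit Hessian and depends continuously on the base point, so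
  its norm is bounded above and away from zero on the compact product with the unit sphere.\<close>

lemma hess_form_bounds:
  fixes g :: "'a::euclidean_space => real^2^2"
  assumes K: "compact K" and g: "continuous_on K g" "\<And>x. x \<in> K ==> spd (g x)"
  shows "\<exists>k C. k > 0 \<and> (\<forall>x\<in>K. \<forall>H. k * norm H <= norm (hess_form (g x) H) \<and> norm (hess_form (g x) H) <= C * norm H)"
proof (cases "K = {}")
  case True
  then show ?thesis by (intro exI[of _ "1::real"]) simp
next
  case False
  define T where "T = K \<times> (sphere 0 1 :: (real^2^2^3) set)"
  obtain e :: "real^2^2^3" where "norm e = 1" using vector_choose_size[of 1] by auto
  then have T: "compact T" "T \<noteq> {}" using K False by (auto simp: T_def intro: compact_Times)
  have g': "continuous_on T (\<lambda>p. g (fst p))"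
    by (rule continuous_on_compose2[OF g(1)]) (auto intro!: continuous_intros simp: T_def)
  have spd: "spd (g (fst p))" if "p \<in> T" for p by (rule g(2)) (use that in \<open>auto simp: T_def\<close>)
  have s: "continuous_on T (\<lambda>p. sqrt2 (inv2 (g (fst p))))"
    by (rule continuous_on_sqrt2[OF continuous_on_inv2[OF g' spd] spd_inv2[OF spd]])
  have "continuous_on T (\<lambda>p. hess_form (g (fst p)) (snd p))"
  proof (rule continuous_on_vec_componentwise)
    fix m
    have "continuous_on T (\<lambda>p. sqrt (sqrt (det (g (fst p)))) *\<^sub>R (sqrt2 (inv2 (g (fst p))) ** (snd p $ m) ** sqrt2 (inv2 (g (fst p)))))"
      by (intro continuous_on_scaleR continuous_on_real_sqrt continuous_on_det2 g' continuous_on_matmul s continuous_intros)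
    then show "continuous_on T (\<lambda>p. hess_form (g (fst p)) (snd p) $ m)" by (simp add: hess_form_def)
  qed
  then have c: "continuous_on T (\<lambda>p. norm (hess_form (g (fst p)) (snd p)))" by (rule continuous_on_norm)
  obtain p where p: "p \<in> T" "\<forall>y\<in>T. norm (hess_form (g (fst p)) (snd p)) <= norm (hess_form (g (fst y)) (snd y))"
    using continuous_attains_inf[OF T c] by blast
  obtain q where q: "\<forall>y\<in>T. norm (hess_form (g (fst y)) (snd y)) <= norm (hess_form (g (fst q)) (snd q))"
    using continuous_attains_sup[OF T c] by blast
  let ?k = "norm (hess_form (g (fst p)) (snd p))" and ?C = "norm (hess_form (g (fst q)) (snd q))"
  have "snd p \<noteq> 0" using p(1) by (auto simp: T_def)
  then have "?k > 0" using hess_form_eq_0[OF spd[OF p(1)]] by auto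
  moreover have "?k * norm H <= norm (hess_form (g x) H) \<and> norm (hess_form (g x) H) <= ?C * norm H" if x: "x \<in> K" for x H
  proof (cases "H = 0")
    case True
    then show ?thesis using hess_form_linear(2)[of "g x" 0 0] by simp
  next
    case False
    define U where "U = (1 / norm H) *\<^sub>R H"
    have "(x, U) \<in> T" using False x by (simp add: T_def U_def)
    then have b: "?k <= norm (hess_form (g x) U)" "norm (hess_form (g x) U) <= ?C" using p(2) q by fastforce+
    have "hess_form (g x) H = norm H *\<^sub>R hess_form (g x) U"
      using False by (simp add: hess_form_linear(2)[symmetric] U_def)
    then have "norm (hess_form (g x) H) = norm (hess_form (g x) U) * norm H" by simp
    then show ?thesis using b by (simp add: mult_right_mono)
  qed
  ultimately show ?thesis by - (rule exI[of _ ?k], rule exI[of _ ?C], blast)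
qed

lemma measurable_matmul:
  assumes "A \<in> borel_measurable M" "(B :: _ => real^2^2) \<in> borel_measurable M"
  shows "(\<lambda>x. (A x :: real^2^2) ** B x) \<in> borel_measurable M"
  by (intro measurable_vec) (unfold mat2_simps(1), intro borel_measurable_add borel_measurable_times measurable_vec_nth assms)

text \<open>With $n = \partial_1\psi\times\partial_2\psi$, this is the coefficient of the
  Hessian in the linear part of the energy density.\<close>

definition tens :: "real^3 => real^2^2 => real^2^2^3" where "tens n B = (\<chi> m. (n $ m) *\<^sub>R B)"

lemma norm_tens: "norm (tens n B) = norm n * norm B"
proof -
  have "(norm (tens n B))\<^sup>2 = (norm n * norm B)\<^sup>2"
    unfolding norm_vec_sq[of "tens n B"] power_mult_distrib norm_vec_sq[of n]
    by (simp add: tens_def power_mult_distrib sum_distrib_right)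
  then show ?thesis by simp
qed

definition second_form_of :: "real^2^3 => real^2^2^3 => real^2^2" where
  "second_form_of G H = (\<chi> i j. - ((\<chi> m. H $ m $ i $ j) \<bullet> (cross_cols G /\<^sub>R norm (cross_cols G))))"

lemma norm_second_form_of: "norm (second_form_of G H) <= norm H"
proof -
  have n: "norm (cross_cols G /\<^sub>R norm (cross_cols G)) <= 1" by (cases "cross_cols G = 0") auto
  have c: "(second_form_of G H $ i $ j)\<^sup>2 <= (\<Sum>m\<in>UNIV. (H $ m $ i $ j)\<^sup>2)" for i j
  proof -
    let ?v = "(\<chi> m. H $ m $ i $ j) :: real^3"
    have "\<bar>?v \<bullet> (cross_cols G /\<^sub>R norm (cross_cols G))\<bar> <= norm ?v * 1"
      by (rule order_trans[OF Cauchy_Schwarz_ineq2 mult_left_mono[OF n norm_ge_zero]])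
    then have "(?v \<bullet> (cross_cols G /\<^sub>R norm (cross_cols G)))\<^sup>2 <= (norm ?v)\<^sup>2"
      by (intro power2_le_iff_abs_le[THEN iffD2]) auto
    then show ?thesis by (simp add: second_form_of_def norm_vec_sq)
  qed
  have "(norm (second_form_of G H))\<^sup>2 = (\<Sum>i\<in>UNIV. \<Sum>j\<in>UNIV. (second_form_of G H $ i $ j)\<^sup>2)"
    by (simp add: norm_vec_sq)
  also have "\<dots> <= (\<Sum>i\<in>UNIV. \<Sum>j\<in>UNIV. \<Sum>m\<in>UNIV. (H $ m $ i $ j)\<^sup>2)" by (intro sum_mono c)
  also have "\<dots> = (norm H)\<^sup>2" by (simp add: norm_vec_sq sum_2 sum_3)
  finally show ?thesis by (simp add: power2_le_iff_abs_le)
qed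

text \<open>On an isometric immersion the normal, multiplied by the area element, is the polynomial
  \<^term>\<open>cross_cols\<close> of the gradient, so that the energy density has no denominators that depend on the immersion.\<close>

lemma density_eq:
  assumes g: "spd g" "gram G = g"
  shows "sqrt (det g) * ((\<Sum>m\<in>UNIV. (norm (inv_sqrt g ** (H $ m) ** inv_sqrt g))\<^sup>2) - 2 * (second_form_of G H \<bullet> B))
    = (norm (hess_form g H))\<^sup>2 + 2 * (H \<bullet> tens (cross_cols G) B)"
proof -
  have d: "sqrt (det g) = norm (cross_cols G)" unfolding g(2)[symmetric] det_gram by simp
  have pos: "norm (cross_cols G) > 0" unfolding d[symmetric] using g(1) by (simp add: spd_2_iff)
  have "(norm (hess_form g H))\<^sup>2 = sqrt (det g) * (\<Sum>m\<in>UNIV. (norm (inv_sqrt g ** (H $ m) ** inv_sqrt g))\<^sup>2)"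
    using g(1) unfolding norm_vec_sq[of "hess_form g H"] unfolding hess_form_def inv_sqrt_eq[OF g(1)]
    by (simp add: power_mult_distrib sum_distrib_left spd_2_iff)
  moreover have "norm (cross_cols G) * (second_form_of G H \<bullet> B) = - (H \<bullet> tens (cross_cols G) B)"
  proof -
    have "norm (cross_cols G) * (second_form_of G H $ i $ j) = - (\<Sum>m\<in>UNIV. H $ m $ i $ j * cross_cols G $ m)" for i j
    proof -
      have "norm (cross_cols G) * (second_form_of G H $ i $ j) = - ((\<chi> m. H $ m $ i $ j) \<bullet> cross_cols G)"
        using pos by (simp add: second_form_of_def)
      then show ?thesis by (simp add: inner_vec_def)
    qed
    note e = this
    have "norm (cross_cols G) * (second_form_of G H \<bullet> B) = (\<Sum>i\<in>UNIV. \<Sum>j\<in>UNIV. (norm (cross_cols G) * (second_form_of G H $ i $ j)) * B $ i $ j)"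
      by (simp add: inner_vec_def sum_distrib_left mult.assoc)
    also have "\<dots> = - (H \<bullet> tens (cross_cols G) B)"
      unfolding e by (simp add: inner_vec_def tens_def sum_2 sum_3 algebra_simps)
    finally show ?thesis .
  qed
  ultimately show ?thesis by (simp add: d algebra_simps)
qed

text \<open>Lebesgue measure is complete. The formula for the energy density in terms of a jet
  holds almost everywhere only, so this is how the density is seen to be measurable.\<close>

lemma measurable_lebesgue_on_cong_AE:
  fixes f h :: "'a::euclidean_space => real"
  assumes \<omega>: "open \<omega>" and f: "f \<in> borel_measurable (leb \<omega>)" and ae: "AE x in leb \<omega>. f x = h x"
  shows "h \<in> borel_measurable (leb \<omega>)"
proof -
  have S: "\<omega> \<in> sets lebesgue" using \<omega> by simp
  obtain N where N: "N \<in> null_sets (leb \<omega>)" "{x \<in> space (leb \<omega>). f x \<noteq> h x} \<subseteq> N"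
    using ae by (auto simp: eventually_ae_filter)
  have "f \<in> borel_measurable (lebesgue_on (\<omega> - N))" using f borel_measurable_diff_null[OF N(1) S] by blast
  moreover have "(f \<in> borel_measurable (lebesgue_on (\<omega> - N))) = (h \<in> borel_measurable (lebesgue_on (\<omega> - N)))"
    by (rule measurable_cong) (use N(2) in auto)
  ultimately show ?thesis using borel_measurable_diff_null[OF N(1) S] by blast
qed

lemma integral_lebesgue_on_cong_AE:
  fixes f h :: "'a::euclidean_space => real"
  assumes "open \<omega>" "f \<in> borel_measurable (leb \<omega>)" "AE x in leb \<omega>. f x = h x"
  shows "(LINT x|leb \<omega>. h x) = (LINT x|leb \<omega>. f x)"
  using integral_cong_AE[OF assms(2) measurable_lebesgue_on_cong_AE[OF assms] assms(3)] by simp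

text \<open>The constant sequence \<open>u\<close> converges in $H^1$ to \<open>u'\<close>, so
  that \<open>trace_eq_on_limit\<close> applies.\<close>

lemma trace_eq_on_cong_AE:
  assumes D: "bounded_lipschitz_domain \<omega>" and \<Gamma>: "\<Gamma> \<subseteq> frontier \<omega>" and eq: "trace_eq_on \<omega> \<Gamma> u g"
    and u': "u' \<in> sobolevH 1 \<omega>" and ae: "AE x in leb \<omega>. u x = u' x"
  shows "trace_eq_on \<omega> \<Gamma> u' g"
proof -
  note \<omega> = lipschitz_domain_open_bounded[OF D]
  have u: "u \<in> sobolevH 1 \<omega>" using eq unfolding trace_eq_on_def is_trace_def by blast
  note s = sobolevH1_sqint[OF u] sobolevH1_sqint[OF u']
  have w: "AE x in leb \<omega>. wpartial \<omega> i u x = wpartial \<omega> i u' x" for i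
    by (rule wpartial_AE_eq[OF \<omega> is_weak_partial_cong_AE[OF sobolevH1_weak[OF u'] _ AE_I2[OF refl]]])
       (use ae sqintD(1)[OF s(1)] sqintD(1)[OF s(4)] in auto)
  have 0: "l2sq (leb \<omega>) (\<lambda>x. a x - b x) = 0" if "AE x in leb \<omega>. a x = b x" for a b :: "real^2 => real"
  proof -
    have "AE x in leb \<omega>. (norm (a x - b x))\<^sup>2 = 0" using that by eventually_elim simp
    then show ?thesis unfolding l2sq_def by (rule integral_eq_zero_AE)
  qed
  have "h1sq \<omega> (\<lambda>x. u x - u' x) = 0" unfolding h1sq_diff(2)[OF \<omega> u u'] by (simp add: 0[OF ae] 0[OF w])
  then show ?thesis by (intro trace_eq_on_limit[OF D \<Gamma> eq u']) simp
qed

text \<open>Mazur's lemma for $L^2$, in the form in which it is needed: one may choose members of a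
  decreasing sequence of convex sets that converge strongly. Elements of almost minimal norm do,
  by the parallelogram identity.\<close>

lemma midpoint_convex_selection:
  fixes P :: "nat => ('a => 'b::euclidean_space) set"
  assumes s: "\<And>j h. h \<in> P j ==> sqint M h" and dec: "\<And>i j. i <= j ==> P j \<subseteq> P i"
    and mid: "\<And>j h h'. h \<in> P j ==> h' \<in> P j ==> (\<lambda>x. (1/2) *\<^sub>R (h x + h' x)) \<in> P j"
    and B: "\<And>j. \<exists>h\<in>P j. l2sq M h <= B"
  shows "\<exists>U u. (\<forall>j. U j \<in> P j) \<and> sqint M u \<and> (\<lambda>j. l2sq M (\<lambda>x. U j x - u x)) \<longlonglongrightarrow> 0"
proof -
  \<comment> \<open>The least norms increase and are bounded, so they converge; a midpoint of two almost minimal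
    elements cannot have a much smaller norm.\<close>
  define d where "d j = Inf (l2sq M ` P j)" for j
  have bdd: "bdd_below (l2sq M ` P j)" for j by (intro bdd_belowI2[of _ 0]) simp
  have ne: "l2sq M ` P j \<noteq> {}" for j using B[of j] by blast
  have d_le: "d j <= l2sq M h" if "h \<in> P j" for j h
    unfolding d_def by (intro cInf_lower bdd imageI that)
  have dB: "d j <= B" for j using B[of j] d_le by force
  have mono: "incseq d"
    unfolding incseq_def d_def using dec by (intro allI impI cInf_superset_mono ne bdd image_mono) 
  have "\<forall>j. \<exists>h. h \<in> P j \<and> l2sq M h < d j + 1 / real (Suc j)"
  proof
    fix j
    have "Inf (l2sq M ` P j) < d j + 1 / real (Suc j)" by (simp add: d_def)
    then show "\<exists>h. h \<in> P j \<and> l2sq M h < d j + 1 / real (Suc j)"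
      using cInf_lessD[OF ne] by blast
  qed
  then obtain U where U: "\<forall>j. U j \<in> P j \<and> l2sq M (U j) < d j + 1 / real (Suc j)"
    unfolding choice_iff by (elim exE)
  have "convergent d"
  proof (rule Bseq_mono_convergent[OF BseqI'[of _ "\<bar>d 0\<bar> + \<bar>B\<bar>"]])
    show "norm (d n) <= \<bar>d 0\<bar> + \<bar>B\<bar>" for n using dB[of n] incseqD[OF mono, of 0 n] by simp
  qed (use mono in \<open>auto simp: incseq_def\<close>)
  then have "Cauchy d" by (rule convergent_Cauchy)
  have est: "l2sq M (\<lambda>x. U i x - U j x) <= 2 * (d i - d j) + 2 / real (Suc i) + 2 / real (Suc j)" if "j <= i" for i j
  proof -
    have Ui: "U i \<in> P j" "U j \<in> P j" using U dec[OF that] by blast+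
    have "d j <= l2sq M (\<lambda>x. (1/2) *\<^sub>R (U i x + U j x))" by (intro d_le mid Ui)
    moreover have "l2sq M (U i) < d i + 1 / real (Suc i)" "l2sq M (U j) < d j + 1 / real (Suc j)" using U by blast+
    ultimately show ?thesis unfolding l2sq_parallelogram[OF s[OF Ui(1)] s[OF Ui(2)]] by simp
  qed
  have C: "\<exists>N. \<forall>m\<ge>N. \<forall>n\<ge>N. l2sq M (\<lambda>x. U m x - U n x) < e" if "e > 0" for e
  proof -
    obtain N1 where N1: "\<forall>m\<ge>N1. \<forall>n\<ge>N1. dist (d m) (d n) < e / 6"
      using \<open>Cauchy d\<close> \<open>e > 0\<close> unfolding Cauchy_def by (metis divide_pos_pos zero_less_numeral)
    obtain N2 where N2: "1 / real (Suc N2) < e / 6" using reals_Archimedean[of "e/6"] \<open>e > 0\<close> by (auto simp: inverse_eq_divide)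
    have t: "2 / real (Suc n) < e / 3" if "n >= N2" for n
    proof -
      have "2 / real (Suc n) <= 2 / real (Suc N2)" using that by (intro divide_left_mono) auto
      then show ?thesis using N2 by simp
    qed
    have *: "l2sq M (\<lambda>x. U m x - U n x) < e" if "n >= max N1 N2" "m >= n" for m n
    proof -
      have "\<bar>d m - d n\<bar> < e / 6" using N1 that by (simp add: dist_real_def)
      then have "d m - d n < e / 6" by linarith
      moreover have "2 / real (Suc m) < e / 3" "2 / real (Suc n) < e / 3" by (rule t, use that in simp)+
      moreover have "L <= 2 * a + p + q ==> L < e" if "a < e / 6" "p < e / 3" "q < e / 3" for L a p q :: real
        using that by linarith
      ultimately show ?thesis using est[OF that(2)] by blast
    qed
    show ?thesis
    proof (intro exI[of _ "max N1 N2"] allI impI)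
      fix m n assume mn: "m >= max N1 N2" "n >= max N1 N2"
      show "l2sq M (\<lambda>x. U m x - U n x) < e"
      proof (cases "n <= m")
        case True then show ?thesis using * mn by blast
      next
        case False
        then show ?thesis using *[of m n] mn unfolding l2sq_minus_commute[of M "U m"] by simp
      qed
    qed
  qed
  have sU: "sqint M (U j)" for j using U s by blast
  obtain u where "sqint M u" "(\<lambda>j. l2sq M (\<lambda>x. U j x - u x)) \<longlonglongrightarrow> 0"
    using l2_complete[of M U, OF sU C] by metis
  then show ?thesis using U by (intro exI[of _ U]) (rule exI[of _ u], blast)
qed

section \<open>Bounds on admissible surfaces\<close>

lemma norm_matmul: "norm (A ** B) <= norm A * norm B" for A B :: "real^2^2"
proof -
  have c: "(a * p + b * q)\<^sup>2 <= (a\<^sup>2 + b\<^sup>2) * (p\<^sup>2 + q\<^sup>2)" for a b p q :: real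
  proof -
    have "(a\<^sup>2 + b\<^sup>2) * (p\<^sup>2 + q\<^sup>2) - (a * p + b * q)\<^sup>2 = (a * q - b * p)\<^sup>2"
      by (simp add: power2_eq_square algebra_simps)
    then show ?thesis using zero_le_power2[of "a * q - b * p"] by linarith
  qed
  have "(norm (A ** B))\<^sup>2 = (\<Sum>i\<in>UNIV. \<Sum>j\<in>UNIV. (A$i$1 * B$1$j + A$i$2 * B$2$j)\<^sup>2)"
    by (simp add: norm_vec_sq mat2_simps(1))
  also have "\<dots> <= (\<Sum>i\<in>UNIV. \<Sum>j\<in>UNIV. ((A$i$1)\<^sup>2 + (A$i$2)\<^sup>2) * ((B$1$j)\<^sup>2 + (B$2$j)\<^sup>2))"
    by (intro sum_mono c)
  also have "\<dots> = (norm A * norm B)\<^sup>2"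
    unfolding power_mult_distrib norm_vec_sq[of A] norm_vec_sq[of B] by (simp add: norm_vec_sq sum_2 algebra_simps)
  finally show ?thesis by (rule power2_le_imp_le) simp
qed

lemma continuous_on_cross_cols: "continuous_on S cross_cols"
proof -
  have "continuous_on S (\<lambda>G :: real^2^3. column j G)" for j
    unfolding column_def by (intro continuous_on_vec_componentwise) (simp, intro continuous_intros)
  then show ?thesis unfolding cross_cols_def by (intro continuous_on_cross)
qed

lemma has_jet_sqint:
  assumes "has_jet \<omega> \<psi> G H"
  shows "sqint (leb \<omega>) \<psi>" "sqint (leb \<omega>) G" "sqint (leb \<omega>) H"
proof -
  have a: "is_weak_partial \<omega> j (\<lambda>x. \<psi> x $ m) (\<lambda>x. G x $ m $ j)" for m j using assms by (simp add: has_jet_def)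
  have b: "is_weak_partial \<omega> i (\<lambda>x. G x $ m $ j) (\<lambda>x. H x $ m $ i $ j)" for m i j using assms by (simp add: has_jet_def)
  show "sqint (leb \<omega>) \<psi>" by (intro sqint_vec) (rule is_weak_partial_sqint[OF a, THEN conjunct1])
  show "sqint (leb \<omega>) G" by (intro sqint_vec) (rule is_weak_partial_sqint[OF a, THEN conjunct2])
  show "sqint (leb \<omega>) H" by (intro sqint_vec) (rule is_weak_partial_sqint[OF b, THEN conjunct2])
qed

lemma l2sq_nth_tendsto:
  fixes U :: "nat => 'a => ('b::euclidean_space)^'n"
  assumes "\<And>k. sqint M (U k)" "sqint M u" "(\<lambda>k. l2sq M (\<lambda>x. U k x - u x)) \<longlonglongrightarrow> 0"
  shows "(\<lambda>k. l2sq M (\<lambda>x. U k x $ i - u x $ i)) \<longlonglongrightarrow> 0"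
proof (rule tendsto_sandwich[OF _ _ tendsto_const assms(3)])
  have "l2sq M (\<lambda>x. U k x $ i - u x $ i) <= l2sq M (\<lambda>x. U k x - u x)" for k
    by (rule l2sq_mono[OF sqint_diff[OF assms(1,2)]])
       (intro AE_I2, simp add: vector_minus_component[symmetric] Finite_Cartesian_Product.norm_nth_le del: vector_minus_component)
  then show "\<forall>\<^sub>F k in sequentially. l2sq M (\<lambda>x. U k x $ i - u x $ i) <= l2sq M (\<lambda>x. U k x - u x)" by simp
qed simp

lemma trace_eq_on_weak_limit:
  assumes D: "bounded_lipschitz_domain \<omega>" and \<Gamma>: "\<Gamma> \<subseteq> frontier \<omega>"
    and eq: "\<And>k. trace_eq_on \<omega> \<Gamma> (U k) g"
    and w: "\<And>k i. is_weak_partial \<omega> i (U k) (V k i)" "\<And>i. is_weak_partial \<omega> i u (v i)"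
    and cu: "(\<lambda>k. l2sq (leb \<omega>) (\<lambda>x. U k x - u x)) \<longlonglongrightarrow> 0"
    and cv: "\<And>i. (\<lambda>k. l2sq (leb \<omega>) (\<lambda>x. V k i x - v i x)) \<longlonglongrightarrow> 0"
  shows "trace_eq_on \<omega> \<Gamma> u g"
proof -
  note \<omega> = lipschitz_domain_open_bounded[OF D]
  have U: "U k \<in> sobolevH 1 \<omega>" for k unfolding sobolevH1_iff by (intro exI[of _ "V k"] allI w)
  have u: "u \<in> sobolevH 1 \<omega>" unfolding sobolevH1_iff by (intro exI[of _ v] allI w)
  have e: "wdist \<omega> i (U k) u = l2sq (leb \<omega>) (\<lambda>x. V k i x - v i x)" for k i
  proof (rule l2sq_cong_AE)
    show "AE x in leb \<omega>. wpartial \<omega> i (U k) x - wpartial \<omega> i u x = V k i x - v i x"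
      using wpartial_AE_eq[OF \<omega> w(1)[of i k]] wpartial_AE_eq[OF \<omega> w(2)[of i]] by eventually_elim simp
    show "(\<lambda>x. wpartial \<omega> i (U k) x - wpartial \<omega> i u x) \<in> borel_measurable (leb \<omega>)"
      by (intro borel_measurable_diff sqintD(1) sobolevH1_sqint U u)
    show "(\<lambda>x. V k i x - v i x) \<in> borel_measurable (leb \<omega>)"
      by (intro borel_measurable_diff sqintD(1)) (rule is_weak_partial_sqint[OF w(1), THEN conjunct2], rule is_weak_partial_sqint[OF w(2), THEN conjunct2])
  qed
  have "(\<lambda>k. h1sq \<omega> (\<lambda>x. U k x - u x)) \<longlonglongrightarrow> 0 + (\<Sum>i\<in>(UNIV :: 2 set). 0)"
    unfolding h1sq_diff(2)[OF \<omega> U u] e by (intro tendsto_add cu tendsto_sum cv)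
  then show ?thesis by (intro trace_eq_on_limit[OF D \<Gamma> eq u]) simp
qed

text \<open>The data of the problem together with a jet of the reference surface whose gradient is continuous
  up to the boundary. Everything below is expressed through jets; \<open>J N\<close> is the energy in which the
  coefficient \<open>N\<close> of the linear term is a parameter, so that it can be frozen.\<close>

locale clamped_plate =
  fixes \<omega> \<Gamma> :: "(real^2) set" and \<psi>A f :: "real^2 => real^3" and \<alpha> :: real and GA HA
  assumes D: "bounded_lipschitz_domain \<omega>" and \<Gamma>: "\<Gamma> \<subseteq> frontier \<omega>" "hausdorff_outer \<Gamma> > 0" and \<alpha>: "\<alpha> > 0"
    and jA: "has_jet \<omega> \<psi>A GA HA" and cA: "continuous_on (closure \<omega>) GA" "continuous_on (closure \<omega>) \<psi>A"
    and rA: "\<And>x. x \<in> closure \<omega> ==> rank (GA x) = 2" and f: "f \<in> L2_vec \<omega>"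
    and reference: "\<psi>A \<in> admissible \<omega> \<Gamma> \<psi>A"
begin

abbreviation "M \<equiv> leb \<omega>"

definition "g x = gram (GA x)"
definition "area x = sqrt (det (g x))"
definition "B x = inv2 (g x) ** second_form_of (GA x) (HA x) ** inv2 (g x)"
definition "F x = area x *\<^sub>R f x"
definition "clamped \<psi> G H \<longleftrightarrow> has_jet \<omega> \<psi> G H \<and> (\<forall>m. trace_eq_on \<omega> \<Gamma> (\<lambda>x. \<psi> x $ m) (\<lambda>x. \<psi>A x $ m)) \<and>
  (\<forall>m j. trace_eq_on \<omega> \<Gamma> (\<lambda>x. G x $ m $ j) (\<lambda>x. grad \<omega> \<psi>A x $ m $ j))"
definition "isometric G \<longleftrightarrow> (AE x in M. gram (G x) = g x)"
definition "nrm G x = tens (cross_cols (G x)) (B x)"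
definition "J N \<phi> H = \<alpha> / 2 * (l2sq M (\<lambda>x. hess_form (g x) (H x)) + 2 * (LINT x|M. H x \<bullet> N x)) - (LINT x|M. F x \<bullet> \<phi> x)"

lemma \<omega>: "open \<omega>" "bounded \<omega>" using D by (auto simp: bounded_lipschitz_domain_def)

sublocale finite_measure M by (rule finite_measure_lebesgue_on_open[OF \<omega>])

lemma cont_bdd:
  fixes h :: "real^2 => 'b::euclidean_space"
  assumes "continuous_on (closure \<omega>) h"
  shows "h \<in> borel_measurable M" "\<exists>C. \<forall>x\<in>\<omega>. norm (h x) <= C"
proof -
  have "continuous_on \<omega> h" by (rule continuous_on_subset[OF assms closure_subset])
  then show "h \<in> borel_measurable M" using \<omega>(1) by (intro continuous_imp_measurable_on_sets_lebesgue) auto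
  have "compact (h ` closure \<omega>)" using \<omega>(2) by (intro compact_continuous_image assms) (simp add: compact_closure)
  then have "bounded (h ` closure \<omega>)" by (rule compact_imp_bounded)
  then obtain C where C: "\<forall>y\<in>h ` closure \<omega>. norm y <= C" unfolding bounded_iff by blast
  show "\<exists>C. \<forall>x\<in>\<omega>. norm (h x) <= C" by (intro exI[of _ C] ballI C[rule_format] imageI subsetD[OF closure_subset])
qed

lemma spd_g: "x \<in> closure \<omega> ==> spd (g x)" unfolding g_def by (intro spd_gram rA)

lemma AE_spd_g: "AE x in M. spd (g x)" by (intro AE_I2 spd_g) (use closure_subset in auto)

lemma cont_g: "continuous_on (closure \<omega>) g" "continuous_on (closure \<omega>) (\<lambda>x. inv2 (g x))"
  "continuous_on (closure \<omega>) (\<lambda>x. sqrt2 (inv2 (g x)))" "continuous_on (closure \<omega>) area"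
proof -
  show g: "continuous_on (closure \<omega>) g" unfolding g_def by (rule continuous_on_gram[OF cA(1)])
  show i: "continuous_on (closure \<omega>) (\<lambda>x. inv2 (g x))" by (rule continuous_on_inv2[OF g spd_g])
  show "continuous_on (closure \<omega>) (\<lambda>x. sqrt2 (inv2 (g x)))" by (rule continuous_on_sqrt2[OF i spd_inv2[OF spd_g]])
  show "continuous_on (closure \<omega>) area" unfolding area_def by (intro continuous_on_real_sqrt continuous_on_det2 g)
qed

lemma measurable_cross_cols: "G \<in> borel_measurable M ==> (\<lambda>x. cross_cols (G x)) \<in> borel_measurable M"
  by (rule measurable_compose[OF _ borel_measurable_continuous_onI[OF continuous_on_cross_cols]])

lemma measurable_hess_form:
  assumes "H \<in> borel_measurable M"
  shows "(\<lambda>x. hess_form (g x) (H x)) \<in> borel_measurable M"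
proof (rule measurable_vec)
  fix m
  have s: "(\<lambda>x. sqrt2 (inv2 (g x))) \<in> borel_measurable M" by (rule cont_bdd(1)[OF cont_g(3)])
  have d: "(\<lambda>x. sqrt (sqrt (det (g x)))) \<in> borel_measurable M"
    by (rule cont_bdd(1)) (intro continuous_on_real_sqrt continuous_on_det2 cont_g)
  have "(\<lambda>x. sqrt (sqrt (det (g x))) *\<^sub>R (sqrt2 (inv2 (g x)) ** (H x $ m) ** sqrt2 (inv2 (g x)))) \<in> borel_measurable M"
    by (intro borel_measurable_scaleR d measurable_matmul s measurable_vec_nth assms)
  then show "(\<lambda>x. hess_form (g x) (H x) $ m) \<in> borel_measurable M" by (simp add: hess_form_def)
qed

lemma measurable_nrm:
  assumes "G \<in> borel_measurable M" "B \<in> borel_measurable M"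
  shows "nrm G \<in> borel_measurable M"
proof (rule measurable_vec)
  fix m
  have "(\<lambda>x. cross_cols (G x) $ m *\<^sub>R B x) \<in> borel_measurable M"
    by (intro borel_measurable_scaleR measurable_vec_nth measurable_cross_cols assms)
  then show "(\<lambda>x. nrm G x $ m) \<in> borel_measurable M" by (simp add: nrm_def tens_def)
qed

lemma sqint_B: "sqint M B"
proof -
  note s = has_jet_sqint[OF jA]
  obtain C where C: "\<forall>x\<in>\<omega>. norm (inv2 (g x)) <= C" using cont_bdd(2)[OF cont_g(2)] by (elim exE)
  have c: "(\<lambda>x. cross_cols (GA x)) \<in> borel_measurable M" by (intro measurable_cross_cols sqintD(1) s)
  have n: "(\<lambda>x. cross_cols (GA x) /\<^sub>R norm (cross_cols (GA x))) \<in> borel_measurable M" using c by measurable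
  have h: "(\<lambda>x. \<chi> m. HA x $ m $ i $ j) \<in> borel_measurable M" for i j
    by (rule measurable_vec) (simp, intro measurable_vec_nth sqintD(1) s)
  have "(\<lambda>x. second_form_of (GA x) (HA x)) \<in> borel_measurable M"
  proof (intro measurable_vec)
    fix i j
    have "(\<lambda>x. - ((\<chi> m. HA x $ m $ i $ j) \<bullet> (cross_cols (GA x) /\<^sub>R norm (cross_cols (GA x))))) \<in> borel_measurable M"
      by (intro borel_measurable_uminus borel_measurable_inner h n)
    then show "(\<lambda>x. second_form_of (GA x) (HA x) $ i $ j) \<in> borel_measurable M" by (simp add: second_form_of_def)
  qed
  then have m: "B \<in> borel_measurable M" unfolding B_def
    by (intro measurable_matmul cont_bdd(1)[OF cont_g(2)])
  have "norm (B x) <= (C * C) * norm (HA x)" if "x \<in> \<omega>" for x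
  proof -
    have Cx: "norm (inv2 (g x)) <= C" using C that by blast
    then have C0: "0 <= C" using norm_ge_zero order_trans by blast
    have "norm (B x) <= norm (inv2 (g x)) * norm (second_form_of (GA x) (HA x)) * norm (inv2 (g x))"
      unfolding B_def by (rule order_trans[OF norm_matmul mult_right_mono[OF norm_matmul norm_ge_zero]])
    also have "\<dots> <= C * norm (HA x) * C"
      by (intro mult_mono Cx norm_second_form_of mult_nonneg_nonneg C0 norm_ge_zero)
    finally show ?thesis by (simp add: mult_ac)
  qed
  then have "AE x in M. (norm (B x))\<^sup>2 <= (C * C)\<^sup>2 * (norm (HA x))\<^sup>2"
    by (intro AE_I2) (simp add: power_mono power_mult_distrib[symmetric])
  then show ?thesis by (rule sqint_bound[OF m integrable_mult_right[OF sqintD(2)[OF s(3)]]])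
qed

lemma sqint_F: "sqint M F"
proof -
  obtain C where C: "\<forall>x\<in>\<omega>. norm (area x) <= C" using cont_bdd(2)[OF cont_g(4)] by (elim exE)
  have "sqint M f" using f by (intro sqint_vec) (simp add: L2_vec_def L2_iff)
  then show ?thesis unfolding F_def
    by (rule sqint_mult_bounded[OF _ cont_bdd(1)[OF cont_g(4)]]) (use C in \<open>auto intro!: AE_I2\<close>)
qed

lemma isometric_cross: "isometric G ==> AE x in M. norm (cross_cols (G x)) = area x"
proof -
  assume "isometric G"
  then show "AE x in M. norm (cross_cols (G x)) = area x" unfolding isometric_def
  proof eventually_elim
    case (elim x)
    then show ?case using det_gram[of "G x"] by (simp add: area_def)
  qed
qed

text \<open>The dominating function does not depend on the immersion, which is needed for
  dominated convergence.\<close>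

lemma sqint_nrm:
  assumes "G \<in> borel_measurable M" "isometric G"
  shows "sqint M (nrm G)" "AE x in M. norm (nrm G x) = area x * norm (B x)"
proof -
  obtain C where C: "\<forall>x\<in>\<omega>. norm (area x) <= C" using cont_bdd(2)[OF cont_g(4)] by (elim exE)
  show n: "AE x in M. norm (nrm G x) = area x * norm (B x)"
    using isometric_cross[OF assms(2)] by eventually_elim (simp add: nrm_def norm_tens)
  have b: "sqint M (\<lambda>x. area x *\<^sub>R B x)"
    by (rule sqint_mult_bounded[OF sqint_B cont_bdd(1)[OF cont_g(4)]]) (use C in \<open>auto intro!: AE_I2\<close>)
  show "sqint M (nrm G)"
  proof (rule sqint_bound[OF measurable_nrm[OF assms(1) sqintD(1)[OF sqint_B]] sqintD(2)[OF b]])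
    show "AE x in M. (norm (nrm G x))\<^sup>2 <= (norm (area x *\<^sub>R B x))\<^sup>2"
      using n by eventually_elim (simp add: power_mult_distrib)
  qed
qed

lemma hess_form_bounds_\<omega>:
  "\<exists>k C. k > 0 \<and> (\<forall>x\<in>\<omega>. \<forall>H. k * norm H <= norm (hess_form (g x) H) \<and> norm (hess_form (g x) H) <= C * norm H)"
proof -
  have "compact (closure \<omega>)" using \<omega>(2) by (simp add: compact_closure)
  then have "\<exists>k C. k > 0 \<and> (\<forall>x\<in>closure \<omega>. \<forall>H. k * norm H <= norm (hess_form (g x) H) \<and> norm (hess_form (g x) H) <= C * norm H)"
    by (rule hess_form_bounds[OF _ cont_g(1) spd_g])
  then obtain k C where "k > 0" and kC: "\<forall>x\<in>closure \<omega>. \<forall>H. k * norm H <= norm (hess_form (g x) H) \<and> norm (hess_form (g x) H) <= C * norm H"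
    by (elim exE conjE)
  moreover have "\<forall>x\<in>\<omega>. \<forall>H. k * norm H <= norm (hess_form (g x) H) \<and> norm (hess_form (g x) H) <= C * norm H"
    by (rule ballI, rule bspec[OF kC], rule subsetD[OF closure_subset])
  ultimately show ?thesis by - (rule exI[of _ k], rule exI[of _ C], rule conjI)
qed

lemma sqint_hess_form:
  assumes "sqint M H"
  shows "sqint M (\<lambda>x. hess_form (g x) (H x))"
proof -
  obtain k C where "\<forall>x\<in>\<omega>. \<forall>H. k * norm H <= norm (hess_form (g x) H) \<and> norm (hess_form (g x) H) <= C * norm H"
    using hess_form_bounds_\<omega> by (elim exE conjE)
  then have "AE x in M. (norm (hess_form (g x) (H x)))\<^sup>2 <= C\<^sup>2 * (norm (H x))\<^sup>2"
    by (intro AE_I2) (simp add: power_mono power_mult_distrib[symmetric])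
  then show ?thesis by (rule sqint_bound[OF measurable_hess_form[OF sqintD(1)[OF assms]] integrable_mult_right[OF sqintD(2)[OF assms]]])
qed

text \<open>The right-hand side contains representatives of gradient and Hessian that are
  measurable functions, and no normal.\<close>

lemma energy_eq:
  assumes j: "has_jet \<omega> \<psi> G H" and iso: "isometric G"
  shows "energy \<omega> \<alpha> \<psi>A f \<psi> = J (nrm G) \<psi> H"
proof -
  note s = has_jet_sqint[OF j]
  have sn: "sqint M (nrm G)" by (rule sqint_nrm(1)[OF sqintD(1)[OF s(2)] iso])
  have ff: "AE x in M. first_form \<omega> \<psi>A x = g x"
    using has_jet_grad_AE[OF \<omega> jA] by eventually_elim (simp add: first_form_def g_def gram_def)
  have sf: "AE x in M. second_form \<omega> \<phi> x = second_form_of (G x) (H x)" if "has_jet \<omega> \<phi> G H" for \<phi> G H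
    using has_jet_grad_AE[OF \<omega> that] has_jet_hess_AE[OF \<omega> that]
    by eventually_elim (simp add: second_form_def second_form_of_def unit_normal_def Let_def cross_cols_def)
  have i1: "integrable M (\<lambda>x. (norm (hess_form (g x) (H x)))\<^sup>2)" and i2: "integrable M (\<lambda>x. H x \<bullet> nrm G x)"
    using sqintD(2)[OF sqint_hess_form[OF s(3)]] integrable_sqint_inner[OF s(3) sn] by auto
  have "(LINT x|M. (let g = first_form \<omega> \<psi>A x in
          sqrt (det g) *
            ((\<Sum>m\<in>UNIV. (norm (inv_sqrt g ** hess \<omega> (\<lambda>y. \<psi> y $ m) x ** inv_sqrt g))\<^sup>2)
             - 2 * (second_form \<omega> \<psi> x \<bullet> (matrix_inv g ** second_form \<omega> \<psi>A x ** matrix_inv g)))))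
      = (LINT x|M. (norm (hess_form (g x) (H x)))\<^sup>2 + 2 * (H x \<bullet> nrm G x))"
  proof (rule integral_lebesgue_on_cong_AE[OF \<omega>(1)])
    show "(\<lambda>x. (norm (hess_form (g x) (H x)))\<^sup>2 + 2 * (H x \<bullet> nrm G x)) \<in> borel_measurable M"
      by (intro borel_measurable_integrable Bochner_Integration.integrable_add i1 integrable_mult_right i2)
    show "AE x in M. (norm (hess_form (g x) (H x)))\<^sup>2 + 2 * (H x \<bullet> nrm G x) = (let g = first_form \<omega> \<psi>A x in
          sqrt (det g) *
            ((\<Sum>m\<in>UNIV. (norm (inv_sqrt g ** hess \<omega> (\<lambda>y. \<psi> y $ m) x ** inv_sqrt g))\<^sup>2)
             - 2 * (second_form \<omega> \<psi> x \<bullet> (matrix_inv g ** second_form \<omega> \<psi>A x ** matrix_inv g))))"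
      using ff sf[OF j] sf[OF jA] has_jet_hess_AE[OF \<omega> j] AE_spd_g iso[unfolded isometric_def]
    proof eventually_elim
      case (elim x)
      have "det (g x) \<noteq> 0" using elim(5) by (simp add: spd_2_iff)
      then have i: "matrix_inv (g x) = inv2 (g x)" by (rule matrix_inv_inv2)
      show ?case unfolding Let_def elim(1,2,3) i elim(4)[rule_format] density_eq[OF elim(5,6)]
        by (simp add: nrm_def B_def)
    qed
  qed
  also have "\<dots> = l2sq M (\<lambda>x. hess_form (g x) (H x)) + 2 * (LINT x|M. H x \<bullet> nrm G x)"
    unfolding l2sq_def using i1 i2 by simp
  finally have e1: "(LINT x|M. (let g = first_form \<omega> \<psi>A x in
          sqrt (det g) *
            ((\<Sum>m\<in>UNIV. (norm (inv_sqrt g ** hess \<omega> (\<lambda>y. \<psi> y $ m) x ** inv_sqrt g))\<^sup>2)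
             - 2 * (second_form \<omega> \<psi> x \<bullet> (matrix_inv g ** second_form \<omega> \<psi>A x ** matrix_inv g)))))
      = l2sq M (\<lambda>x. hess_form (g x) (H x)) + 2 * (LINT x|M. H x \<bullet> nrm G x)" .
  have e2: "(LINT x|M. sqrt (det (first_form \<omega> \<psi>A x)) * (f x \<bullet> \<psi> x)) = (LINT x|M. F x \<bullet> \<psi> x)"
  proof (rule integral_lebesgue_on_cong_AE[OF \<omega>(1)])
    show "(\<lambda>x. F x \<bullet> \<psi> x) \<in> borel_measurable M"
      by (rule borel_measurable_integrable[OF integrable_sqint_inner[OF sqint_F s(1)]])
    show "AE x in M. F x \<bullet> \<psi> x = sqrt (det (first_form \<omega> \<psi>A x)) * (f x \<bullet> \<psi> x)"
      using ff by eventually_elim (simp add: F_def area_def)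
  qed
  show ?thesis unfolding energy_def J_def e1 e2 ..
qed

lemma admissible_iff: "\<psi> \<in> admissible \<omega> \<Gamma> \<psi>A \<longleftrightarrow> (\<exists>G H. clamped \<psi> G H \<and> isometric G)"
proof -
  have ff: "AE x in M. first_form \<omega> \<psi>A x = g x"
    using has_jet_grad_AE[OF \<omega> jA] by eventually_elim (simp add: first_form_def g_def gram_def)
  have iff: "(AE x in M. first_form \<omega> \<psi> x = first_form \<omega> \<psi>A x) \<longleftrightarrow> isometric G" if "has_jet \<omega> \<psi> G H" for G H
  proof
    assume "AE x in M. first_form \<omega> \<psi> x = first_form \<omega> \<psi>A x"
    then show "isometric G" unfolding isometric_def
      using ff has_jet_grad_AE[OF \<omega> that] by eventually_elim (simp add: first_form_def gram_def)
  next
    assume "isometric G"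
    then show "AE x in M. first_form \<omega> \<psi> x = first_form \<omega> \<psi>A x" unfolding isometric_def
      using ff has_jet_grad_AE[OF \<omega> that] by eventually_elim (simp add: first_form_def gram_def)
  qed
  have ae: "AE x in M. G x $ m $ j = grad \<omega> \<psi> x $ m $ j" "AE x in M. grad \<omega> \<psi> x $ m $ j = G x $ m $ j" if "has_jet \<omega> \<psi> G H" for G H m j
    using has_jet_grad_AE[OF \<omega> that] by (eventually_elim, simp)+
  show ?thesis
  proof
    assume a: "\<psi> \<in> admissible \<omega> \<Gamma> \<psi>A"
    then obtain G H where j: "has_jet \<omega> \<psi> G H" unfolding admissible_def using sobolevH_vec2_jet by blast
    have "trace_eq_on \<omega> \<Gamma> (\<lambda>x. G x $ m $ j) (\<lambda>x. grad \<omega> \<psi>A x $ m $ j)" for m j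
      by (rule trace_eq_on_cong_AE[OF D \<Gamma>(1) _ jet_components_H1(2)[OF \<omega> \<open>has_jet \<omega> \<psi> G H\<close>] ae(2)[OF \<open>has_jet \<omega> \<psi> G H\<close>]])
         (use a in \<open>simp add: admissible_def\<close>)
    then have "clamped \<psi> G H" unfolding clamped_def using a j by (simp add: admissible_def)
    moreover have "isometric G" using a iff[OF j] by (simp add: admissible_def)
    ultimately show "\<exists>G H. clamped \<psi> G H \<and> isometric G" by - (rule exI[of _ G], rule exI[of _ H], rule conjI)
  next
    assume "\<exists>G H. clamped \<psi> G H \<and> isometric G"
    then obtain G H where c: "clamped \<psi> G H" and i: "isometric G" by (elim exE conjE)
    have jj: "has_jet \<omega> \<psi> G H" using c by (simp add: clamped_def)
    have "trace_eq_on \<omega> \<Gamma> (\<lambda>x. grad \<omega> \<psi> x $ m $ j) (\<lambda>x. grad \<omega> \<psi>A x $ m $ j)" for m j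
      by (rule trace_eq_on_cong_AE[OF D \<Gamma>(1) _ jet_components_H1(3)[OF \<omega> jj] ae(1)[OF jj]])
         (use c in \<open>simp add: clamped_def\<close>)
    then show "\<psi> \<in> admissible \<omega> \<Gamma> \<psi>A"
      unfolding admissible_def using c has_jet_sobolevH_vec2[OF jj] iff[OF jj] i by (simp add: clamped_def)
  qed
qed

lemma l2sq_le_const:
  fixes u :: "real^2 => real"
  assumes "AE x in M. \<bar>u x\<bar> <= c"
  shows "l2sq M u <= l2sq M (\<lambda>_. c)"
  by (rule l2sq_mono[OF sqint_const]) (use assms in eventually_elim, simp)

lemma isometric_bound: "\<exists>T\<ge>0. \<forall>G. isometric G --> (AE x in M. (norm (G x))\<^sup>2 <= T\<^sup>2)"
proof -
  obtain C where C: "\<forall>x\<in>\<omega>. norm (trace (g x)) <= C" using cont_bdd(2)[OF continuous_on_trace2[OF cont_g(1)]] by (elim exE)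
  show ?thesis
  proof (intro exI[of _ "sqrt \<bar>C\<bar>"] conjI allI impI)
    fix G assume "isometric G"
    then show "AE x in M. (norm (G x))\<^sup>2 <= (sqrt \<bar>C\<bar>)\<^sup>2"
      unfolding isometric_def norm_gram by (rule AE_mp) (intro AE_I2 impI, use C in force)
  qed simp
qed

text \<open>An isometric immersion has a bounded gradient, hence oscillates boundedly; the boundary
  condition on a set of positive length then bounds the function itself.\<close>

lemma uniform_bound:
  "\<exists>K. \<forall>\<psi> G H. clamped \<psi> G H --> isometric G -->
     (\<forall>m. AE x in M. \<bar>\<psi> x $ m\<bar> <= K) \<and> (\<forall>m j. AE x in M. \<bar>G x $ m $ j\<bar> <= K)"
proof -
  obtain T where T0: "T >= 0" and T: "\<forall>G. isometric G --> (AE x in M. (norm (G x))\<^sup>2 <= T\<^sup>2)" using isometric_bound by (elim exE conjE)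
  obtain K where K: "\<forall>u v C. (\<forall>i. is_weak_partial \<omega> i u (v i)) --> C >= 0 --> (AE x in M. (sumsq v x) <= C\<^sup>2)
     --> (\<exists>c. AE x in M. \<bar>u x - c\<bar> <= K * C)" using oscillation_bound[OF D] by (elim exE)
  obtain C where C0: "C >= 0" and C: "\<forall>u g c. trace_eq_on \<omega> \<Gamma> u g -->
    c\<^sup>2 <= C * (l2sq M (\<lambda>x. u x - g x - c) + (\<Sum>i\<in>UNIV. l2sq M (\<lambda>x. wpartial \<omega> i u x - wpartial \<omega> i g x)))"
    using trace_eq_on_const_bound[OF D \<Gamma>] by (elim exE conjE)
  obtain A where A: "\<forall>x\<in>\<omega>. norm (\<psi>A x) <= A" using cont_bdd(2)[OF cA(2)] by (elim exE)
  define R where "R = sqrt (C * (l2sq M (\<lambda>_. K * T + A) + (\<Sum>i\<in>(UNIV::2 set). l2sq M (\<lambda>_. 2 * T))))"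
  have comp: "\<bar>v $ m $ j\<bar> <= norm v" for v :: "real^2^3" and m j
    using Finite_Cartesian_Product.norm_nth_le[of "v $ m" j] Finite_Cartesian_Product.norm_nth_le[of v m] by simp
  have Gb: "AE x in M. \<bar>G x $ m $ j\<bar> <= T" if "isometric G" for G m j
    using T[rule_format, OF that]
  proof eventually_elim
    case (elim x)
    then have "norm (G x) <= T" using T0 by (rule power2_le_imp_le)
    then show ?case using comp[of "G x" m j] by simp
  qed
  have isoA: "isometric GA" by (simp add: isometric_def g_def)
  have main: "AE x in M. \<bar>\<psi> x $ m\<bar> <= \<bar>K * T\<bar> + R" if cl: "clamped \<psi> G H" and iso: "isometric G" for \<psi> G H m
  proof -
    have jj: "has_jet \<omega> \<psi> G H" using cl by (simp add: clamped_def)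
    have w: "\<forall>i. is_weak_partial \<omega> i (\<lambda>x. \<psi> x $ m) (\<lambda>x. G x $ m $ i)" using jj by (simp add: has_jet_def)
    have "AE x in M. (\<Sum>i\<in>UNIV. (G x $ m $ i)\<^sup>2) <= T\<^sup>2" using T[rule_format, OF iso]
    proof eventually_elim
      case (elim x)
      have "(\<Sum>i\<in>UNIV. (G x $ m $ i)\<^sup>2) = (norm (G x $ m))\<^sup>2" by (simp add: norm_vec_sq)
      also have "\<dots> <= (norm (G x))\<^sup>2" by (intro power_mono Finite_Cartesian_Product.norm_nth_le norm_ge_zero)
      finally show ?case using elim by linarith
    qed
    then have "\<exists>c. AE x in M. \<bar>\<psi> x $ m - c\<bar> <= K * T"
      by (rule K[rule_format, of "\<lambda>x. \<psi> x $ m" "\<lambda>i x. G x $ m $ i" T, OF w[rule_format] T0])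
    then obtain c where c: "AE x in M. \<bar>\<psi> x $ m - c\<bar> <= K * T" by (elim exE)
    have tr: "trace_eq_on \<omega> \<Gamma> (\<lambda>x. \<psi> x $ m) (\<lambda>x. \<psi>A x $ m)" using cl by (simp add: clamped_def)
    have "l2sq M (\<lambda>x. \<psi> x $ m - \<psi>A x $ m - c) <= l2sq M (\<lambda>_. K * T + A)"
    proof (rule l2sq_le_const)
      have a: "AE x in M. \<bar>\<psi>A x $ m\<bar> <= A"
      proof (intro AE_I2)
        fix x assume "x \<in> space M"
        then have "norm (\<psi>A x) <= A" using A by simp
        then show "\<bar>\<psi>A x $ m\<bar> <= A" using component_le_norm_cart[of "\<psi>A x" m] by linarith
      qed
      show "AE x in M. \<bar>\<psi> x $ m - \<psi>A x $ m - c\<bar> <= K * T + A" using a c by eventually_elim linarith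
    qed
    moreover have "l2sq M (\<lambda>x. wpartial \<omega> i (\<lambda>x. \<psi> x $ m) x - wpartial \<omega> i (\<lambda>x. \<psi>A x $ m) x) <= l2sq M (\<lambda>_. 2 * T)" for i
    proof (rule l2sq_le_const)
      show "AE x in M. \<bar>wpartial \<omega> i (\<lambda>x. \<psi> x $ m) x - wpartial \<omega> i (\<lambda>x. \<psi>A x $ m) x\<bar> <= 2 * T"
        using jet_components_H1(4)[OF \<omega> jj, of i m] jet_components_H1(4)[OF \<omega> jA, of i m] Gb[OF iso, of m i] Gb[OF isoA, of m i]
        by eventually_elim linarith
    qed
    ultimately have "C * (l2sq M (\<lambda>x. \<psi> x $ m - \<psi>A x $ m - c) + (\<Sum>i\<in>UNIV. l2sq M (\<lambda>x. wpartial \<omega> i (\<lambda>x. \<psi> x $ m) x - wpartial \<omega> i (\<lambda>x. \<psi>A x $ m) x)))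
       <= C * (l2sq M (\<lambda>_. K * T + A) + (\<Sum>i\<in>(UNIV::2 set). l2sq M (\<lambda>_. 2 * T)))"
      by (intro mult_left_mono C0 add_mono sum_mono)
    then have "c\<^sup>2 <= C * (l2sq M (\<lambda>_. K * T + A) + (\<Sum>i\<in>(UNIV::2 set). l2sq M (\<lambda>_. 2 * T)))"
      using C[rule_format, OF tr, of c] by linarith
    then have cR: "\<bar>c\<bar> <= R" unfolding R_def by (rule real_le_rsqrt[of "\<bar>c\<bar>", simplified])
    show ?thesis using c
    proof eventually_elim
      case (elim x)
      then show ?case using cR by linarith
    qed
  qed
  show ?thesis
  proof (intro exI[of _ "\<bar>K * T\<bar> + \<bar>R\<bar> + T"] allI impI conjI)
    fix \<psi> G H m assume cl: "clamped \<psi> G H" and iso: "isometric G"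
    show "AE x in M. \<bar>\<psi> x $ m\<bar> <= \<bar>K * T\<bar> + \<bar>R\<bar> + T" using main[OF cl iso, of m]
    proof eventually_elim
      case (elim x)
      then show ?case using T0 by linarith
    qed
    show "AE x in M. \<bar>G x $ m $ j\<bar> <= \<bar>K * T\<bar> + \<bar>R\<bar> + T" for j using Gb[OF iso, of m j]
    proof eventually_elim
      case (elim x)
      then show ?case by linarith
    qed
  qed
qed

end

section \<open>The direct method\<close>

lemma has_jet_midpoint:
  assumes \<omega>: "open \<omega>" "bounded \<omega>" and j: "has_jet \<omega> \<psi> G H" "has_jet \<omega> \<psi>' G' H'"
  shows "has_jet \<omega> (\<lambda>x. (1/2) *\<^sub>R (\<psi> x + \<psi>' x)) (\<lambda>x. (1/2) *\<^sub>R (G x + G' x)) (\<lambda>x. (1/2) *\<^sub>R (H x + H' x))"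
proof -
  have "is_weak_partial \<omega> j (\<lambda>x. (1/2) * \<psi> x $ m + (1/2) * \<psi>' x $ m) (\<lambda>x. (1/2) * G x $ m $ j + (1/2) * G' x $ m $ j)" for m j
    by (rule is_weak_partial_lincomb[OF \<omega>]) (use j in \<open>simp_all add: has_jet_def\<close>)
  moreover have "is_weak_partial \<omega> i (\<lambda>x. (1/2) * G x $ m $ j + (1/2) * G' x $ m $ j) (\<lambda>x. (1/2) * H x $ m $ i $ j + (1/2) * H' x $ m $ i $ j)" for m i j
    by (rule is_weak_partial_lincomb[OF \<omega>]) (use j in \<open>simp_all add: has_jet_def\<close>)
  ultimately show ?thesis by (simp add: has_jet_def distrib_left)
qed

lemma l2sq_midpoint_le:
  assumes "sqint M u" "sqint M v" "l2sq M u <= t" "l2sq M v <= t"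
  shows "l2sq M (\<lambda>x. (1/2) *\<^sub>R (u x + v x)) <= t"
  using l2sq_parallelogram[OF assms(1,2)] l2sq_nonneg[of M "\<lambda>x. u x - v x"] assms(3,4) by linarith

lemma l2sq_midpoint_dist_le:
  assumes "sqint M u" "sqint M v" "sqint M w" "l2sq M (\<lambda>x. u x - w x) <= t" "l2sq M (\<lambda>x. v x - w x) <= t"
  shows "l2sq M (\<lambda>x. (1/2) *\<^sub>R (u x + v x) - w x) <= t"
proof -
  have e: "(1/2) *\<^sub>R (u x + v x) - w x = (1/2) *\<^sub>R ((u x - w x) + (v x - w x))" for x
  proof -
    have "(u x - w x) + (v x - w x) = (u x + v x) - (w x + w x)" by simp
    then show ?thesis by (simp only: scaleR_diff_right scaleR_half_double)
  qed
  show ?thesis unfolding e by (rule l2sq_midpoint_le[OF sqint_diff[OF assms(1,3)] sqint_diff[OF assms(2,3)] assms(4,5)])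
qed

lemma l2sq_Young:
  assumes "sqint M u" "sqint M v"
  shows "2 * s * (LINT x|M. u x \<bullet> v x) >= - l2sq M u - s\<^sup>2 * l2sq M v"
  using l2sq_add_scaleR[OF assms, of s] l2sq_nonneg[of M "\<lambda>x. u x + s *\<^sub>R v x"] by linarith

context clamped_plate
begin

lemma l2sq_hess_form:
  "\<exists>k C. k > 0 \<and> (\<forall>H. sqint M H --> k\<^sup>2 * l2sq M H <= l2sq M (\<lambda>x. hess_form (g x) (H x)) \<and> l2sq M (\<lambda>x. hess_form (g x) (H x)) <= C\<^sup>2 * l2sq M H)"
proof -
  obtain k C where k: "k > 0" and b: "\<forall>x\<in>\<omega>. \<forall>H. k * norm H <= norm (hess_form (g x) H) \<and> norm (hess_form (g x) H) <= C * norm H"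
    using hess_form_bounds_\<omega> by (elim exE conjE)
  have "k\<^sup>2 * l2sq M H <= l2sq M (\<lambda>x. hess_form (g x) (H x)) \<and> l2sq M (\<lambda>x. hess_form (g x) (H x)) <= C\<^sup>2 * l2sq M H" if s: "sqint M H" for H
  proof -
    have "l2sq M (\<lambda>x. k *\<^sub>R H x) <= l2sq M (\<lambda>x. hess_form (g x) (H x))"
      by (rule l2sq_mono[OF sqint_hess_form[OF s]]) (use b k in \<open>auto intro!: AE_I2\<close>)
    moreover have "l2sq M (\<lambda>x. hess_form (g x) (H x)) <= l2sq M (\<lambda>x. C *\<^sub>R H x)"
    proof (rule l2sq_mono[OF sqint_scaleR[OF s]], intro AE_I2)
      fix x assume "x \<in> space M"
      then have "norm (hess_form (g x) (H x)) <= C * norm (H x)" using b by simp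
      also have "\<dots> <= \<bar>C\<bar> * norm (H x)" by (intro mult_right_mono) auto
      finally show "norm (hess_form (g x) (H x)) <= norm (C *\<^sub>R H x)" by simp
    qed
    ultimately show ?thesis by (simp add: l2sq_scaleR)
  qed
  then show ?thesis using k by - (rule exI[of _ k], rule exI[of _ C], blast)
qed

text \<open>Young's inequality absorbs the linear term, whose coefficient has a fixed $L^2$ bound, into half
  of the quadratic form; the load term is bounded by \<open>uniform_bound\<close>.\<close>

lemma coercive:
  "\<exists>c1 c2. c1 > 0 \<and> (\<forall>\<psi> G H. clamped \<psi> G H --> isometric G --> c1 * l2sq M H <= J (nrm G) \<psi> H + c2)"
proof -
  obtain K where K: "\<forall>\<psi> G H. clamped \<psi> G H --> isometric G -->
     (\<forall>m. AE x in M. \<bar>\<psi> x $ m\<bar> <= K) \<and> (\<forall>m j. AE x in M. \<bar>G x $ m $ j\<bar> <= K)" using uniform_bound by (elim exE)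
  obtain k C where k: "k > 0" and kC: "\<forall>H. sqint M H --> k\<^sup>2 * l2sq M H <= l2sq M (\<lambda>x. hess_form (g x) (H x)) \<and> l2sq M (\<lambda>x. hess_form (g x) (H x)) <= C\<^sup>2 * l2sq M H"
    using l2sq_hess_form by (elim exE conjE)
  define n where "n = l2sq M (\<lambda>x. area x *\<^sub>R B x)"
  define p where "p = (\<Sum>m\<in>(UNIV::3 set). l2sq M (\<lambda>_. K))"
  define s where "s = k\<^sup>2 / 2"
  have s0: "s > 0" using k by (simp add: s_def)
  have aB: "sqint M (\<lambda>x. area x *\<^sub>R B x)"
  proof -
    obtain C where C: "\<forall>x\<in>\<omega>. norm (area x) <= C" using cont_bdd(2)[OF cont_g(4)] by (elim exE)
    show ?thesis by (rule sqint_mult_bounded[OF sqint_B cont_bdd(1)[OF cont_g(4)]]) (use C in \<open>auto intro!: AE_I2\<close>)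
  qed
  have "(\<alpha> / 2 * s) * l2sq M H <= J (nrm G) \<psi> H + (\<alpha> / 2 * (n / s) + (l2sq M F + p) / 2)"
    if cl: "clamped \<psi> G H" and iso: "isometric G" for \<psi> G H
  proof -
    have jj: "has_jet \<omega> \<psi> G H" using cl by (simp add: clamped_def)
    note q = has_jet_sqint[OF jj]
    note sn = sqint_nrm[OF sqintD(1)[OF q(2)] iso]
    have nn: "l2sq M (nrm G) <= n" unfolding n_def
      by (rule l2sq_mono[OF aB]) (use sn(2) in \<open>eventually_elim, simp add: mult_right_mono\<close>)
    have "l2sq M \<psi> = (\<Sum>m\<in>UNIV. l2sq M (\<lambda>x. \<psi> x $ m))" by (rule l2sq_vec[OF q(1)])
    also have "\<dots> <= p" unfolding p_def
      by (intro sum_mono l2sq_le_const) (rule K[rule_format, OF cl iso, THEN conjunct1, rule_format])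
    finally have pp: "l2sq M \<psi> <= p" .
    have "2 * s * (LINT x|M. nrm G x \<bullet> H x) >= - l2sq M (nrm G) - s\<^sup>2 * l2sq M H" by (rule l2sq_Young[OF sn(1) q(3)])
    then have "s * (2 * (LINT x|M. H x \<bullet> nrm G x)) >= s * (- (n / s) - s * l2sq M H)"
      using nn s0 by (simp add: inner_commute power2_eq_square algebra_simps)
    then have I: "2 * (LINT x|M. H x \<bullet> nrm G x) >= - (n / s) - s * l2sq M H" using s0 by simp
    have "k\<^sup>2 * l2sq M H <= l2sq M (\<lambda>x. hess_form (g x) (H x))" using kC q(3) by blast
    then have Q: "2 * s * l2sq M H <= l2sq M (\<lambda>x. hess_form (g x) (H x))" by (simp add: s_def)
    have "2 * (- 1) * (LINT x|M. F x \<bullet> \<psi> x) >= - l2sq M F - (- 1)\<^sup>2 * l2sq M \<psi>" by (rule l2sq_Young[OF sqint_F q(1)])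
    then have L: "(LINT x|M. F x \<bullet> \<psi> x) <= (l2sq M F + p) / 2" using pp by simp
    have "\<alpha> / 2 * (s * l2sq M H - n / s) <= \<alpha> / 2 * (l2sq M (\<lambda>x. hess_form (g x) (H x)) + 2 * (LINT x|M. H x \<bullet> nrm G x))"
      using I Q \<alpha> by (intro mult_left_mono) auto
    moreover have "\<alpha> / 2 * (s * l2sq M H - n / s) = \<alpha> / 2 * s * l2sq M H - \<alpha> / 2 * (n / s)" by (simp add: right_diff_distrib mult.assoc)
    ultimately show ?thesis unfolding J_def using L by linarith
  qed
  moreover have "\<alpha> / 2 * s > 0" using \<alpha> s0 by simp
  ultimately show ?thesis by - (rule exI[of _ "\<alpha> / 2 * s"], rule exI[of _ "\<alpha> / 2 * (n / s) + (l2sq M F + p) / 2"], blast)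
qed

text \<open>With a fixed coefficient \<open>N\<close> the functional is a square of a norm plus
  linear terms.\<close>

lemma J_midpoint:
  assumes s: "sqint M N" "sqint M \<phi>" "sqint M \<phi>'" "sqint M H" "sqint M H'" and t: "J N \<phi> H <= t" "J N \<phi>' H' <= t"
  shows "J N (\<lambda>x. (1/2) *\<^sub>R (\<phi> x + \<phi>' x)) (\<lambda>x. (1/2) *\<^sub>R (H x + H' x)) <= t"
proof -
  let ?q = "\<lambda>H x. hess_form (g x) (H x)"
  have "4 * l2sq M (\<lambda>x. (1/2) *\<^sub>R (?q H x + ?q H' x)) <= 2 * l2sq M (?q H) + 2 * l2sq M (?q H')"
    using l2sq_parallelogram[OF sqint_hess_form[OF s(4)] sqint_hess_form[OF s(5)]] l2sq_nonneg[of M "\<lambda>x. ?q H x - ?q H' x"] by linarith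
  then have Q: "l2sq M (\<lambda>x. hess_form (g x) ((1/2) *\<^sub>R (H x + H' x))) <= (l2sq M (?q H) + l2sq M (?q H')) / 2"
    by (simp add: hess_form_linear)
  note i = integrable_sqint_inner[OF s(4,1)] integrable_sqint_inner[OF s(5,1)] integrable_sqint_inner[OF sqint_F s(2)] integrable_sqint_inner[OF sqint_F s(3)]
  have I: "(LINT x|M. ((1/2) *\<^sub>R (H x + H' x)) \<bullet> N x) = ((LINT x|M. H x \<bullet> N x) + (LINT x|M. H' x \<bullet> N x)) / 2"
    using i by (simp add: inner_add_left)
  have L: "(LINT x|M. F x \<bullet> ((1/2) *\<^sub>R (\<phi> x + \<phi>' x))) = ((LINT x|M. F x \<bullet> \<phi> x) + (LINT x|M. F x \<bullet> \<phi>' x)) / 2"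
    using i by (simp add: inner_add_right)
  have "\<alpha> / 2 * (l2sq M (\<lambda>x. hess_form (g x) ((1/2) *\<^sub>R (H x + H' x))) + 2 * (LINT x|M. ((1/2) *\<^sub>R (H x + H' x)) \<bullet> N x))
     <= \<alpha> / 2 * ((l2sq M (?q H) + l2sq M (?q H')) / 2 + 2 * (LINT x|M. ((1/2) *\<^sub>R (H x + H' x)) \<bullet> N x))"
    using Q \<alpha> by (intro mult_left_mono) auto
  then have "J N (\<lambda>x. (1/2) *\<^sub>R (\<phi> x + \<phi>' x)) (\<lambda>x. (1/2) *\<^sub>R (H x + H' x)) <= (J N \<phi> H + J N \<phi>' H') / 2"
    unfolding J_def I L by (simp add: algebra_simps add_divide_distrib diff_divide_distrib)
  also have "\<dots> <= t" using t by simp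
  finally show ?thesis .
qed

lemma J_tendsto:
  assumes s: "sqint M N" "\<And>j. sqint M (\<phi> j)" "sqint M \<phi>'" "\<And>j. sqint M (H j)" "sqint M H'"
    and c: "(\<lambda>j. l2sq M (\<lambda>x. \<phi> j x - \<phi>' x)) \<longlonglongrightarrow> 0" "(\<lambda>j. l2sq M (\<lambda>x. H j x - H' x)) \<longlonglongrightarrow> 0"
  shows "(\<lambda>j. J N (\<phi> j) (H j)) \<longlonglongrightarrow> J N \<phi>' H'"
proof -
  obtain k C where kC: "\<forall>H. sqint M H --> k\<^sup>2 * l2sq M H <= l2sq M (\<lambda>x. hess_form (g x) (H x)) \<and> l2sq M (\<lambda>x. hess_form (g x) (H x)) <= C\<^sup>2 * l2sq M H"
    using l2sq_hess_form by (elim exE conjE)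
  have "(\<lambda>j. l2sq M (\<lambda>x. hess_form (g x) (H j x) - hess_form (g x) (H' x))) \<longlonglongrightarrow> 0"
  proof (rule tendsto_sandwich[OF _ _ tendsto_const])
    have "l2sq M (\<lambda>x. hess_form (g x) (H j x) - hess_form (g x) (H' x)) <= C\<^sup>2 * l2sq M (\<lambda>x. H j x - H' x)" for j
      using kC sqint_diff[OF s(4)[of j] s(5)] unfolding hess_form_linear(3)[symmetric] by blast
    then show "\<forall>\<^sub>F j in sequentially. l2sq M (\<lambda>x. hess_form (g x) (H j x) - hess_form (g x) (H' x)) <= C\<^sup>2 * l2sq M (\<lambda>x. H j x - H' x)"
      by (intro always_eventually allI)
    show "(\<lambda>j. C\<^sup>2 * l2sq M (\<lambda>x. H j x - H' x)) \<longlonglongrightarrow> 0" using tendsto_mult_right_zero[OF c(2)] .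
  qed simp
  then have Q: "(\<lambda>j. l2sq M (\<lambda>x. hess_form (g x) (H j x))) \<longlonglongrightarrow> l2sq M (\<lambda>x. hess_form (g x) (H' x))"
    by (rule l2sq_tendsto[OF sqint_hess_form[OF s(4)] sqint_hess_form[OF s(5)]])
  have z: "(\<lambda>j::nat. l2sq M (\<lambda>x. w x - w x)) \<longlonglongrightarrow> 0" for w :: "real^2 => 'b::euclidean_space" by (simp add: l2sq_def)
  have I: "(\<lambda>j. LINT x|M. H j x \<bullet> N x) \<longlonglongrightarrow> (LINT x|M. H' x \<bullet> N x)"
    by (rule l2sq_tendsto_inner[OF s(4,5) s(1) s(1) c(2) z])
  have L: "(\<lambda>j. LINT x|M. F x \<bullet> \<phi> j x) \<longlonglongrightarrow> (LINT x|M. F x \<bullet> \<phi>' x)"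
    by (rule l2sq_tendsto_inner[OF sqint_F sqint_F s(2,3) z c(1)])
  show ?thesis unfolding J_def by (intro tendsto_intros Q I L)
qed

lemma clamped_midpoint:
  assumes "clamped \<phi> G H" "clamped \<phi>' G' H'"
  shows "clamped (\<lambda>x. (1/2) *\<^sub>R (\<phi> x + \<phi>' x)) (\<lambda>x. (1/2) *\<^sub>R (G x + G' x)) (\<lambda>x. (1/2) *\<^sub>R (H x + H' x))"
proof -
  have "trace_eq_on \<omega> \<Gamma> (\<lambda>x. (1/2) * \<phi> x $ m + (1/2) * \<phi>' x $ m) (\<lambda>x. \<psi>A x $ m)" for m
    by (rule trace_eq_on_midpoint[OF D \<Gamma>(1)]) (use assms in \<open>simp_all add: clamped_def\<close>)
  moreover have "trace_eq_on \<omega> \<Gamma> (\<lambda>x. (1/2) * G x $ m $ j + (1/2) * G' x $ m $ j) (\<lambda>x. grad \<omega> \<psi>A x $ m $ j)" for m j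
    by (rule trace_eq_on_midpoint[OF D \<Gamma>(1)]) (use assms in \<open>simp_all add: clamped_def\<close>)
  moreover have "has_jet \<omega> (\<lambda>x. (1/2) *\<^sub>R (\<phi> x + \<phi>' x)) (\<lambda>x. (1/2) *\<^sub>R (G x + G' x)) (\<lambda>x. (1/2) *\<^sub>R (H x + H' x))"
    by (rule has_jet_midpoint[OF \<omega>]) (use assms in \<open>simp_all add: clamped_def\<close>)
  ultimately show ?thesis by (simp add: clamped_def distrib_left)
qed

text \<open>Weak derivatives and traces are closed under $L^2$ convergence of the whole jet.\<close>

lemma clamped_limit:
  assumes cl: "\<And>k. clamped (\<phi> k) (G k) (H k)" and s: "sqint M \<phi>'" "sqint M G'" "sqint M H'"
    and c: "(\<lambda>k. l2sq M (\<lambda>x. \<phi> k x - \<phi>' x)) \<longlonglongrightarrow> 0" "(\<lambda>k. l2sq M (\<lambda>x. G k x - G' x)) \<longlonglongrightarrow> 0"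
      "(\<lambda>k. l2sq M (\<lambda>x. H k x - H' x)) \<longlonglongrightarrow> 0"
  shows "clamped \<phi>' G' H'"
proof -
  have jj: "has_jet \<omega> (\<phi> k) (G k) (H k)" for k using cl by (simp add: clamped_def)
  note q = has_jet_sqint[OF jj]
  have c1: "(\<lambda>k. l2sq M (\<lambda>x. \<phi> k x $ m - \<phi>' x $ m)) \<longlonglongrightarrow> 0" for m by (rule l2sq_nth_tendsto[OF q(1) s(1) c(1)])
  have c2: "(\<lambda>k. l2sq M (\<lambda>x. G k x $ m $ j - G' x $ m $ j)) \<longlonglongrightarrow> 0" for m j
    by (rule l2sq_nth_tendsto[OF sqint_nth[OF q(2)] sqint_nth[OF s(2)] l2sq_nth_tendsto[OF q(2) s(2) c(2)]])
  have c3: "(\<lambda>k. l2sq M (\<lambda>x. H k x $ m $ i $ j - H' x $ m $ i $ j)) \<longlonglongrightarrow> 0" for m i j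
    by (rule l2sq_nth_tendsto[OF sqint_nth[OF sqint_nth[OF q(3)]] sqint_nth[OF sqint_nth[OF s(3)]]
       l2sq_nth_tendsto[OF sqint_nth[OF q(3)] sqint_nth[OF s(3)] l2sq_nth_tendsto[OF q(3) s(3) c(3)]]])
  have wk: "is_weak_partial \<omega> j (\<lambda>x. \<phi> k x $ m) (\<lambda>x. G k x $ m $ j)" "is_weak_partial \<omega> i (\<lambda>x. G k x $ m $ j) (\<lambda>x. H k x $ m $ i $ j)" for k m i j
    using jj[of k] by (simp_all add: has_jet_def)
  have w1: "is_weak_partial \<omega> j (\<lambda>x. \<phi>' x $ m) (\<lambda>x. G' x $ m $ j)" for m j
    by (rule is_weak_partial_limit[OF \<omega> wk(1) sqint_nth[OF s(1)] sqint_nth[OF sqint_nth[OF s(2)]] c1 c2])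
  have w2: "is_weak_partial \<omega> i (\<lambda>x. G' x $ m $ j) (\<lambda>x. H' x $ m $ i $ j)" for m i j
    by (rule is_weak_partial_limit[OF \<omega> wk(2) sqint_nth[OF sqint_nth[OF s(2)]] sqint_nth[OF sqint_nth[OF sqint_nth[OF s(3)]]] c2 c3])
  have "trace_eq_on \<omega> \<Gamma> (\<lambda>x. \<phi>' x $ m) (\<lambda>x. \<psi>A x $ m)" for m
  proof (rule trace_eq_on_weak_limit[OF D \<Gamma>(1) _ wk(1) w1 c1 c2])
    show "trace_eq_on \<omega> \<Gamma> (\<lambda>x. \<phi> k x $ m) (\<lambda>x. \<psi>A x $ m)" for k using cl[of k] by (simp add: clamped_def)
  qed
  moreover have "trace_eq_on \<omega> \<Gamma> (\<lambda>x. G' x $ m $ j) (\<lambda>x. grad \<omega> \<psi>A x $ m $ j)" for m j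
  proof (rule trace_eq_on_weak_limit[OF D \<Gamma>(1) _ wk(2) w2 c2 c3])
    show "trace_eq_on \<omega> \<Gamma> (\<lambda>x. G k x $ m $ j) (\<lambda>x. grad \<omega> \<psi>A x $ m $ j)" for k using cl[of k] by (simp add: clamped_def)
  qed
  ultimately show ?thesis using w1 w2 by (simp add: clamped_def has_jet_def)
qed

end

context clamped_plate
begin

text \<open>The coefficient of the linear term converges strongly because it is dominated by a fixed
  function and the gradients converge almost everywhere along a further subsequence.\<close>

lemma compactness:
  assumes cl: "\<And>k. clamped (\<psi> k) (G k) (H k)" and iso: "\<And>k. isometric (G k)" and BH: "\<And>k. l2sq M (H k) <= b"
  shows "\<exists>r \<psi>' G'. strict_mono (r :: nat => nat) \<and> sqint M \<psi>' \<and> sqint M G' \<and> isometric G' \<and>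
    (\<lambda>k. l2sq M (\<lambda>x. \<psi> (r k) x - \<psi>' x)) \<longlonglongrightarrow> 0 \<and> (\<lambda>k. l2sq M (\<lambda>x. G (r k) x - G' x)) \<longlonglongrightarrow> 0 \<and>
    (\<lambda>k. l2sq M (\<lambda>x. nrm (G (r k)) x - nrm G' x)) \<longlonglongrightarrow> 0"
proof -
  have jj: "has_jet \<omega> (\<psi> k) (G k) (H k)" for k using cl by (simp add: clamped_def)
  note q = has_jet_sqint[OF jj]
  obtain K where K: "\<forall>\<psi> G H. clamped \<psi> G H --> isometric G -->
     (\<forall>m. AE x in M. \<bar>\<psi> x $ m\<bar> <= K) \<and> (\<forall>m j. AE x in M. \<bar>G x $ m $ j\<bar> <= K)" using uniform_bound by (elim exE)
  have K1: "AE x in M. \<bar>\<psi> k x $ m\<bar> <= K" and K2: "AE x in M. \<bar>G k x $ m $ j\<bar> <= K" for k m j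
    using K[rule_format, OF cl[of k] iso[of k]] by blast+
  \<comment> \<open>the three components of the immersion and the six of its gradient, as one indexed family\<close>
  define u :: "nat => 3 + 3 \<times> 2 => real^2 => real"
    where "u k c = (case c of Inl m => \<lambda>x. \<psi> k x $ m | Inr (m, j) => \<lambda>x. G k x $ m $ j)" for k c
  define v :: "nat => 3 + 3 \<times> 2 => 2 => real^2 => real"
    where "v k c i = (case c of Inl m => \<lambda>x. G k x $ m $ i | Inr (m, j) => \<lambda>x. H k x $ m $ i $ j)" for k c i
  have w: "is_weak_partial \<omega> i (u k c) (v k c i)" for k c i
    using jj[of k] by (cases c) (auto simp: u_def v_def has_jet_def)
  have uK: "AE x in M. \<bar>u k c x\<bar> <= K" for k c
    using K1 K2 by (cases c) (simp_all add: u_def split: prod.split)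
  have b0: "0 <= b" using BH[of 0] l2sq_nonneg[of M "H 0"] by linarith
  have vB: "l2sq M (v k c i) <= l2sq M (\<lambda>_. K) + b" for k c i
  proof (cases c)
    case (Inl m)
    then show ?thesis using l2sq_le_const[OF K2[of k m i]] b0 by (simp add: v_def)
  next
    case (Inr p)
    obtain m j where p: "p = (m, j)" by fastforce
    have "\<bar>H k x $ m $ i $ j\<bar> <= norm (H k x)" for x
      using Finite_Cartesian_Product.norm_nth_le[of "H k x $ m $ i" j] Finite_Cartesian_Product.norm_nth_le[of "H k x $ m" i]
        Finite_Cartesian_Product.norm_nth_le[of "H k x" m] by simp
    then have "l2sq M (\<lambda>x. H k x $ m $ i $ j) <= l2sq M (H k)" by (intro l2sq_mono q(3) AE_I2) simp
    then have "l2sq M (\<lambda>x. H k x $ m $ i $ j) <= b" by (rule order_trans[OF _ BH])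
    then have "l2sq M (\<lambda>x. H k x $ m $ i $ j) <= l2sq M (\<lambda>_. K) + b" by (rule add_increasing[OF l2sq_nonneg])
    then show ?thesis by (simp add: v_def Inr p)
  qed
  have "\<exists>r. strict_mono (r :: nat => nat) \<and> (\<forall>c e. e > 0 --> (\<exists>N. \<forall>k\<ge>N. \<forall>l\<ge>N. l2sq M (\<lambda>x. u (r k) c x - u (r l) c x) < e))"
  proof (rule interior_compactness[OF \<omega> w uK vB])
    fix r :: "nat => nat"
    assume "strict_mono r" and C: "\<And>c e. e > 0 ==> \<exists>N. \<forall>k\<ge>N. \<forall>l\<ge>N. l2sq M (\<lambda>x. u (r k) c x - u (r l) c x) < e"
    then show ?thesis by (intro exI[of _ r] conjI allI impI C)
  qed
  then obtain r where r: "strict_mono (r :: nat => nat)"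
    and C: "\<forall>c e. e > 0 --> (\<exists>N. \<forall>k\<ge>N. \<forall>l\<ge>N. l2sq M (\<lambda>x. u (r k) c x - u (r l) c x) < e)" by (elim exE conjE)
  have us: "sqint M (u k c)" for k c by (rule is_weak_partial_sqint[OF w[of undefined k c], THEN conjunct1])
  have "\<forall>c. \<exists>z. sqint M z \<and> (\<lambda>k. l2sq M (\<lambda>x. u (r k) c x - z x)) \<longlonglongrightarrow> 0"
  proof
    fix c
    show "\<exists>z. sqint M z \<and> (\<lambda>k. l2sq M (\<lambda>x. u (r k) c x - z x)) \<longlonglongrightarrow> 0"
    proof (rule l2_complete[of M "\<lambda>k. u (r k) c"])
      show "sqint M (u (r k) c)" for k by (rule us)
      show "\<exists>N. \<forall>k\<ge>N. \<forall>l\<ge>N. l2sq M (\<lambda>x. u (r k) c x - u (r l) c x) < e" if "e > 0" for e by (rule C[rule_format, OF that])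
      fix z assume "sqint M z" "(\<lambda>k. l2sq M (\<lambda>x. u (r k) c x - z x)) \<longlonglongrightarrow> 0"
      then show "\<exists>z. sqint M z \<and> (\<lambda>k. l2sq M (\<lambda>x. u (r k) c x - z x)) \<longlonglongrightarrow> 0" by (intro exI[of _ z] conjI)
    qed
  qed
  then obtain z where z: "\<forall>c. sqint M (z c) \<and> (\<lambda>k. l2sq M (\<lambda>x. u (r k) c x - z c x)) \<longlonglongrightarrow> 0"
    unfolding choice_iff by (elim exE)
  define \<psi>' :: "real^2 => real^3" where "\<psi>' x = (\<chi> m. z (Inl m) x)" for x
  define G' :: "real^2 => real^2^3" where "G' x = (\<chi> m j. z (Inr (m, j)) x)" for x
  have s\<psi>: "sqint M \<psi>'" using z by (intro sqint_vec) (simp add: \<psi>'_def)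
  have sG: "sqint M G'" using z by (intro sqint_vec) (simp add: G'_def)
  have c\<psi>: "(\<lambda>k. l2sq M (\<lambda>x. \<psi> (r k) x - \<psi>' x)) \<longlonglongrightarrow> 0"
  proof -
    have "(\<lambda>k. l2sq M (\<lambda>x. \<psi> (r k) x $ m - \<psi>' x $ m)) \<longlonglongrightarrow> 0" for m
      using z[rule_format, of "Inl m"] by (simp add: u_def \<psi>'_def)
    then have "(\<lambda>k. \<Sum>m\<in>UNIV. l2sq M (\<lambda>x. \<psi> (r k) x $ m - \<psi>' x $ m)) \<longlonglongrightarrow> (\<Sum>m\<in>(UNIV::3 set). 0)" by (intro tendsto_sum)
    then show ?thesis by (simp add: l2sq_vec[OF sqint_diff[OF q(1) s\<psi>]])
  qed
  have cG: "(\<lambda>k. l2sq M (\<lambda>x. G (r k) x - G' x)) \<longlonglongrightarrow> 0"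
  proof -
    have "(\<lambda>k. l2sq M (\<lambda>x. G (r k) x $ m $ j - G' x $ m $ j)) \<longlonglongrightarrow> 0" for m j
      using z[rule_format, of "Inr (m, j)"] by (simp add: u_def G'_def)
    then have "(\<lambda>k. \<Sum>m\<in>UNIV. \<Sum>j\<in>UNIV. l2sq M (\<lambda>x. G (r k) x $ m $ j - G' x $ m $ j)) \<longlonglongrightarrow> (\<Sum>m\<in>(UNIV::3 set). \<Sum>j\<in>(UNIV::2 set). 0)"
      by (intro tendsto_sum)
    moreover have "l2sq M (\<lambda>x. G (r k) x - G' x) = (\<Sum>m\<in>UNIV. \<Sum>j\<in>UNIV. l2sq M (\<lambda>x. G (r k) x $ m $ j - G' x $ m $ j))" for k
      using l2sq_vec[OF sqint_diff[OF q(2) sG], of "r k"] l2sq_vec[OF sqint_nth[OF sqint_diff[OF q(2) sG]], of "r k"] by simp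
    ultimately show ?thesis by simp
  qed
  have "\<exists>r2. strict_mono (r2 :: nat => nat) \<and> (AE x in M. (\<lambda>k. G (r (r2 k)) x) \<longlonglongrightarrow> G' x)"
  proof (rule l2sq_AE_subseq[of M "\<lambda>k. G (r k)" G', OF q(2) sG cG])
    fix r2 :: "nat => nat" assume "strict_mono r2" "AE x in M. (\<lambda>k. G (r (r2 k)) x) \<longlonglongrightarrow> G' x"
    then show ?thesis by (intro exI[of _ r2] conjI)
  qed
  then obtain r2 where r2: "strict_mono (r2 :: nat => nat)" and lim: "AE x in M. (\<lambda>k. G (r (r2 k)) x) \<longlonglongrightarrow> G' x" by (elim exE conjE)
  have gr: "AE x in M. \<forall>k. gram (G k x) = g x"
    unfolding AE_all_countable using iso by (simp add: isometric_def)
  have isoG: "isometric G'" unfolding isometric_def using lim gr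
  proof eventually_elim
    case (elim x)
    have "(\<lambda>k. gram (G (r (r2 k)) x)) \<longlonglongrightarrow> gram (G' x)"
      by (rule continuous_on_tendsto_compose[OF continuous_on_gram[OF continuous_on_id[of UNIV]] elim(1)]) auto
    then show ?case using elim(2) by (simp add: LIMSEQ_const_iff)
  qed
  obtain aC where "\<forall>x\<in>\<omega>. norm (area x) <= aC" using cont_bdd(2)[OF cont_g(4)] by (elim exE)
  then have aB: "sqint M (\<lambda>x. area x *\<^sub>R B x)"
    by (intro sqint_mult_bounded[OF sqint_B cont_bdd(1)[OF cont_g(4)]] AE_I2) auto
  note sn = sqint_nrm[OF sqintD(1)[OF q(2)] iso] and sn' = sqint_nrm[OF sqintD(1)[OF sG] isoG]
  have cN: "(\<lambda>k. l2sq M (\<lambda>x. nrm (G (r (r2 k))) x - nrm G' x)) \<longlonglongrightarrow> 0"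
  proof (rule l2sq_dominated_convergence[where w="\<lambda>x. norm (2 *\<^sub>R (area x *\<^sub>R B x))"])
    show "integrable M (\<lambda>x. (norm (2 *\<^sub>R (area x *\<^sub>R B x)))\<^sup>2)" by (rule sqintD(2)[OF sqint_scaleR[OF aB]])
    show "AE x in M. norm (nrm (G (r (r2 k))) x - nrm G' x) <= norm (2 *\<^sub>R (area x *\<^sub>R B x))" for k
      using sn(2)[of "r (r2 k)"] sn'(2)
    proof eventually_elim
      case (elim x)
      have "area x * norm (B x) <= \<bar>area x\<bar> * norm (B x)" by (intro mult_right_mono) auto
      then show ?case using norm_triangle_ineq4[of "nrm (G (r (r2 k))) x" "nrm G' x"] elim by simp
    qed
    show "AE x in M. (\<lambda>k. nrm (G (r (r2 k))) x) \<longlonglongrightarrow> nrm G' x" using lim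
    proof eventually_elim
      case (elim x)
      have c: "(\<lambda>k. cross_cols (G (r (r2 k)) x)) \<longlonglongrightarrow> cross_cols (G' x)"
        by (rule continuous_on_tendsto_compose[OF continuous_on_cross_cols[of UNIV] elim]) auto
      show ?case unfolding nrm_def tens_def by (intro tendsto_vec_lambda tendsto_scaleR tendsto_vec_nth c tendsto_const)
    qed
  qed (rule sqintD(1)[OF sn(1)] sqintD(1)[OF sn'(1)])+
  have "strict_mono (\<lambda>k. r (r2 k))" using strict_mono_compose[OF r r2] .
  moreover have "(\<lambda>k. l2sq M (\<lambda>x. \<psi> (r (r2 k)) x - \<psi>' x)) \<longlonglongrightarrow> 0" using LIMSEQ_subseq_LIMSEQ[OF c\<psi> r2] by (simp add: o_def)
  moreover have "(\<lambda>k. l2sq M (\<lambda>x. G (r (r2 k)) x - G' x)) \<longlonglongrightarrow> 0" using LIMSEQ_subseq_LIMSEQ[OF cG r2] by (simp add: o_def)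
  ultimately show ?thesis using s\<psi> sG isoG cN
    by - (rule exI[of _ "\<lambda>k. r (r2 k)"], rule exI[of _ \<psi>'], rule exI[of _ G'], intro conjI)
qed

text \<open>The difference is the pairing of a bounded sequence of Hessians with the difference
  of the coefficients.\<close>

lemma J_freeze:
  assumes s: "\<And>k. sqint M (H k)" "\<And>k. sqint M (N k)" "sqint M N'" and BH: "\<And>k. l2sq M (H k) <= b"
    and c: "(\<lambda>k. l2sq M (\<lambda>x. N k x - N' x)) \<longlonglongrightarrow> 0"
  shows "(\<lambda>k. J N' (\<psi> k) (H k) - J (N k) (\<psi> k) (H k)) \<longlonglongrightarrow> 0"
proof -
  let ?I = "\<lambda>k. LINT x|M. H k x \<bullet> (N k x - N' x)"
  have "(\<lambda>k. (?I k)\<^sup>2) \<longlonglongrightarrow> 0"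
  proof (rule tendsto_sandwich[OF _ _ tendsto_const])
    have "(?I k)\<^sup>2 <= b * l2sq M (\<lambda>x. N k x - N' x)" for k
      by (rule order_trans[OF l2sq_Cauchy_Schwarz[OF s(1) sqint_diff[OF s(2,3)]] mult_right_mono[OF BH l2sq_nonneg]])
    then show "\<forall>\<^sub>F k in sequentially. (?I k)\<^sup>2 <= b * l2sq M (\<lambda>x. N k x - N' x)" by (intro always_eventually allI)
    show "(\<lambda>k. b * l2sq M (\<lambda>x. N k x - N' x)) \<longlonglongrightarrow> 0" by (rule tendsto_mult_right_zero[OF c])
  qed simp
  then have I: "?I \<longlonglongrightarrow> 0" by simp
  have "J N' (\<psi> k) (H k) - J (N k) (\<psi> k) (H k) = - \<alpha> * ?I k" for k
  proof -
    have I_eq: "?I k = (LINT x|M. H k x \<bullet> N k x) - (LINT x|M. H k x \<bullet> N' x)"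
      unfolding inner_diff_right using integrable_sqint_inner[OF s(1,2)] integrable_sqint_inner[OF s(1,3)]
      by (intro Bochner_Integration.integral_diff)
    show ?thesis unfolding I_eq J_def by (simp add: algebra_simps)
  qed
  then show ?thesis using tendsto_mult_right_zero[OF I, of "- \<alpha>"] by simp
qed

lemma minimizer_exists:
  "\<exists>\<psi>B \<in> admissible \<omega> \<Gamma> \<psi>A. \<forall>\<psi> \<in> admissible \<omega> \<Gamma> \<psi>A. energy \<omega> \<alpha> \<psi>A f \<psi>B <= energy \<omega> \<alpha> \<psi>A f \<psi>"
proof -
  obtain c1 c2 where c1: "c1 > 0" and co: "\<forall>\<psi> G H. clamped \<psi> G H --> isometric G --> c1 * l2sq M H <= J (nrm G) \<psi> H + c2"
    using coercive by (elim exE conjE)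
  have E: "energy \<omega> \<alpha> \<psi>A f \<psi> = J (nrm G) \<psi> H" if "clamped \<psi> G H" "isometric G" for \<psi> G H
    by (rule energy_eq) (use that in \<open>simp_all add: clamped_def\<close>)
  define S where "S = energy \<omega> \<alpha> \<psi>A f ` admissible \<omega> \<Gamma> \<psi>A"
  have ne: "S \<noteq> {}" using reference by (auto simp: S_def)
  have "- c2 <= y" if "y \<in> S" for y
  proof -
    obtain \<psi> where \<psi>: "y = energy \<omega> \<alpha> \<psi>A f \<psi>" "\<psi> \<in> admissible \<omega> \<Gamma> \<psi>A" using \<open>y \<in> S\<close> by (auto simp: S_def)
    obtain G H where G: "clamped \<psi> G H" "isometric G" using \<psi>(2) unfolding admissible_iff by (elim exE conjE)
    have "0 <= c1 * l2sq M H" using c1 by simp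
    then show ?thesis using co[rule_format, OF G] E[OF G] \<psi>(1) by linarith
  qed
  then have bdd: "bdd_below S" by (intro bdd_belowI[of _ "- c2"])
  define \<mu> where "\<mu> = Inf S"
  have \<mu>: "\<mu> <= energy \<omega> \<alpha> \<psi>A f \<psi>" if "\<psi> \<in> admissible \<omega> \<Gamma> \<psi>A" for \<psi>
    unfolding \<mu>_def using that by (intro cInf_lower bdd) (simp add: S_def)
  have "\<forall>k. \<exists>p. clamped (fst p) (fst (snd p)) (snd (snd p)) \<and> isometric (fst (snd p)) \<and>
    J (nrm (fst (snd p))) (fst p) (snd (snd p)) < \<mu> + 1 / real (Suc k)"
  proof
    fix k
    have "Inf S < \<mu> + 1 / real (Suc k)" by (simp add: \<mu>_def)
    then obtain y where "y \<in> S" "y < \<mu> + 1 / real (Suc k)" using cInf_lessD[OF ne] by blast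
    then obtain \<psi> where \<psi>: "energy \<omega> \<alpha> \<psi>A f \<psi> < \<mu> + 1 / real (Suc k)" "\<psi> \<in> admissible \<omega> \<Gamma> \<psi>A" by (auto simp: S_def)
    obtain G H where G: "clamped \<psi> G H" "isometric G" using \<psi>(2) unfolding admissible_iff by (elim exE conjE)
    show "\<exists>p. clamped (fst p) (fst (snd p)) (snd (snd p)) \<and> isometric (fst (snd p)) \<and>
      J (nrm (fst (snd p))) (fst p) (snd (snd p)) < \<mu> + 1 / real (Suc k)"
      by (rule exI[of _ "(\<psi>, G, H)"]) (use G \<psi>(1) E[OF G] in simp)
  qed
  then obtain p where p: "\<forall>k. clamped (fst (p k)) (fst (snd (p k))) (snd (snd (p k))) \<and> isometric (fst (snd (p k))) \<and>
    J (nrm (fst (snd (p k)))) (fst (p k)) (snd (snd (p k))) < \<mu> + 1 / real (Suc k)"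
    unfolding choice_iff by (elim exE)
  define \<psi> where "\<psi> k = fst (p k)" for k
  define G where "G k = fst (snd (p k))" for k
  define H where "H k = snd (snd (p k))" for k
  have cl: "clamped (\<psi> k) (G k) (H k)" and iso: "isometric (G k)" and Jk: "J (nrm (G k)) (\<psi> k) (H k) < \<mu> + 1 / real (Suc k)" for k
    using p unfolding \<psi>_def G_def H_def by blast+
  have jj: "has_jet \<omega> (\<psi> k) (G k) (H k)" for k using cl by (simp add: clamped_def)
  note q = has_jet_sqint[OF jj]
  define b where "b = (\<mu> + 1 + c2) / c1"
  have BH: "l2sq M (H k) <= b" for k
  proof -
    have "1 / real (Suc k) <= 1" by simp
    then have "c1 * l2sq M (H k) <= \<mu> + 1 + c2" using co[rule_format, OF cl iso, of k] Jk[of k] by linarith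
    then show ?thesis using c1 by (simp add: b_def pos_le_divide_eq mult.commute)
  qed
  obtain r \<psi>' G' where r: "strict_mono (r :: nat => nat)" and s': "sqint M \<psi>'" "sqint M G'" and iso': "isometric G'"
    and c\<psi>: "(\<lambda>k. l2sq M (\<lambda>x. \<psi> (r k) x - \<psi>' x)) \<longlonglongrightarrow> 0" and cG: "(\<lambda>k. l2sq M (\<lambda>x. G (r k) x - G' x)) \<longlonglongrightarrow> 0"
    and cN: "(\<lambda>k. l2sq M (\<lambda>x. nrm (G (r k)) x - nrm G' x)) \<longlonglongrightarrow> 0"
    using compactness[of \<psi> G H b, OF cl iso BH] by (elim exE conjE)
  have sN: "sqint M (nrm (G k))" for k by (rule sqint_nrm(1)[OF sqintD(1)[OF q(2)] iso])
  have sN': "sqint M (nrm G')" by (rule sqint_nrm(1)[OF sqintD(1)[OF s'(2)] iso'])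
  have fr: "(\<lambda>k. J (nrm G') (\<psi> (r k)) (H (r k)) - J (nrm (G (r k))) (\<psi> (r k)) (H (r k))) \<longlonglongrightarrow> 0"
    by (rule J_freeze[of "\<lambda>k. H (r k)" "\<lambda>k. nrm (G (r k))", OF q(3) sN sN' BH cN])
  define e where "e j = 1 / real (Suc j)" for j
  have e0: "e j > 0" for j by (simp add: e_def)
  \<comment> \<open>These sets are convex, because the coefficient is frozen and the isometry constraint is left
    out. Each of them contains a tail of the minimizing subsequence.\<close>
  define P where "P j = {h. \<exists>\<phi> \<Theta>. clamped \<phi> \<Theta> h \<and> J (nrm G') \<phi> h <= \<mu> + e j \<and>
    l2sq M (\<lambda>x. \<phi> x - \<psi>' x) <= e j \<and> l2sq M (\<lambda>x. \<Theta> x - G' x) <= e j}" for j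
  have sq: "sqint M \<phi>" "sqint M \<Theta>" "sqint M h" if "clamped \<phi> \<Theta> h" for \<phi> \<Theta> h
    using has_jet_sqint[of \<omega> \<phi> \<Theta> h] that by (simp_all add: clamped_def)
  have "\<exists>U h. (\<forall>j. U j \<in> P j) \<and> sqint M h \<and> (\<lambda>j. l2sq M (\<lambda>x. U j x - h x)) \<longlonglongrightarrow> 0"
  proof (rule midpoint_convex_selection[of P M b])
    show "sqint M h" if "h \<in> P j" for j h using that sq(3) unfolding P_def mem_Collect_eq by (elim exE conjE)
    show "P j \<subseteq> P i" if "i <= j" for i j
    proof
      fix h assume "h \<in> P j"
      then obtain \<phi> \<Theta> where a: "clamped \<phi> \<Theta> h" "J (nrm G') \<phi> h <= \<mu> + e j"
        "l2sq M (\<lambda>x. \<phi> x - \<psi>' x) <= e j" "l2sq M (\<lambda>x. \<Theta> x - G' x) <= e j" unfolding P_def mem_Collect_eq by (elim exE conjE)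
      have "e j <= e i" unfolding e_def using that by (simp add: frac_le)
      then show "h \<in> P i" unfolding P_def mem_Collect_eq using a
        by - (rule exI[of _ \<phi>], rule exI[of _ \<Theta>], simp)
    qed
    show "(\<lambda>x. (1/2) *\<^sub>R (h x + h' x)) \<in> P j" if "h \<in> P j" "h' \<in> P j" for j h h'
    proof -
      obtain \<phi> \<Theta> where a: "clamped \<phi> \<Theta> h" "J (nrm G') \<phi> h <= \<mu> + e j"
        "l2sq M (\<lambda>x. \<phi> x - \<psi>' x) <= e j" "l2sq M (\<lambda>x. \<Theta> x - G' x) <= e j" using \<open>h \<in> P j\<close> unfolding P_def mem_Collect_eq by (elim exE conjE)
      obtain \<phi>' \<Theta>' where a': "clamped \<phi>' \<Theta>' h'" "J (nrm G') \<phi>' h' <= \<mu> + e j"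
        "l2sq M (\<lambda>x. \<phi>' x - \<psi>' x) <= e j" "l2sq M (\<lambda>x. \<Theta>' x - G' x) <= e j" using \<open>h' \<in> P j\<close> unfolding P_def mem_Collect_eq by (elim exE conjE)
      note sa = sq[OF a(1)] and sa' = sq[OF a'(1)]
      show ?thesis unfolding P_def mem_Collect_eq
        by (rule exI[of _ "\<lambda>x. (1/2) *\<^sub>R (\<phi> x + \<phi>' x)"], rule exI[of _ "\<lambda>x. (1/2) *\<^sub>R (\<Theta> x + \<Theta>' x)"],
            intro conjI clamped_midpoint[OF a(1) a'(1)] J_midpoint[OF sN' sa(1) sa'(1) sa(3) sa'(3) a(2) a'(2)]
              l2sq_midpoint_dist_le[OF sa(1) sa'(1) s'(1) a(3) a'(3)] l2sq_midpoint_dist_le[OF sa(2) sa'(2) s'(2) a(4) a'(4)])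
    qed
    show "\<exists>h\<in>P j. l2sq M h <= b" for j
    proof -
      have ej: "e j / 2 > 0" using e0[of j] by simp
      have 1: "\<forall>\<^sub>F k in sequentially. J (nrm G') (\<psi> (r k)) (H (r k)) - J (nrm (G (r k))) (\<psi> (r k)) (H (r k)) < e j / 2"
        using order_tendstoD(2)[OF fr ej] .
      have 2: "\<forall>\<^sub>F k in sequentially. l2sq M (\<lambda>x. \<psi> (r k) x - \<psi>' x) < e j" using order_tendstoD(2)[OF c\<psi> e0] .
      have 3: "\<forall>\<^sub>F k in sequentially. l2sq M (\<lambda>x. G (r k) x - G' x) < e j" using order_tendstoD(2)[OF cG e0] .
      have 4: "\<forall>\<^sub>F k in sequentially. e (r k) < e j / 2"
      proof -
        have "e \<longlonglongrightarrow> 0" unfolding e_def by (rule LIMSEQ_Suc[OF lim_1_over_n])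
        then have "(\<lambda>k. e (r k)) \<longlonglongrightarrow> 0" using LIMSEQ_subseq_LIMSEQ[OF _ r, of e 0] by (simp add: o_def)
        then show ?thesis using ej by (rule order_tendstoD(2))
      qed
      have "\<forall>\<^sub>F k in sequentially. H (r k) \<in> P j" using 1 2 3 4
      proof eventually_elim
        case (elim k)
        have "J (nrm G') (\<psi> (r k)) (H (r k)) <= \<mu> + e j" using elim(1,4) Jk[of "r k"] unfolding e_def by linarith
        then show ?case unfolding P_def mem_Collect_eq using elim cl[of "r k"]
          by - (rule exI[of _ "\<psi> (r k)"], rule exI[of _ "G (r k)"], simp)
      qed
      then obtain k where "H (r k) \<in> P j" unfolding eventually_sequentially by blast
      then show ?thesis using BH by blast
    qed
  qed
  then obtain U h where U: "\<forall>j. U j \<in> P j" and sh: "sqint M h" and cU: "(\<lambda>j. l2sq M (\<lambda>x. U j x - h x)) \<longlonglongrightarrow> 0" by (elim exE conjE)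
  have "\<forall>j. \<exists>\<phi> \<Theta>. clamped \<phi> \<Theta> (U j) \<and> J (nrm G') \<phi> (U j) <= \<mu> + e j \<and>
    l2sq M (\<lambda>x. \<phi> x - \<psi>' x) <= e j \<and> l2sq M (\<lambda>x. \<Theta> x - G' x) <= e j" using U unfolding P_def by blast
  then obtain \<phi> \<Theta> where \<phi>: "\<forall>j. clamped (\<phi> j) (\<Theta> j) (U j) \<and> J (nrm G') (\<phi> j) (U j) <= \<mu> + e j \<and>
    l2sq M (\<lambda>x. \<phi> j x - \<psi>' x) <= e j \<and> l2sq M (\<lambda>x. \<Theta> j x - G' x) <= e j" unfolding choice_iff by (elim exE)
  have e_lim: "e \<longlonglongrightarrow> 0" unfolding e_def by (rule LIMSEQ_Suc[OF lim_1_over_n])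
  have c1': "(\<lambda>j. l2sq M (\<lambda>x. \<phi> j x - \<psi>' x)) \<longlonglongrightarrow> 0"
    by (rule tendsto_sandwich[OF _ _ tendsto_const e_lim]) (use \<phi> in simp_all)
  have c2': "(\<lambda>j. l2sq M (\<lambda>x. \<Theta> j x - G' x)) \<longlonglongrightarrow> 0"
    by (rule tendsto_sandwich[OF _ _ tendsto_const e_lim]) (use \<phi> in simp_all)
  have \<phi>cl: "clamped (\<phi> j) (\<Theta> j) (U j)" for j using \<phi> by blast
  have cl': "clamped \<psi>' G' h" by (rule clamped_limit[OF \<phi>cl s' sh c1' c2' cU])
  have adm: "\<psi>' \<in> admissible \<omega> \<Gamma> \<psi>A" unfolding admissible_iff
    by (rule exI[of _ G'], rule exI[of _ h], rule conjI[OF cl' iso'])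
  have "(\<lambda>j. J (nrm G') (\<phi> j) (U j)) \<longlonglongrightarrow> J (nrm G') \<psi>' h"
    by (rule J_tendsto[OF sN' sq(1)[OF \<phi>cl] s'(1) sq(3)[OF \<phi>cl] sh c1' cU])
  moreover have "(\<lambda>j. \<mu> + e j) \<longlonglongrightarrow> \<mu> + 0" by (intro tendsto_add tendsto_const e_lim)
  ultimately have "J (nrm G') \<psi>' h <= \<mu> + 0" by (rule LIMSEQ_le) (use \<phi> in blast)
  then have "energy \<omega> \<alpha> \<psi>A f \<psi>' <= \<mu>" using E[OF cl' iso'] by simp
  then show ?thesis using adm \<mu> order_trans by blast
qed

end

theorem theorem2p3:
  fixes \<omega> \<Gamma>\<^sub>D :: "(real^2) set" and \<psi>\<^sub>A f :: "real^2 \<Rightarrow> real^3" and \<alpha> :: real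
  assumes "bounded_lipschitz_domain \<omega>"
    and "\<Gamma>\<^sub>D \<subseteq> frontier \<omega>"
    and "hausdorff_outer \<Gamma>\<^sub>D > 0"
    and "\<alpha> > 0"
    and "injective_regular_param \<omega> \<psi>\<^sub>A"
    and "f \<in> L2_vec \<omega>"
  shows "\<exists>\<psi>\<^sub>B \<in> admissible \<omega> \<Gamma>\<^sub>D \<psi>\<^sub>A. \<forall>\<psi> \<in> admissible \<omega> \<Gamma>\<^sub>D \<psi>\<^sub>A.
           energy \<omega> \<alpha> \<psi>\<^sub>A f \<psi>\<^sub>B \<le> energy \<omega> \<alpha> \<psi>\<^sub>A f \<psi>"
proof -
  note \<omega> = lipschitz_domain_open_bounded[OF assms(1)]
  obtain GA HA where "has_jet \<omega> \<psi>\<^sub>A GA HA" "continuous_on (closure \<omega>) GA" "continuous_on (closure \<omega>) \<psi>\<^sub>A"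
    "\<And>x. x \<in> closure \<omega> \<Longrightarrow> rank (GA x) = 2"
    using regular_param_jet[OF \<omega> assms(5)] by metis
  then interpret clamped_plate \<omega> \<Gamma>\<^sub>D \<psi>\<^sub>A f \<alpha> GA HA
    using assms reference_admissible[OF \<omega> assms(5)] by unfold_locales
  show ?thesis by (rule minimizer_exists)
qed

end
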